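(* Let $\tau\in(0,1)$, let $\lambda_1>0$ be fixed and let $\lambda_2=\lambda_{2,n}>0$ depend on $n$. Put $\lambda_n=\lambda_2-\lambda_1$ and $\gamma_n=\gamma_2-\gamma_1$. Assume that $\Delta_n\to0$ and $n\Delta_n\to\infty$ as $n\to\infty$, and that $$\lambda_n\to0,\qquad \frac{\sqrt{n\Delta_n}\,\gamma_n}{\sqrt{\log n}}\to\infty .$$ Let $\tilde\lambda$ be any consistent estimator for $\lambda_1$ or $\lambda_2$. Then the estimator $\hat\tau=\hat k_0/n$ satisfies $$\frac{n\Delta_n\gamma_n^2(\hat\tau-\tau)}{\tilde\lambda}\ \stackrel{d}{\to}\ \arg\max_{v\in\mathbb R}\left\{W(v)-\frac{|v|}2\right\},$$ where $W$ is a two-sided Brownian motion.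
   Context: Fix a velocity $c>0$. For each $n\ge 2$ let $\Delta_n>0$, $T=n\Delta_n$, $t_i=i\Delta_n$ for $i=0,\dots,n$. The telegraph process is $X(t)=V(0)\int_0^t(-1)^{N(s)}\,ds$, $0\le t\le T$, where $N$ is an inhomogeneous Poisson process with intensity $\lambda(t)=\lambda_1\mathbf 1_{\{t\le\theta_0\}}+\lambda_2\mathbf 1_{\{t>\theta_0\}}$, and $V(0)$ is independent of $N$ and takes the values $+c,-c$ with probability $1/2$ each. The change occurs at the observation time $\theta_0=k_0\Delta_n$ with $k_0=[n\tau]$ (integer part). Only $X_i=X(t_i)$, $i=0,\dots,n$ (with $X_0=0$) are observed. Put $\eta_i=X_i-X_{i-1}$ and $Y_i=\mathbf 1_{\{|\eta_i|<c\Delta_n\}}/\Delta_n$, $i=1,\dots,n$. Let $\gamma_m=\frac{1-e^{-\lambda_m\Delta_n}}{\Delta_n}$, $m=1,2$, which is the mean of $Y_i$ for $i\le k_0$ ($m=1$) and for $i>k_0$ ($m=2$). For $1\le k\le n-1$ let $\bar Y_k=\frac1k\sum_{i=1}^kY_i$, $\bar Y_{n-k}=\frac1{n-k}\sum_{i=k+1}^nY_i$ (the mean of the last $n-k$ variables), and $$V_k=\sqrt{\frac{k(n-k)}{n^2}}\,(\bar Y_{n-k}-\bar Y_k).$$ The least squares change point estimator $\hat k_0$ is $$\hat k_0=\arg\min_{1\le k\le n-1}\Big\{\sum_{i=1}^k(Y_i-\bar Y_k)^2+\sum_{i=k+1}^n(Y_i-\bar Y_{n-k})^2\Big\}=\arg\max_{1\le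 k\le n-1}V_k^2 .$$ A consistent estimator of $\lambda_1$ (resp. $\lambda_2$) is a sequence of statistics $\tilde\lambda$ with $\tilde\lambda-\lambda_1\to0$ (resp. $\tilde\lambda-\lambda_2\to0$) in probability. The two-sided Brownian motion is $W(u)=W_1(-u)$ for $u<0$ and $W(u)=W_2(u)$ for $u\ge0$, where $W_1,W_2$ are independent standard Brownian motions on $[0,\infty)$. *)

theory Defs
  imports "HOL-Probability.Probability"
begin

text \<open>
  Inhomogeneous Poisson process on \<open>[0,\<infinity>)\<close> with intensity \<open>\<Lambda>\<close>. Every path is a counting path:
  it starts at 0, is nondecreasing (so the subtraction on \<^typ>\<open>nat\<close> never truncates) and
  right-continuous. \<^const>\<open>poisson_pmf\<close> is specified only for positive rates; below it is used
  for \<open>s < t\<close> and a positive, locally integrable \<open>\<Lambda>\<close>.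
\<close>

definition poisson_process :: "'a measure \<Rightarrow> (real \<Rightarrow> real) \<Rightarrow> (real \<Rightarrow> 'a \<Rightarrow> nat) \<Rightarrow> bool" where
  "poisson_process M \<Lambda> N \<longleftrightarrow>
     prob_space M \<and>
     (\<forall>t\<ge>0. N t \<in> measurable M (count_space UNIV)) \<and>
     (\<forall>\<omega>\<in>space M. N 0 \<omega> = 0 \<and> mono_on {0..} (\<lambda>t. N t \<omega>) \<and>
        (\<forall>t\<ge>0. continuous (at_right t) (\<lambda>s. real (N s \<omega>)))) \<and>
     (\<forall>(m::nat) t. 0 \<le> t 0 \<longrightarrow> (\<forall>i<m. t i \<le> t (Suc i)) \<longrightarrow>
        prob_space.indep_vars M (\<lambda>_. count_space UNIV)
          (\<lambda>i \<omega>. N (t (Suc i)) \<omega> - N (t i) \<omega>) {..<m}) \<and>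
     (\<forall>s t. 0 \<le> s \<longrightarrow> s < t \<longrightarrow>
        distr M (count_space UNIV) (\<lambda>\<omega>. N t \<omega> - N s \<omega>)
          = measure_pmf (poisson_pmf (LBINT u:{s..t}. \<Lambda> u)))"

text \<open>
  Driving data of a telegraph process with speed \<open>c\<close>: the initial velocity \<open>V0\<close> is independent of
  the whole process \<open>N\<close>, i.e. the sigma-algebras generated by them are independent.
\<close>

definition telegraph_driver ::
    "'a measure \<Rightarrow> real \<Rightarrow> (real \<Rightarrow> real) \<Rightarrow> ('a \<Rightarrow> real) \<Rightarrow> (real \<Rightarrow> 'a \<Rightarrow> nat) \<Rightarrow> bool" where
  "telegraph_driver M c \<Lambda> V0 N \<longleftrightarrow>
     poisson_process M \<Lambda> N \<and>
     V0 \<in> borel_measurable M \<and>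
     measure M {\<omega>\<in>space M. V0 \<omega> = c} = 1/2 \<and>
     measure M {\<omega>\<in>space M. V0 \<omega> = - c} = 1/2 \<and>
     prob_space.indep_set M
       (sets (vimage_algebra (space M) V0 borel))
       (sets (vimage_algebra (space M) (\<lambda>\<omega>. \<lambda>t\<in>{0..}. N t \<omega>)
          (Pi\<^sub>M {0..} (\<lambda>_. count_space UNIV))))"

definition telegraph :: "('a \<Rightarrow> real) \<Rightarrow> (real \<Rightarrow> 'a \<Rightarrow> nat) \<Rightarrow> real \<Rightarrow> 'a \<Rightarrow> real" where
  "telegraph V0 N t \<omega> = V0 \<omega> * (LBINT s:{0..t}. (- 1) ^ N s \<omega>)"

definition change_index :: "real \<Rightarrow> nat \<Rightarrow> nat" where
  "change_index \<tau> n = nat \<lfloor>real n * \<tau>\<rfloor>"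

definition change_intensity :: "real \<Rightarrow> real \<Rightarrow> real \<Rightarrow> real \<Rightarrow> real" where
  "change_intensity l1 l2 \<theta> t = (if t \<le> \<theta> then l1 else l2)"

definition gam :: "real \<Rightarrow> real \<Rightarrow> real" where
  "gam \<delta> l = (1 - exp (- l * \<delta>)) / \<delta>"

text \<open>
  The data are vectors \<open>x = (x\<^sub>0, \<dots>, x\<^sub>n)\<close>, elements of the product space below;
  statistics are measurable functions on it.
\<close>

definition data_space :: "nat \<Rightarrow> (nat \<Rightarrow> real) measure" where
  "data_space n = Pi\<^sub>M {0..n} (\<lambda>_. borel)"

definition observations :: "nat \<Rightarrow> real \<Rightarrow> (real \<Rightarrow> 'a \<Rightarrow> real) \<Rightarrow> 'a \<Rightarrow> nat \<Rightarrow> real" where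
  "observations n \<delta> X \<omega> = (\<lambda>i\<in>{0..n}. X (real i * \<delta>) \<omega>)"

definition Y_stat :: "real \<Rightarrow> real \<Rightarrow> (nat \<Rightarrow> real) \<Rightarrow> nat \<Rightarrow> real" where
  "Y_stat c \<delta> x i = (if \<bar>x i - x (i - 1)\<bar> < c * \<delta> then 1 else 0) / \<delta>"

definition mean_upto :: "(nat \<Rightarrow> real) \<Rightarrow> nat \<Rightarrow> real" where
  "mean_upto y k = (\<Sum>i=1..k. y i) / real k"

definition mean_after :: "nat \<Rightarrow> (nat \<Rightarrow> real) \<Rightarrow> nat \<Rightarrow> real" where
  "mean_after n y k = (\<Sum>i=k+1..n. y i) / (real n - real k)"

definition ls_criterion :: "nat \<Rightarrow> (nat \<Rightarrow> real) \<Rightarrow> nat \<Rightarrow> real" where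
  "ls_criterion n y k =
     (\<Sum>i=1..k. (y i - mean_upto y k)\<^sup>2) + (\<Sum>i=k+1..n. (y i - mean_after n y k)\<^sup>2)"

text \<open>
  The minimiser need not be unique, so an estimator is any measurable choice of a minimiser.
\<close>

definition ls_change_estimator :: "real \<Rightarrow> real \<Rightarrow> nat \<Rightarrow> ((nat \<Rightarrow> real) \<Rightarrow> nat) \<Rightarrow> bool" where
  "ls_change_estimator c \<delta> n K \<longleftrightarrow>
     K \<in> measurable (data_space n) (count_space UNIV) \<and>
     (\<forall>x\<in>space (data_space n).
        is_arg_min (ls_criterion n (Y_stat c \<delta> x)) (\<lambda>k. 1 \<le> k \<and> k \<le> n - 1) (K x))"

text \<open>The probability space may change with \<open>n\<close>.\<close>

definition tendsto_zero_in_prob :: "(nat \<Rightarrow> 'a measure) \<Rightarrow> (nat \<Rightarrow> 'a \<Rightarrow> real) \<Rightarrow> bool" where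
  "tendsto_zero_in_prob M Z \<longleftrightarrow>
     (\<forall>\<epsilon>>0. (\<lambda>n. measure (M n) {\<omega>\<in>space (M n). \<bar>Z n \<omega>\<bar> > \<epsilon>}) \<longlonglongrightarrow> 0)"

definition brownian_motion :: "'b measure \<Rightarrow> (real \<Rightarrow> 'b \<Rightarrow> real) \<Rightarrow> bool" where
  "brownian_motion P B \<longleftrightarrow>
     prob_space P \<and>
     (\<forall>t\<ge>0. B t \<in> borel_measurable P) \<and>
     (\<forall>\<omega>\<in>space P. B 0 \<omega> = 0 \<and> continuous_on {0..} (\<lambda>t. B t \<omega>)) \<and>
     (\<forall>(m::nat) t. 0 \<le> t 0 \<longrightarrow> (\<forall>i<m. t i \<le> t (Suc i)) \<longrightarrow>
        prob_space.indep_vars P (\<lambda>_. borel) (\<lambda>i \<omega>. B (t (Suc i)) \<omega> - B (t i) \<omega>) {..<m}) \<and>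
     (\<forall>s t. 0 \<le> s \<longrightarrow> s < t \<longrightarrow>
        distributed P lborel (\<lambda>\<omega>. B t \<omega> - B s \<omega>) (normal_density 0 (sqrt (t - s))))"

definition two_sided_brownian_motion :: "'b measure \<Rightarrow> (real \<Rightarrow> 'b \<Rightarrow> real) \<Rightarrow> bool" where
  "two_sided_brownian_motion P W \<longleftrightarrow>
     (\<exists>W1 W2. brownian_motion P W1 \<and> brownian_motion P W2 \<and>
        prob_space.indep_var P
          (Pi\<^sub>M {0..} (\<lambda>_. borel)) (\<lambda>\<omega>. \<lambda>t\<in>{0..}. W1 t \<omega>)
          (Pi\<^sub>M {0..} (\<lambda>_. borel)) (\<lambda>\<omega>. \<lambda>t\<in>{0..}. W2 t \<omega>) \<and>
        (\<forall>u. \<forall>\<omega>\<in>space P. W u \<omega> = (if u < 0 then W1 (- u) \<omega> else W2 u \<omega>)))"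

text \<open>
  The random variable \<open>arg max Z\<close> of a process indexed by the real line: a random variable that is
  almost surely the one and only maximiser of the path. It is thereby determined up to a null set.
\<close>

definition is_argmax_rv :: "'b measure \<Rightarrow> (real \<Rightarrow> 'b \<Rightarrow> real) \<Rightarrow> ('b \<Rightarrow> real) \<Rightarrow> bool" where
  "is_argmax_rv P Z \<xi> \<longleftrightarrow>
     \<xi> \<in> borel_measurable P \<and>
     (AE \<omega> in P. {v. is_arg_max (\<lambda>v. Z v \<omega>) (\<lambda>_. True) v} = {\<xi> \<omega>})"

end

theory Submission
  imports Defs
begin

text \<open>
  The proof reduces the telegraph process to coin tossing, the estimator to the maximiser of a random
  walk with drift, and the walk to Brownian motion.

  The path moves with constant speed \<open>c\<close>, so over one sampling interval it covers the full distance
  \<open>c * \<Delta>\<close> unless it turns round there. Almost surely the strict inequality in \<open>Y_stat\<close> therefore says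
  that the Poisson process jumps in the interval, and \<open>\<Delta> * Y\<close> is a sequence of independent indicators
  with success probability \<open>p1\<close> before and \<open>p2\<close> after the change (\<open>telegraph_switch_indicators\<close>). The
  least squares criterion is a constant minus a multiple of the squared and weighted cusum
  \<open>contrast\<close>, so the estimator maximises the contrast (\<open>ls_minimiser_maximises_contrast\<close>).

  Write \<open>\<delta> = p2 - p1\<close>, \<open>q = l1 * \<Delta>\<close>, \<open>a = \<delta>^2 / q\<close>, \<open>s = \<delta> / q\<close>, and let \<open>m\<close> be the centred partial sums
  of the indicators. Expanding the square around the true change index \<open>k0\<close> shows that, up to a
  positive factor, the contrast at \<open>k\<close> exceeds that at \<open>k0\<close> by
  \<open>- s * (m k - m k0) - a * \<bar>k - k0\<bar> / 2\<close> plus an error (\<open>contrast_change_bounds\<close>). The error is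
  controlled once \<open>m\<close> is small against \<open>\<delta> * sqrt (n * k)\<close> for all \<open>k\<close> at the same time. The Hajek-Renyi
  inequality bounds the probability of the opposite by a multiple of \<open>(1 + \<Sum>k\<le>n. 1 / k) / (n * a)\<close>, and
  this is the place where the logarithm in the hypothesis on \<open>\<gamma>\<close> is needed
  (\<open>not_uniformly_small_prob\<close>). One step of the walk \<open>s * m\<close> has variance about \<open>s^2 * q = a\<close>; hence in
  the time scale \<open>v = a * (k - k0)\<close> the walk looks like \<open>W v - \<bar>v\<bar> / 2\<close>.

  To pass to the limit it is enough to bound, for closed \<open>S\<close>, the upper limit of the probability that
  \<open>a * (k - k0)\<close>, with \<open>k\<close> the estimator, lies in \<open>S\<close> by the probability that the Brownian argmax lies in \<open>S\<close>
  (\<open>rescaled_maximiser_limsup\<close>). This is done on a grid, so that no convergence in a function space is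
  involved. Outside a window of size \<open>K\<close> the drift wins (\<open>contrast_less_far_from_change\<close>). Inside, the
  walk is compared with its values on a grid of mesh \<open>h\<close>: the oscillation in a cell exceeds \<open>\<eta>\<close>
  with probability of order \<open>h^2 / \<eta>^4\<close>, there are of order \<open>1 / h\<close> cells, and \<open>\<eta>^4 = sqrt h\<close> makes
  the total small while \<open>\<eta>\<close> still tends to \<open>0\<close>. The increments of the walk over the cells are
  independent and each satisfies a central limit theorem (\<open>block_sums_converge\<close>); applying the
  Skorohod representation to each coordinate turns this into the bound for closed sets of grid
  functions. So the event in question is asymptotically no more likely than that the Brownian grid
  function has an approximate maximiser close to \<open>S\<close>, and by continuity of the paths and
  uniqueness of the maximiser this last event shrinks to \<open>\<xi> \<in> S\<close> when the mesh goes to \<open>0\<close>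
  (\<open>grid_near_argmax_eventually_less\<close>).

  The Brownian maximiser exists because the paths grow sublinearly. It is unique because the maxima of
  the path to the left and to the right of a short interval differ by the increment over the interval
  plus an independent quantity, and a normal increment has no atoms (\<open>grid_maxima_not_close\<close>).
  Replacing \<open>l1\<close> by a consistent estimator and \<open>k0\<close> by \<open>n * \<tau>\<close> changes the statistic by an amount that
  vanishes in probability.
\<close>

section \<open>Maximal inequalities for sums of independent variables\<close>

text \<open>
  Independence turns the joint law into a product measure, so Tonelli applies. Writing the inner
  integral over the same probability space allows one variable to be frozen without naming laws.
\<close>

lemma (in prob_space) indep_var_nn_integral_iterated:
  fixes F :: "'b \<Rightarrow> 'b \<Rightarrow> ennreal"
  assumes ind: "indep_var S U T V"
    and F: "case_prod F \<in> borel_measurable (S \<Otimes>\<^sub>M T)"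
  shows "(\<integral>\<^sup>+\<omega>. F (U \<omega>) (V \<omega>) \<partial>M) = (\<integral>\<^sup>+\<omega>. (\<integral>\<^sup>+\<omega>'. F (U \<omega>) (V \<omega>') \<partial>M) \<partial>M)"
proof -
  note d = ind[unfolded indep_var_distribution_eq]
  from d have [measurable]: "U \<in> measurable M S" "V \<in> measurable M T" by auto
  note F[measurable]
  interpret V: prob_space "distr M T V" by (rule prob_space_distr) measurable
  have "(\<integral>\<^sup>+\<omega>. F (U \<omega>) (V \<omega>) \<partial>M) = (\<integral>\<^sup>+z. case_prod F z \<partial>distr M (S \<Otimes>\<^sub>M T) (\<lambda>x. (U x, V x)))"
    by (subst nn_integral_distr) auto
  also have "\<dots> = (\<integral>\<^sup>+z. case_prod F z \<partial>(distr M S U \<Otimes>\<^sub>M distr M T V))"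
    using d by simp
  also have "\<dots> = (\<integral>\<^sup>+x. (\<integral>\<^sup>+y. F x y \<partial>distr M T V) \<partial>distr M S U)"
    by (subst V.nn_integral_fst[symmetric]) auto
  also have "\<dots> = (\<integral>\<^sup>+\<omega>. (\<integral>\<^sup>+y. F (U \<omega>) y \<partial>distr M T V) \<partial>M)"
    by (subst nn_integral_distr) (auto intro!: V.borel_measurable_nn_integral)
  also have "\<dots> = (\<integral>\<^sup>+\<omega>. (\<integral>\<^sup>+\<omega>'. F (U \<omega>) (V \<omega>') \<partial>M) \<partial>M)"
    by (intro nn_integral_cong, subst nn_integral_distr) auto
  finally show ?thesis .
qed

text \<open>
  A discrete supermartingale argument without filtrations. The function \<open>\<Phi> k\<close> bounds the conditional
  probability that the walk, being at \<open>x\<close> at time \<open>k\<close>, enters one of the sets \<open>A\<close> from then on: it is at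
  least \<open>1\<close> on the sets and does not increase in the mean under one step. The process equal to
  \<open>1\<close> after the first entry and to the potential before it then has decreasing expectation.
  Both maximal inequalities below are choices of a potential.
\<close>

lemma (in prob_space) potential_maximal_inequality:
  fixes X :: "nat \<Rightarrow> 'a \<Rightarrow> real" and \<Phi> :: "nat \<Rightarrow> real \<Rightarrow> ennreal" and A :: "nat \<Rightarrow> real set"
  assumes ind: "indep_vars (\<lambda>_. borel) X {..<n}"
    and meas: "\<And>k. k \<le> n \<Longrightarrow> \<Phi> k \<in> borel_measurable borel" "\<And>k. k \<le> n \<Longrightarrow> A k \<in> sets borel"
    and dom: "\<And>k x. k \<le> n \<Longrightarrow> x \<in> A k \<Longrightarrow> 1 \<le> \<Phi> k x"
    and step: "\<And>k x. k < n \<Longrightarrow> (\<integral>\<^sup>+\<omega>. \<Phi> (Suc k) (x + X k \<omega>) \<partial>M) \<le> \<Phi> k x"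
  shows "emeasure M {\<omega>\<in>space M. \<exists>k\<le>n. (\<Sum>i<k. X i \<omega>) \<in> A k} \<le> \<Phi> 0 0"
proof -
  have X[measurable]: "X i \<in> borel_measurable M" if "i < n" for i
    using ind that by (auto simp: indep_vars_def)
  define S where "S k \<omega> = (\<Sum>i<k. X i \<omega>)" for k \<omega>
  have S[measurable]: "S k \<in> borel_measurable M" if "k \<le> n" for k
    unfolding S_def using that by (intro borel_measurable_sum X) auto
  define H where "H k = {\<omega>\<in>space M. \<exists>l\<le>k. S l \<omega> \<in> A l}" for k
  have H: "H k \<in> sets M" if "k \<le> n" for k
  proof -
    have "H k = (\<Union>l\<in>{..k}. S l -` A l \<inter> space M)" unfolding H_def by auto
    also have "\<dots> \<in> sets M" using that meas(2) S by (intro sets.finite_UN) (auto intro!: measurable_sets)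
    finally show ?thesis .
  qed
  \<comment> \<open>the potential stopped at the first entry\<close>
  define f where "f k \<omega> = (if \<omega> \<in> H k then 1 else \<Phi> k (S k \<omega>))" for k \<omega>
  have decr: "(\<integral>\<^sup>+\<omega>. f (Suc k) \<omega> \<partial>M) \<le> (\<integral>\<^sup>+\<omega>. f k \<omega> \<partial>M)" if k: "k < n" for k
  proof -
    \<comment> \<open>the entry event up to time \<open>k\<close>, as a set of paths of the first \<open>k\<close> steps\<close>
    define HH where "HH = {u \<in> space (PiM {..<k} (\<lambda>_. borel :: real measure)). \<exists>l\<le>k. (\<Sum>i<l. u i) \<in> A l}"
    have HH: "HH \<in> sets (PiM {..<k} (\<lambda>_. borel))"
    proof -
      have "HH = (\<Union>l\<in>{..k}. (\<lambda>u. \<Sum>i<l. u i) -` A l \<inter> space (PiM {..<k} (\<lambda>_. borel :: real measure)))"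
        unfolding HH_def by auto
      also have "\<dots> \<in> sets (PiM {..<k} (\<lambda>_. borel))"
        using k meas(2)
        by (intro sets.finite_UN measurable_sets[of _ _ borel] borel_measurable_sum measurable_component_singleton) auto
      finally show ?thesis .
    qed
    define F where "F u y = (if u \<in> HH then 1 else \<Phi> (Suc k) ((\<Sum>i<k. u i) + y))" for u and y :: real
    have [measurable]: "\<Phi> (Suc k) \<in> borel_measurable borel" using meas(1) k by simp
    have Fm: "case_prod F \<in> borel_measurable (PiM {..<k} (\<lambda>_. borel) \<Otimes>\<^sub>M borel)"
      unfolding F_def using HH by measurable
    define U where "U \<omega> = restrict (\<lambda>i. X i \<omega>) {..<k}" for \<omega>
    define W where "W \<omega> = restrict (\<lambda>i. X i \<omega>) {k}" for \<omega>
    have iv: "indep_var (PiM {..<k} (\<lambda>_. borel)) U (PiM {k} (\<lambda>_. borel)) W"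
      unfolding U_def W_def by (rule indep_var_restrict[OF ind]) (use k in auto)
    have Fm': "case_prod (\<lambda>u w. F u (w k)) \<in> borel_measurable (PiM {..<k} (\<lambda>_. borel) \<Otimes>\<^sub>M PiM {k} (\<lambda>_. borel))"
      using Fm by measurable
    have WX: "W \<omega> k = X k \<omega>" for \<omega> unfolding W_def by simp
    have UH: "U \<omega> \<in> HH \<longleftrightarrow> \<omega> \<in> H k" if "\<omega> \<in> space M" for \<omega>
    proof -
      have "(\<Sum>i<l. U \<omega> i) = S l \<omega>" if "l \<le> k" for l
        unfolding U_def S_def using that by (intro sum.cong) auto
      then show ?thesis using that unfolding HH_def H_def by (auto simp: U_def space_PiM)
    qed
    have US: "(\<Sum>i<k. U \<omega> i) = S k \<omega>" for \<omega> unfolding U_def S_def by simp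
    have "(\<integral>\<^sup>+\<omega>. f (Suc k) \<omega> \<partial>M) \<le> (\<integral>\<^sup>+\<omega>. F (U \<omega>) (X k \<omega>) \<partial>M)"
    proof (rule nn_integral_mono)
      fix \<omega> assume w: "\<omega> \<in> space M"
      have "1 \<le> \<Phi> (Suc k) (S (Suc k) \<omega>)" if "\<omega> \<in> H (Suc k)" "\<omega> \<notin> H k"
        using that k dom[of "Suc k"] unfolding H_def by (auto simp: le_Suc_eq)
      moreover have "\<omega> \<in> H (Suc k)" if "\<omega> \<in> H k" using that unfolding H_def by (auto simp: le_Suc_eq)
      moreover have "S (Suc k) \<omega> = S k \<omega> + X k \<omega>" unfolding S_def by simp
      ultimately show "f (Suc k) \<omega> \<le> F (U \<omega>) (X k \<omega>)"
        unfolding f_def F_def using UH[OF w] US by auto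
    qed
    also have "\<dots> = (\<integral>\<^sup>+\<omega>. (\<integral>\<^sup>+\<omega>'. F (U \<omega>) (X k \<omega>') \<partial>M) \<partial>M)"
      by (rule indep_var_nn_integral_iterated[OF iv Fm', unfolded WX])
    also have "\<dots> \<le> (\<integral>\<^sup>+\<omega>. f k \<omega> \<partial>M)"
    proof (rule nn_integral_mono)
      fix \<omega> assume w: "\<omega> \<in> space M"
      show "(\<integral>\<^sup>+\<omega>'. F (U \<omega>) (X k \<omega>') \<partial>M) \<le> f k \<omega>"
        using step[OF k, of "S k \<omega>"] UH[OF w]
        by (cases "\<omega> \<in> H k") (auto simp: F_def f_def US emeasure_space_1)
    qed
    finally show ?thesis .
  qed
  have le: "(\<integral>\<^sup>+\<omega>. f k \<omega> \<partial>M) \<le> (\<integral>\<^sup>+\<omega>. f 0 \<omega> \<partial>M)" if "k \<le> n" for k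
    using that
  proof (induction k)
    case (Suc k)
    then show ?case using decr[of k] by (auto intro: order_trans)
  qed simp
  have "emeasure M (H n) = (\<integral>\<^sup>+\<omega>. indicator (H n) \<omega> \<partial>M)" using H by simp
  also have "\<dots> \<le> (\<integral>\<^sup>+\<omega>. f n \<omega> \<partial>M)"
    by (intro nn_integral_mono) (auto simp: f_def indicator_def)
  also have "\<dots> \<le> (\<integral>\<^sup>+\<omega>. f 0 \<omega> \<partial>M)" by (rule le) simp
  also have "\<dots> \<le> (\<integral>\<^sup>+\<omega>. \<Phi> 0 0 \<partial>M)"
    using dom[of 0 0] by (intro nn_integral_mono) (auto simp: f_def H_def S_def)
  also have "\<dots> = \<Phi> 0 0" by (simp add: emeasure_space_1)
  finally show ?thesis unfolding H_def S_def .
qed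

text \<open>
  The mean of a quadratic expression in a centred variable only involves its variance. This verifies
  the step condition for polynomial potentials.
\<close>

lemma (in prob_space) nn_integral_quadratic_bound:
  fixes X g :: "'a \<Rightarrow> real"
  assumes X: "integrable M X" "expectation X = 0"
    and X2: "integrable M (\<lambda>\<omega>. (X \<omega>)\<^sup>2)" "expectation (\<lambda>\<omega>. (X \<omega>)\<^sup>2) \<le> v"
    and g: "\<And>\<omega>. \<omega> \<in> space M \<Longrightarrow> 0 \<le> g \<omega> \<and> g \<omega> \<le> \<alpha> + \<beta> * X \<omega> + \<kappa> * (X \<omega>)\<^sup>2" and "0 \<le> \<kappa>"
  shows "(\<integral>\<^sup>+\<omega>. ennreal (g \<omega>) \<partial>M) \<le> ennreal (\<alpha> + \<kappa> * v)"
proof -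
  let ?h = "\<lambda>\<omega>. \<alpha> + \<beta> * X \<omega> + \<kappa> * (X \<omega>)\<^sup>2"
  have "(\<integral>\<^sup>+\<omega>. ennreal (g \<omega>) \<partial>M) \<le> (\<integral>\<^sup>+\<omega>. ennreal (?h \<omega>) \<partial>M)"
    using g by (intro nn_integral_mono ennreal_leI) auto
  also have "\<dots> = ennreal (expectation ?h)"
    using X X2 g by (intro nn_integral_eq_integral AE_I2) (auto intro: order_trans)
  also have "expectation ?h = \<alpha> + \<kappa> * expectation (\<lambda>\<omega>. (X \<omega>)\<^sup>2)"
    using X X2 by (simp add: prob_space)
  also have "ennreal \<dots> \<le> ennreal (\<alpha> + \<kappa> * v)"
    using X2 \<open>0 \<le> \<kappa>\<close> by (intro ennreal_leI add_left_mono mult_left_mono)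
  finally show ?thesis .
qed

text \<open>
  The potential is the squared weighted position plus the weighted variance still to come. Decreasing
  weights make it decrease in the mean.
\<close>

lemma (in prob_space) hajek_renyi:
  fixes X :: "nat \<Rightarrow> 'a \<Rightarrow> real" and c v :: "nat \<Rightarrow> real"
  assumes ind: "indep_vars (\<lambda>_. borel) X {..<n}"
    and X: "\<And>i. i < n \<Longrightarrow> integrable M (X i)" "\<And>i. i < n \<Longrightarrow> expectation (X i) = 0"
    and X2: "\<And>i. i < n \<Longrightarrow> integrable M (\<lambda>\<omega>. (X i \<omega>)\<^sup>2)" "\<And>i. i < n \<Longrightarrow> expectation (\<lambda>\<omega>. (X i \<omega>)\<^sup>2) \<le> v i"
    and c: "\<And>i. 0 \<le> c i" "\<And>i. c (Suc i) \<le> c i"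
  shows "prob {\<omega>\<in>space M. \<exists>k\<le>n. 1 \<le> c k * \<bar>\<Sum>i<k. X i \<omega>\<bar>} \<le> (\<Sum>i<n. (c (Suc i))\<^sup>2 * v i)"
proof -
  have v: "0 \<le> v i" if "i < n" for i
  proof -
    have "0 \<le> expectation (\<lambda>\<omega>. (X i \<omega>)\<^sup>2)" by (intro integral_nonneg_AE) auto
    then show ?thesis using X2(2)[OF that] by linarith
  qed
  define R where "R k = (\<Sum>i\<in>{k..<n}. (c (Suc i))\<^sup>2 * v i)" for k
  have R: "0 \<le> R k" for k unfolding R_def using v by (intro sum_nonneg) auto
  have RS: "R k = (c (Suc k))\<^sup>2 * v k + R (Suc k)" if "k < n" for k
    unfolding R_def using that by (simp add: sum.atLeast_Suc_lessThan)
  define \<Phi> where "\<Phi> k x = ennreal ((c k)\<^sup>2 * x\<^sup>2 + R k)" for k x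
  define A where "A k = {x. 1 \<le> c k * \<bar>x\<bar>}" for k
  have "emeasure M {\<omega>\<in>space M. \<exists>k\<le>n. (\<Sum>i<k. X i \<omega>) \<in> A k} \<le> \<Phi> 0 0"
  proof (rule potential_maximal_inequality[OF ind])
    show "\<Phi> k \<in> borel_measurable borel" for k unfolding \<Phi>_def by measurable
    show "A k \<in> sets borel" for k unfolding A_def by measurable
    show "1 \<le> \<Phi> k x" if "x \<in> A k" for k x
    proof -
      have "1 \<le> (c k * \<bar>x\<bar>)\<^sup>2" using that unfolding A_def by (intro one_le_power) auto
      then have "1 \<le> (c k)\<^sup>2 * x\<^sup>2 + R k" using R[of k] by (simp add: power_mult_distrib)
      then show ?thesis unfolding \<Phi>_def by simp
    qed
    show "(\<integral>\<^sup>+\<omega>. \<Phi> (Suc k) (x + X k \<omega>) \<partial>M) \<le> \<Phi> k x" if k: "k < n" for k x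
    proof -
      let ?d = "(c (Suc k))\<^sup>2"
      have "(\<integral>\<^sup>+\<omega>. \<Phi> (Suc k) (x + X k \<omega>) \<partial>M) \<le> ennreal ((?d * x\<^sup>2 + R (Suc k)) + ?d * v k)"
        unfolding \<Phi>_def
      proof (rule nn_integral_quadratic_bound[where \<beta>="2 * ?d * x", OF X[OF k] X2[OF k]], intro conjI)
        show "0 \<le> ?d * (x + X k \<omega>)\<^sup>2 + R (Suc k)" for \<omega> using R by (intro add_nonneg_nonneg) auto
      qed (auto simp: power2_sum algebra_simps)
      also have "\<dots> \<le> \<Phi> k x"
        unfolding \<Phi>_def RS[OF k] using c
        by (intro ennreal_leI) (auto intro!: mult_right_mono power_mono)
      finally show ?thesis .
    qed
  qed
  then show ?thesis
    unfolding \<Phi>_def R_def A_def emeasure_eq_measure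
    using R[of 0] by (simp add: R_def lessThan_atLeast0)
qed

text \<open>
  The leading term is the square of the total variance. Summed over many short blocks it still
  vanishes with the block length, which a second moment bound would not achieve.
\<close>

lemma (in prob_space) fourth_moment_maximal_inequality:
  fixes X :: "nat \<Rightarrow> 'a \<Rightarrow> real"
  assumes ind: "indep_vars (\<lambda>_. borel) X {..<n}"
    and X: "\<And>i. i < n \<Longrightarrow> integrable M (X i)" "\<And>i. i < n \<Longrightarrow> expectation (X i) = 0"
    and X2: "\<And>i. i < n \<Longrightarrow> integrable M (\<lambda>\<omega>. (X i \<omega>)\<^sup>2)" "\<And>i. i < n \<Longrightarrow> expectation (\<lambda>\<omega>. (X i \<omega>)\<^sup>2) \<le> v"
    and b: "\<And>i \<omega>. i < n \<Longrightarrow> \<omega> \<in> space M \<Longrightarrow> \<bar>X i \<omega>\<bar> \<le> b" and v: "0 \<le> v" and \<eta>: "0 < \<eta>"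
  shows "prob {\<omega>\<in>space M. \<exists>k\<le>n. \<eta> \<le> \<bar>\<Sum>i<k. X i \<omega>\<bar>} \<le> (4 * (real n * v)\<^sup>2 + 3 * b\<^sup>2 * (real n * v)) / \<eta>^4"
proof -
  define V where "V k = (real n - real k) * v" for k
  have V: "0 \<le> V k" if "k \<le> n" for k unfolding V_def using that v by auto
  \<comment> \<open>\<open>V k\<close> is the variance to come; the coefficients of the lower terms leave room for the cross terms of one step\<close>
  define p where "p k x = x^4 + 8 * V k * x\<^sup>2 + (4 * (V k)\<^sup>2 + 3 * b\<^sup>2 * V k)" for k and x :: real
  have p: "0 \<le> p k x" "x^4 \<le> p k x" if "k \<le> n" for k x
    unfolding p_def using V[OF that] by auto
  define \<Phi> where "\<Phi> k x = ennreal (p k x / \<eta>^4)" for k x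
  define A where "A k = {x. \<eta> \<le> \<bar>x\<bar>}" for k :: nat
  have "emeasure M {\<omega>\<in>space M. \<exists>k\<le>n. (\<Sum>i<k. X i \<omega>) \<in> A k} \<le> \<Phi> 0 0"
  proof (rule potential_maximal_inequality[OF ind])
    show "\<Phi> k \<in> borel_measurable borel" for k unfolding \<Phi>_def p_def by measurable
    show "A k \<in> sets borel" for k unfolding A_def by measurable
    show "1 \<le> \<Phi> k x" if "x \<in> A k" "k \<le> n" for k x
    proof -
      have "\<eta>^4 \<le> \<bar>x\<bar>^4" using that \<eta> unfolding A_def by (intro power_mono) auto
      then have "\<eta>^4 \<le> p k x" using p[OF that(2), of x] by simp
      then show ?thesis unfolding \<Phi>_def using \<eta> by simp
    qed
    show "(\<integral>\<^sup>+\<omega>. \<Phi> (Suc k) (x + X k \<omega>) \<partial>M) \<le> \<Phi> k x" if k: "k < n" for k x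
    proof -
      let ?V = "V (Suc k)"
      have VS: "V k = ?V + v" unfolding V_def by (simp add: algebra_simps)
      let ?\<alpha> = "x^4 + 8 * ?V * x\<^sup>2 + (4 * ?V\<^sup>2 + 3 * b\<^sup>2 * ?V)"
      let ?\<kappa> = "8 * x\<^sup>2 + 3 * b\<^sup>2 + 8 * ?V"
      have pt: "p (Suc k) (x + X k \<omega>) \<le> ?\<alpha> + (4 * x^3 + 16 * ?V * x) * X k \<omega> + ?\<kappa> * (X k \<omega>)\<^sup>2"
        if w: "\<omega> \<in> space M" for \<omega>
      proof -
        let ?y = "X k \<omega>"
        have y: "\<bar>?y\<bar> \<le> b" using b k w by auto
        then have yb: "?y\<^sup>2 \<le> b\<^sup>2" by (metis abs_ge_zero power2_abs power_mono)
        have "4 * (x * ?y) \<le> 2 * (x\<^sup>2 + b\<^sup>2)"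
        proof -
          have "0 \<le> (x - ?y)\<^sup>2" by simp
          then show ?thesis using yb by (simp add: power2_diff)
        qed
        then have "4 * (x * ?y) * ?y\<^sup>2 \<le> 2 * (x\<^sup>2 + b\<^sup>2) * ?y\<^sup>2" by (intro mult_right_mono) auto
        moreover have "?y^4 \<le> b\<^sup>2 * ?y\<^sup>2"
        proof -
          have "?y\<^sup>2 * ?y\<^sup>2 \<le> b\<^sup>2 * ?y\<^sup>2" using yb by (intro mult_right_mono) auto
          then show ?thesis by (simp add: power2_eq_square power4_eq_xxxx mult.assoc)
        qed
        moreover have "(x + ?y)^4 = x^4 + 4 * x^3 * ?y + 6 * x\<^sup>2 * ?y\<^sup>2 + 4 * (x * ?y) * ?y\<^sup>2 + ?y^4"
          by algebra
        moreover have "(x + ?y)\<^sup>2 = x\<^sup>2 + 2 * x * ?y + ?y\<^sup>2" by algebra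
        ultimately show ?thesis unfolding p_def by (simp add: algebra_simps)
      qed
      have le: "?\<alpha> + ?\<kappa> * v \<le> p k x"
        unfolding p_def VS using v V[of "Suc k"] k by (simp add: power2_sum algebra_simps)
      have "(\<integral>\<^sup>+\<omega>. \<Phi> (Suc k) (x + X k \<omega>) \<partial>M) \<le> ennreal (?\<alpha> / \<eta>^4 + (?\<kappa> / \<eta>^4) * v)"
        unfolding \<Phi>_def
      proof (rule nn_integral_quadratic_bound[where \<beta>="(4 * x^3 + 16 * ?V * x) / \<eta>^4", OF X[OF k] X2[OF k]], intro conjI)
        fix \<omega> assume w: "\<omega> \<in> space M"
        show "0 \<le> p (Suc k) (x + X k \<omega>) / \<eta> ^ 4" using p(1)[of "Suc k"] k by simp
        have "p (Suc k) (x + X k \<omega>) / \<eta> ^ 4 \<le> (?\<alpha> + (4 * x^3 + 16 * ?V * x) * X k \<omega> + ?\<kappa> * (X k \<omega>)\<^sup>2) / \<eta> ^ 4"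
          using pt[OF w] \<eta> by (intro divide_right_mono) auto
        then show "p (Suc k) (x + X k \<omega>) / \<eta> ^ 4 \<le> ?\<alpha> / \<eta>^4 + (4 * x^3 + 16 * ?V * x) / \<eta>^4 * X k \<omega> + ?\<kappa> / \<eta>^4 * (X k \<omega>)\<^sup>2"
          by (simp add: add_divide_distrib distrib_right)
      next
        show "0 \<le> ?\<kappa> / \<eta> ^ 4" using V[of "Suc k"] k by simp
      qed
      also have "?\<alpha> / \<eta>^4 + (?\<kappa> / \<eta>^4) * v = (?\<alpha> + ?\<kappa> * v) / \<eta>^4" by (simp add: add_divide_distrib distrib_right)
      also have "ennreal \<dots> \<le> \<Phi> k x"
        unfolding \<Phi>_def using le by (intro ennreal_leI divide_right_mono) auto
      finally show ?thesis .
    qed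
  qed
  then have "emeasure M {\<omega>\<in>space M. \<exists>k\<le>n. \<eta> \<le> \<bar>\<Sum>i<k. X i \<omega>\<bar>} \<le> ennreal (p 0 0 / \<eta>^4)"
    unfolding \<Phi>_def A_def by simp
  then show ?thesis using p(1)[of 0 0]
    by (simp add: emeasure_eq_measure p_def V_def)
qed

section \<open>Limits of probabilities and of independent coordinates\<close>

lemma (in prob_space) prob_tendsto_zero_if_eventually_outside:
  fixes E :: "nat \<Rightarrow> 'a set"
  assumes E: "\<And>n. E n \<in> events" and ev: "AE \<omega> in M. eventually (\<lambda>n. \<omega> \<notin> E n) sequentially"
  shows "(\<lambda>n. prob (E n)) \<longlonglongrightarrow> 0"
proof -
  have "(\<lambda>n. \<integral>\<omega>. indicator (E n) \<omega> \<partial>M) \<longlonglongrightarrow> (\<integral>\<omega>. (0::real) \<partial>M)"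
  proof (rule integral_dominated_convergence[where w="\<lambda>_. 1"])
    show "AE \<omega> in M. (\<lambda>n. indicat_real (E n) \<omega>) \<longlonglongrightarrow> 0"
      using ev by eventually_elim (auto intro!: tendsto_eventually elim: eventually_mono)
  qed (use E in \<open>auto simp: indicator_def\<close>)
  then show ?thesis using E by simp
qed

text \<open>
  Events that hold from some index on form an increasing union of intersections, each below any single
  event. This passes a bound along refining grids to the limit.
\<close>

lemma (in prob_space) prob_liminf_events_le:
  fixes E :: "nat \<Rightarrow> 'a set"
  assumes E: "\<And>r. E r \<in> events" and B: "\<And>r. prob (E r) \<le> B"
  shows "(\<Union>R. \<Inter>r\<in>{R..}. E r) \<in> events" "prob (\<Union>R. \<Inter>r\<in>{R..}. E r) \<le> B"
proof -
  have m: "(\<Inter>r\<in>{R..}. E r) \<in> events" for R :: nat using E by (intro sets.countable_INT) auto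
  then show "(\<Union>R. \<Inter>r\<in>{R..}. E r) \<in> events" by auto
  have "(\<lambda>R. prob (\<Inter>r\<in>{R..}. E r)) \<longlonglongrightarrow> prob (\<Union>R. \<Inter>r\<in>{R..}. E r)"
    using m by (intro finite_Lim_measure_incseq) (auto simp: incseq_def)
  moreover have "prob (\<Inter>r\<in>{R..}. E r) \<le> B" for R :: nat
  proof -
    have "prob (\<Inter>r\<in>{R..}. E r) \<le> prob (E R)" using E by (intro finite_measure_mono) auto
    then show ?thesis using B[of R] by simp
  qed
  ultimately show "prob (\<Union>R. \<Inter>r\<in>{R..}. E r) \<le> B"
    by (intro LIMSEQ_le_const2) auto
qed

text \<open>
  The topology on functions is the product topology, hence convergence is pointwise.
\<close>

lemma tendsto_fun_componentwise:
  fixes f :: "nat \<Rightarrow> 'i \<Rightarrow> real"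
  assumes "\<And>i. (\<lambda>n. f n i) \<longlonglongrightarrow> g i"
  shows "f \<longlonglongrightarrow> g"
proof -
  have "limitin (product_topology (\<lambda>i. euclidean) UNIV) f g sequentially"
    unfolding limitin_componentwise using assms by auto
  then show ?thesis by (simp add: euclidean_product_topology)
qed

text \<open>
  Independent variables have a product law, so the probability of a joint event depends on the marginal
  laws only. The two families in the next theorem can thereby be moved to a common product space.
\<close>

lemma prob_restrict_indep_vars:
  fixes U :: "'i::countable \<Rightarrow> 'a \<Rightarrow> real" and C :: "('i \<Rightarrow> real) set"
  assumes M: "prob_space M" and ind: "prob_space.indep_vars M (\<lambda>_. borel) U I"
    and I: "finite I" "I \<noteq> {}" and C: "closed C"
  shows "{\<omega>\<in>space M. restrict (\<lambda>i. U i \<omega>) I \<in> C} \<in> sets M"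
    and "measure M {\<omega>\<in>space M. restrict (\<lambda>i. U i \<omega>) I \<in> C} =
      measure (PiM I (\<lambda>i. distr M borel (U i))) {u \<in> space (PiM I (\<lambda>_. borel)). u \<in> C}"
proof -
  interpret prob_space M by fact
  have U: "U i \<in> borel_measurable M" if "i \<in> I" for i using ind that by (auto simp: indep_vars_def)
  have Um: "(\<lambda>\<omega>. restrict (\<lambda>i. U i \<omega>) I) \<in> measurable M (PiM I (\<lambda>_. borel))"
    by (intro measurable_restrict U)
  have id: "(\<lambda>u. u) \<in> borel_measurable (PiM I (\<lambda>_. borel :: real measure))"
  proof (rule measurable_coordinatewise_then_product)
    fix i
    show "(\<lambda>u. u i) \<in> borel_measurable (PiM I (\<lambda>_. borel :: real measure))"
    proof (cases "i \<in> I")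
      case False
      then have "(\<lambda>u. u i) \<in> borel_measurable (PiM I (\<lambda>_. borel :: real measure)) \<longleftrightarrow>
        (\<lambda>u. undefined :: real) \<in> borel_measurable (PiM I (\<lambda>_. borel :: real measure))"
        by (intro measurable_cong) (auto simp: space_PiM PiE_def extensional_def)
      then show ?thesis by simp
    qed simp
  qed
  have Cm: "{u \<in> space (PiM I (\<lambda>_. borel)). u \<in> C} \<in> sets (PiM I (\<lambda>_. borel))"
    using measurable_sets[OF id borel_closed[OF C]] by (simp add: vimage_def Int_def conj_commute)
  have eq: "{\<omega>\<in>space M. restrict (\<lambda>i. U i \<omega>) I \<in> C} =
      (\<lambda>\<omega>. restrict (\<lambda>i. U i \<omega>) I) -` {u \<in> space (PiM I (\<lambda>_. borel)). u \<in> C} \<inter> space M"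
    by (auto simp: space_PiM)
  show "{\<omega>\<in>space M. restrict (\<lambda>i. U i \<omega>) I \<in> C} \<in> sets M"
    unfolding eq by (rule measurable_sets[OF Um Cm])
  have "measure M {\<omega>\<in>space M. restrict (\<lambda>i. U i \<omega>) I \<in> C} =
    measure (distr M (PiM I (\<lambda>_. borel)) (\<lambda>\<omega>. restrict (\<lambda>i. U i \<omega>) I)) {u \<in> space (PiM I (\<lambda>_. borel)). u \<in> C}"
    unfolding eq by (rule measure_distr[OF Um Cm, symmetric])
  also have "distr M (PiM I (\<lambda>_. borel)) (\<lambda>\<omega>. restrict (\<lambda>i. U i \<omega>) I) = PiM I (\<lambda>i. distr M borel (U i))"
    using ind by (subst (asm) indep_vars_iff_distr_eq_PiM'[OF I(2) U]) auto
  finally show "measure M {\<omega>\<in>space M. restrict (\<lambda>i. U i \<omega>) I \<in> C} =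
      measure (PiM I (\<lambda>i. distr M borel (U i))) {u \<in> space (PiM I (\<lambda>_. borel)). u \<in> C}" .
qed

lemma indep_vars_PiM_coordinates:
  assumes I: "I \<noteq> {}" and N: "\<And>i. i \<in> I \<Longrightarrow> prob_space (N i)"
  shows "prob_space.indep_vars (PiM I N) N (\<lambda>i \<omega>. \<omega> i) I"
proof -
  interpret prob_space "PiM I N" by (rule prob_space_PiM[OF N])
  show ?thesis
  proof (subst indep_vars_iff_distr_eq_PiM'[OF I])
    have "distr (PiM I N) (PiM I N) (\<lambda>x. restrict x I) = distr (PiM I N) (PiM I N) (\<lambda>x. x)"
      by (rule distr_cong) (auto simp: space_PiM)
    also have "\<dots> = PiM I (\<lambda>i. distr (PiM I N) (N i) (\<lambda>x. x i))"
      by (subst distr_id2) (auto intro!: PiM_cong simp: distr_PiM_component N)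
    finally show "distr (PiM I N) (PiM I N) (\<lambda>x. restrict (\<lambda>i. x i) I) =
      PiM I (\<lambda>i. distr (PiM I N) (N i) (\<lambda>x. x i))" by simp
  qed simp
qed

text \<open>
  The portmanteau inequality for vectors with independent coordinates, from weak convergence of each
  coordinate alone. Skorohod representations of the coordinates, placed on a product space, converge
  pointwise; a point of the open complement of \<open>C\<close> is then eventually avoided.
\<close>

lemma independent_coordinates_closed_set_limsup:
  fixes M :: "nat \<Rightarrow> 'a measure" and P :: "'b measure" and C :: "('i::countable \<Rightarrow> real) set"
    and U :: "nat \<Rightarrow> 'i \<Rightarrow> 'a \<Rightarrow> real" and V :: "'i \<Rightarrow> 'b \<Rightarrow> real"
  assumes I: "finite I" "I \<noteq> {}"
    and M: "\<And>n. prob_space (M n)" "\<And>n. prob_space.indep_vars (M n) (\<lambda>_. borel) (U n) I"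
    and P: "prob_space P" "prob_space.indep_vars P (\<lambda>_. borel) V I"
    and conv: "\<And>i. i \<in> I \<Longrightarrow> weak_conv_m (\<lambda>n. distr (M n) borel (U n i)) (distr P borel (V i))"
    and C: "closed C" and \<epsilon>: "0 < \<epsilon>"
  shows "eventually (\<lambda>n. measure (M n) {\<omega>\<in>space (M n). restrict (\<lambda>i. U n i \<omega>) I \<in> C}
    < measure P {\<omega>\<in>space P. restrict (\<lambda>i. V i \<omega>) I \<in> C} + \<epsilon>) sequentially"
proof -
  have U: "U n i \<in> borel_measurable (M n)" if "i \<in> I" for n i
    using M(2)[of n] that by (auto simp: prob_space.indep_vars_def[OF M(1)])
  have V: "V i \<in> borel_measurable P" if "i \<in> I" for i
    using P(2) that by (auto simp: prob_space.indep_vars_def[OF P(1)])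
  let ?R = "\<lambda>i (\<Omega> :: real measure, Ys :: nat \<Rightarrow> real \<Rightarrow> real, Y).
    prob_space \<Omega> \<and> (\<forall>n. Ys n \<in> measurable \<Omega> borel) \<and> (\<forall>n. distr \<Omega> borel (Ys n) = distr (M n) borel (U n i)) \<and>
    Y \<in> measurable \<Omega> lborel \<and> distr \<Omega> borel Y = distr P borel (V i) \<and>
    (\<forall>x\<in>space \<Omega>. (\<lambda>n. Ys n x) \<longlonglongrightarrow> Y x)"
  have ex: "\<forall>i\<in>I. \<exists>t. ?R i t"
  proof
    fix i assume i: "i \<in> I"
    have "real_distribution (distr (M n) borel (U n i))" for n
      using U[OF i] by (rule prob_space.real_distribution_distr[OF M(1)])
    moreover have "real_distribution (distr P borel (V i))"
      using V[OF i] by (rule prob_space.real_distribution_distr[OF P(1)])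
    ultimately have "\<exists>(\<Omega> :: real measure) (Ys :: nat \<Rightarrow> real \<Rightarrow> real) (Y :: real \<Rightarrow> real). ?R i (\<Omega>, Ys, Y)"
      using Skorohod[of "\<lambda>n. distr (M n) borel (U n i)" "distr P borel (V i)", OF _ _ conv[OF i]]
      by simp
    then show "\<exists>t. ?R i t" by blast
  qed
  from bchoice[OF ex] obtain t where t: "\<forall>i\<in>I. ?R i (t i)" by blast
  define \<Omega> Ys Y where "\<Omega> i = fst (t i)" and "Ys i = fst (snd (t i))" and "Y i = snd (snd (t i))" for i
  have t': "prob_space (\<Omega> i) \<and> (\<forall>n. Ys i n \<in> measurable (\<Omega> i) borel) \<and>
    (\<forall>n. distr (\<Omega> i) borel (Ys i n) = distr (M n) borel (U n i)) \<and>
    Y i \<in> measurable (\<Omega> i) lborel \<and> distr (\<Omega> i) borel (Y i) = distr P borel (V i) \<and>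
    (\<forall>x\<in>space (\<Omega> i). (\<lambda>n. Ys i n x) \<longlonglongrightarrow> Y i x)" if "i \<in> I" for i
    using bspec[OF t that] unfolding \<Omega>_def Ys_def Y_def case_prod_beta .
  have \<Omega>: "\<And>i. i \<in> I \<Longrightarrow> prob_space (\<Omega> i)" using t' by blast
  have Ys: "\<And>i n. i \<in> I \<Longrightarrow> Ys i n \<in> borel_measurable (\<Omega> i)"
      "\<And>i n. i \<in> I \<Longrightarrow> distr (\<Omega> i) borel (Ys i n) = distr (M n) borel (U n i)"
    using t' by blast+
  have Y: "\<And>i. i \<in> I \<Longrightarrow> Y i \<in> borel_measurable (\<Omega> i)"
      "\<And>i. i \<in> I \<Longrightarrow> distr (\<Omega> i) borel (Y i) = distr P borel (V i)"
    using t' by auto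
  have lim: "\<And>i x. i \<in> I \<Longrightarrow> x \<in> space (\<Omega> i) \<Longrightarrow> (\<lambda>n. Ys i n x) \<longlonglongrightarrow> Y i x"
    using t' by blast
  define Q where "Q = PiM I \<Omega>"
  have Q: "prob_space Q" unfolding Q_def by (rule prob_space_PiM[OF \<Omega>])
  interpret Q: prob_space Q by fact
  have key: "Q.indep_vars (\<lambda>_. borel) (\<lambda>i \<omega>. Z i (\<omega> i)) I"
       "measure Q {\<omega>\<in>space Q. restrict (\<lambda>i. Z i (\<omega> i)) I \<in> C} =
        measure (PiM I (\<lambda>i. distr (\<Omega> i) borel (Z i))) {u \<in> space (PiM I (\<lambda>_. borel)). u \<in> C}"
    if Z: "\<And>i. i \<in> I \<Longrightarrow> Z i \<in> borel_measurable (\<Omega> i)" for Z :: "'i \<Rightarrow> real \<Rightarrow> real"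
  proof -
    show iv: "Q.indep_vars (\<lambda>_. borel) (\<lambda>i \<omega>. Z i (\<omega> i)) I"
      using prob_space.indep_vars_compose2[OF Q[unfolded Q_def] indep_vars_PiM_coordinates[OF I(2) \<Omega>] Z]
      unfolding Q_def by simp
    have "distr Q borel (\<lambda>\<omega>. Z i (\<omega> i)) = distr (\<Omega> i) borel (Z i)" if i: "i \<in> I" for i
    proof -
      have "distr (\<Omega> i) borel (Z i) = distr (distr Q (\<Omega> i) (\<lambda>\<omega>. \<omega> i)) borel (Z i)"
        unfolding Q_def by (subst distr_PiM_component[OF \<Omega> i]) auto
      also have "\<dots> = distr Q borel (\<lambda>\<omega>. Z i (\<omega> i))"
        unfolding Q_def using Z[OF i] i by (subst distr_distr) (auto simp: o_def)
      finally show ?thesis by simp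
    qed
    then show "measure Q {\<omega>\<in>space Q. restrict (\<lambda>i. Z i (\<omega> i)) I \<in> C} =
        measure (PiM I (\<lambda>i. distr (\<Omega> i) borel (Z i))) {u \<in> space (PiM I (\<lambda>_. borel)). u \<in> C}"
      by (subst prob_restrict_indep_vars(2)[OF Q iv I C]) (auto intro!: arg_cong2[where f=measure] PiM_cong)
  qed
  define E where "E n = {\<omega>\<in>space Q. restrict (\<lambda>i. Ys i n (\<omega> i)) I \<in> C}" for n
  define E0 where "E0 = {\<omega>\<in>space Q. restrict (\<lambda>i. Y i (\<omega> i)) I \<in> C}"
  have Es: "E n \<in> sets Q" "E0 \<in> sets Q" for n
    unfolding E_def E0_def using key(1)[of "\<lambda>i. Ys i n"] key(1)[of Y] Ys(1) Y(1)
    by (auto intro!: prob_restrict_indep_vars(1)[OF Q _ I C])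
  have mE: "measure (M n) {\<omega>\<in>space (M n). restrict (\<lambda>i. U n i \<omega>) I \<in> C} = measure Q (E n)" for n
    unfolding E_def using Ys
    by (subst key(2)[of "\<lambda>i. Ys i n"], simp, subst prob_restrict_indep_vars(2)[OF M I C])
       (auto intro!: arg_cong2[where f=measure] PiM_cong)
  have mE0: "measure P {\<omega>\<in>space P. restrict (\<lambda>i. V i \<omega>) I \<in> C} = measure Q E0"
    unfolding E0_def using Y
    by (subst key(2)[of Y], simp, subst prob_restrict_indep_vars(2)[OF P I C])
       (auto intro!: arg_cong2[where f=measure] PiM_cong)
  have "(\<lambda>n. measure Q (E n - E0)) \<longlonglongrightarrow> 0"
  proof (rule Q.prob_tendsto_zero_if_eventually_outside)
    show "E n - E0 \<in> sets Q" for n using Es by auto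
    show "AE \<omega> in Q. eventually (\<lambda>n. \<omega> \<notin> E n - E0) sequentially"
    proof (rule AE_I2)
      fix \<omega> assume w: "\<omega> \<in> space Q"
      show "eventually (\<lambda>n. \<omega> \<notin> E n - E0) sequentially"
      proof (cases "\<omega> \<in> E0")
        case False
        have "(\<lambda>n. restrict (\<lambda>i. Ys i n (\<omega> i)) I) \<longlonglongrightarrow> restrict (\<lambda>i. Y i (\<omega> i)) I"
        proof (rule tendsto_fun_componentwise)
          fix i
          show "(\<lambda>n. restrict (\<lambda>i. Ys i n (\<omega> i)) I i) \<longlonglongrightarrow> restrict (\<lambda>i. Y i (\<omega> i)) I i"
            using w lim[of i "\<omega> i"] by (cases "i \<in> I") (auto simp: Q_def space_PiM PiE_def)
        qed
        moreover have "open (- C)" using C by (simp add: open_Compl)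
        moreover have "restrict (\<lambda>i. Y i (\<omega> i)) I \<in> - C" using False w by (auto simp: E0_def)
        ultimately have "eventually (\<lambda>n. restrict (\<lambda>i. Ys i n (\<omega> i)) I \<in> - C) sequentially"
          by (rule topological_tendstoD)
        then show ?thesis by eventually_elim (auto simp: E_def)
      qed simp
    qed
  qed
  then have "eventually (\<lambda>n. measure Q (E n - E0) < \<epsilon>) sequentially"
    using \<epsilon> by (rule order_tendstoD)
  then show ?thesis
  proof eventually_elim
    case (elim n)
    have "measure Q (E n) \<le> measure Q (E0 \<union> (E n - E0))" using Es by (intro Q.finite_measure_mono) auto
    also have "\<dots> \<le> measure Q E0 + measure Q (E n - E0)" using Es by (intro measure_Un_le) auto
    finally show ?case unfolding mE mE0 using elim by simp
  qed
qed

section \<open>Normal laws and a central limit theorem for blocks\<close>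

lemma normal_density_le: "0 < \<sigma> \<Longrightarrow> normal_density \<mu> \<sigma> x \<le> 1 / sqrt (2 * pi * \<sigma>\<^sup>2)"
  unfolding normal_density_def by (intro mult_left_le) auto

lemma (in prob_space) prob_normal_interval_le:
  assumes X: "distributed M lborel X (normal_density \<mu> \<sigma>)" and \<sigma>: "0 < \<sigma>" and "a \<le> b"
  shows "emeasure M {\<omega>\<in>space M. X \<omega> \<in> {a..b}} \<le> ennreal ((b - a) / sqrt (2 * pi * \<sigma>\<^sup>2))"
proof -
  have "emeasure M (X -` {a..b} \<inter> space M) = (\<integral>\<^sup>+x. ennreal (normal_density \<mu> \<sigma> x) * indicator {a..b} x \<partial>lborel)"
    by (rule distributed_emeasure[OF X]) simp
  also have "\<dots> \<le> (\<integral>\<^sup>+x. ennreal (1 / sqrt (2 * pi * \<sigma>\<^sup>2)) * indicator {a..b} x \<partial>lborel)"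
    by (intro nn_integral_mono mult_right_mono ennreal_leI normal_density_le[OF \<sigma>]) auto
  also have "\<dots> = ennreal (1 / sqrt (2 * pi * \<sigma>\<^sup>2)) * ennreal (b - a)"
    using \<open>a \<le> b\<close> by (simp add: nn_integral_cmult_indicator)
  also have "\<dots> = ennreal ((b - a) / sqrt (2 * pi * \<sigma>\<^sup>2))"
    using \<open>a \<le> b\<close> by (subst ennreal_mult[symmetric]) auto
  finally show ?thesis by (simp add: vimage_def Int_def conj_commute)
qed

text \<open>
  A normal variable with bounded density is within \<open>\<eta>\<close> of any fixed number with probability of order
  \<open>\<eta>\<close>; conditioning on an independent variable extends this to a random centre.
\<close>

lemma (in prob_space) prob_independent_normal_near_le:
  assumes ind: "indep_var S U T V"
    and f: "f \<in> borel_measurable S" and g: "g \<in> borel_measurable T"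
    and X: "distributed M lborel (\<lambda>\<omega>. g (V \<omega>)) (normal_density \<mu> \<sigma>)" and \<sigma>: "0 < \<sigma>" and \<eta>: "0 \<le> \<eta>"
  shows "prob {\<omega>\<in>space M. \<bar>g (V \<omega>) - f (U \<omega>)\<bar> \<le> \<eta>} \<le> 2 * \<eta> / sqrt (2 * pi * \<sigma>\<^sup>2)"
proof -
  have [measurable]: "U \<in> measurable M S" "V \<in> measurable M T"
    using ind by (auto dest: indep_var_rv1 indep_var_rv2)
  note f[measurable] g[measurable]
  let ?F = "\<lambda>u v. indicator {z. \<bar>g (snd z) - f (fst z)\<bar> \<le> \<eta>} (u, v) :: ennreal"
  have "emeasure M {\<omega>\<in>space M. \<bar>g (V \<omega>) - f (U \<omega>)\<bar> \<le> \<eta>} = (\<integral>\<^sup>+\<omega>. ?F (U \<omega>) (V \<omega>) \<partial>M)"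
    (is "emeasure M ?E = _")
  proof -
    have "emeasure M ?E = (\<integral>\<^sup>+\<omega>. indicator ?E \<omega> \<partial>M)"
      by (rule nn_integral_indicator[symmetric]) measurable
    also have "\<dots> = (\<integral>\<^sup>+\<omega>. ?F (U \<omega>) (V \<omega>) \<partial>M)"
      by (intro nn_integral_cong) (auto simp: indicator_def)
    finally show ?thesis .
  qed
  also have "\<dots> = (\<integral>\<^sup>+\<omega>. (\<integral>\<^sup>+\<omega>'. ?F (U \<omega>) (V \<omega>') \<partial>M) \<partial>M)"
    by (rule indep_var_nn_integral_iterated[OF ind]) (simp add: case_prod_beta, measurable)
  also have "\<dots> \<le> (\<integral>\<^sup>+\<omega>. ennreal (2 * \<eta> / sqrt (2 * pi * \<sigma>\<^sup>2)) \<partial>M)"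
  proof (rule nn_integral_mono)
    fix \<omega>
    have "(\<integral>\<^sup>+\<omega>'. ?F (U \<omega>) (V \<omega>') \<partial>M) = emeasure M {\<omega>'\<in>space M. g (V \<omega>') \<in> {f (U \<omega>) - \<eta>..f (U \<omega>) + \<eta>}}"
      (is "_ = emeasure M ?E")
    proof -
      have "emeasure M ?E = (\<integral>\<^sup>+\<omega>'. indicator ?E \<omega>' \<partial>M)"
        by (rule nn_integral_indicator[symmetric]) measurable
      also have "\<dots> = (\<integral>\<^sup>+\<omega>'. ?F (U \<omega>) (V \<omega>') \<partial>M)"
        by (intro nn_integral_cong) (auto simp: indicator_def)
      finally show ?thesis by simp
    qed
    also have "\<dots> \<le> ennreal (2 * \<eta> / sqrt (2 * pi * \<sigma>\<^sup>2))"
      using prob_normal_interval_le[OF X \<sigma>, of "f (U \<omega>) - \<eta>" "f (U \<omega>) + \<eta>"] \<eta> by simp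
    finally show "(\<integral>\<^sup>+\<omega>'. ?F (U \<omega>) (V \<omega>') \<partial>M) \<le> ennreal (2 * \<eta> / sqrt (2 * pi * \<sigma>\<^sup>2))" .
  qed
  also have "\<dots> = ennreal (2 * \<eta> / sqrt (2 * pi * \<sigma>\<^sup>2))" by (simp add: emeasure_space_1)
  finally show ?thesis using \<eta> by (simp add: emeasure_eq_measure)
qed

lemma (in prob_space) char_distr_scale:
  assumes [measurable]: "X \<in> borel_measurable M"
  shows "char (distr M borel (\<lambda>\<omega>. s * X \<omega>)) t = char (distr M borel X) (s * t)"
  unfolding char_def by (simp add: integral_distr mult_ac)

lemma (in prob_space) char_normal:
  assumes X: "distributed M lborel X (normal_density 0 \<sigma>)" and \<sigma>: "0 < \<sigma>"
  shows "char (distr M borel X) t = exp (- (\<sigma>\<^sup>2 * t\<^sup>2) / 2)"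
proof -
  have Xm[measurable]: "X \<in> borel_measurable M" using X by (auto simp: distributed_def)
  have "distributed M lborel (\<lambda>x. X x / \<sigma>) std_normal_density"
    using X normal_standard_normal_convert[OF \<sigma>, of X 0] by simp
  then have d: "distr M borel (\<lambda>x. X x / \<sigma>) = std_normal_distribution"
    by (auto simp: distributed_def cong: distr_cong)
  have "char (distr M borel X) t = char (distr M borel (\<lambda>\<omega>. \<sigma> * (X \<omega> / \<sigma>))) t"
    using \<sigma> by (intro arg_cong2[where f=char] distr_cong) auto
  also have "\<dots> = char std_normal_distribution (\<sigma> * t)"
    by (subst char_distr_scale) (auto simp: d)
  finally show ?thesis by (simp add: char_std_normal_distribution power_mult_distrib)
qed

lemma exp_minus_linear_error:
  fixes y :: real assumes "0 \<le> y" shows "\<bar>(1 - y) - exp (- y)\<bar> \<le> y\<^sup>2"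
proof -
  have "1 - y \<le> exp (- y)" using exp_ge_add_one_self[of "- y"] by simp
  moreover have "exp (- y) \<le> 1 - y + y\<^sup>2"
  proof -
    have "1 \<le> (1 - y + y\<^sup>2) * (1 + y)"
    proof -
      have "(1 - y + y\<^sup>2) * (1 + y) = 1 + y^3" by algebra
      then show ?thesis using assms by simp
    qed
    also have "\<dots> \<le> (1 - y + y\<^sup>2) * exp y"
    proof (rule mult_left_mono)
      show "1 + y \<le> exp y" by (rule exp_ge_add_one_self)
      have "0 \<le> (1 - y / 2)\<^sup>2 + 3 / 4 * y\<^sup>2" by simp
      also have "\<dots> = 1 - y + y\<^sup>2" by (simp add: power2_eq_square algebra_simps)
      finally show "0 \<le> 1 - y + y\<^sup>2" .
    qed
    finally show ?thesis by (simp add: exp_minus field_simps)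
  qed
  ultimately show ?thesis by (simp add: abs_le_iff)
qed

text \<open>
  The product of the characteristic functions is compared factor by factor with a product of
  exponentials. A summand bounded by \<open>1\<close> has third absolute moment at most its variance, so the total
  error is the variance of the scaled sum times a quantity that vanishes with \<open>s\<close>.
\<close>

lemma (in prob_space) char_scaled_sum_error:
  fixes X :: "'i \<Rightarrow> 'a \<Rightarrow> real" and s t w :: real
  assumes ind: "indep_vars (\<lambda>_. borel) X J" and J: "finite J"
    and X: "\<And>i. i \<in> J \<Longrightarrow> expectation (X i) = 0" "\<And>i. i \<in> J \<Longrightarrow> expectation (\<lambda>\<omega>. (X i \<omega>)\<^sup>2) = w"
    and b: "\<And>i \<omega>. i \<in> J \<Longrightarrow> \<omega> \<in> space M \<Longrightarrow> \<bar>X i \<omega>\<bar> \<le> 1" and w: "0 \<le> w" "w \<le> 1"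
  shows "cmod (char (distr M borel (\<lambda>\<omega>. s * (\<Sum>i\<in>J. X i \<omega>))) t - exp (- (card J * s\<^sup>2 * w * t\<^sup>2) / 2))
    \<le> card J * s\<^sup>2 * w * (\<bar>s\<bar> * \<bar>t\<bar>^3 / 6 + s\<^sup>2 * t^4 / 4)"
proof -
  have Xm[measurable]: "X i \<in> borel_measurable M" if "i \<in> J" for i
    using ind that by (auto simp: indep_vars_def)
  define u where "u = s * t"
  define y where "y = u\<^sup>2 * w / 2"
  have y: "0 \<le> y" unfolding y_def using w by simp
  have int: "integrable M (X i)" "integrable M (\<lambda>\<omega>. (X i \<omega>)\<^sup>2)" if i: "i \<in> J" for i
    using b[OF i] Xm[OF i]
    by (auto intro!: integrable_const_bound[where B=1] AE_I2 simp: abs_square_le_1)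
  have e1: "char (distr M borel (\<lambda>\<omega>. s * (\<Sum>i\<in>J. X i \<omega>))) t = (\<Prod>i\<in>J. char (distr M borel (X i)) u)"
    unfolding u_def by (subst char_distr_scale) (auto simp: char_distr_sum[OF ind])
  have e2: "complex_of_real (exp (- (card J * s\<^sup>2 * w * t\<^sup>2) / 2)) = (\<Prod>i\<in>J. complex_of_real (exp (- y)))"
    unfolding y_def u_def by (simp flip: of_real_power exp_of_nat_mult add: power_mult_distrib mult_ac)
  have "cmod ((\<Prod>i\<in>J. char (distr M borel (X i)) u) - (\<Prod>i\<in>J. complex_of_real (exp (- y))))
      \<le> (\<Sum>i\<in>J. cmod (char (distr M borel (X i)) u - complex_of_real (exp (- y))))"
  proof (rule norm_prod_diff)
    show "cmod (char (distr M borel (X i)) u) \<le> 1" if "i \<in> J" for i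
      using that by (intro real_distribution.cmod_char_le_1) simp
    show "cmod (complex_of_real (exp (- y))) \<le> 1" using y by simp
  qed
  also have "\<dots> \<le> (\<Sum>i\<in>J. u\<^sup>2 * w * (\<bar>u\<bar> / 6 + u\<^sup>2 / 4))"
  proof (rule sum_mono)
    fix i assume i: "i \<in> J"
    have "cmod (char (distr M borel (X i)) u - (1 - u\<^sup>2 * w / 2)) \<le>
      (u\<^sup>2 / 6) * expectation (\<lambda>x. min (6 * (X i x)\<^sup>2) (\<bar>u\<bar> * \<bar>X i x\<bar>^3))"
      by (rule char_approx3'[OF Xm[OF i] int[OF i] X(1)[OF i]]) (use X i in auto)
    also have "\<dots> \<le> (u\<^sup>2 / 6) * expectation (\<lambda>x. \<bar>u\<bar> * (X i x)\<^sup>2)"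
    proof (intro mult_left_mono integral_mono')
      fix \<omega> assume w: "\<omega> \<in> space M"
      have "\<bar>X i \<omega>\<bar>^3 = (X i \<omega>)\<^sup>2 * \<bar>X i \<omega>\<bar>" by (simp add: power3_eq_cube power2_eq_square abs_mult_self_eq)
      also have "\<dots> \<le> (X i \<omega>)\<^sup>2 * 1" using b[OF i w] by (intro mult_left_mono) auto
      finally have "\<bar>u\<bar> * \<bar>X i \<omega>\<bar>^3 \<le> \<bar>u\<bar> * (X i \<omega>)\<^sup>2" by (intro mult_left_mono) auto
      then show "min (6 * (X i \<omega>)\<^sup>2) (\<bar>u\<bar> * \<bar>X i \<omega>\<bar> ^ 3) \<le> \<bar>u\<bar> * (X i \<omega>)\<^sup>2" by simp
    qed (use int[OF i] in auto)
    also have "\<dots> = u\<^sup>2 * w * (\<bar>u\<bar> / 6)" using X(2)[OF i] by simp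
    finally have 1: "cmod (char (distr M borel (X i)) u - (1 - u\<^sup>2 * w / 2)) \<le> u\<^sup>2 * w * (\<bar>u\<bar> / 6)" .
    have "cmod (complex_of_real (1 - u\<^sup>2 * w / 2) - complex_of_real (exp (- y))) = \<bar>(1 - y) - exp (- y)\<bar>"
      unfolding y_def by (simp flip: of_real_diff)
    also have "\<dots> \<le> y\<^sup>2" by (rule exp_minus_linear_error[OF y])
    also have "\<dots> = (u\<^sup>2 * w * (u\<^sup>2 / 4)) * w" unfolding y_def by (simp add: power2_eq_square)
    also have "\<dots> \<le> u\<^sup>2 * w * (u\<^sup>2 / 4)" using w by (intro mult_left_le) auto
    finally have 2: "cmod (complex_of_real (1 - u\<^sup>2 * w / 2) - complex_of_real (exp (- y))) \<le> u\<^sup>2 * w * (u\<^sup>2 / 4)" .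
    have "cmod (char (distr M borel (X i)) u - complex_of_real (exp (- y))) \<le>
      cmod (char (distr M borel (X i)) u - (1 - u\<^sup>2 * w / 2)) +
      cmod (complex_of_real (1 - u\<^sup>2 * w / 2) - complex_of_real (exp (- y)))"
      by (rule order_trans[OF _ norm_triangle_ineq]) simp
    also have "\<dots> \<le> u\<^sup>2 * w * (\<bar>u\<bar> / 6) + u\<^sup>2 * w * (u\<^sup>2 / 4)" using 1 2 by (intro add_mono)
    finally show "cmod (char (distr M borel (X i)) u - complex_of_real (exp (- y))) \<le> u\<^sup>2 * w * (\<bar>u\<bar> / 6 + u\<^sup>2 / 4)"
      by (simp add: distrib_left)
  qed
  also have "\<dots> = card J * s\<^sup>2 * w * (\<bar>s\<bar> * \<bar>t\<bar>^3 / 6 + s\<^sup>2 * t^4 / 4)"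
  proof -
    have t3: "\<bar>t\<bar>^3 = t\<^sup>2 * \<bar>t\<bar>" by (simp add: power3_eq_cube power2_eq_square abs_mult_self_eq)
    have t4: "t^4 = t\<^sup>2 * t\<^sup>2" by (simp add: power2_eq_square power4_eq_xxxx mult.assoc)
    have "u\<^sup>2 * (\<bar>u\<bar> / 6 + u\<^sup>2 / 4) = s\<^sup>2 * (\<bar>s\<bar> * \<bar>t\<bar>^3 / 6 + s\<^sup>2 * t^4 / 4)"
      unfolding u_def t3 t4 by (simp add: power_mult_distrib abs_mult distrib_left distrib_right mult_ac)
    then show ?thesis by (simp add: mult_ac)
  qed
  finally show ?thesis unfolding e1 e2 .
qed

text \<open>
  The variance of one summand may tend to \<open>0\<close> with \<open>n\<close>, as happens for rare indicators. It is enough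
  that the scaled total variance converges and that the scale \<open>s\<close>, which bounds every scaled summand,
  vanishes.
\<close>

lemma triangular_block_clt:
  fixes M :: "nat \<Rightarrow> 'a measure" and P :: "'b measure" and X :: "nat \<Rightarrow> 'i \<Rightarrow> 'a \<Rightarrow> real"
    and s w :: "nat \<Rightarrow> real" and h :: real
  assumes M: "\<And>n. prob_space (M n)" "\<And>n. prob_space.indep_vars (M n) (\<lambda>_. borel) (X n) (J n)" "\<And>n. finite (J n)"
    and X: "\<And>n i. i \<in> J n \<Longrightarrow> (\<integral>\<omega>. X n i \<omega> \<partial>M n) = 0" "\<And>n i. i \<in> J n \<Longrightarrow> (\<integral>\<omega>. (X n i \<omega>)\<^sup>2 \<partial>M n) = w n"
    and b: "\<And>n i \<omega>. i \<in> J n \<Longrightarrow> \<omega> \<in> space (M n) \<Longrightarrow> \<bar>X n i \<omega>\<bar> \<le> 1" and w: "\<And>n. 0 \<le> w n" "\<And>n. w n \<le> 1"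
    and s: "s \<longlonglongrightarrow> 0" and lim: "(\<lambda>n. card (J n) * (s n)\<^sup>2 * w n) \<longlonglongrightarrow> h" and h: "0 < h"
    and P: "prob_space P" "distributed P lborel V (normal_density 0 (sqrt h))"
  shows "weak_conv_m (\<lambda>n. distr (M n) borel (\<lambda>\<omega>. s n * (\<Sum>i\<in>J n. X n i \<omega>))) (distr P borel V)"
proof (rule levy_continuity)
  have Xm: "X n i \<in> borel_measurable (M n)" if "i \<in> J n" for n i
    using M(2)[of n] that by (auto simp: prob_space.indep_vars_def[OF M(1)])
  show "real_distribution (distr (M n) borel (\<lambda>\<omega>. s n * (\<Sum>i\<in>J n. X n i \<omega>)))" for n
    using Xm by (intro prob_space.real_distribution_distr[OF M(1)]) auto
  show "real_distribution (distr P borel V)"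
    using P by (intro prob_space.real_distribution_distr) (auto simp: distributed_def)
  fix t
  let ?c = "\<lambda>n. card (J n) * (s n)\<^sup>2 * w n"
  let ?ch = "\<lambda>n. char (distr (M n) borel (\<lambda>\<omega>. s n * (\<Sum>i\<in>J n. X n i \<omega>))) t"
  have "(\<lambda>n. ?c n * (\<bar>s n\<bar> * \<bar>t\<bar>^3 / 6 + (s n)\<^sup>2 * t^4 / 4)) \<longlonglongrightarrow> h * (\<bar>0\<bar> * \<bar>t\<bar>^3 / 6 + 0\<^sup>2 * t^4 / 4)"
    by (intro tendsto_intros lim s) auto
  then have "(\<lambda>n. ?c n * (\<bar>s n\<bar> * \<bar>t\<bar>^3 / 6 + (s n)\<^sup>2 * t^4 / 4)) \<longlonglongrightarrow> 0" by simp
  then have "(\<lambda>n. ?ch n - complex_of_real (exp (- (?c n * t\<^sup>2) / 2))) \<longlonglongrightarrow> 0"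
    by (rule Lim_null_comparison[rotated])
       (intro always_eventually allI prob_space.char_scaled_sum_error[OF M(1) M(2) M(3) X b w]; assumption)
  moreover have "(\<lambda>n. complex_of_real (exp (- (?c n * t\<^sup>2) / 2))) \<longlonglongrightarrow> complex_of_real (exp (- (h * t\<^sup>2) / 2))"
    by (intro tendsto_intros lim) auto
  ultimately have "?ch \<longlonglongrightarrow> complex_of_real (exp (- (h * t\<^sup>2) / 2))"
    by (rule Lim_transform[rotated])
  then show "?ch \<longlonglongrightarrow> char (distr P borel V) t"
    using h by (subst prob_space.char_normal[OF P]) auto
qed

section \<open>Independent families and the growth of Brownian motion\<close>

text \<open>
  For a finite index set and constant target space the product formula needs to be checked on full
  families only; a smaller family is covered by choosing the whole space for the other indices. The
  empty index set is split off because the left side is then trivial.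
\<close>

lemma (in prob_space) indep_vars_finite_iff:
  assumes I: "finite I" and rv: "\<And>i. i \<in> I \<Longrightarrow> X i \<in> measurable M N"
  shows "indep_vars (\<lambda>_. N) X I \<longleftrightarrow> (\<forall>A. (\<forall>i\<in>I. A i \<in> sets N) \<longrightarrow>
    prob (\<Inter>i\<in>I. X i -` A i \<inter> space M) = (\<Prod>i\<in>I. prob (X i -` A i \<inter> space M))) \<or> I = {}"
proof (cases "I = {}")
  case True
  then show ?thesis by (simp add: indep_vars_def indep_sets_def)
next
  case False
  have "indep_vars (\<lambda>_. N) X I \<longleftrightarrow>
    (\<forall>A\<in>(\<Pi> i\<in>I. sets N). prob (\<Inter>j\<in>I. X j -` A j \<inter> space M) = (\<Prod>j\<in>I. prob (X j -` A j \<inter> space M)))"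
    using False I rv
    by (intro indep_vars_finite) (auto simp: Int_stable_def sets.sigma_sets_eq sets.space_closed)
  then show ?thesis using False by (auto simp: Pi_iff)
qed

lemma (in prob_space) indep_vars_reindex:
  assumes J: "finite J" "inj_on g J" and ind: "indep_vars (\<lambda>_. N) X (g ` J)"
  shows "indep_vars (\<lambda>_. N) (\<lambda>j. X (g j)) J"
proof (cases "J = {}")
  case True
  then show ?thesis by (simp add: indep_vars_def indep_sets_def)
next
  case False
  have rv: "X i \<in> measurable M N" if "i \<in> g ` J" for i using ind that by (auto simp: indep_vars_def2)
  show ?thesis
  proof (subst indep_vars_finite_iff[OF J(1)], use rv in blast, intro disjI1 allI impI)
    fix A assume A: "\<forall>i\<in>J. A i \<in> sets N"
    let ?B = "\<lambda>i. A (the_inv_into J g i)"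
    have "prob (\<Inter>i\<in>g ` J. X i -` ?B i \<inter> space M) = (\<Prod>i\<in>g ` J. prob (X i -` ?B i \<inter> space M))"
      using A J False by (intro indep_varsD_finite[OF ind]) (auto simp: the_inv_into_f_f)
    moreover have "(\<Inter>i\<in>g ` J. X i -` ?B i \<inter> space M) = (\<Inter>i\<in>J. X (g i) -` A i \<inter> space M)"
      using J by (auto simp: the_inv_into_f_f)
    ultimately show "prob (\<Inter>i\<in>J. X (g i) -` A i \<inter> space M) = (\<Prod>i\<in>J. prob (X (g i) -` A i \<inter> space M))"
      using J by (simp add: prod.reindex the_inv_into_f_f)
  qed
qed

lemma (in prob_space) indep_vars_cong_space:
  assumes X: "indep_vars N X I" and eq: "\<And>i \<omega>. i \<in> I \<Longrightarrow> \<omega> \<in> space M \<Longrightarrow> X i \<omega> = Y i \<omega>"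
  shows "indep_vars N Y I"
  unfolding indep_vars_def2
proof
  show "\<forall>i\<in>I. random_variable (N i) (Y i)"
    using X eq by (auto simp: indep_vars_def2 cong: measurable_cong)
  have "{X i -` A \<inter> space M |A. A \<in> sets (N i)} = {Y i -` A \<inter> space M |A. A \<in> sets (N i)}" if "i \<in> I" for i
  proof -
    have "X i -` A \<inter> space M = Y i -` A \<inter> space M" for A using eq[OF that] by auto
    then show ?thesis by simp
  qed
  then have "indep_sets (\<lambda>i. {X i -` A \<inter> space M |A. A \<in> sets (N i)}) I \<longleftrightarrow>
      indep_sets (\<lambda>i. {Y i -` A \<inter> space M |A. A \<in> sets (N i)}) I"
    by (intro indep_sets_cong refl)
  then show "indep_sets (\<lambda>i. {Y i -` A \<inter> space M |A. A \<in> sets (N i)}) I"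
    using X by (auto simp: indep_vars_def2)
qed

text \<open>
  Two independent families that are independent of each other merge into one. It joins the increments
  of the two halves of a two-sided Brownian motion.
\<close>

lemma (in prob_space) indep_vars_Un:
  assumes fin: "finite A" "finite B" and dis: "A \<inter> B = {}"
    and A: "indep_vars (\<lambda>_. N) X A" and B: "indep_vars (\<lambda>_. N) X B"
    and AB: "indep_var (PiM A (\<lambda>_. N)) (\<lambda>\<omega>. restrict (\<lambda>i. X i \<omega>) A) (PiM B (\<lambda>_. N)) (\<lambda>\<omega>. restrict (\<lambda>i. X i \<omega>) B)"
  shows "indep_vars (\<lambda>_. N) X (A \<union> B)"
proof (cases "A = {} \<or> B = {}")
  case True
  then show ?thesis using A B by auto
next
  case False
  then have ne: "A \<noteq> {}" "B \<noteq> {}" by auto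
  have rv: "X i \<in> measurable M N" if "i \<in> A \<union> B" for i using A B that by (auto simp: indep_vars_def2)
  show ?thesis
  proof (subst indep_vars_finite_iff, use fin in blast, use rv in blast, intro disjI1 allI impI)
    fix S assume S: "\<forall>i\<in>A \<union> B. S i \<in> sets N"
    let ?a = "\<lambda>\<omega>. restrict (\<lambda>i. X i \<omega>) A" and ?b = "\<lambda>\<omega>. restrict (\<lambda>i. X i \<omega>) B"
    have pre: "?a -` (PiE A S) \<inter> space M = (\<Inter>i\<in>A. X i -` S i \<inter> space M)"
      "?b -` (PiE B S) \<inter> space M = (\<Inter>i\<in>B. X i -` S i \<inter> space M)"
      using ne by (auto simp: PiE_def Pi_def)
    have "prob (\<Inter>i\<in>A \<union> B. X i -` S i \<inter> space M) =
        prob ((\<lambda>x. (?a x, ?b x)) -` (PiE A S \<times> PiE B S) \<inter> space M)"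
      using ne by (intro arg_cong[where f=prob]) (auto simp: PiE_def Pi_def)
    also have "\<dots> = prob (?a -` (PiE A S) \<inter> space M) * prob (?b -` (PiE B S) \<inter> space M)"
      using S fin by (intro indep_varD[OF AB] sets_PiM_I_finite) auto
    also have "\<dots> = (\<Prod>i\<in>A. prob (X i -` S i \<inter> space M)) * (\<Prod>i\<in>B. prob (X i -` S i \<inter> space M))"
      unfolding pre using S ne fin
      by (intro arg_cong2[where f="(*)"] indep_varsD_finite[OF A] indep_varsD_finite[OF B]) auto
    also have "\<dots> = (\<Prod>i\<in>A \<union> B. prob (X i -` S i \<inter> space M))"
      using fin dis by (simp add: prod.union_disjoint)
    finally show "prob (\<Inter>i\<in>A \<union> B. X i -` S i \<inter> space M) = (\<Prod>i\<in>A \<union> B. prob (X i -` S i \<inter> space M))" .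
  qed
qed

lemma (in prob_space) distributed_normal_uminus:
  assumes "distributed M lborel X (normal_density 0 \<sigma>)" "0 < \<sigma>"
  shows "distributed M lborel (\<lambda>\<omega>. - X \<omega>) (normal_density 0 \<sigma>)"
  using normal_density_affine[OF assms, of "-1" 0] by simp

text \<open>
  Comparison with a telescoping sum. It evaluates the Hajek-Renyi bound for linear boundaries,
  uniformly in the mesh \<open>h\<close>.
\<close>

lemma sum_inverse_square_le:
  fixes y h :: real assumes "0 < y" "0 \<le> h"
  shows "(\<Sum>i<n. h / (real (Suc i) * h + y)\<^sup>2) \<le> 1 / y"
proof -
  have "h / (real (Suc i) * h + y)\<^sup>2 \<le> 1 / (real i * h + y) - 1 / (real (Suc i) * h + y)" for i
  proof -
    let ?p = "real i * h + y" and ?q = "real (Suc i) * h + y"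
    have pq: "0 < ?p" "?p \<le> ?q" "?q - ?p = h" using assms by (auto simp: add_nonneg_pos distrib_right)
    then have "1 / ?p - 1 / ?q = h / (?p * ?q)" by (simp add: field_simps)
    moreover have "h / ?q\<^sup>2 \<le> h / (?p * ?q)"
      unfolding power2_eq_square using pq assms by (intro divide_left_mono mult_right_mono mult_pos_pos) auto
    ultimately show ?thesis by simp
  qed
  then have "(\<Sum>i<n. h / (real (Suc i) * h + y)\<^sup>2) \<le> (\<Sum>i<n. 1 / (real i * h + y) - 1 / (real (Suc i) * h + y))"
    by (intro sum_mono)
  also have "\<dots> = 1 / y - 1 / (real n * h + y)"
    using sum_lessThan_telescope'[of "\<lambda>i. 1 / (real i * h + y)" n] by simp
  also have "\<dots> \<le> 1 / y" using assms by (simp add: add_nonneg_pos less_imp_le)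
  finally show ?thesis .
qed

text \<open>
  On the grid of mesh \<open>1 / (r + 1)\<close> up to time \<open>r + 1\<close> the Hajek-Renyi inequality bounds the crossing of the
  line \<open>(v + K) / 8\<close> by \<open>64 / K\<close>, whatever the mesh. A crossing by the continuous path is seen by all
  sufficiently fine grids. The slope is smaller than the drift \<open>1 / 2\<close>, which makes the drifted path
  negative far out.
\<close>

lemma brownian_motion_sublinear:
  assumes B: "brownian_motion P B" and K: "0 < K"
  shows "\<exists>E\<in>sets P. measure P E \<le> 64 / K \<and> (\<forall>\<omega>\<in>space P - E. \<forall>v\<ge>0. \<bar>B v \<omega>\<bar> \<le> (v + K) / 8)"
proof -
  interpret prob_space P using B unfolding brownian_motion_def by blast
  have Bm: "B t \<in> borel_measurable P" if "0 \<le> t" for t using B that unfolding brownian_motion_def by blast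
  have path: "B 0 \<omega> = 0" "continuous_on {0..} (\<lambda>t. B t \<omega>)" if "\<omega> \<in> space P" for \<omega>
    using B that unfolding brownian_motion_def by blast+
  have inc: "indep_vars (\<lambda>_. borel) (\<lambda>i \<omega>. B (t (Suc i)) \<omega> - B (t i) \<omega>) {..<m}"
    if "0 \<le> t 0" "\<forall>i<m. t i \<le> t (Suc i)" for t and m :: nat
    using B that unfolding brownian_motion_def by blast
  have nrm: "distributed P lborel (\<lambda>\<omega>. B t \<omega> - B s \<omega>) (normal_density 0 (sqrt (t - s)))" if "0 \<le> s" "s < t" for s t
    using B that unfolding brownian_motion_def by blast
  define h where "h r = 1 / real (Suc r)" for r
  have h: "0 < h r" for r unfolding h_def by simp
  define E where "E r = {\<omega>\<in>space P. \<exists>k\<le>(Suc r)\<^sup>2. 1 \<le> 8 / (real k * h r + K) * \<bar>\<Sum>i<k. B (real (Suc i) * h r) \<omega> - B (real i * h r) \<omega>\<bar>}" for r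
  have tel: "(\<Sum>i<k. B (real (Suc i) * h r) \<omega> - B (real i * h r) \<omega>) = B (real k * h r) \<omega>" if "\<omega> \<in> space P" for k r \<omega>
    using sum_lessThan_telescope[of "\<lambda>i. B (real i * h r) \<omega>" k] path(1)[OF that] by simp
  have Es: "E r \<in> events" for r
  proof -
    have "E r = (\<Union>k\<in>{..(Suc r)\<^sup>2}. {\<omega>\<in>space P. 1 \<le> 8 / (real k * h r + K) * \<bar>\<Sum>i<k. B (real (Suc i) * h r) \<omega> - B (real i * h r) \<omega>\<bar>})"
      unfolding E_def by auto
    also have "\<dots> \<in> events"
    proof (intro sets.finite_UN)
      fix k
      have [measurable]: "(\<lambda>\<omega>. \<Sum>i<k. B (real (Suc i) * h r) \<omega> - B (real i * h r) \<omega>) \<in> borel_measurable P"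
        using h[of r] by (intro borel_measurable_sum borel_measurable_diff Bm) auto
      show "{\<omega>\<in>space P. 1 \<le> 8 / (real k * h r + K) * \<bar>\<Sum>i<k. B (real (Suc i) * h r) \<omega> - B (real i * h r) \<omega>\<bar>} \<in> events"
        by measurable
    qed simp
    finally show ?thesis .
  qed
  have Ep: "prob (E r) \<le> 64 / K" for r
  proof -
    let ?X = "\<lambda>i \<omega>. B (real (Suc i) * h r) \<omega> - B (real i * h r) \<omega>"
    have D: "distributed P lborel (?X i) (normal_density 0 (sqrt (h r)))" for i
    proof -
      have "real (Suc i) * h r - real i * h r = h r" by (simp add: algebra_simps)
      then show ?thesis using nrm[of "real i * h r" "real (Suc i) * h r"] h[of r] by simp
    qed
    have e2: "expectation (\<lambda>\<omega>. (?X i \<omega>)\<^sup>2) = h r" for i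
      using normal_distributed_variance[OF _ D[of i]] normal_distributed_expectation[OF _ D[of i]] h[of r] by simp
    \<comment> \<open>\<open>(8 / (i * h + K))^2 * h\<close> sums to at most \<open>64 / K\<close>\<close>
    have "prob (E r) \<le> (\<Sum>i<(Suc r)\<^sup>2. (8 / (real (Suc i) * h r + K))\<^sup>2 * h r)"
      unfolding E_def
    proof (rule hajek_renyi)
      show "indep_vars (\<lambda>_. borel) ?X {..<(Suc r)\<^sup>2}"
        by (rule inc) (use h[of r] in auto)
      show "expectation (?X i) = 0" for i
        using normal_distributed_expectation[OF _ D[of i]] h[of r] by simp
      show "integrable P (\<lambda>\<omega>. (?X i \<omega>)\<^sup>2)" for i
      proof (rule ccontr)
        assume "\<not> ?thesis"
        then have "expectation (\<lambda>\<omega>. (?X i \<omega>)\<^sup>2) = 0" by (rule not_integrable_integral_eq)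
        then show False using e2[of i] h[of r] by simp
      qed
      then show "integrable P (?X i)" for i
        using Bm h[of r] by (intro square_integrable_imp_integrable[of "?X i"]) auto
      show "expectation (\<lambda>\<omega>. (?X i \<omega>)\<^sup>2) \<le> h r" for i using e2 by simp
      show "0 \<le> 8 / (real i * h r + K)" for i using K h[of r] by simp
      show "8 / (real (Suc i) * h r + K) \<le> 8 / (real i * h r + K)" for i
      proof -
        have "0 < real i * h r + K" "real i * h r + K \<le> real (Suc i) * h r + K"
          using K h[of r] by (auto simp: add_nonneg_pos distrib_right)
        then show ?thesis by (intro divide_left_mono mult_pos_pos) auto
      qed
    qed
    also have "\<dots> = 64 * (\<Sum>i<(Suc r)\<^sup>2. h r / (real (Suc i) * h r + K)\<^sup>2)"
      by (simp add: sum_distrib_left power_divide)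
    also have "\<dots> \<le> 64 * (1 / K)" using K h[of r] by (intro mult_left_mono sum_inverse_square_le) auto
    finally show ?thesis by simp
  qed
  let ?E = "\<Union>R. \<Inter>r\<in>{R..}. E r"
  have "?E \<in> events" "prob ?E \<le> 64 / K" using prob_liminf_events_le[of E, OF Es Ep] by auto
  moreover have "\<bar>B v \<omega>\<bar> \<le> (v + K) / 8" if w: "\<omega> \<in> space P - ?E" and v: "0 \<le> v" for \<omega> v
  proof (rule ccontr)
    assume "\<not> \<bar>B v \<omega>\<bar> \<le> (v + K) / 8"
    then have gt: "0 < \<bar>B v \<omega>\<bar> - (v + K) / 8" by simp
    define u where "u r = real (nat \<lfloor>v * real (Suc r)\<rfloor>) * h r" for r
    have u_bounds: "0 \<le> u r" "u r \<le> v" "v - h r \<le> u r" for r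
    proof -
      have fl: "real (nat \<lfloor>v * real (Suc r)\<rfloor>) = of_int \<lfloor>v * real (Suc r)\<rfloor>" using v by simp
      have "of_int \<lfloor>v * real (Suc r)\<rfloor> \<le> v * real (Suc r)" "v * real (Suc r) - 1 \<le> of_int \<lfloor>v * real (Suc r)\<rfloor>" by linarith+
      from this[THEN mult_right_mono, of "h r"]
      have "of_int \<lfloor>v * real (Suc r)\<rfloor> * h r \<le> v * real (Suc r) * h r"
        "(v * real (Suc r) - 1) * h r \<le> of_int \<lfloor>v * real (Suc r)\<rfloor> * h r" using less_imp_le[OF h[of r]] by blast+
      moreover have "v * real (Suc r) * h r = v" "(v * real (Suc r) - 1) * h r = v - h r"
        unfolding h_def by (simp_all add: divide_simps)
      ultimately show "u r \<le> v" "v - h r \<le> u r" unfolding u_def fl by (simp_all only:)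
      show "0 \<le> u r" unfolding u_def using h[of r] by simp
    qed
    have h0: "h \<longlonglongrightarrow> 0" unfolding h_def using LIMSEQ_inverse_real_of_nat by (simp add: inverse_eq_divide)
    have u_lim: "u \<longlonglongrightarrow> v"
      by (rule tendsto_sandwich[of "\<lambda>r. v - h r" _ _ "\<lambda>_. v"])
         (use u_bounds h0 in \<open>auto intro!: tendsto_eq_intros\<close>)
    from this have "(\<lambda>r. B (u r) \<omega>) \<longlonglongrightarrow> B v \<omega>"
      using w u_bounds(1) v by (intro continuous_on_tendsto_compose[OF path(2)]) auto
    then have "(\<lambda>r. \<bar>B (u r) \<omega>\<bar> - (u r + K) / 8) \<longlonglongrightarrow> \<bar>B v \<omega>\<bar> - (v + K) / 8"
      using u_lim by (intro tendsto_intros) auto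
    then have ev: "eventually (\<lambda>r. 0 < \<bar>B (u r) \<omega>\<bar> - (u r + K) / 8) sequentially"
      using gt by (rule order_tendstoD)
    moreover have "eventually (\<lambda>r. v \<le> real (Suc r)) sequentially"
      using eventually_ge_at_top[of "nat \<lceil>v\<rceil>"] by eventually_elim linarith
    ultimately have "eventually (\<lambda>r. \<omega> \<in> E r) sequentially"
    proof eventually_elim
      case (elim r)
      let ?k = "nat \<lfloor>v * real (Suc r)\<rfloor>"
      have "v * real (Suc r) \<le> real (Suc r) * real (Suc r)" using elim by (intro mult_right_mono) auto
      then have "v * real (Suc r) \<le> real ((Suc r)\<^sup>2)" by (simp only: power2_eq_square of_nat_mult)
      from floor_mono[OF this] have k: "?k \<le> (Suc r)\<^sup>2" by (simp only: floor_of_nat nat_le_iff)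
      have "0 < u r + K" using u_bounds(1)[of r] K by simp
      then have "1 \<le> 8 / (u r + K) * \<bar>B (u r) \<omega>\<bar>" using elim by (simp add: field_simps)
      then have "1 \<le> 8 / (real ?k * h r + K) * \<bar>\<Sum>i<?k. B (real (Suc i) * h r) \<omega> - B (real i * h r) \<omega>\<bar>"
        unfolding tel[OF DiffD1[OF w]] u_def .
      then show ?case unfolding E_def using w k by blast
    qed
    then show False using w unfolding eventually_sequentially by blast
  qed
  ultimately show ?thesis by blast
qed

section \<open>Two-sided Brownian motion\<close>

locale two_sided_bm = prob_space P for P :: "'b measure" +
  fixes W :: "real \<Rightarrow> 'b \<Rightarrow> real"
  assumes two_sided: "two_sided_brownian_motion P W"
begin

definition Z :: "real \<Rightarrow> 'b \<Rightarrow> real" where "Z v \<omega> = W v \<omega> - \<bar>v\<bar> / 2"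

lemma halves:
  obtains W1 W2 where "brownian_motion P W1" "brownian_motion P W2"
    "indep_var (Pi\<^sub>M {0..} (\<lambda>_. borel)) (\<lambda>\<omega>. \<lambda>t\<in>{0..}. W1 t \<omega>)
          (Pi\<^sub>M {0..} (\<lambda>_. borel)) (\<lambda>\<omega>. \<lambda>t\<in>{0..}. W2 t \<omega>)"
    "\<And>u \<omega>. \<omega> \<in> space P \<Longrightarrow> W u \<omega> = (if u \<le> 0 then W1 (- u) \<omega> else W2 u \<omega>)"
    "\<And>u \<omega>. \<omega> \<in> space P \<Longrightarrow> W u \<omega> = (if u < 0 then W1 (- u) \<omega> else W2 u \<omega>)"
proof -
  obtain W1 W2 where w: "brownian_motion P W1" "brownian_motion P W2"
    "indep_var (Pi\<^sub>M {0..} (\<lambda>_. borel)) (\<lambda>\<omega>. \<lambda>t\<in>{0..}. W1 t \<omega>)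
          (Pi\<^sub>M {0..} (\<lambda>_. borel)) (\<lambda>\<omega>. \<lambda>t\<in>{0..}. W2 t \<omega>)"
    and W: "\<And>u \<omega>. \<omega> \<in> space P \<Longrightarrow> W u \<omega> = (if u < 0 then W1 (- u) \<omega> else W2 u \<omega>)"
    using two_sided unfolding two_sided_brownian_motion_def by blast
  have z: "W1 0 \<omega> = 0" "W2 0 \<omega> = 0" if "\<omega> \<in> space P" for \<omega>
    using w(1,2) that unfolding brownian_motion_def by blast+
  have "W u \<omega> = (if u \<le> 0 then W1 (- u) \<omega> else W2 u \<omega>)" if "\<omega> \<in> space P" for u \<omega>
    using W[OF that, of u] z[OF that] by (cases "u = 0") auto
  then show thesis using that w W by blast
qed

lemma W_0: "\<omega> \<in> space P \<Longrightarrow> W 0 \<omega> = 0"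
  by (rule halves, unfold brownian_motion_def) auto

lemma W_measurable[measurable]: "W u \<in> borel_measurable P"
proof -
  obtain W1 W2 where w: "brownian_motion P W1" "brownian_motion P W2"
    and W: "\<And>u \<omega>. \<omega> \<in> space P \<Longrightarrow> W u \<omega> = (if u < 0 then W1 (- u) \<omega> else W2 u \<omega>)"
    by (rule halves) blast
  have "W1 (- u) \<in> borel_measurable P" if "u < 0"
    using w(1) that unfolding brownian_motion_def by (meson less_imp_le neg_0_le_iff_le)
  moreover have "W2 u \<in> borel_measurable P" if "\<not> u < 0"
    using w(2) that unfolding brownian_motion_def by (meson not_less)
  ultimately show ?thesis
    by (cases "u < 0") (simp_all add: W cong: measurable_cong)
qed

lemma Z_measurable[measurable]: "Z u \<in> borel_measurable P"
  unfolding Z_def by measurable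

lemma W_continuous: assumes "\<omega> \<in> space P" shows "continuous_on UNIV (\<lambda>u. W u \<omega>)"
proof -
  obtain W1 W2 where w: "brownian_motion P W1" "brownian_motion P W2"
    and W: "\<And>u \<omega>. \<omega> \<in> space P \<Longrightarrow> W u \<omega> = (if u \<le> 0 then W1 (- u) \<omega> else W2 u \<omega>)"
    by (rule halves) blast
  have c: "continuous_on {0..} (\<lambda>t. W1 t \<omega>)" "continuous_on {0..} (\<lambda>t. W2 t \<omega>)" "W1 0 \<omega> = 0" "W2 0 \<omega> = 0"
    using w assms unfolding brownian_motion_def by blast+
  have "continuous_on ({..0} \<union> {0..}) (\<lambda>u. if u \<le> 0 then W1 (- u) \<omega> else W2 u \<omega>)"
    by (rule continuous_on_If) (use c in \<open>auto intro!: continuous_on_compose2[OF c(1)] continuous_intros\<close>)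
  moreover have "{..0} \<union> {0..} = (UNIV :: real set)" by auto
  ultimately show ?thesis using W[OF assms] by simp
qed

lemma Z_continuous: "\<omega> \<in> space P \<Longrightarrow> continuous_on UNIV (\<lambda>u. Z u \<omega>)"
  unfolding Z_def by (intro continuous_intros W_continuous) auto

lemma W_increment_normal:
  assumes "s < t" "0 \<le> s \<or> t \<le> 0"
  shows "distributed P lborel (\<lambda>\<omega>. W t \<omega> - W s \<omega>) (normal_density 0 (sqrt (t - s)))"
proof -
  obtain W1 W2 where w: "brownian_motion P W1" "brownian_motion P W2"
    and Wle: "\<And>u \<omega>. \<omega> \<in> space P \<Longrightarrow> W u \<omega> = (if u \<le> 0 then W1 (- u) \<omega> else W2 u \<omega>)"
    and Wlt: "\<And>u \<omega>. \<omega> \<in> space P \<Longrightarrow> W u \<omega> = (if u < 0 then W1 (- u) \<omega> else W2 u \<omega>)"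
    by (rule halves) blast
  have nrm: "distributed P lborel (\<lambda>\<omega>. B t \<omega> - B s \<omega>) (normal_density 0 (sqrt (t - s)))"
    if "brownian_motion P B" "0 \<le> s" "s < t" for s t B
    using that unfolding brownian_motion_def by blast
  show ?thesis
  proof (cases "0 \<le> s")
    case True
    have "distributed P lborel (\<lambda>\<omega>. W2 t \<omega> - W2 s \<omega>) (normal_density 0 (sqrt (t - s)))"
      by (rule nrm[OF w(2) True assms(1)])
    moreover have "W2 t \<omega> - W2 s \<omega> = W t \<omega> - W s \<omega>" if "\<omega> \<in> space P" for \<omega>
      using Wlt[OF that] True assms(1) by auto
    ultimately show ?thesis by (simp add: distributed_def cong: distr_cong measurable_cong)
  next
    case False
    have "- s - - t = t - s" by simp
    then have "distributed P lborel (\<lambda>\<omega>. W1 (- s) \<omega> - W1 (- t) \<omega>) (normal_density 0 (sqrt (t - s)))"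
      using nrm[OF w(1), of "- t" "- s"] assms False by simp
    then have "distributed P lborel (\<lambda>\<omega>. - (W1 (- s) \<omega> - W1 (- t) \<omega>)) (normal_density 0 (sqrt (t - s)))"
      using assms by (intro distributed_normal_uminus) auto
    moreover have "- (W1 (- s) \<omega> - W1 (- t) \<omega>) = W t \<omega> - W s \<omega>" if "\<omega> \<in> space P" for \<omega>
      using Wle[OF that] False assms by auto
    ultimately show ?thesis by (simp add: distributed_def cong: distr_cong measurable_cong)
  qed
qed

text \<open>
  Increments on the negative side are negated increments of the reversed half \<open>W1\<close>; the index shift by
  one comes from the reversal of the cell \<open>[i, i + 1]\<close>.
\<close>

lemma W_grid_increments_indep:
  assumes h: "0 < h"
  shows "indep_vars (\<lambda>_. borel) (\<lambda>i \<omega>. W (of_int (i + 1) * h) \<omega> - W (of_int i * h) \<omega>) {- int m..<int m}"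
proof -
  obtain W1 W2 where w: "brownian_motion P W1" "brownian_motion P W2"
    and ind: "indep_var (Pi\<^sub>M {0..} (\<lambda>_. borel)) (\<lambda>\<omega>. \<lambda>t\<in>{0..}. W1 t \<omega>)
          (Pi\<^sub>M {0..} (\<lambda>_. borel)) (\<lambda>\<omega>. \<lambda>t\<in>{0..}. W2 t \<omega>)"
    and Wle: "\<And>u \<omega>. \<omega> \<in> space P \<Longrightarrow> W u \<omega> = (if u \<le> 0 then W1 (- u) \<omega> else W2 u \<omega>)"
    and Wlt: "\<And>u \<omega>. \<omega> \<in> space P \<Longrightarrow> W u \<omega> = (if u < 0 then W1 (- u) \<omega> else W2 u \<omega>)"
    by (rule halves) blast
  have inc: "indep_vars (\<lambda>_. borel) (\<lambda>i \<omega>. B (real (Suc i) * h) \<omega> - B (real i * h) \<omega>) {..<m}"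
    if "brownian_motion P B" for B
  proof -
    have "\<forall>(m::nat) t. 0 \<le> t 0 \<longrightarrow> (\<forall>i<m. t i \<le> t (Suc i)) \<longrightarrow>
        indep_vars (\<lambda>_. borel) (\<lambda>i \<omega>. B (t (Suc i)) \<omega> - B (t i) \<omega>) {..<m}"
      using that unfolding brownian_motion_def by blast
    from this[rule_format, of "\<lambda>i. real i * h" m] show ?thesis using h by auto
  qed
  let ?U = "\<lambda>i \<omega>. W (of_int (i + 1) * h) \<omega> - W (of_int i * h) \<omega>"
  let ?N = "{- int m..<0}" and ?R = "{0..<int m}"
  have UN: "?U i \<omega> = W1 (- of_int (i + 1) * h) \<omega> - W1 (- of_int i * h) \<omega>" if "i < 0" "\<omega> \<in> space P" for i \<omega>
  proof -
    have "of_int (i + 1) * h \<le> 0" "of_int i * h \<le> 0" using that(1) h by (auto simp: mult_le_0_iff)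
    then show ?thesis
      using Wle[OF that(2), of "of_int (i + 1) * h"] Wle[OF that(2), of "of_int i * h"]
      by (simp only: if_True mult_minus_left)
  qed
  have UR: "?U i \<omega> = W2 (of_int (i + 1) * h) \<omega> - W2 (of_int i * h) \<omega>" if "0 \<le> i" "\<omega> \<in> space P" for i \<omega>
    using Wlt[OF that(2)] that(1) h by (auto simp: mult_less_0_iff)
  have "indep_vars (\<lambda>_. borel) ?U (?N \<union> ?R)"
  proof (rule indep_vars_Un)
    have "indep_vars (\<lambda>_. borel) (\<lambda>i \<omega>. - (W1 (real (Suc (nat (- i - 1))) * h) \<omega> - W1 (real (nat (- i - 1)) * h) \<omega>)) ?N"
    proof (rule indep_vars_reindex[where g="\<lambda>i. nat (- i - 1)" and X="\<lambda>i \<omega>. - (W1 (real (Suc i) * h) \<omega> - W1 (real i * h) \<omega>)"])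
      show "inj_on (\<lambda>i. nat (- i - 1)) ?N" by (auto simp: inj_on_def)
      have "indep_vars (\<lambda>_. borel) (\<lambda>i \<omega>. - (W1 (real (Suc i) * h) \<omega> - W1 (real i * h) \<omega>)) {..<m}"
        using indep_vars_compose2[OF inc[OF w(1)], of "\<lambda>_ x. - x"] by simp
      then show "indep_vars (\<lambda>_. borel) (\<lambda>i \<omega>. - (W1 (real (Suc i) * h) \<omega> - W1 (real i * h) \<omega>)) ((\<lambda>i. nat (- i - 1)) ` ?N)"
        by (rule indep_vars_subset) auto
    qed simp
    then show "indep_vars (\<lambda>_. borel) ?U ?N"
    proof (rule indep_vars_cong_space)
      fix i \<omega> assume i: "i \<in> ?N" and w: "\<omega> \<in> space P"
      have "real (Suc (nat (- i - 1))) = - of_int i" "real (nat (- i - 1)) = - of_int (i + 1)" using i by auto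
      then show "- (W1 (real (Suc (nat (- i - 1))) * h) \<omega> - W1 (real (nat (- i - 1)) * h) \<omega>) = ?U i \<omega>"
        using UN[of i \<omega>] i w by auto
    qed
    have "indep_vars (\<lambda>_. borel) (\<lambda>i \<omega>. (W2 (real (Suc (nat i)) * h) \<omega> - W2 (real (nat i) * h) \<omega>)) ?R"
    proof (rule indep_vars_reindex[where g="\<lambda>i. nat i" and X="\<lambda>i \<omega>. (W2 (real (Suc i) * h) \<omega> - W2 (real i * h) \<omega>)"])
      show "indep_vars (\<lambda>_. borel) (\<lambda>i \<omega>. (W2 (real (Suc i) * h) \<omega> - W2 (real i * h) \<omega>)) ((\<lambda>i. nat i) ` ?R)"
        by (rule indep_vars_subset[OF inc[OF w(2)]]) auto
    qed (auto simp: inj_on_def)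
    then show "indep_vars (\<lambda>_. borel) ?U ?R"
    proof (rule indep_vars_cong_space)
      fix i \<omega> assume i: "i \<in> ?R" and w: "\<omega> \<in> space P"
      have e: "real (Suc (nat i)) = of_int (i + 1)" "real (nat i) = of_int i" using i by auto
      have u: "?U i \<omega> = W2 (of_int (i + 1) * h) \<omega> - W2 (of_int i * h) \<omega>"
        by (rule UR) (use i w in auto)
      show "W2 (real (Suc (nat i)) * h) \<omega> - W2 (real (nat i) * h) \<omega> = ?U i \<omega>"
        unfolding u e ..
    qed
    show "indep_var (Pi\<^sub>M ?N (\<lambda>_. borel)) (\<lambda>\<omega>. \<lambda>i\<in>?N. ?U i \<omega>) (Pi\<^sub>M ?R (\<lambda>_. borel)) (\<lambda>\<omega>. \<lambda>i\<in>?R. ?U i \<omega>)"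
    proof -
      let ?f = "\<lambda>B :: real \<Rightarrow> real. restrict (\<lambda>i. B (- of_int (i + 1) * h) - B (- of_int i * h)) ?N"
      let ?g = "\<lambda>B :: real \<Rightarrow> real. restrict (\<lambda>i. B (of_int (i + 1) * h) - B (of_int i * h)) ?R"
      have "indep_var (Pi\<^sub>M ?N (\<lambda>_. borel)) (?f \<circ> (\<lambda>\<omega>. \<lambda>t\<in>{0..}. W1 t \<omega>)) (Pi\<^sub>M ?R (\<lambda>_. borel)) (?g \<circ> (\<lambda>\<omega>. \<lambda>t\<in>{0..}. W2 t \<omega>))"
        using h
        by (intro indep_var_compose[OF ind] measurable_restrict borel_measurable_diff measurable_component_singleton)
           (auto simp: mult_nonneg_nonneg mult_nonpos_nonneg)
      then show ?thesis
        unfolding indep_var_def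
        by (rule indep_vars_cong_space)
           (use UN UR h in \<open>auto simp: fun_eq_iff mult_nonneg_nonneg mult_nonpos_nonneg split: bool.split\<close>)
    qed
  qed auto
  moreover have "?N \<union> ?R = {- int m..<int m}" by auto
  ultimately show ?thesis by simp
qed

lemma W_sublinear_AE: "AE \<omega> in P. \<exists>K>0. \<forall>v. \<bar>W v \<omega>\<bar> \<le> (\<bar>v\<bar> + K) / 8"
proof -
  obtain W1 W2 where w: "brownian_motion P W1" "brownian_motion P W2"
    and W: "\<And>u \<omega>. \<omega> \<in> space P \<Longrightarrow> W u \<omega> = (if u < 0 then W1 (- u) \<omega> else W2 u \<omega>)"
    by (rule halves) blast
  have "\<exists>E\<in>events. prob E \<le> 128 / K \<and> (\<forall>\<omega>\<in>space P - E. \<forall>v. \<bar>W v \<omega>\<bar> \<le> (\<bar>v\<bar> + K) / 8)" if K: "0 < K" for K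
  proof -
    obtain E1 where E1: "E1 \<in> events" "prob E1 \<le> 64 / K" "\<forall>\<omega>\<in>space P - E1. \<forall>v\<ge>0. \<bar>W1 v \<omega>\<bar> \<le> (v + K) / 8"
      using brownian_motion_sublinear[OF w(1) K] by blast
    obtain E2 where E2: "E2 \<in> events" "prob E2 \<le> 64 / K" "\<forall>\<omega>\<in>space P - E2. \<forall>v\<ge>0. \<bar>W2 v \<omega>\<bar> \<le> (v + K) / 8"
      using brownian_motion_sublinear[OF w(2) K] by blast
    have "prob (E1 \<union> E2) \<le> 128 / K" using measure_Un_le[of E1 P E2] E1 E2 by simp
    moreover have "\<bar>W v \<omega>\<bar> \<le> (\<bar>v\<bar> + K) / 8" if "\<omega> \<in> space P - (E1 \<union> E2)" for v \<omega>
    proof (cases "v < 0")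
      case True
      have "\<bar>W1 (- v) \<omega>\<bar> \<le> (- v + K) / 8" using E1(3)[rule_format, of \<omega> "- v"] that True by auto
      then show ?thesis using W[of \<omega> v] that True by auto
    next
      case False
      have "\<bar>W2 v \<omega>\<bar> \<le> (v + K) / 8" using E2(3)[rule_format, of \<omega> v] that False by auto
      then show ?thesis using W[of \<omega> v] that False by auto
    qed
    ultimately show ?thesis using E1 E2 by blast
  qed
  then obtain E where E: "\<And>K. 0 < K \<Longrightarrow> E K \<in> events" "\<And>K. 0 < K \<Longrightarrow> prob (E K) \<le> 128 / K"
    "\<And>K \<omega> v. 0 < K \<Longrightarrow> \<omega> \<in> space P - E K \<Longrightarrow> \<bar>W v \<omega>\<bar> \<le> (\<bar>v\<bar> + K) / 8"
    by metis
  let ?N = "\<Inter>k::nat. E (real (Suc k))"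
  have N: "?N \<in> events" using E(1) by auto
  have "prob ?N \<le> 128 / real (Suc k)" for k
  proof -
    have "prob ?N \<le> prob (E (real (Suc k)))" using E(1) by (intro finite_measure_mono) auto
    also have "\<dots> \<le> 128 / real (Suc k)" by (rule E(2)) simp
    finally show ?thesis .
  qed
  moreover have "(\<lambda>k. 128 / real (Suc k)) \<longlonglongrightarrow> 0"
    using LIMSEQ_Suc[OF lim_const_over_n[of "128 :: real"]] by simp
  ultimately have "prob ?N \<le> 0" by (intro LIMSEQ_le_const) auto
  then have "?N \<in> null_sets P" using N by (simp add: null_sets_def emeasure_eq_measure measure_le_0_iff)
  then show ?thesis
  proof (rule AE_I')
    show "{\<omega> \<in> space P. \<not> (\<exists>K>0. \<forall>v. \<bar>W v \<omega>\<bar> \<le> (\<bar>v\<bar> + K) / 8)} \<subseteq> ?N"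
      using E(3) by (auto simp del: of_nat_Suc) (metis DiffI of_nat_0_less_iff zero_less_Suc)
  qed
qed

text \<open>
  Relative to the values at \<open>b\<close> and \<open>c\<close>, the two maxima depend only on increments outside the
  interval from \<open>b\<close> to \<open>c\<close>. Their difference is therefore an independent shift of the normal increment
  over that interval. The origin is kept out of the interior of the interval, so that the increment
  belongs to one half of \<open>W\<close>.
\<close>

lemma grid_maxima_not_close:
  assumes h: "0 < h" and bc: "- int m \<le> b" "b < c" "c \<le> int m" and \<eta>: "0 \<le> \<eta>"
    and side: "0 \<le> b \<or> c \<le> 0"
  defines "A \<equiv> \<lambda>\<omega>. Max ((\<lambda>i. Z (of_int i * h) \<omega>) ` {- int m..b})"
    and "A' \<equiv> \<lambda>\<omega>. Max ((\<lambda>i. Z (of_int i * h) \<omega>) ` {c..int m})"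
  shows "{\<omega>\<in>space P. \<bar>A \<omega> - A' \<omega>\<bar> \<le> \<eta>} \<in> events"
    and "prob {\<omega>\<in>space P. \<bar>A \<omega> - A' \<omega>\<bar> \<le> \<eta>} \<le> 2 * \<eta> / sqrt (2 * pi * (of_int (c - b) * h))"
proof -
  have [measurable]: "A \<in> borel_measurable P" "A' \<in> borel_measurable P"
    unfolding A_def A'_def by (intro borel_measurable_Max; simp)+
  show "{\<omega>\<in>space P. \<bar>A \<omega> - A' \<omega>\<bar> \<le> \<eta>} \<in> events" by measurable
  define U where "U i \<omega> = W (of_int (i + 1) * h) \<omega> - W (of_int i * h) \<omega>" for i \<omega>
  have tel: "(\<Sum>l\<in>{i..<j}. U l \<omega>) = W (of_int j * h) \<omega> - W (of_int i * h) \<omega>" if "i \<le> j" for i j \<omega>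
    using that
  proof (induction j rule: int_ge_induct)
    case (step j)
    have "{i..<j + 1} = insert j {i..<j}" using step by auto
    then show ?case using step by (simp add: U_def)
  qed simp
  let ?L = "{- int m..<b} \<union> {c..<int m}" and ?R = "{b..<c}"
  let ?u = "\<lambda>\<omega>. restrict (\<lambda>i. U i \<omega>) ?L" and ?v = "\<lambda>\<omega>. restrict (\<lambda>i. U i \<omega>) ?R"
  have ind: "indep_var (PiM ?L (\<lambda>_. borel)) ?u (PiM ?R (\<lambda>_. borel)) ?v"
    unfolding U_def by (rule indep_var_restrict[OF W_grid_increments_indep[OF h, of m]]) (use bc in auto)
  \<comment> \<open>the difference of the maxima, each taken relative to the inner end of its side\<close>
  define f where "f u = Max ((\<lambda>i. - (\<Sum>l\<in>{i..<b}. u l) - \<bar>of_int i * h\<bar> / 2) ` {- int m..b})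
    - Max ((\<lambda>i. (\<Sum>l\<in>{c..<i}. u l) - \<bar>of_int i * h\<bar> / 2) ` {c..int m})" for u :: "int \<Rightarrow> real"
  define g where "g v = (\<Sum>l\<in>{b..<c}. v l)" for v :: "int \<Rightarrow> real"
  have fm: "f \<in> borel_measurable (PiM ?L (\<lambda>_. borel))"
    unfolding f_def
    by (intro borel_measurable_diff borel_measurable_Max borel_measurable_uminus borel_measurable_sum measurable_component_singleton)
       auto
  have gm: "g \<in> borel_measurable (PiM ?R (\<lambda>_. borel))"
    unfolding g_def by (intro borel_measurable_sum measurable_component_singleton) auto
  have gv: "g (?v \<omega>) = W (of_int c * h) \<omega> - W (of_int b * h) \<omega>" for \<omega>
    unfolding g_def using tel[of b c \<omega>] bc by simp
  have fu: "f (?u \<omega>) = (A \<omega> - W (of_int b * h) \<omega>) - (A' \<omega> - W (of_int c * h) \<omega>)" for \<omega>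
  proof -
    have e1: "(\<lambda>i. - (\<Sum>l\<in>{i..<b}. ?u \<omega> l) - \<bar>of_int i * h\<bar> / 2) ` {- int m..b} =
        (\<lambda>x. - W (of_int b * h) \<omega> + x) ` (\<lambda>i. Z (of_int i * h) \<omega>) ` {- int m..b}"
      unfolding image_image
    proof (rule image_cong[OF refl])
      fix i assume i: "i \<in> {- int m..b}"
      have "(\<Sum>l\<in>{i..<b}. ?u \<omega> l) = (\<Sum>l\<in>{i..<b}. U l \<omega>)" using i by (intro sum.cong) auto
      then show "- (\<Sum>l\<in>{i..<b}. ?u \<omega> l) - \<bar>of_int i * h\<bar> / 2 = - W (of_int b * h) \<omega> + Z (of_int i * h) \<omega>"
        using tel[of i b \<omega>] i by (simp add: Z_def)
    qed
    have e2: "(\<lambda>i. (\<Sum>l\<in>{c..<i}. ?u \<omega> l) - \<bar>of_int i * h\<bar> / 2) ` {c..int m} =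
        (\<lambda>x. - W (of_int c * h) \<omega> + x) ` (\<lambda>i. Z (of_int i * h) \<omega>) ` {c..int m}"
      unfolding image_image
    proof (rule image_cong[OF refl])
      fix i assume i: "i \<in> {c..int m}"
      have "(\<Sum>l\<in>{c..<i}. ?u \<omega> l) = (\<Sum>l\<in>{c..<i}. U l \<omega>)" using i by (intro sum.cong) auto
      then show "(\<Sum>l\<in>{c..<i}. ?u \<omega> l) - \<bar>of_int i * h\<bar> / 2 = - W (of_int c * h) \<omega> + Z (of_int i * h) \<omega>"
        using tel[of c i \<omega>] i by (simp add: Z_def)
    qed
    have mx: "Max ((\<lambda>x. a + x) ` S) = a + Max S" if "finite S" "S \<noteq> {}" for a :: real and S
      using mono_Max_commute[of "\<lambda>x. a + x" S] that by (simp add: mono_def)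
    have "Max ((\<lambda>x. - W (of_int b * h) \<omega> + x) ` (\<lambda>i. Z (of_int i * h) \<omega>) ` {- int m..b}) = - W (of_int b * h) \<omega> + A \<omega>"
      unfolding A_def by (rule mx) (use bc in auto)
    moreover have "Max ((\<lambda>x. - W (of_int c * h) \<omega> + x) ` (\<lambda>i. Z (of_int i * h) \<omega>) ` {c..int m}) = - W (of_int c * h) \<omega> + A' \<omega>"
      unfolding A'_def by (rule mx) (use bc in auto)
    ultimately show ?thesis unfolding f_def e1 e2 by linarith
  qed
  have "of_int c * h - of_int b * h = of_int (c - b) * h" by (simp add: algebra_simps)
  moreover have hb: "0 < of_int (c - b) * h" using bc h by simp
  moreover have "of_int b * h < of_int c * h" using bc h by simp
  moreover have "0 \<le> of_int b * h \<or> of_int c * h \<le> 0" using side h by (auto simp: mult_le_0_iff)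
  ultimately have D: "distributed P lborel (\<lambda>\<omega>. g (?v \<omega>)) (normal_density 0 (sqrt (of_int (c - b) * h)))"
    unfolding gv using W_increment_normal[of "of_int b * h" "of_int c * h"] by simp
  have "prob {\<omega>\<in>space P. \<bar>g (?v \<omega>) - f (?u \<omega>)\<bar> \<le> \<eta>} \<le> 2 * \<eta> / sqrt (2 * pi * (sqrt (of_int (c - b) * h))\<^sup>2)"
    by (rule prob_independent_normal_near_le[where U="?u" and V="?v" and f=f and g=g, OF ind fm gm D]) (use hb \<eta> in auto)
  moreover have "\<bar>g (?v \<omega>) - f (?u \<omega>)\<bar> = \<bar>A \<omega> - A' \<omega>\<bar>" for \<omega>
    unfolding gv fu by (simp add: abs_minus_commute)
  ultimately show "prob {\<omega>\<in>space P. \<bar>A \<omega> - A' \<omega>\<bar> \<le> \<eta>} \<le> 2 * \<eta> / sqrt (2 * pi * (of_int (c - b) * h))"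
    using hb by simp
qed

end

section \<open>The maximiser of Brownian motion with drift\<close>

context two_sided_bm begin

definition maximisers :: "'b \<Rightarrow> real set" where
  "maximisers \<omega> = {v. \<forall>y. Z y \<omega> \<le> Z v \<omega>}"

text \<open>
  Two maximisers on different sides of a fixed interval with endpoints in the lattice of mesh
  \<open>1 / (D + 1)\<close> force the grid maxima on both sides to be within \<open>\<eta>\<close> on all fine grids, for every \<open>\<eta>\<close>.
  That has probability \<open>0\<close> by the bound for grid maxima.
\<close>

lemma no_two_separated_maximisers_AE:
  "AE \<omega> in P. \<not> (\<exists>u v. real_of_int (- int K) \<le> u \<and> u \<le> of_int \<beta> / real (Suc D) \<and>
     of_int (\<beta> + 1) / real (Suc D) \<le> v \<and> v \<le> real K \<and> u \<in> maximisers \<omega> \<and> v \<in> maximisers \<omega>)"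
    (is "AE \<omega> in P. \<not> ?ex \<omega>")
proof (cases "- int K * int (Suc D) \<le> \<beta> \<and> \<beta> + 1 \<le> int K * int (Suc D)")
  case False
  have "\<not> ?ex \<omega>" for \<omega>
  proof
    assume "?ex \<omega>"
    then have "real_of_int (- int K) \<le> of_int \<beta> / real (Suc D)" "of_int (\<beta> + 1) / real (Suc D) \<le> real K" by linarith+
    then have "real_of_int (- int K * int (Suc D)) \<le> of_int \<beta>" "real_of_int (\<beta> + 1) \<le> of_int (int K * int (Suc D))"
      by (simp_all add: field_simps)
    then show False using False by linarith
  qed
  then show ?thesis by simp
next
  case True
  define h where "h r = 1 / (real (Suc D) * real (Suc r))" for r
  define m b c where "m r = K * Suc D * Suc r" and "b r = \<beta> * int (Suc r)" and "c r = (\<beta> + 1) * int (Suc r)" for r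
  have h: "0 < h r" for r unfolding h_def by simp
  have bc: "- int (m r) \<le> b r" "b r < c r" "c r \<le> int (m r)" "0 \<le> b r \<or> c r \<le> 0" for r
  proof -
    show "- int (m r) \<le> b r" using mult_right_mono[OF conjunct1[OF True], of "int (Suc r)"]
      by (simp only: m_def b_def of_nat_mult mult_minus_left)
    show "c r \<le> int (m r)" using mult_right_mono[OF conjunct2[OF True], of "int (Suc r)"]
      by (simp only: m_def c_def of_nat_mult)
    show "b r < c r" unfolding b_def c_def by (simp add: distrib_right)
    show "0 \<le> b r \<or> c r \<le> 0" unfolding b_def c_def by (cases "0 \<le> \<beta>") (auto simp: mult_nonpos_nonneg)
  qed
  have pts: "of_int (b r) * h r = of_int \<beta> / real (Suc D)" "of_int (c r) * h r = of_int (\<beta> + 1) / real (Suc D)"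
    "real (m r) * h r = real K" for r
    unfolding b_def c_def m_def h_def by (simp_all del: of_nat_Suc mult_Suc mult_Suc_right)
  define A A' where "A r \<omega> = Max ((\<lambda>i. Z (of_int i * h r) \<omega>) ` {- int (m r)..b r})"
    and "A' r \<omega> = Max ((\<lambda>i. Z (of_int i * h r) \<omega>) ` {c r..int (m r)})" for r \<omega>
  define E where "E \<eta> r = {\<omega>\<in>space P. \<bar>A r \<omega> - A' r \<omega>\<bar> \<le> \<eta>}" for \<eta> r
  have cbh: "of_int (c r - b r) * h r = 1 / real (Suc D)" for r
    unfolding b_def c_def h_def by (simp add: left_diff_distrib[symmetric] del: of_nat_Suc)
  have Em: "E \<eta> r \<in> events" "prob (E \<eta> r) \<le> 2 * \<eta> / sqrt (2 * pi * (1 / real (Suc D)))" if "0 \<le> \<eta>" for \<eta> r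
    unfolding E_def A_def A'_def
    by (rule grid_maxima_not_close[OF h[of r] bc(1-3)[of r] that bc(4)[of r], unfolded cbh])+
  define N where "N \<eta> = (\<Union>R. \<Inter>r\<in>{R..}. E \<eta> r)" for \<eta>
  have Nm: "N \<eta> \<in> events" "prob (N \<eta>) \<le> 2 * \<eta> / sqrt (2 * pi * (1 / real (Suc D)))" if "0 \<le> \<eta>" for \<eta>
    unfolding N_def using prob_liminf_events_le[of "E \<eta>", OF Em[OF that]] by auto
  let ?N = "\<Inter>k::nat. N (1 / real (Suc k))"
  have N0: "?N \<in> events" using Nm(1) by auto
  have "prob ?N \<le> 2 * (1 / real (Suc k)) / sqrt (2 * pi * (1 / real (Suc D)))" for k
  proof -
    have "prob ?N \<le> prob (N (1 / real (Suc k)))" using Nm(1) by (intro finite_measure_mono) auto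
    also have "\<dots> \<le> 2 * (1 / real (Suc k)) / sqrt (2 * pi * (1 / real (Suc D)))" by (rule Nm(2)) simp
    finally show ?thesis .
  qed
  moreover have "(\<lambda>k. 2 * (1 / real (Suc k)) / sqrt (2 * pi * (1 / real (Suc D)))) \<longlonglongrightarrow> 2 * 0 / sqrt (2 * pi * (1 / real (Suc D)))"
    using LIMSEQ_Suc[OF lim_const_over_n[of "1 :: real"]] by (intro tendsto_intros) auto
  ultimately have "prob ?N \<le> 0" by (intro LIMSEQ_le_const) auto
  then have "?N \<in> null_sets P" using N0 by (simp add: null_sets_def emeasure_eq_measure measure_le_0_iff)
  then show ?thesis
  proof (rule AE_I')
    show "{\<omega> \<in> space P. \<not> \<not> ?ex \<omega>} \<subseteq> ?N"
    proof (intro subsetI INT_I)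
      fix \<omega> and k :: nat assume "\<omega> \<in> {\<omega> \<in> space P. \<not> \<not> ?ex \<omega>}"
      then obtain u v where w: "\<omega> \<in> space P" and u: "real_of_int (- int K) \<le> u" "u \<le> of_int \<beta> / real (Suc D)"
        and v: "of_int (\<beta> + 1) / real (Suc D) \<le> v" "v \<le> real K" and max: "u \<in> maximisers \<omega>" "v \<in> maximisers \<omega>"
        by blast
      define \<eta> where "\<eta> = 1 / real (Suc k)"
      have \<eta>: "0 < \<eta>" unfolding \<eta>_def by simp
      have Zuv: "Z u \<omega> = Z v \<omega>" using max unfolding maximisers_def by (auto intro: antisym)
      \<comment> \<open>rounding away from the interval keeps the grid points on their sides\<close>
      define i j where "i r = \<lfloor>u / h r\<rfloor>" and "j r = \<lceil>v / h r\<rceil>" for r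
      have ij: "- int (m r) \<le> i r" "i r \<le> b r" "c r \<le> j r" "j r \<le> int (m r)"
        "\<bar>of_int (i r) * h r - u\<bar> \<le> h r" "\<bar>of_int (j r) * h r - v\<bar> \<le> h r" for r
      proof -
        have "- real (m r) \<le> u / h r" "u / h r \<le> of_int (b r)" "of_int (c r) \<le> v / h r" "v / h r \<le> real (m r)"
          using u v h[of r] pts[of r] by (simp_all add: pos_le_divide_eq pos_divide_le_eq)
        then show "- int (m r) \<le> i r" "i r \<le> b r" "c r \<le> j r" "j r \<le> int (m r)"
          unfolding i_def j_def by linarith+
        have "\<bar>of_int (i r) - u / h r\<bar> \<le> 1" "\<bar>of_int (j r) - v / h r\<bar> \<le> 1"
          unfolding i_def j_def by linarith+
        then have "\<bar>of_int (i r) - u / h r\<bar> * h r \<le> 1 * h r" "\<bar>of_int (j r) - v / h r\<bar> * h r \<le> 1 * h r"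
          using h[of r] by (intro mult_right_mono; simp)+
        moreover have "\<bar>of_int (i r) - u / h r\<bar> * h r = \<bar>of_int (i r) * h r - u\<bar>"
          "\<bar>of_int (j r) - v / h r\<bar> * h r = \<bar>of_int (j r) * h r - v\<bar>"
          using h[of r] by (simp_all add: abs_mult_pos left_diff_distrib)
        ultimately show "\<bar>of_int (i r) * h r - u\<bar> \<le> h r" "\<bar>of_int (j r) * h r - v\<bar> \<le> h r" by simp_all
      qed
      have h0: "h \<longlonglongrightarrow> 0"
      proof -
        have "(\<lambda>r. 1 / real (Suc D) * (1 / real (Suc r))) \<longlonglongrightarrow> 1 / real (Suc D) * 0"
          using LIMSEQ_Suc[OF lim_const_over_n[of "1 :: real"]] by (intro tendsto_intros) auto
        then show ?thesis unfolding h_def by simp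
      qed
      have lim: "(\<lambda>r. Z (of_int (i r) * h r) \<omega>) \<longlonglongrightarrow> Z u \<omega>" "(\<lambda>r. Z (of_int (j r) * h r) \<omega>) \<longlonglongrightarrow> Z v \<omega>"
      proof -
        have "(\<lambda>r. of_int (i r) * h r) \<longlonglongrightarrow> u" "(\<lambda>r. of_int (j r) * h r) \<longlonglongrightarrow> v"
          using ij(5,6) h0 by (auto intro!: metric_tendsto_imp_tendsto[OF h0] always_eventually
            simp: dist_real_def abs_of_pos[OF h])
        then show "(\<lambda>r. Z (of_int (i r) * h r) \<omega>) \<longlonglongrightarrow> Z u \<omega>" "(\<lambda>r. Z (of_int (j r) * h r) \<omega>) \<longlonglongrightarrow> Z v \<omega>"
          by (intro continuous_on_tendsto_compose[OF Z_continuous[OF w]]; simp)+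
      qed
      have "eventually (\<lambda>r. Z u \<omega> - \<eta> < Z (of_int (i r) * h r) \<omega>) sequentially"
        "eventually (\<lambda>r. Z v \<omega> - \<eta> < Z (of_int (j r) * h r) \<omega>) sequentially"
        using \<eta> by (intro order_tendstoD(1)[OF lim(1)] order_tendstoD(1)[OF lim(2)]; simp)+
      then have "eventually (\<lambda>r. \<omega> \<in> E \<eta> r) sequentially"
      proof eventually_elim
        case (elim r)
        have "Z (of_int (i r) * h r) \<omega> \<le> A r \<omega>" unfolding A_def using ij(1,2)[of r] by (intro Max_ge) auto
        moreover have "Z (of_int (j r) * h r) \<omega> \<le> A' r \<omega>" unfolding A'_def using ij(3,4)[of r] by (intro Max_ge) auto
        moreover have "A r \<omega> \<le> Z u \<omega>" unfolding A_def
          using max(1) bc[of r] by (subst Max_le_iff) (auto simp: maximisers_def)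
        moreover have "A' r \<omega> \<le> Z v \<omega>" unfolding A'_def
          using max(2) bc[of r] by (subst Max_le_iff) (auto simp: maximisers_def)
        ultimately show ?case unfolding E_def using w elim Zuv by auto
      qed
      then show "\<omega> \<in> N (1 / real (Suc k))"
        unfolding N_def \<eta>_def[symmetric] eventually_sequentially by auto
    qed
  qed
qed

text \<open>
  Existence: sublinear growth confines the maximiser to a compact interval, as the value at the origin is
  \<open>0\<close> and the values far out are negative. Uniqueness: two maximisers are separated by one of countably
  many lattice intervals.
\<close>

lemma unique_maximiser_AE: "AE \<omega> in P. \<exists>v. maximisers \<omega> = {v}"
proof -
  have "AE \<omega> in P. \<forall>K D \<beta>. \<not> (\<exists>u v. real_of_int (- int K) \<le> u \<and> u \<le> of_int \<beta> / real (Suc D) \<and>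
     of_int (\<beta> + 1) / real (Suc D) \<le> v \<and> v \<le> real K \<and> u \<in> maximisers \<omega> \<and> v \<in> maximisers \<omega>)"
    unfolding AE_all_countable using no_two_separated_maximisers_AE by auto
  with W_sublinear_AE AE_space show ?thesis
  proof eventually_elim
    case (elim \<omega>)
    note w = elim(2) and sep = elim(3)
    obtain K where K: "0 < K" "\<And>v. \<bar>W v \<omega>\<bar> \<le> (\<bar>v\<bar> + K) / 8" using elim(1) by auto
    have out: "Z v \<omega> < 0" if "K < \<bar>v\<bar>" for v
      using K(2)[of v] that K(1) unfolding Z_def by (auto simp: abs_le_iff)
    have Z0: "Z 0 \<omega> = 0" unfolding Z_def using W_0[OF w] by simp
    have "\<exists>v\<in>{-K..K}. \<forall>y\<in>{-K..K}. Z y \<omega> \<le> Z v \<omega>"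
      using K(1) by (intro continuous_attains_sup continuous_on_subset[OF Z_continuous[OF w]]) auto
    then obtain v where v: "v \<in> {-K..K}" "\<And>y. y \<in> {-K..K} \<Longrightarrow> Z y \<omega> \<le> Z v \<omega>" by blast
    have "v \<in> maximisers \<omega>"
      unfolding maximisers_def
    proof clarify
      fix y show "Z y \<omega> \<le> Z v \<omega>"
      proof (cases "y \<in> {-K..K}")
        case False
        then have "Z y \<omega> < 0" by (intro out) auto
        also have "0 \<le> Z v \<omega>" using v(2)[of 0] K(1) Z0 by auto
        finally show ?thesis by simp
      qed (rule v(2))
    qed
    moreover have False if uv: "u \<in> maximisers \<omega>" "v \<in> maximisers \<omega>" "u < v" for u v
    proof -
      obtain D :: nat where D: "2 / (v - u) < real D" using reals_Archimedean2 by blast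
      \<comment> \<open>the lattice is so fine that two lattice points fit between \<open>u\<close> and \<open>v\<close>\<close>
      define \<beta> where "\<beta> = \<lfloor>u * real (Suc D)\<rfloor> + 1"
      obtain K :: nat where K: "max \<bar>u\<bar> \<bar>v\<bar> < real K" using reals_Archimedean2 by blast
      have "2 < real (Suc D) * (v - u)"
      proof -
        have "2 < real D * (v - u)" using D uv(3) by (simp add: pos_divide_less_eq)
        also have "\<dots> \<le> real (Suc D) * (v - u)" using uv(3) by (intro mult_right_mono) auto
        finally show ?thesis .
      qed
      then have "u * real (Suc D) + 2 \<le> v * real (Suc D)" by (simp add: algebra_simps)
      then have "u * real (Suc D) \<le> of_int \<beta>" "of_int (\<beta> + 1) \<le> v * real (Suc D)"
        unfolding \<beta>_def by linarith+
      then have "u \<le> of_int \<beta> / real (Suc D)" "of_int (\<beta> + 1) / real (Suc D) \<le> v"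
        by (simp_all add: pos_le_divide_eq pos_divide_le_eq)
      moreover have "real_of_int (- int K) \<le> u" "v \<le> real K" using K by auto
      ultimately show False using sep uv by blast
    qed
    ultimately have "maximisers \<omega> = {v}" by (blast intro: linorder_neqE_linordered_idom)
    then show ?case by blast
  qed
qed

text \<open>
  Measurability comes from describing \<open>\<xi> \<le> x\<close> through countably many values: some compact interval
  ending at \<open>x\<close> contains rationals at which the path comes arbitrarily close to every rational value.
  On the exceptional null set \<open>\<xi>\<close> is \<open>0\<close>.
\<close>

lemma argmax_exists:
  obtains \<xi> where "\<xi> \<in> borel_measurable P" "AE \<omega> in P. maximisers \<omega> = {\<xi> \<omega>}"
proof -
  obtain N where N: "{\<omega>\<in>space P. \<not> (\<exists>v. maximisers \<omega> = {v})} \<subseteq> N" "N \<in> events" "emeasure P N = 0"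
    by (rule AE_E[OF unique_maximiser_AE])
  define \<xi> where "\<xi> \<omega> = (if \<omega> \<in> N then 0 else (THE v. v \<in> maximisers \<omega>))" for \<omega>
  have \<xi>: "maximisers \<omega> = {\<xi> \<omega>}" if w: "\<omega> \<in> space P - N" for \<omega>
  proof -
    obtain v where v: "maximisers \<omega> = {v}" using N w by blast
    then have "(THE v. v \<in> maximisers \<omega>) = v" by simp
    then show ?thesis using v w by (simp add: \<xi>_def)
  qed
  have lower: "\<xi> \<omega> \<le> x \<longleftrightarrow> (\<exists>k::nat. \<forall>q\<in>\<rat>. \<forall>l::nat. \<exists>r\<in>\<rat>. - real k \<le> r \<and> r \<le> x \<and> Z q \<omega> \<le> Z r \<omega> + 1 / real (Suc l))"
    if w: "\<omega> \<in> space P - N" for x \<omega>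
  proof
    assume le: "\<xi> \<omega> \<le> x"
    obtain k :: nat where k: "\<bar>\<xi> \<omega>\<bar> + 1 < real k" using reals_Archimedean2 by blast
    have "\<exists>r\<in>\<rat>. - real k \<le> r \<and> r \<le> x \<and> Z q \<omega> \<le> Z r \<omega> + 1 / real (Suc l)" for q and l :: nat
    proof -
      have "isCont (\<lambda>u. Z u \<omega>) (\<xi> \<omega>)" using Z_continuous w by (simp add: continuous_on_eq_continuous_at)
      then obtain d where d: "0 < d" "\<And>y. dist y (\<xi> \<omega>) < d \<Longrightarrow> dist (Z y \<omega>) (Z (\<xi> \<omega>) \<omega>) < 1 / real (Suc l)"
        unfolding continuous_at_eps_delta by (metis of_nat_0_less_iff zero_less_Suc zero_less_divide_1_iff)
      \<comment> \<open>approaching \<open>\<xi>\<close> from the left keeps the rational below \<open>x\<close>\<close>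
      obtain r where r: "r \<in> \<rat>" "\<xi> \<omega> - min d 1 < r" "r < \<xi> \<omega>"
        using Rats_dense_in_real[of "\<xi> \<omega> - min d 1" "\<xi> \<omega>"] d(1) by auto
      have "Z (\<xi> \<omega>) \<omega> \<le> Z r \<omega> + 1 / real (Suc l)" using d(2)[of r] r by (auto simp: dist_real_def min_def abs_less_iff split: if_splits)
      moreover have "Z q \<omega> \<le> Z (\<xi> \<omega>) \<omega>" using \<xi>[OF w] unfolding maximisers_def by blast
      ultimately show ?thesis using r k le by (intro bexI[of _ r]) auto
    qed
    then show "\<exists>k::nat. \<forall>q\<in>\<rat>. \<forall>l::nat. \<exists>r\<in>\<rat>. - real k \<le> r \<and> r \<le> x \<and> Z q \<omega> \<le> Z r \<omega> + 1 / real (Suc l)" by blast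
  next
    assume "\<exists>k::nat. \<forall>q\<in>\<rat>. \<forall>l::nat. \<exists>r\<in>\<rat>. - real k \<le> r \<and> r \<le> x \<and> Z q \<omega> \<le> Z r \<omega> + 1 / real (Suc l)"
    then obtain k :: nat where k: "\<And>q l. q \<in> \<rat> \<Longrightarrow> \<exists>r\<in>\<rat>. - real k \<le> r \<and> r \<le> x \<and> Z q \<omega> \<le> Z r \<omega> + 1 / real (Suc l)" by blast
    have "- real k \<le> x" using k[of 0 0] by auto
    then have "\<exists>v\<in>{- real k..x}. \<forall>y\<in>{- real k..x}. Z y \<omega> \<le> Z v \<omega>"
      using w by (intro continuous_attains_sup continuous_on_subset[OF Z_continuous]) auto
    then obtain v where v: "v \<le> x" "\<And>y. - real k \<le> y \<Longrightarrow> y \<le> x \<Longrightarrow> Z y \<omega> \<le> Z v \<omega>" by auto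
    have q: "Z q \<omega> \<le> Z v \<omega>" if "q \<in> \<rat>" for q
    proof (rule LIMSEQ_le_const)
      show "(\<lambda>l. Z v \<omega> + 1 / real (Suc l)) \<longlonglongrightarrow> Z v \<omega>"
        using tendsto_add[OF tendsto_const LIMSEQ_Suc[OF lim_const_over_n[of "1 :: real"]]] by simp
      show "\<exists>N. \<forall>l\<ge>N. Z q \<omega> \<le> Z v \<omega> + 1 / real (Suc l)"
        using k[OF that] v(2) by (metis add_right_mono order_trans)
    qed
    have "Z y \<omega> \<le> Z v \<omega>" for y
    proof (rule ccontr)
      assume "\<not> Z y \<omega> \<le> Z v \<omega>"
      moreover have "isCont (\<lambda>u. Z u \<omega>) y" using Z_continuous w by (simp add: continuous_on_eq_continuous_at)
      ultimately obtain d where d: "0 < d" "\<And>z. dist z y < d \<Longrightarrow> dist (Z z \<omega>) (Z y \<omega>) < Z y \<omega> - Z v \<omega>"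
        unfolding continuous_at_eps_delta by (metis diff_gt_0_iff_gt not_le)
      obtain r where r: "r \<in> \<rat>" "y - d < r" "r < y" using Rats_dense_in_real[of "y - d" y] d(1) by auto
      then have "Z v \<omega> < Z r \<omega>" using d(2)[of r] by (auto simp: dist_real_def abs_less_iff)
      then show False using q[OF r(1)] by simp
    qed
    then have "v \<in> maximisers \<omega>" unfolding maximisers_def by blast
    then show "\<xi> \<omega> \<le> x" using \<xi>[OF w] v(1) by auto
  qed
  have "\<xi> \<in> borel_measurable P"
  proof (rule borel_measurableI_le)
    fix x
    have "{\<omega>\<in>space P. \<xi> \<omega> \<le> x} = (if 0 \<le> x then N else {}) \<union>
      ({\<omega>\<in>space P. \<exists>k::nat. \<forall>q\<in>\<rat>. \<forall>l::nat. \<exists>r\<in>\<rat>. - real k \<le> r \<and> r \<le> x \<and> Z q \<omega> \<le> Z r \<omega> + 1 / real (Suc l)} - N)"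
      (is "?l = _ \<union> (?r - N)")
    proof (rule set_eqI)
      fix \<omega>
      show "\<omega> \<in> ?l \<longleftrightarrow> \<omega> \<in> (if 0 \<le> x then N else {}) \<union> (?r - N)"
        using lower[of \<omega> x] sets.sets_into_space[OF N(2)] by (cases "\<omega> \<in> N") (auto simp: \<xi>_def)
    qed
    moreover have "?r \<in> events"
    proof -
      have [measurable]: "Measurable.pred P (\<lambda>\<omega>. \<exists>k::nat. \<forall>q\<in>\<rat>. \<forall>l::nat. \<exists>r\<in>\<rat>. - real k \<le> r \<and> r \<le> x \<and> Z q \<omega> \<le> Z r \<omega> + 1 / real (Suc l))"
        unfolding Rats_def ball_simps bex_simps by measurable
      show ?thesis by measurable
    qed
    ultimately show "{\<omega>\<in>space P. \<xi> \<omega> \<le> x} \<in> events" using N(2) by auto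
  qed
  moreover have "AE \<omega> in P. maximisers \<omega> = {\<xi> \<omega>}"
    using N \<xi> by (intro AE_I[of _ _ N]) auto
  ultimately show thesis using that by blast
qed

end

section \<open>Approximate maximisers on a grid\<close>

context two_sided_bm begin

text \<open>
  The event that some grid point \<open>i / (r + 1)\<close> in the window \<open>[-K, K]\<close>, within one mesh of \<open>S\<close>, maximises the
  drifted path over the grid up to \<open>\<eta>\<close>.
\<close>

definition grid_near_argmax :: "real set \<Rightarrow> nat \<Rightarrow> nat \<Rightarrow> real \<Rightarrow> 'b set" where
  "grid_near_argmax S K r \<eta> = {\<omega>\<in>space P. \<exists>i\<in>{- int (K * Suc r)..int (K * Suc r)}.
     (\<exists>s\<in>S. \<bar>of_int i / real (Suc r) - s\<bar> \<le> 1 / real (Suc r)) \<and>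
     (\<forall>j\<in>{- int (K * Suc r)..int (K * Suc r)}.
        Z (of_int j / real (Suc r)) \<omega> - \<eta> \<le> Z (of_int i / real (Suc r)) \<omega>)}"

text \<open>
  Suppose that along a subsequence of grids there is an \<open>\<eta>\<close>-maximal grid point near \<open>S\<close>. These points stay
  in the window, and a limit point of them lies in \<open>S\<close> and maximises the path if the true maximiser
  lies inside the window; by uniqueness the maximiser is then in \<open>S\<close>. The second term accounts for a
  maximiser outside the window.
\<close>

lemma grid_near_argmax_eventually_less:
  assumes S: "closed S" and \<eta>: "\<eta> \<longlonglongrightarrow> 0" "\<And>r. 0 < \<eta> r"
    and \<xi>[measurable]: "\<xi> \<in> borel_measurable P" and max: "AE \<omega> in P. maximisers \<omega> = {\<xi> \<omega>}" and \<epsilon>: "0 < \<epsilon>"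
  shows "eventually (\<lambda>r. prob (grid_near_argmax S K r (\<eta> r)) <
    prob {\<omega>\<in>space P. \<xi> \<omega> \<in> S} + prob {\<omega>\<in>space P. real K \<le> \<bar>\<xi> \<omega>\<bar>} + \<epsilon>) sequentially"
proof -
  have [measurable]: "S \<in> sets borel" using S by simp
  let ?C = "\<lambda>r. grid_near_argmax S K r (\<eta> r)"
  let ?A = "{\<omega>\<in>space P. \<xi> \<omega> \<in> S}" and ?B = "{\<omega>\<in>space P. real K \<le> \<bar>\<xi> \<omega>\<bar>}"
  have C: "?C r \<in> events" for r
    unfolding grid_near_argmax_def by measurable
  have AB: "?A \<in> events" "?B \<in> events" by measurable
  have "(\<lambda>r. prob (?C r - (?A \<union> ?B))) \<longlonglongrightarrow> 0"
  proof (rule prob_tendsto_zero_if_eventually_outside)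
    show "?C r - (?A \<union> ?B) \<in> events" for r using C AB by auto
    show "AE \<omega> in P. eventually (\<lambda>r. \<omega> \<notin> ?C r - (?A \<union> ?B)) sequentially"
      using max AE_space
    proof eventually_elim
      case (elim \<omega>)
      note w = elim(2)
      show ?case
      proof (rule ccontr)
        assume not: "\<not> ?case"
        then have inf: "\<exists>\<^sub>F r in sequentially. \<omega> \<in> ?C r" and out: "\<xi> \<omega> \<notin> S" "\<bar>\<xi> \<omega>\<bar> < real K"
          using w by (auto simp: frequently_def elim: eventually_mono)
        have inf': "infinite {r. \<omega> \<in> ?C r}"
          using inf by (simp add: cofinite_eq_sequentially[symmetric] frequently_cofinite)
        \<comment> \<open>a subsequence of grids with near-maximal points near \<open>S\<close>\<close>
        define \<rho> where "\<rho> = enumerate {r. \<omega> \<in> ?C r}"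
        have \<rho>: "strict_mono \<rho>" "\<And>n. \<omega> \<in> ?C (\<rho> n)"
          unfolding \<rho>_def using inf' enumerate_in_set[OF inf'] by (auto intro: strict_mono_enumerate)
        have "\<forall>n. \<exists>i s. - int (K * Suc (\<rho> n)) \<le> i \<and> i \<le> int (K * Suc (\<rho> n)) \<and> s \<in> S \<and>
          \<bar>of_int i / real (Suc (\<rho> n)) - s\<bar> \<le> 1 / real (Suc (\<rho> n)) \<and>
          (\<forall>j\<in>{- int (K * Suc (\<rho> n))..int (K * Suc (\<rho> n))}.
            Z (of_int j / real (Suc (\<rho> n))) \<omega> - \<eta> (\<rho> n) \<le> Z (of_int i / real (Suc (\<rho> n))) \<omega>)"
          (is "\<forall>n. ?S n")
        proof
          fix n
          from \<rho>(2)[of n] show "?S n" unfolding grid_near_argmax_def mem_Collect_eq Bex_def atLeastAtMost_iff by blast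
        qed
        then obtain i s where i: "\<And>n. - int (K * Suc (\<rho> n)) \<le> i n" "\<And>n. i n \<le> int (K * Suc (\<rho> n))"
          and s: "\<And>n. s n \<in> S" "\<And>n. \<bar>of_int (i n) / real (Suc (\<rho> n)) - s n\<bar> \<le> 1 / real (Suc (\<rho> n))"
          and top: "\<And>n j. j \<in> {- int (K * Suc (\<rho> n))..int (K * Suc (\<rho> n))} \<Longrightarrow>
             Z (of_int j / real (Suc (\<rho> n))) \<omega> - \<eta> (\<rho> n) \<le> Z (of_int (i n) / real (Suc (\<rho> n))) \<omega>"
          by metis
        define v where "v n = of_int (i n) / real (Suc (\<rho> n))" for n
        have "v n \<in> {- real K..real K}" for n
        proof -
          have "real_of_int (- int (K * Suc (\<rho> n))) \<le> of_int (i n)" "real_of_int (i n) \<le> of_int (int (K * Suc (\<rho> n)))"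
            using i[of n] by (simp_all only: of_int_le_iff)
          then have "- real K * real (Suc (\<rho> n)) \<le> of_int (i n)" "of_int (i n) \<le> real K * real (Suc (\<rho> n))"
            by (simp_all only: of_int_minus of_int_of_nat_eq of_nat_mult mult_minus_left of_int_mult)
          then show ?thesis
            unfolding v_def by (simp add: pos_le_divide_eq pos_divide_le_eq del: of_nat_Suc)
        qed
        then obtain v0 \<sigma> where \<sigma>: "strict_mono (\<sigma> :: nat \<Rightarrow> nat)" and v0: "(v \<circ> \<sigma>) \<longlonglongrightarrow> v0"
          using compact_Icc[of "- real K" "real K"] unfolding compact_def by metis
        define R where "R n = \<rho> (\<sigma> n)" for n
        have R: "filterlim R sequentially sequentially"
          unfolding R_def using \<rho>(1) \<sigma> by (intro filterlim_subseq) (auto simp: strict_mono_def)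
        have h0: "(\<lambda>n. 1 / real (Suc (R n))) \<longlonglongrightarrow> 0"
          using filterlim_compose[OF LIMSEQ_Suc[OF lim_const_over_n[of "1 :: real"]] R] by simp
        have "(\<lambda>n. s (\<sigma> n)) \<longlonglongrightarrow> v0"
        proof -
          have "(\<lambda>n. v (\<sigma> n) - s (\<sigma> n)) \<longlonglongrightarrow> 0"
            by (rule Lim_null_comparison[OF _ h0]) (use s(2) in \<open>auto simp: v_def R_def\<close>)
          from tendsto_diff[OF v0 this] show ?thesis by (simp add: o_def)
        qed
        then have v0S: "v0 \<in> S" using s(1) by (intro Lim_in_closed_set[OF S _ trivial_limit_sequentially]) auto
        have contZ: "(\<lambda>n. Z (f n) \<omega>) \<longlonglongrightarrow> Z y \<omega>" if "f \<longlonglongrightarrow> y" for f :: "nat \<Rightarrow> real" and y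
          using that by (intro continuous_on_tendsto_compose[OF Z_continuous[OF w]]) auto
        define j where "j n = \<lfloor>\<xi> \<omega> * real (Suc (R n))\<rfloor>" for n
        have j: "j n \<in> {- int (K * Suc (R n))..int (K * Suc (R n))}" for n
        proof -
          have "- real K * real (Suc (R n)) \<le> \<xi> \<omega> * real (Suc (R n))" "\<xi> \<omega> * real (Suc (R n)) \<le> real K * real (Suc (R n))"
            using out(2) by (intro mult_right_mono; simp)+
          then have "real_of_int (- int (K * Suc (R n))) \<le> \<xi> \<omega> * real (Suc (R n))" "\<xi> \<omega> * real (Suc (R n)) \<le> real_of_int (int (K * Suc (R n)))"
            by (simp_all only: of_int_minus of_int_of_nat_eq of_nat_mult mult_minus_left of_int_mult)
          then show ?thesis unfolding j_def atLeastAtMost_iff by linarith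
        qed
        have "(\<lambda>n. of_int (j n) / real (Suc (R n))) \<longlonglongrightarrow> \<xi> \<omega>"
        proof -
          have "\<bar>of_int (j n) / real (Suc (R n)) - \<xi> \<omega>\<bar> \<le> 1 / real (Suc (R n))" for n
          proof -
            have "\<bar>of_int (j n) - \<xi> \<omega> * real (Suc (R n))\<bar> \<le> 1" unfolding j_def by linarith
            then have "\<bar>of_int (j n) - \<xi> \<omega> * real (Suc (R n))\<bar> / real (Suc (R n)) \<le> 1 / real (Suc (R n))"
              by (intro divide_right_mono) auto
            moreover have "\<bar>of_int (j n) - \<xi> \<omega> * real (Suc (R n))\<bar> / real (Suc (R n)) = \<bar>of_int (j n) / real (Suc (R n)) - \<xi> \<omega>\<bar>"
              by (subst abs_div_pos) (simp_all add: diff_divide_distrib del: of_nat_Suc)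
            ultimately show ?thesis by simp
          qed
          then have "(\<lambda>n. of_int (j n) / real (Suc (R n)) - \<xi> \<omega>) \<longlonglongrightarrow> 0"
            by (intro Lim_null_comparison[OF _ h0]) auto
          then show ?thesis by (simp add: LIM_zero_iff)
        qed
        then have "(\<lambda>n. Z (of_int (j n) / real (Suc (R n))) \<omega> - \<eta> (R n)) \<longlonglongrightarrow> Z (\<xi> \<omega>) \<omega> - 0"
          by (intro tendsto_diff contZ filterlim_compose[OF \<eta>(1) R])
        moreover have "(\<lambda>n. Z (v (\<sigma> n)) \<omega>) \<longlonglongrightarrow> Z v0 \<omega>" using contZ[OF v0] by (simp add: o_def)
        ultimately have "Z (\<xi> \<omega>) \<omega> - 0 \<le> Z v0 \<omega>"
        proof (rule LIMSEQ_le)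
          show "\<exists>N. \<forall>n\<ge>N. Z (of_int (j n) / real (Suc (R n))) \<omega> - \<eta> (R n) \<le> Z (v (\<sigma> n)) \<omega>"
            using top[of "j n" "\<sigma> n" for n] j unfolding v_def R_def by blast
        qed
        moreover have "\<xi> \<omega> \<in> maximisers \<omega>" using elim(1) by simp
        ultimately have "v0 \<in> maximisers \<omega>" unfolding maximisers_def by (auto intro: order_trans)
        then show False using elim(1) v0S out(1) by simp
      qed
    qed
  qed
  then have "eventually (\<lambda>r. prob (?C r - (?A \<union> ?B)) < \<epsilon>) sequentially"
    using \<epsilon> by (rule order_tendstoD)
  then show ?thesis
  proof eventually_elim
    case (elim r)
    have "prob (?C r) \<le> prob ((?A \<union> ?B) \<union> (?C r - (?A \<union> ?B)))" using C AB by (intro finite_measure_mono) auto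
    also have "\<dots> \<le> prob (?A \<union> ?B) + prob (?C r - (?A \<union> ?B))" using C AB by (intro measure_Un_le) auto
    also have "prob (?A \<union> ?B) \<le> prob ?A + prob ?B" using AB by (intro measure_Un_le) auto
    finally show ?case using elim by linarith
  qed
qed

end

section \<open>Poisson paths and telegraph increments\<close>

lemma one_minus_exp_le: "1 - exp (- \<mu>) \<le> (\<mu> :: real)"
  using exp_ge_add_one_self[of "- \<mu>"] by simp

text \<open>
  The probability of at least two points is quadratic in the mean. That is what excludes two jumps
  in a short cell of a fine partition.
\<close>

lemma poisson_tail_bounds:
  fixes \<mu> :: real assumes \<mu>: "0 < \<mu>"
  shows "measure (measure_pmf (poisson_pmf \<mu>)) {1..} = 1 - exp (- \<mu>)"
    and "measure (measure_pmf (poisson_pmf \<mu>)) {2..} \<le> \<mu>\<^sup>2"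
proof -
  interpret prob_space "measure_pmf (poisson_pmf \<mu>)" by (rule prob_space_measure_pmf)
  let ?p = "poisson_pmf \<mu>"
  have "{1..} = space ?p - {0 :: nat}" "{2..} = space ?p - {0 :: nat, 1}" by auto
  then have e: "measure ?p {1..} = 1 - measure ?p {0}" "measure ?p {2..} = 1 - measure ?p {0, 1}"
    by (simp_all only: measure_pmf.prob_compl sets_measure_pmf UNIV_I)
  then show "measure ?p {1..} = 1 - exp (- \<mu>)"
    using \<mu> by (simp only: measure_pmf_single pmf_poisson) simp
  have "measure ?p {2..} = 1 - measure ?p {0, 1}" by (fact e(2))
  also have "measure (measure_pmf (poisson_pmf \<mu>)) {0, 1} = exp (- \<mu>) + \<mu> * exp (- \<mu>)"
    using \<mu> by (subst measure_measure_pmf_finite) auto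
  also have "1 - (exp (- \<mu>) + \<mu> * exp (- \<mu>)) \<le> \<mu>\<^sup>2"
  proof -
    have "(1 + \<mu>) * (1 - \<mu>) \<le> (1 + \<mu>) * exp (- \<mu>)"
      using \<mu> exp_ge_add_one_self[of "- \<mu>"] by (intro mult_left_mono) auto
    then show ?thesis by (simp add: algebra_simps power2_eq_square)
  qed
  finally show "measure (measure_pmf (poisson_pmf \<mu>)) {2..} \<le> \<mu>\<^sup>2" .
qed

text \<open>
  The intensity at the change point itself belongs to the first regime; this is invisible to the integral.
\<close>

lemma change_intensity_integral:
  assumes st: "s \<le> t"
  shows "t \<le> \<theta> \<Longrightarrow> (LBINT u:{s..t}. change_intensity l1 l2 \<theta> u) = l1 * (t - s)"
    and "\<theta> \<le> s \<Longrightarrow> (LBINT u:{s..t}. change_intensity l1 l2 \<theta> u) = l2 * (t - s)"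
proof -
  have c: "(LBINT u:{s..t}. l) = l * (t - s)" for l :: real
    using st unfolding set_lebesgue_integral_def by simp
  show "(LBINT u:{s..t}. change_intensity l1 l2 \<theta> u) = l1 * (t - s)" if "t \<le> \<theta>"
  proof -
    have "(LBINT u:{s..t}. change_intensity l1 l2 \<theta> u) = (LBINT u:{s..t}. l1)"
      using that by (intro set_lebesgue_integral_cong) (auto simp: change_intensity_def)
    then show ?thesis using c by simp
  qed
  show "(LBINT u:{s..t}. change_intensity l1 l2 \<theta> u) = l2 * (t - s)" if "\<theta> \<le> s"
  proof -
    have "(LBINT u:{s..t}. change_intensity l1 l2 \<theta> u) = (LBINT u:{s..t}. l2)"
      unfolding set_lebesgue_integral_def
    proof (rule integral_cong_AE)
      show "AE u in lborel. indicator {s..t} u *\<^sub>R change_intensity l1 l2 \<theta> u = indicator {s..t} u *\<^sub>R l2"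
        using AE_lborel_singleton[of \<theta>]
        by eventually_elim (use that in \<open>auto simp: change_intensity_def indicator_def\<close>)
      show "(\<lambda>u. indicat_real {s..t} u *\<^sub>R change_intensity l1 l2 \<theta> u) \<in> borel_measurable lborel"
        unfolding change_intensity_def by measurable
    qed auto
    then show ?thesis using c by simp
  qed
qed

locale poisson_path = prob_space M for M :: "'a measure" +
  fixes \<Lambda> :: "real \<Rightarrow> real" and N :: "real \<Rightarrow> 'a \<Rightarrow> nat"
  assumes poisson: "poisson_process M \<Lambda> N"
begin

lemma N_measurable: "0 \<le> t \<Longrightarrow> N t \<in> measurable M (count_space UNIV)"
  using poisson unfolding poisson_process_def by blast

lemma N_mono: "\<omega> \<in> space M \<Longrightarrow> 0 \<le> s \<Longrightarrow> s \<le> t \<Longrightarrow> N s \<omega> \<le> N t \<omega>"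
proof -
  assume a: "\<omega> \<in> space M" "0 \<le> s" "s \<le> t"
  then have "mono_on {0..} (\<lambda>t. N t \<omega>)" using poisson unfolding poisson_process_def by blast
  then show ?thesis using a by (auto simp: mono_on_def)
qed

text \<open>
  A right-continuous integer-valued path cannot move immediately.
\<close>

lemma N_locally_constant_right:
  assumes w: "\<omega> \<in> space M" and t: "0 \<le> t"
  shows "\<exists>d>0. \<forall>s. t \<le> s \<longrightarrow> s < t + d \<longrightarrow> N s \<omega> = N t \<omega>"
proof -
  have "continuous (at_right t) (\<lambda>s. real (N s \<omega>))" using poisson w t unfolding poisson_process_def by blast
  then have "((\<lambda>s. real (N s \<omega>)) \<longlongrightarrow> real (N t \<omega>)) (at_right t)" by (simp add: continuous_within)
  then have "eventually (\<lambda>s. dist (real (N s \<omega>)) (real (N t \<omega>)) < 1) (at_right t)" by (rule tendstoD) simp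
  then obtain b where b: "t < b" "\<And>s. t < s \<Longrightarrow> s < b \<Longrightarrow> dist (real (N s \<omega>)) (real (N t \<omega>)) < 1"
    unfolding eventually_at_right_field by blast
  have "N s \<omega> = N t \<omega>" if "t \<le> s" "s < t + (b - t)" for s
  proof (cases "s = t")
    case False
    then have "dist (real (N s \<omega>)) (real (N t \<omega>)) < 1" using b(2)[of s] that by simp
    then show ?thesis by (simp add: dist_real_def)
  qed simp
  moreover have "0 < b - t" using b(1) by simp
  ultimately show ?thesis by blast
qed

lemma N_increments_indep:
  assumes "0 \<le> t 0" "\<And>i. i < m \<Longrightarrow> t i \<le> t (Suc i)"
  shows "indep_vars (\<lambda>_. count_space UNIV) (\<lambda>i \<omega>. N (t (Suc i)) \<omega> - N (t i) \<omega>) {..<m::nat}"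
  using poisson assms unfolding poisson_process_def by blast

lemma N_increment_prob:
  assumes "0 \<le> s" "s < t"
  shows "prob {\<omega>\<in>space M. N t \<omega> - N s \<omega> \<in> A} = measure (measure_pmf (poisson_pmf (LBINT u:{s..t}. \<Lambda> u))) A"
proof -
  have d: "distr M (count_space UNIV) (\<lambda>\<omega>. N t \<omega> - N s \<omega>) = measure_pmf (poisson_pmf (LBINT u:{s..t}. \<Lambda> u))"
    using poisson assms unfolding poisson_process_def by blast
  have [measurable]: "N t \<in> measurable M (count_space UNIV)" "N s \<in> measurable M (count_space UNIV)"
    using N_measurable assms by auto
  have "measure (distr M (count_space UNIV) (\<lambda>\<omega>. N t \<omega> - N s \<omega>)) A = prob ((\<lambda>\<omega>. N t \<omega> - N s \<omega>) -` A \<inter> space M)"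
    by (rule measure_distr) auto
  then show ?thesis unfolding d by (simp add: vimage_def Int_def conj_commute)
qed

definition sgn_path :: "real \<Rightarrow> 'a \<Rightarrow> real" where "sgn_path s \<omega> = (- 1) ^ N s \<omega>"

lemma abs_sgn_path[simp]: "\<bar>sgn_path s \<omega>\<bar> = 1"
  unfolding sgn_path_def by (simp add: power_abs)

lemma sgn_path_integrable: assumes w: "\<omega> \<in> space M" and a: "0 \<le> a"
  shows "set_integrable lborel {a..b} (\<lambda>s. sgn_path s \<omega>)"
proof -
  have "mono_on {a..b} (\<lambda>s. real (N s \<omega>))" using N_mono[OF w] a by (auto simp: mono_on_def)
  then have 1: "(\<lambda>s. real (N s \<omega>)) \<in> borel_measurable (restrict_space borel {a..b})"
    by (rule borel_measurable_mono_on_fnc)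
  have "(\<lambda>s. sgn_path s \<omega>) = (\<lambda>s. (- 1) ^ nat \<lfloor>real (N s \<omega>)\<rfloor>)" unfolding sgn_path_def by simp
  also have "\<dots> \<in> borel_measurable (restrict_space borel {a..b})" using 1 by measurable
  finally have "(\<lambda>s. indicator {a..b} s *\<^sub>R sgn_path s \<omega>) \<in> borel_measurable borel"
    by (subst (asm) borel_measurable_restrict_space_iff) auto
  then show ?thesis unfolding set_integrable_def
    by (intro integrableI_bounded_set[where A="{a..b}" and B=1]) (auto simp: indicator_def emeasure_lborel_Icc_eq)
qed

text \<open>
  The sign path is jointly measurable as a limit of step functions evaluated at the next grid point to
  the right, which converge by right continuity; integrating out time preserves measurability.
\<close>

lemma telegraph_measurable:
  assumes V0[measurable]: "V0 \<in> borel_measurable M"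
  shows "telegraph V0 N t \<in> borel_measurable M"
proof -
  define r where "r m s = real (nat \<lfloor>s * real (Suc m)\<rfloor> + 1) / real (Suc m)" for m :: nat and s
  have sg[measurable]: "sgn_path s \<in> borel_measurable M" if "0 \<le> s" for s
    using measurable_compose[OF N_measurable[OF that], of "\<lambda>k. (- 1) ^ k" borel] unfolding sgn_path_def by simp
  have gm: "(\<lambda>(\<omega>, s). indicator {0..t} s *\<^sub>R sgn_path (r m s) \<omega>) \<in> borel_measurable (M \<Otimes>\<^sub>M lborel)" for m
  proof -
    have "(\<lambda>x. sgn_path (real (nat \<lfloor>snd x * real (Suc m)\<rfloor> + 1) / real (Suc m)) (fst x)) \<in> borel_measurable (M \<Otimes>\<^sub>M lborel)"
    proof (rule measurable_compose_countable[where g="\<lambda>x. nat \<lfloor>snd x * real (Suc m)\<rfloor>"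
        and f="\<lambda>k x. sgn_path (real (k + 1) / real (Suc m)) (fst x)"])
      show "(\<lambda>x. sgn_path (real (k + 1) / real (Suc m)) (fst x)) \<in> borel_measurable (M \<Otimes>\<^sub>M lborel)" for k
        by (rule measurable_compose[OF measurable_fst sg]) simp
      show "(\<lambda>x. nat \<lfloor>snd x * real (Suc m)\<rfloor>) \<in> measurable (M \<Otimes>\<^sub>M lborel) (count_space UNIV)" by measurable
    qed
    then show ?thesis unfolding r_def case_prod_beta by measurable
  qed
  have lim: "(\<lambda>m. indicator {0..t} s *\<^sub>R sgn_path (r m s) \<omega>) \<longlonglongrightarrow> indicator {0..t} s *\<^sub>R sgn_path s \<omega>"
    if w: "\<omega> \<in> space M" for s \<omega>
  proof (cases "s \<in> {0..t}")
    case True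
    then have s: "0 \<le> s" by simp
    obtain d where d: "0 < d" "\<And>u. s \<le> u \<Longrightarrow> u < s + d \<Longrightarrow> N u \<omega> = N s \<omega>"
      using N_locally_constant_right[OF w s] by blast
    have "eventually (\<lambda>m. 1 / real (Suc m) < d) sequentially"
      using LIMSEQ_Suc[OF lim_const_over_n[of "1 :: real"]] d(1) by (auto dest: order_tendstoD)
    then have "eventually (\<lambda>m. indicator {0..t} s *\<^sub>R sgn_path (r m s) \<omega> = indicator {0..t} s *\<^sub>R sgn_path s \<omega>) sequentially"
    proof eventually_elim
      case (elim m)
      have fl: "s * real (Suc m) \<le> real (nat \<lfloor>s * real (Suc m)\<rfloor> + 1)" "real (nat \<lfloor>s * real (Suc m)\<rfloor> + 1) \<le> s * real (Suc m) + 1"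
      proof -
        have "0 \<le> s * real (Suc m)" using s by simp
        then show "s * real (Suc m) \<le> real (nat \<lfloor>s * real (Suc m)\<rfloor> + 1)" "real (nat \<lfloor>s * real (Suc m)\<rfloor> + 1) \<le> s * real (Suc m) + 1"
          by linarith+
      qed
      have "s \<le> r m s" unfolding r_def using fl(1) by (simp add: pos_le_divide_eq del: of_nat_Suc)
      moreover have "r m s \<le> s + 1 / real (Suc m)"
        unfolding r_def using divide_right_mono[OF fl(2), of "real (Suc m)"] by (simp add: add_divide_distrib del: of_nat_Suc)
      ultimately have "N (r m s) \<omega> = N s \<omega>" using d(2)[of "r m s"] elim by simp
      then show ?case by (simp add: sgn_path_def)
    qed
    then show ?thesis by (rule tendsto_eventually)
  qed simp
  have "(\<lambda>x. indicator {0..t} (snd x) *\<^sub>R sgn_path (snd x) (fst x)) \<in> borel_measurable (M \<Otimes>\<^sub>M lborel)"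
  proof (rule borel_measurable_LIMSEQ_real)
    show "(\<lambda>x. indicator {0..t} (snd x) *\<^sub>R sgn_path (r m (snd x)) (fst x)) \<in> borel_measurable (M \<Otimes>\<^sub>M lborel)" for m
      using gm[of m] unfolding case_prod_beta .
    show "(\<lambda>m. indicator {0..t} (snd x) *\<^sub>R sgn_path (r m (snd x)) (fst x)) \<longlonglongrightarrow> indicator {0..t} (snd x) *\<^sub>R sgn_path (snd x) (fst x)"
      if "x \<in> space (M \<Otimes>\<^sub>M lborel)" for x
      using that by (intro lim) (auto simp: space_pair_measure)
  qed
  then have "(\<lambda>\<omega>. \<integral>s. indicator {0..t} s *\<^sub>R sgn_path s \<omega> \<partial>lborel) \<in> borel_measurable M"
    by (intro lborel.borel_measurable_lebesgue_integral) (simp add: case_prod_beta)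
  then have lb: "(\<lambda>\<omega>. LBINT s:{0..t}. (- 1 :: real) ^ N s \<omega>) \<in> borel_measurable M"
    unfolding set_lebesgue_integral_def sgn_path_def .
  show ?thesis unfolding telegraph_def[abs_def] by (intro borel_measurable_times V0 lb)
qed

lemma telegraph_increment:
  assumes w: "\<omega> \<in> space M" and ab: "0 \<le> a" "a \<le> b"
  shows "telegraph V0 N b \<omega> - telegraph V0 N a \<omega> = V0 \<omega> * (LBINT s:{a..b}. sgn_path s \<omega>)"
proof -
  have "(LBINT s:{0..b}. sgn_path s \<omega>) = (LBINT s:{0..a} \<union> {a..b}. sgn_path s \<omega>)"
    using ab by (intro arg_cong2[where f="\<lambda>A f. set_lebesgue_integral lborel A f"]) auto
  also have "\<dots> = (LBINT s:{0..a}. sgn_path s \<omega>) + (LBINT s:{a..b}. sgn_path s \<omega>)"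
  proof (rule set_integral_Un_AE)
    show "AE x in lborel. \<not> (x \<in> {0..a} \<and> x \<in> {a..b})"
      using AE_lborel_singleton[of a] by eventually_elim auto
  qed (use sgn_path_integrable[OF w] ab in auto)
  finally show ?thesis unfolding telegraph_def sgn_path_def by (simp add: algebra_simps)
qed

lemma constant_path_increment:
  assumes w: "\<omega> \<in> space M" and ab: "0 \<le> a" "a \<le> b" and eq: "N a \<omega> = N b \<omega>"
  shows "\<bar>telegraph V0 N b \<omega> - telegraph V0 N a \<omega>\<bar> = \<bar>V0 \<omega>\<bar> * (b - a)"
proof -
  have "N s \<omega> = N a \<omega>" if "s \<in> {a..b}" for s
    using N_mono[OF w ab(1), of s] N_mono[OF w, of s b] that eq ab by auto
  then have "sgn_path s \<omega> = (- 1) ^ N a \<omega>" if "s \<in> {a..b}" for s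
    unfolding sgn_path_def using that by metis
  then have "(LBINT s:{a..b}. sgn_path s \<omega>) = (LBINT s:{a..b}. (- 1) ^ N a \<omega>)"
    by (intro set_lebesgue_integral_cong) auto
  also have "\<dots> = (b - a) * (- 1) ^ N a \<omega>" using ab unfolding set_lebesgue_integral_def by simp
  finally show ?thesis using ab by (simp add: telegraph_increment[OF w ab] abs_mult power_abs)
qed

text \<open>
  If the path covers the full distance, the sign must be constant on \<open>[a, b)\<close>: a wrong sign at a point
  would persist on an interval to its right and cost distance there. A constant sign means an even
  number of jumps.
\<close>

lemma extremal_increment_even:
  assumes w: "\<omega> \<in> space M" and ab: "0 \<le> a" "a < b" and V0: "V0 \<omega> \<noteq> 0"
    and ge: "\<bar>V0 \<omega>\<bar> * (b - a) \<le> \<bar>telegraph V0 N b \<omega> - telegraph V0 N a \<omega>\<bar>"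
    and st: "a \<le> s" "s \<le> t" "t < b"
  shows "even (N t \<omega> - N s \<omega>)"
proof -
  let ?I = "LBINT s:{a..b}. sgn_path s \<omega>"
  have "\<bar>V0 \<omega>\<bar> * (b - a) \<le> \<bar>V0 \<omega>\<bar> * \<bar>?I\<bar>"
    using ge telegraph_increment[OF w ab(1), of b V0] ab by (simp add: abs_mult)
  then have I: "b - a \<le> \<bar>?I\<bar>" using V0 by simp
  define \<sigma> where "\<sigma> = sgn ?I"
  have I0: "?I \<noteq> 0" using I ab by auto
  have \<sigma>: "\<sigma> * ?I = \<bar>?I\<bar>" "\<sigma> = 1 \<or> \<sigma> = - 1" unfolding \<sigma>_def using I0 by (auto simp: sgn_if)
  have const: "sgn_path u \<omega> = \<sigma>" if u: "a \<le> u" "u < b" for u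
  proof (rule ccontr)
    assume ne: "sgn_path u \<omega> \<noteq> \<sigma>"
    have pm: "sgn_path x \<omega> = 1 \<or> sgn_path x \<omega> = - 1" for x
      unfolding sgn_path_def by (cases "even (N x \<omega>)") auto
    obtain d where d: "0 < d" "\<And>x. u \<le> x \<Longrightarrow> x < u + d \<Longrightarrow> N x \<omega> = N u \<omega>"
      using N_locally_constant_right[OF w, of u] u ab by auto
    define e where "e = min (d / 2) ((b - u) / 2)"
    have e: "0 < e" "u + e < b" "e < d" unfolding e_def using d(1) u by (auto simp: min_def field_simps)
    have neg: "\<sigma> * sgn_path x \<omega> = - 1" if "x \<in> {u..u + e}" for x
    proof -
      have "sgn_path x \<omega> = sgn_path u \<omega>" using d(2)[of x] that e unfolding sgn_path_def by auto
      then show ?thesis using ne \<sigma>(2) pm[of u] by auto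
    qed
    have le1: "\<sigma> * sgn_path x \<omega> \<le> 1" for x using \<sigma>(2) pm[of x] by auto
    have int: "integrable lborel (\<lambda>x. indicator {a..b} x *\<^sub>R sgn_path x \<omega>)"
      using sgn_path_integrable[OF w ab(1), of b] unfolding set_integrable_def .
    have "b - a \<le> \<sigma> * ?I" using I \<sigma>(1) by simp
    also have "\<dots> = (\<integral>x. \<sigma> * (indicator {a..b} x *\<^sub>R sgn_path x \<omega>) \<partial>lborel)"
      unfolding set_lebesgue_integral_def by simp
    also have "\<dots> \<le> (\<integral>x. indicator {a..b} x - 2 * indicator {u..u + e} x \<partial>lborel)"
    proof (rule integral_mono)
      show "integrable lborel (\<lambda>x. \<sigma> * (indicator {a..b} x *\<^sub>R sgn_path x \<omega>))" using int by simp
      show "integrable lborel (\<lambda>x. indicator {a..b} x - 2 * indicat_real {u..u + e} x)"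
        using ab e by (intro Bochner_Integration.integrable_diff integrable_mult_right integrable_real_indicator) auto
      show "\<sigma> * (indicator {a..b} x *\<^sub>R sgn_path x \<omega>) \<le> indicator {a..b} x - 2 * indicator {u..u + e} x" for x
        using neg[of x] le1[of x] u e by (auto simp: indicator_def)
    qed
    also have "\<dots> = (b - a) - 2 * e"
      using ab e by (subst Bochner_Integration.integral_diff) (auto intro!: integrable_mult_right integrable_real_indicator)
    finally show False using e by simp
  qed
  have "sgn_path s \<omega> = sgn_path t \<omega>" using const[of s] const[of t] st by simp
  then have "even (N s \<omega>) = even (N t \<omega>)"
    unfolding sgn_path_def by (metis (no_types) neg_one_even_power neg_one_odd_power one_neq_neg_one)
  moreover have "N s \<omega> \<le> N t \<omega>" using N_mono[OF w, of s t] st ab by auto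
  ultimately show ?thesis by simp
qed

end

section \<open>Slow increments are switches\<close>

context poisson_path begin

text \<open>
  Only one direction needs probability. A jump without loss of distance would have to consist of an even
  number of jumps in every cell of every partition, or happen in the last cell, where the sign at the
  right endpoint does not contribute. Two jumps in one of \<open>k\<close> cells, or one jump in the last cell, have
  probability of order \<open>1 / k\<close>; so this is excluded almost surely.
\<close>

lemma slow_iff_jump_AE:
  assumes ab: "0 \<le> a" "a < b" and l: "0 < l"
    and rate: "\<And>s t. a \<le> s \<Longrightarrow> s < t \<Longrightarrow> t \<le> b \<Longrightarrow> (LBINT u:{s..t}. \<Lambda> u) = l * (t - s)"
    and V0: "AE \<omega> in M. \<bar>V0 \<omega>\<bar> = c" and c: "0 < c"
  shows "AE \<omega> in M. \<bar>telegraph V0 N b \<omega> - telegraph V0 N a \<omega>\<bar> < c * (b - a) \<longleftrightarrow> 1 \<le> N b \<omega> - N a \<omega>"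
proof -
  define h where "h k = (b - a) / real (Suc k)" for k
  define pt where "pt k i = a + real i * h k" for k i
  have h: "0 < h k" for k unfolding h_def using ab by simp
  have pts: "a \<le> pt k i" "pt k i < pt k (Suc i)" "pt k 0 = a" "pt k (Suc k) = b" "pt k (Suc i) - pt k i = h k" for k i
  proof -
    show "pt k (Suc k) = b" unfolding pt_def h_def by (simp del: of_nat_Suc)
  qed (use h[of k] in \<open>auto simp: pt_def distrib_right\<close>)
  have pt_mono: "pt k i \<le> pt k j" if "i \<le> j" for k i j
    unfolding pt_def using that h[of k] by (auto intro!: mult_right_mono)
  have ptb: "pt k i \<le> b" if "i \<le> Suc k" for k i using pt_mono[OF that, of k] pts(4)[of k] by simp
  \<comment> \<open>a jump in the last cell, or two jumps in another one\<close>
  define Bad where "Bad k = {\<omega>\<in>space M. N b \<omega> - N (pt k k) \<omega> \<in> {1..}} \<union>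
    (\<Union>i<k. {\<omega>\<in>space M. N (pt k (Suc i)) \<omega> - N (pt k i) \<omega> \<in> {2..}})" for k
  have incm: "{\<omega>\<in>space M. N t \<omega> - N s \<omega> \<in> A} \<in> events" if "0 \<le> s" "0 \<le> t" for s t A
  proof -
    have [measurable]: "N t \<in> measurable M (count_space UNIV)" "N s \<in> measurable M (count_space UNIV)"
      using N_measurable that by auto
    show ?thesis by measurable
  qed
  have pt0: "0 \<le> pt k i" for k i using pts(1)[of k i] ab by linarith
  have Bm: "Bad k \<in> events" for k
    unfolding Bad_def using pt0 ab by (intro sets.Un sets.finite_UN incm) auto
  have Bp: "prob (Bad k) \<le> (l * (b - a) + (l * (b - a))\<^sup>2) / real (Suc k)" for k
  proof -
    let ?h = "l * h k"
    have mu: "(LBINT u:{pt k i..pt k (Suc i)}. \<Lambda> u) = ?h" if "i \<le> k" for i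
      using rate[OF pts(1)[of k i] pts(2)[of k i] ptb] that pts(5)[of k i] by simp
    have h0: "0 < ?h" using l h by simp
    have "prob {\<omega>\<in>space M. N b \<omega> - N (pt k k) \<omega> \<in> {1..}} \<le> ?h"
      using N_increment_prob[OF pt0[of k k] pts(2)[of k k], of "{1..}"] mu[of k] pts(4)[of k]
        poisson_tail_bounds(1)[OF h0] one_minus_exp_le[of ?h] by simp
    moreover have "prob (\<Union>i<k. {\<omega>\<in>space M. N (pt k (Suc i)) \<omega> - N (pt k i) \<omega> \<in> {2..}}) \<le> (\<Sum>i<k. ?h\<^sup>2)"
    proof (rule order_trans[OF finite_measure_subadditive_finite sum_mono])
      show "prob {\<omega>\<in>space M. N (pt k (Suc i)) \<omega> - N (pt k i) \<omega> \<in> {2..}} \<le> ?h\<^sup>2" if "i \<in> {..<k}" for i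
        using N_increment_prob[OF pt0[of k i] pts(2)[of k i], of "{2..}"] mu[of i] that
          poisson_tail_bounds(2)[OF h0] by simp
    qed ((rule finite_lessThan | (rule image_subsetI, rule incm[OF pt0 pt0]))+)
    moreover have "prob (Bad k) \<le> prob {\<omega>\<in>space M. N b \<omega> - N (pt k k) \<omega> \<in> {1..}} +
        prob (\<Union>i<k. {\<omega>\<in>space M. N (pt k (Suc i)) \<omega> - N (pt k i) \<omega> \<in> {2..}})"
      unfolding Bad_def using pt0 ab by (intro measure_Un_le sets.finite_UN incm) auto
    moreover have "(\<Sum>i<k. ?h\<^sup>2) \<le> (l * (b - a))\<^sup>2 / real (Suc k)"
    proof -
      have "real k * ?h\<^sup>2 \<le> real (Suc k) * ?h\<^sup>2" by (intro mult_right_mono) auto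
      also have "\<dots> = (l * (b - a))\<^sup>2 / real (Suc k)"
        unfolding h_def by (simp add: power2_eq_square del: of_nat_Suc)
      finally show ?thesis by simp
    qed
    moreover have "?h = l * (b - a) / real (Suc k)" unfolding h_def by simp
    ultimately show ?thesis by (simp add: add_divide_distrib del: of_nat_Suc)
  qed
  let ?N = "\<Inter>k. Bad k"
  have N: "?N \<in> events" using Bm by auto
  have "prob ?N \<le> (l * (b - a) + (l * (b - a))\<^sup>2) / real (Suc k)" for k
    using finite_measure_mono[of ?N "Bad k"] Bm Bp[of k] by (auto intro: order_trans)
  then have "prob ?N \<le> 0"
    using LIMSEQ_Suc[OF lim_const_over_n[of "l * (b - a) + (l * (b - a))\<^sup>2"]] by (intro LIMSEQ_le_const) auto
  then have "?N \<in> null_sets M" using N by (simp add: null_sets_def emeasure_eq_measure measure_le_0_iff)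
  then have "AE \<omega> in M. \<omega> \<notin> ?N" by (rule AE_not_in)
  then show ?thesis using V0 AE_space
  proof eventually_elim
    case (elim \<omega>)
    note w = elim(3) and V = elim(2)
    have mono: "N a \<omega> \<le> N b \<omega>" using N_mono[OF w ab(1), of b] ab by simp
    show ?case
    proof
      assume lt: "\<bar>telegraph V0 N b \<omega> - telegraph V0 N a \<omega>\<bar> < c * (b - a)"
      show "1 \<le> N b \<omega> - N a \<omega>"
      proof (rule ccontr)
        assume "\<not> ?thesis"
        then have "N a \<omega> = N b \<omega>" using mono by simp
        then show False using constant_path_increment[OF w ab(1), of b V0] ab lt V by simp
      qed
    next
      assume jump: "1 \<le> N b \<omega> - N a \<omega>"
      show "\<bar>telegraph V0 N b \<omega> - telegraph V0 N a \<omega>\<bar> < c * (b - a)"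
      proof (rule ccontr)
        assume "\<not> ?thesis"
        then have ge: "\<bar>V0 \<omega>\<bar> * (b - a) \<le> \<bar>telegraph V0 N b \<omega> - telegraph V0 N a \<omega>\<bar>" using V by simp
        have V0': "V0 \<omega> \<noteq> 0" using V c by auto
        obtain k where k: "\<omega> \<notin> Bad k" using elim(1) by blast
        have eq: "N (pt k i) \<omega> = N a \<omega>" if "i \<le> k" for i
          using that
        proof (induction i)
          case (Suc i)
          have ltb: "pt k (Suc i) < b" using pts(2)[of k "Suc i"] ptb[of "Suc (Suc i)" k] Suc.prems by simp
          have "even (N (pt k (Suc i)) \<omega> - N (pt k i) \<omega>)"
            using extremal_increment_even[OF w ab V0' ge pts(1) less_imp_le[OF pts(2)[of k i]] ltb] .
          moreover have "N (pt k (Suc i)) \<omega> - N (pt k i) \<omega> \<notin> {2..}" using k w Suc.prems unfolding Bad_def by auto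
          moreover have "even n \<Longrightarrow> n \<notin> {2..} \<Longrightarrow> n = 0" for n :: nat by (cases n) (auto elim: oddE evenE)
          ultimately have "N (pt k (Suc i)) \<omega> - N (pt k i) \<omega> = 0" by blast
          moreover have "N (pt k i) \<omega> \<le> N (pt k (Suc i)) \<omega>" using N_mono[OF w pt0 less_imp_le[OF pts(2)]] .
          ultimately show ?case using Suc by simp
        qed (simp add: pts)
        have "N b \<omega> - N (pt k k) \<omega> \<notin> {1..}" using k w unfolding Bad_def by auto
        then show False using jump eq[of k] by simp
      qed
    qed
  qed
qed

end

lemma observations_measurable:
  assumes "\<And>t. telegraph V0 N t \<in> borel_measurable M"
  shows "observations n \<delta> (telegraph V0 N) \<in> measurable M (data_space n)"
  unfolding observations_def data_space_def using assms by (intro measurable_restrict) auto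

text \<open>
  Everything that the asymptotic analysis uses about the telegraph process. The change happens at a
  sampling time, so the intensity is constant on each sampling interval.
\<close>

lemma telegraph_switch_indicators:
  assumes driver: "telegraph_driver M c (change_intensity l1 l2 (real k0 * \<delta>)) V0 N"
    and pos: "0 < c" "0 < \<delta>" "0 < l1" "0 < l2"
  defines "J \<equiv> \<lambda>i \<omega>. if 1 \<le> N (real (Suc i) * \<delta>) \<omega> - N (real i * \<delta>) \<omega> then 1 else (0 :: real)"
  shows "prob_space M" "prob_space.indep_vars M (\<lambda>_. borel) J {..<n}"
    and "\<And>i. (\<integral>\<omega>. J i \<omega> \<partial>M) = 1 - exp (- (if i < k0 then l1 else l2) * \<delta>)"
    and "\<And>i \<omega>. J i \<omega> \<in> {0, 1}"
    and "observations n \<delta> (telegraph V0 N) \<in> measurable M (data_space n)"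
    and "AE \<omega> in M. \<forall>i\<in>{1..n}. Y_stat c \<delta> (observations n \<delta> (telegraph V0 N) \<omega>) i = J (i - 1) \<omega> / \<delta>"
proof -
  let ?\<Lambda> = "change_intensity l1 l2 (real k0 * \<delta>)"
  have pp: "poisson_process M ?\<Lambda> N" and V0m: "V0 \<in> borel_measurable M"
    and V0p: "measure M {\<omega>\<in>space M. V0 \<omega> = c} = 1/2" "measure M {\<omega>\<in>space M. V0 \<omega> = - c} = 1/2"
    using driver unfolding telegraph_driver_def by blast+
  show M: "prob_space M" using pp unfolding poisson_process_def by blast
  interpret prob_space M by fact
  interpret poisson_path M ?\<Lambda> N using pp by unfold_locales
  show "J i \<omega> \<in> {0, 1}" for i \<omega> unfolding J_def by simp
  show "observations n \<delta> (telegraph V0 N) \<in> measurable M (data_space n)"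
    by (intro observations_measurable telegraph_measurable V0m)
  have "indep_vars (\<lambda>_. count_space UNIV) (\<lambda>i \<omega>. N (real (Suc i) * \<delta>) \<omega> - N (real i * \<delta>) \<omega>) {..<n}"
    using pos by (intro N_increments_indep[of "\<lambda>i. real i * \<delta>"]) auto
  from indep_vars_compose2[OF this, of "\<lambda>_ k. if 1 \<le> k then 1 else (0 :: real)" "\<lambda>_. borel"]
  show "indep_vars (\<lambda>_. borel) J {..<n}" unfolding J_def by simp
  have rate: "(LBINT u:{s..t}. ?\<Lambda> u) = (if i < k0 then l1 else l2) * (t - s)"
    if st: "real i * \<delta> \<le> s" "s < t" "t \<le> real (Suc i) * \<delta>" for i s t
  proof (cases "i < k0")
    case True
    then have "real (Suc i) * \<delta> \<le> real k0 * \<delta>" using pos by (intro mult_right_mono) auto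
    then have "t \<le> real k0 * \<delta>" using st by linarith
    then show ?thesis using True change_intensity_integral(1)[OF less_imp_le[OF st(2)]] by simp
  next
    case False
    then have "real k0 * \<delta> \<le> real i * \<delta>" using pos by (intro mult_right_mono) auto
    then have "real k0 * \<delta> \<le> s" using st by linarith
    then show ?thesis using False change_intensity_integral(2)[OF less_imp_le[OF st(2)]] by simp
  qed
  have stp: "real i * \<delta> < real (Suc i) * \<delta>" "0 \<le> real i * \<delta>" "real (Suc i) * \<delta> - real i * \<delta> = \<delta>" for i
    using pos by (auto simp: distrib_right)
  show "(\<integral>\<omega>. J i \<omega> \<partial>M) = 1 - exp (- (if i < k0 then l1 else l2) * \<delta>)" for i
  proof -
    let ?l = "if i < k0 then l1 else l2"
    have l: "0 < ?l * \<delta>" using pos by simp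
    let ?E = "{\<omega>\<in>space M. N (real (Suc i) * \<delta>) \<omega> - N (real i * \<delta>) \<omega> \<in> {1..}}"
    have [measurable]: "N (real (Suc i) * \<delta>) \<in> measurable M (count_space UNIV)" "N (real i * \<delta>) \<in> measurable M (count_space UNIV)"
      using pos by (auto intro!: N_measurable)
    have "?E \<in> events" by measurable
    moreover have "(\<integral>\<omega>. J i \<omega> \<partial>M) = (\<integral>\<omega>. indicator ?E \<omega> \<partial>M)"
      by (intro Bochner_Integration.integral_cong) (auto simp: J_def indicator_def)
    ultimately have "(\<integral>\<omega>. J i \<omega> \<partial>M) = prob ?E" by simp
    also have "\<dots> = 1 - exp (- (?l * \<delta>))"
      using N_increment_prob[OF stp(2)[of i] stp(1)[of i], of "{1..}"] rate[OF order_refl stp(1)[of i] order_refl] stp(3)[of i]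
        poisson_tail_bounds(1)[OF l] by simp
    finally show ?thesis by (simp only: mult_minus_left)
  qed
  have V0: "AE \<omega> in M. \<bar>V0 \<omega>\<bar> = c"
  proof -
    note V0m[measurable]
    let ?A = "{\<omega>\<in>space M. V0 \<omega> = c}" and ?B = "{\<omega>\<in>space M. V0 \<omega> = - c}"
    have "prob (?A \<union> ?B) = 1" using V0p pos by (subst finite_measure_Union) auto
    then have "AE \<omega> in M. \<omega> \<in> ?A \<union> ?B" by (subst prob_eq_1[symmetric]) auto
    then show ?thesis by eventually_elim (use pos in auto)
  qed
  have "AE \<omega> in M. \<forall>i<n. \<bar>telegraph V0 N (real (Suc i) * \<delta>) \<omega> - telegraph V0 N (real i * \<delta>) \<omega>\<bar> < c * \<delta> \<longleftrightarrow>
     1 \<le> N (real (Suc i) * \<delta>) \<omega> - N (real i * \<delta>) \<omega>"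
  proof (subst AE_all_countable, intro allI)
    fix i
    have "0 < (if i < k0 then l1 else l2)" using pos by simp
    then have "AE \<omega> in M. \<bar>telegraph V0 N (real (Suc i) * \<delta>) \<omega> - telegraph V0 N (real i * \<delta>) \<omega>\<bar> < c * \<delta> \<longleftrightarrow>
        1 \<le> N (real (Suc i) * \<delta>) \<omega> - N (real i * \<delta>) \<omega>"
      by (rule slow_iff_jump_AE[OF stp(2)[of i] stp(1)[of i] _ _ V0 pos(1), unfolded stp(3)]) (rule rate)
    then show "AE \<omega> in M. i < n \<longrightarrow> (\<bar>telegraph V0 N (real (Suc i) * \<delta>) \<omega> - telegraph V0 N (real i * \<delta>) \<omega>\<bar> < c * \<delta> \<longleftrightarrow>
       1 \<le> N (real (Suc i) * \<delta>) \<omega> - N (real i * \<delta>) \<omega>)"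
      by eventually_elim blast
  qed
  then show "AE \<omega> in M. \<forall>i\<in>{1..n}. Y_stat c \<delta> (observations n \<delta> (telegraph V0 N) \<omega>) i = J (i - 1) \<omega> / \<delta>"
  proof eventually_elim
    case (elim \<omega>)
    show ?case
    proof
      fix i assume i: "i \<in> {1..n}"
      then obtain j where j: "i = Suc j" "j < n" by (cases i) auto
      have "observations n \<delta> (telegraph V0 N) \<omega> i - observations n \<delta> (telegraph V0 N) \<omega> (i - 1) =
          telegraph V0 N (real (Suc j) * \<delta>) \<omega> - telegraph V0 N (real j * \<delta>) \<omega>"
        unfolding observations_def using j by simp
      then show "Y_stat c \<delta> (observations n \<delta> (telegraph V0 N) \<omega>) i = J (i - 1) \<omega> / \<delta>"
        unfolding Y_stat_def J_def using elim[rule_format, OF j(2)] j by simp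
    qed
  qed
qed

section \<open>Least squares and the cusum contrast\<close>

lemma sum_squared_deviation:
  fixes y :: "nat \<Rightarrow> real"
  assumes "finite A" "card A \<noteq> 0"
  shows "(\<Sum>i\<in>A. (y i - (\<Sum>i\<in>A. y i) / real (card A))\<^sup>2) = (\<Sum>i\<in>A. (y i)\<^sup>2) - (\<Sum>i\<in>A. y i)\<^sup>2 / real (card A)"
proof -
  define m where "m = (\<Sum>i\<in>A. y i) / real (card A)"
  have s: "(\<Sum>i\<in>A. y i) = real (card A) * m" unfolding m_def using assms by simp
  have "(\<Sum>i\<in>A. (y i - m)\<^sup>2) = (\<Sum>i\<in>A. (y i)\<^sup>2 - 2 * m * y i + m\<^sup>2)"
    by (intro sum.cong refl) (simp add: power2_diff)
  also have "\<dots> = (\<Sum>i\<in>A. (y i)\<^sup>2) - 2 * m * (\<Sum>i\<in>A. y i) + real (card A) * m\<^sup>2"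
    by (simp add: sum.distrib sum_subtractf sum_distrib_left)
  also have "\<dots> = (\<Sum>i\<in>A. (y i)\<^sup>2) - (\<Sum>i\<in>A. y i)\<^sup>2 / real (card A)"
    unfolding s using assms by (simp add: power2_eq_square)
  finally show ?thesis unfolding m_def .
qed

text \<open>
  With \<open>s\<close> and \<open>t\<close> the sums over the two segments, of lengths \<open>a\<close> and \<open>c - a\<close>, the reduction of the
  residual sum of squares by splitting is a weighted squared cusum.
\<close>

lemma two_sample_identity:
  fixes a c s t :: real
  assumes "a \<noteq> 0" "c - a \<noteq> 0" "c \<noteq> 0"
  shows "c * (s - a / c * (s + t))\<^sup>2 / (a * (c - a)) = s\<^sup>2 / a + t\<^sup>2 / (c - a) - (s + t)\<^sup>2 / c"
proof -
  define e where "e = c - a"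
  have c: "c = a + e" "e \<noteq> 0" unfolding e_def using assms by simp_all
  have "s - a / c * (s + t) = (e * s - a * t) / c" using assms unfolding c(1) by (simp add: field_simps)
  then have "c * (s - a / c * (s + t))\<^sup>2 / (a * e) = (e * s - a * t)\<^sup>2 / (a * e * c)"
    using assms by (simp add: power_divide power2_eq_square)
  moreover have "s\<^sup>2 / a + t\<^sup>2 / e - (s + t)\<^sup>2 / c = ((s\<^sup>2 * e + t\<^sup>2 * a) * c - (s + t)\<^sup>2 * (a * e)) / (a * e * c)"
    using assms c(2) by (simp add: add_divide_distrib diff_divide_distrib distrib_right)
  moreover have "(s\<^sup>2 * e + t\<^sup>2 * a) * c - (s + t)\<^sup>2 * (a * e) = (e * s - a * t)\<^sup>2"
    unfolding c(1) by algebra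
  ultimately show ?thesis unfolding e_def[symmetric] by simp
qed

text \<open>
  Cumulative sums minus their linear interpolation; the indices of \<open>y\<close> start at \<open>0\<close>.
\<close>

definition cusum :: "nat \<Rightarrow> (nat \<Rightarrow> real) \<Rightarrow> nat \<Rightarrow> real" where
  "cusum n y k = (\<Sum>i<k. y i) - real k / real n * (\<Sum>i<n. y i)"

definition contrast :: "nat \<Rightarrow> (nat \<Rightarrow> real) \<Rightarrow> nat \<Rightarrow> real" where
  "contrast n y k = (cusum n y k)\<^sup>2 / (real k * (real n - real k))"

text \<open>
  The total sum of squares does not depend on \<open>k\<close>, and splitting reduces the residual by the contrast.
  The shift from \<open>i\<close> to \<open>i - 1\<close> passes from observations numbered from \<open>1\<close> to indicators numbered from \<open>0\<close>.
\<close>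

lemma ls_criterion_contrast:
  fixes b :: "nat \<Rightarrow> real"
  assumes k: "1 \<le> k" "k \<le> n - 1" and y: "\<And>i. i \<in> {1..n} \<Longrightarrow> y i = b (i - 1) / \<delta>"
  shows "ls_criterion n y k = (\<Sum>i=1..n. (y i)\<^sup>2) - (\<Sum>i=1..n. y i)\<^sup>2 / real n - real n * contrast n b k / \<delta>\<^sup>2"
proof -
  have n: "2 \<le> n" "k < n" using k by auto
  define s t where "s = (\<Sum>i=1..k. y i)" and "t = (\<Sum>i=k+1..n. y i)"
  have split: "(\<Sum>i=1..n. f i) = (\<Sum>i=1..k. f i) + (\<Sum>i=k+1..n. f i)" for f :: "nat \<Rightarrow> real"
  proof -
    have "{1..n} = {1..k} \<union> {k+1..n}" using n by auto
    then show ?thesis by (simp add: sum.union_disjoint)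
  qed
  have c: "card {1..k} = k" "real (card {k+1..n}) = real n - real k" using n by auto
  have A: "(\<Sum>i=1..k. (y i - mean_upto y k)\<^sup>2) = (\<Sum>i=1..k. (y i)\<^sup>2) - s\<^sup>2 / real k"
    unfolding mean_upto_def s_def using sum_squared_deviation[of "{1..k}" y] k by simp
  have B: "(\<Sum>i=k+1..n. (y i - mean_after n y k)\<^sup>2) = (\<Sum>i=k+1..n. (y i)\<^sup>2) - t\<^sup>2 / (real n - real k)"
    unfolding mean_after_def t_def using sum_squared_deviation[of "{k+1..n}" y] n c by simp
  have sb: "(\<Sum>i=1..l. y i) = (\<Sum>i<l. b i) / \<delta>" if "l \<le> n" for l
  proof -
    have "(\<Sum>i=1..l. y i) = (\<Sum>i=1..l. b (i - 1) / \<delta>)" using y that by (intro sum.cong) auto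
    also have "\<dots> = (\<Sum>i<l. b i / \<delta>)"
      by (rule sum.reindex_bij_witness[of _ Suc "\<lambda>i. i - 1"]) auto
    finally show ?thesis by (simp add: sum_divide_distrib)
  qed
  have cs: "cusum n b k / \<delta> = s - real k / real n * (s + t)"
  proof -
    have "(\<Sum>i<k. b i) / \<delta> = s" "(\<Sum>i<n. b i) / \<delta> = s + t"
      unfolding s_def t_def using sb[of k] sb[of n] split[of y] n by simp_all
    moreover have "cusum n b k / \<delta> = (\<Sum>i<k. b i) / \<delta> - real k / real n * ((\<Sum>i<n. b i) / \<delta>)"
      unfolding cusum_def by (simp add: diff_divide_distrib)
    ultimately show ?thesis by (simp only:)
  qed
  have nz: "real k \<noteq> 0" "real n - real k \<noteq> 0" "real n \<noteq> 0" using k n by auto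
  have "real n * contrast n b k / \<delta>\<^sup>2 = real n * (cusum n b k / \<delta>)\<^sup>2 / (real k * (real n - real k))"
    unfolding contrast_def by (simp add: power_divide)
  also have "\<dots> = s\<^sup>2 / real k + t\<^sup>2 / (real n - real k) - (s + t)\<^sup>2 / real n"
    unfolding cs by (rule two_sample_identity[OF nz])
  finally have "real n * contrast n b k / \<delta>\<^sup>2 = s\<^sup>2 / real k + t\<^sup>2 / (real n - real k) - (s + t)\<^sup>2 / real n" .
  moreover have "(\<Sum>i=1..n. y i) = s + t" unfolding s_def t_def by (rule split)
  ultimately show ?thesis unfolding ls_criterion_def A B split[of "\<lambda>i. (y i)\<^sup>2"] by simp
qed

lemma ls_minimiser_maximises_contrast:
  fixes b :: "nat \<Rightarrow> real"
  assumes min: "is_arg_min (ls_criterion n y) (\<lambda>k. 1 \<le> k \<and> k \<le> n - 1) K"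
    and y: "\<And>i. i \<in> {1..n} \<Longrightarrow> y i = b (i - 1) / \<delta>" and \<delta>: "\<delta> \<noteq> 0" and k: "1 \<le> k" "k \<le> n - 1"
  shows "contrast n b k \<le> contrast n b K"
proof -
  have K: "1 \<le> K" "K \<le> n - 1" and le: "ls_criterion n y K \<le> ls_criterion n y k"
    using min k unfolding is_arg_min_def by (auto simp: not_less)
  have "real n * contrast n b k / \<delta>\<^sup>2 \<le> real n * contrast n b K / \<delta>\<^sup>2"
  proof -
    let ?c = "(\<Sum>i=1..n. (y i)\<^sup>2) - (\<Sum>i=1..n. y i)\<^sup>2 / real n"
    have "ls_criterion n y k = ?c - real n * contrast n b k / \<delta>\<^sup>2"
      by (rule ls_criterion_contrast[OF k]) (rule y)
    moreover have "ls_criterion n y K = ?c - real n * contrast n b K / \<delta>\<^sup>2"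
      by (rule ls_criterion_contrast[OF K]) (rule y)
    ultimately show ?thesis using le by linarith
  qed
  then have "real n * contrast n b k \<le> real n * contrast n b K" using \<delta> by (simp add: divide_le_cancel)
  then show ?thesis using k by (simp add: mult_le_cancel_left)
qed

text \<open>
  Here \<open>x = k / n\<close> and \<open>t = k0 / n\<close>. The noiseless contrast is \<open>w^2 * x * (1 - x)\<close> up to the factor \<open>\<delta>^2\<close>
  and equals \<open>t * (1 - t)\<close> at the change; the first identity is its exact loss away from the change.
\<close>

lemma contrast_weight:
  fixes x t b :: real
  assumes x: "0 < x" "x < 1" and t: "b \<le> t" "t \<le> 1 - b" and b: "0 < b" "b \<le> 1 / 2"
  defines "v \<equiv> x * (1 - x)" and "w \<equiv> min (x * (1 - t)) (t * (1 - x)) / (x * (1 - x))"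
  shows "w\<^sup>2 * v - t * (1 - t) = - w * \<bar>x - t\<bar>" "b \<le> w" "w \<le> 1" "1 - w \<le> \<bar>x - t\<bar> / b"
    "min (x * (1 - t)) (t * (1 - x)) = w * v"
proof -
  have v: "0 < v" unfolding v_def using x by simp
  show "min (x * (1 - t)) (t * (1 - x)) = w * v"
  proof -
    have "min (x * (1 - t)) (t * (1 - x)) / v * v = min (x * (1 - t)) (t * (1 - x))" using v by simp
    then show ?thesis unfolding w_def v_def by (rule sym)
  qed
  have t01: "0 < t" "t < 1" using t b by linarith+
  have "w\<^sup>2 * v - t * (1 - t) = - w * \<bar>x - t\<bar> \<and> b \<le> w \<and> w \<le> 1 \<and> 1 - w \<le> \<bar>x - t\<bar> / b"
  proof (cases "x \<le> t")
    case True
    have "x * (1 - t) \<le> t * (1 - x)" using True by (simp add: algebra_simps)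
    then have w: "w = (1 - t) / (1 - x)" unfolding w_def using x by (simp add: min_def)
    have 1: "w\<^sup>2 * v - t * (1 - t) = - w * \<bar>x - t\<bar>"
      unfolding w v_def using x True by (simp add: divide_simps) algebra
    have "b * (1 - x) \<le> (1 - t) * 1" using x t b by (intro mult_mono) auto
    then have 2: "b \<le> w" unfolding w using x by (simp add: pos_le_divide_eq)
    have 3: "w \<le> 1" unfolding w using x True by simp
    have "1 - w = \<bar>x - t\<bar> / (1 - x)" unfolding w using x True by (simp add: divide_simps)
    also have "\<dots> \<le> \<bar>x - t\<bar> / b" using x t b True by (intro divide_left_mono) auto
    finally show ?thesis using 1 2 3 by simp
  next
    case False
    have "t * (1 - x) \<le> x * (1 - t)" using False by (simp add: algebra_simps)
    then have w: "w = t / x" unfolding w_def using x by (simp add: min_def)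
    have 1: "w\<^sup>2 * v - t * (1 - t) = - w * \<bar>x - t\<bar>"
      unfolding w v_def using x False by (simp add: divide_simps) algebra
    have "b * x \<le> t * 1" using x t b by (intro mult_mono) auto
    then have 2: "b \<le> w" unfolding w using x by (simp add: pos_le_divide_eq)
    have 3: "w \<le> 1" unfolding w using x False by simp
    have "1 - w = \<bar>x - t\<bar> / x" unfolding w using x False by (simp add: divide_simps)
    also have "\<dots> \<le> \<bar>x - t\<bar> / b" using x t b False by (intro divide_left_mono) auto
    finally show ?thesis using 1 2 3 by simp
  qed
  then show "w\<^sup>2 * v - t * (1 - t) = - w * \<bar>x - t\<bar>" "b \<le> w" "w \<le> 1" "1 - w \<le> \<bar>x - t\<bar> / b" by auto
qed

text \<open>
  Here \<open>Q\<close> and \<open>Qt\<close> are the contrasts at \<open>x\<close> and at the change \<open>t\<close>, written as signal plus noise \<open>\<rho>\<close>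
  over the weight. The first bound is crude but has the right sign at a distance of order \<open>\<epsilon>\<close>. The second
  linearises: apart from the drift and the difference of the noises every term carries a factor that
  is small when \<open>\<epsilon>\<close> or the distance is.
\<close>

lemma contrast_perturbation:
  fixes x t b \<delta> \<epsilon> \<rho> \<rho>t :: real
  assumes x: "0 < x" "x < 1" and t: "b \<le> t" "t \<le> 1 - b" and b: "0 < b" "b \<le> 1 / 2"
    and \<delta>: "0 < \<delta>" and \<epsilon>: "0 < \<epsilon>" "\<epsilon> \<le> 1"
    and \<rho>: "\<rho>\<^sup>2 \<le> 4 * \<epsilon>\<^sup>2 * \<delta>\<^sup>2 * (x * (1 - x))" and \<rho>t: "\<rho>t\<^sup>2 \<le> 4 * \<epsilon>\<^sup>2 * \<delta>\<^sup>2 * (t * (1 - t))"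
  defines "Q \<equiv> (\<delta> * min (x * (1 - t)) (t * (1 - x)) + \<rho>)\<^sup>2 / (x * (1 - x))"
    and "Qt \<equiv> (\<delta> * (t * (1 - t)) + \<rho>t)\<^sup>2 / (t * (1 - t))"
  shows "Q - Qt \<le> - \<delta>\<^sup>2 * b * \<bar>x - t\<bar> + 8 * \<epsilon> * \<delta>\<^sup>2"
    and "\<bar>(Q - Qt) - (- \<delta>\<^sup>2 * \<bar>x - t\<bar> + 2 * \<delta> * (\<rho> - \<rho>t))\<bar>
      \<le> \<delta>\<^sup>2 * \<bar>x - t\<bar>\<^sup>2 / b + 10 * \<epsilon> * \<delta>\<^sup>2 * \<bar>x - t\<bar> / b + 4 * \<epsilon> * \<delta> * \<bar>\<rho> - \<rho>t\<bar> / b"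
proof -
  define v vt d where "v = x * (1 - x)" and "vt = t * (1 - t)" and "d = \<bar>x - t\<bar>"
  define w where "w = min (x * (1 - t)) (t * (1 - x)) / (x * (1 - x))"
  note W = contrast_weight[OF x t b, folded w_def v_def vt_def d_def]
  have t01: "0 < t" "t < 1" using t b by linarith+
  have v: "0 < v" "0 < vt" unfolding v_def vt_def using x t01 by simp_all
  have quarter: "y * (1 - y) \<le> 1 / 4" for y :: real
  proof -
    have "0 \<le> (y - 1 / 2)\<^sup>2" by simp
    then show ?thesis by (simp add: power2_eq_square algebra_simps)
  qed
  have d0: "0 \<le> d" unfolding d_def by simp
  have small: "\<bar>r\<bar> \<le> \<epsilon> * \<delta>" if "r\<^sup>2 \<le> 4 * \<epsilon>\<^sup>2 * \<delta>\<^sup>2 * (y * (1 - y))" for r y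
  proof -
    have "4 * \<epsilon>\<^sup>2 * \<delta>\<^sup>2 * (y * (1 - y)) \<le> 4 * \<epsilon>\<^sup>2 * \<delta>\<^sup>2 * (1 / 4)" using quarter by (intro mult_left_mono) auto
    then have "r\<^sup>2 \<le> (\<epsilon> * \<delta>)\<^sup>2" using that by (simp add: power_mult_distrib)
    then show ?thesis using \<epsilon> \<delta> by (metis abs_le_square_iff abs_of_pos mult_pos_pos)
  qed
  have r: "\<bar>\<rho>\<bar> \<le> \<epsilon> * \<delta>" "\<bar>\<rho>t\<bar> \<le> \<epsilon> * \<delta>" using small[OF \<rho>] small[OF \<rho>t] by auto
  have q: "0 \<le> \<rho>\<^sup>2 / v" "\<rho>\<^sup>2 / v \<le> 4 * \<epsilon>\<^sup>2 * \<delta>\<^sup>2" "0 \<le> \<rho>t\<^sup>2 / vt" "\<rho>t\<^sup>2 / vt \<le> 4 * \<epsilon>\<^sup>2 * \<delta>\<^sup>2"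
    using \<rho> \<rho>t v unfolding v_def[symmetric] vt_def[symmetric] by (simp_all add: pos_divide_le_eq)
  have e2: "\<epsilon>\<^sup>2 \<le> \<epsilon>" using \<epsilon> by (simp add: power2_eq_square mult_left_le)
  have Q: "Q = \<delta>\<^sup>2 * (w\<^sup>2 * v) + 2 * \<delta> * w * \<rho> + \<rho>\<^sup>2 / v"
    unfolding Q_def v_def[symmetric] W(5) using v by (simp add: divide_simps) algebra
  have Qt: "Qt = \<delta>\<^sup>2 * vt + 2 * \<delta> * \<rho>t + \<rho>t\<^sup>2 / vt"
    unfolding Qt_def vt_def[symmetric] using v by (simp add: divide_simps) algebra
  have diff: "Q - Qt = - \<delta>\<^sup>2 * w * d + 2 * \<delta> * (w * \<rho> - \<rho>t) + (\<rho>\<^sup>2 / v - \<rho>t\<^sup>2 / vt)"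
  proof -
    have "\<delta>\<^sup>2 * (w\<^sup>2 * v) - \<delta>\<^sup>2 * vt = \<delta>\<^sup>2 * (- w * d)" unfolding W(1)[symmetric] by (simp add: right_diff_distrib)
    then show ?thesis unfolding Q Qt by (simp add: algebra_simps)
  qed
  have w0: "0 \<le> w" "w \<le> 1" using W(2,3) b by auto
  show "Q - Qt \<le> - \<delta>\<^sup>2 * b * \<bar>x - t\<bar> + 8 * \<epsilon> * \<delta>\<^sup>2"
  proof -
    have "\<delta>\<^sup>2 * b * d \<le> \<delta>\<^sup>2 * w * d" using W(2) d0 by (intro mult_right_mono mult_left_mono) auto
    moreover have "2 * \<delta> * (w * \<rho> - \<rho>t) \<le> 2 * \<delta> * (2 * \<epsilon> * \<delta>)"
    proof (rule mult_left_mono)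
      have "w * \<rho> \<le> w * \<bar>\<rho>\<bar>" using w0 by (intro mult_left_mono) auto
      also have "\<dots> \<le> 1 * (\<epsilon> * \<delta>)" using w0 r \<epsilon> \<delta> by (intro mult_mono) auto
      finally show "w * \<rho> - \<rho>t \<le> 2 * \<epsilon> * \<delta>" using r by simp
    qed (use \<delta> in simp)
    moreover have "\<rho>\<^sup>2 / v - \<rho>t\<^sup>2 / vt \<le> 4 * \<epsilon> * \<delta>\<^sup>2"
    proof -
      have "4 * \<epsilon>\<^sup>2 * \<delta>\<^sup>2 \<le> 4 * \<epsilon> * \<delta>\<^sup>2" using e2 by (intro mult_right_mono) auto
      then show ?thesis using q by linarith
    qed
    ultimately show ?thesis unfolding diff d_def[symmetric] by (simp add: power2_eq_square algebra_simps)
  qed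
  show "\<bar>(Q - Qt) - (- \<delta>\<^sup>2 * \<bar>x - t\<bar> + 2 * \<delta> * (\<rho> - \<rho>t))\<bar>
      \<le> \<delta>\<^sup>2 * \<bar>x - t\<bar>\<^sup>2 / b + 10 * \<epsilon> * \<delta>\<^sup>2 * \<bar>x - t\<bar> / b + 4 * \<epsilon> * \<delta> * \<bar>\<rho> - \<rho>t\<bar> / b"
  proof -
    have eq: "(Q - Qt) - (- \<delta>\<^sup>2 * d + 2 * \<delta> * (\<rho> - \<rho>t)) =
        \<delta>\<^sup>2 * (1 - w) * d - 2 * \<delta> * (1 - w) * \<rho> + ((\<rho>\<^sup>2 - \<rho>t\<^sup>2) / vt + \<rho>\<^sup>2 / v * ((vt - v) / vt))"
    proof -
      have "\<rho>\<^sup>2 / v - \<rho>t\<^sup>2 / vt = (\<rho>\<^sup>2 - \<rho>t\<^sup>2) / vt + \<rho>\<^sup>2 / v * ((vt - v) / vt)"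
      proof -
        have "\<rho>\<^sup>2 / v * ((vt - v) / vt) = \<rho>\<^sup>2 / v - \<rho>\<^sup>2 / vt"
          using v by (simp add: divide_simps) (simp add: algebra_simps)
        then show ?thesis by (simp add: diff_divide_distrib)
      qed
      from this[symmetric] show ?thesis unfolding diff by (simp only:) (simp add: algebra_simps)
    qed
    have dw: "0 \<le> 1 - w" "1 - w \<le> d / b" using W(3,4) by auto
    have T1: "\<bar>\<delta>\<^sup>2 * (1 - w) * d\<bar> \<le> \<delta>\<^sup>2 * d\<^sup>2 / b"
    proof -
      have "\<bar>\<delta>\<^sup>2 * (1 - w) * d\<bar> = \<delta>\<^sup>2 * (1 - w) * d" using dw d0 by simp
      also have "\<dots> \<le> \<delta>\<^sup>2 * (d / b) * d" using dw d0 by (intro mult_right_mono mult_left_mono) auto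
      finally show ?thesis by (simp add: power2_eq_square)
    qed
    have T2: "\<bar>2 * \<delta> * (1 - w) * \<rho>\<bar> \<le> 2 * \<epsilon> * \<delta>\<^sup>2 * d / b"
    proof -
      have "\<bar>2 * \<delta> * (1 - w) * \<rho>\<bar> = 2 * \<delta> * (1 - w) * \<bar>\<rho>\<bar>" using dw \<delta> by (simp add: abs_mult)
      also have "\<dots> \<le> 2 * \<delta> * (d / b) * (\<epsilon> * \<delta>)" using dw d0 \<delta> b r by (intro mult_mono) auto
      finally show ?thesis by (simp add: power2_eq_square mult_ac)
    qed
    have vt: "b / 2 \<le> vt"
    proof -
      have "b * (1 / 2) \<le> b * (1 - b)" using b by (intro mult_left_mono) auto
      also have "\<dots> \<le> t * (1 - t)"
      proof -
        have "0 \<le> (t - b) * (1 - b - t)" using t by simp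
        then show ?thesis by (simp add: algebra_simps)
      qed
      finally show ?thesis unfolding vt_def by simp
    qed
    have T3: "\<bar>(\<rho>\<^sup>2 - \<rho>t\<^sup>2) / vt\<bar> \<le> 4 * \<epsilon> * \<delta> * \<bar>\<rho> - \<rho>t\<bar> / b"
    proof -
      have "\<bar>\<rho>\<^sup>2 - \<rho>t\<^sup>2\<bar> = \<bar>\<rho> - \<rho>t\<bar> * \<bar>\<rho> + \<rho>t\<bar>"
        unfolding abs_mult[symmetric] by (simp add: power2_eq_square algebra_simps)
      also have "\<dots> \<le> \<bar>\<rho> - \<rho>t\<bar> * (2 * (\<epsilon> * \<delta>))" using r by (intro mult_left_mono) auto
      finally have "\<bar>\<rho>\<^sup>2 - \<rho>t\<^sup>2\<bar> / vt \<le> \<bar>\<rho> - \<rho>t\<bar> * (2 * (\<epsilon> * \<delta>)) / (b / 2)"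
        using vt b \<epsilon> \<delta> by (intro frac_le) auto
      then show ?thesis using v by (simp add: mult_ac)
    qed
    have T4: "\<bar>\<rho>\<^sup>2 / v * ((vt - v) / vt)\<bar> \<le> 8 * \<epsilon> * \<delta>\<^sup>2 * d / b"
    proof -
      have "\<bar>vt - v\<bar> = \<bar>x - t\<bar> * \<bar>1 - x - t\<bar>"
        unfolding abs_mult[symmetric] v_def vt_def by (subst abs_minus_commute) (simp add: algebra_simps)
      also have "\<dots> \<le> \<bar>x - t\<bar> * 1" using x t01 by (intro mult_left_mono) auto
      finally have "\<bar>vt - v\<bar> / vt \<le> d / (b / 2)" using vt b d0 by (intro frac_le) (auto simp: d_def)
      then have "\<rho>\<^sup>2 / v * (\<bar>vt - v\<bar> / vt) \<le> (4 * \<epsilon> * \<delta>\<^sup>2) * (d / (b / 2))"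
      proof (rule mult_mono[rotated])
        have "4 * \<epsilon>\<^sup>2 * \<delta>\<^sup>2 \<le> 4 * \<epsilon> * \<delta>\<^sup>2" using e2 by (intro mult_right_mono) auto
        then show "\<rho>\<^sup>2 / v \<le> 4 * \<epsilon> * \<delta>\<^sup>2" using q by linarith
      qed (use v \<epsilon> in auto)
      moreover have "\<bar>\<rho>\<^sup>2 / v * ((vt - v) / vt)\<bar> = \<rho>\<^sup>2 / v * (\<bar>vt - v\<bar> / vt)" using v by (simp add: abs_mult)
      ultimately show ?thesis by simp
    qed
    have "\<delta>\<^sup>2 * d\<^sup>2 / b + 10 * \<epsilon> * \<delta>\<^sup>2 * d / b + 4 * \<epsilon> * \<delta> * \<bar>\<rho> - \<rho>t\<bar> / b =
      \<delta>\<^sup>2 * d\<^sup>2 / b + 2 * \<epsilon> * \<delta>\<^sup>2 * d / b + (4 * \<epsilon> * \<delta> * \<bar>\<rho> - \<rho>t\<bar> / b + 8 * \<epsilon> * \<delta>\<^sup>2 * d / b)"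
      by (simp add: field_simps)
    moreover have tri: "\<bar>A - B + (C + D)\<bar> \<le> a' + b' + (c' + d')"
      if "\<bar>A\<bar> \<le> a'" "\<bar>B\<bar> \<le> b'" "\<bar>C\<bar> \<le> c'" "\<bar>D\<bar> \<le> d'" for A B C D a' b' c' d' :: real
      using that by linarith
    ultimately show ?thesis unfolding d_def[symmetric] eq using tri[OF T1 T2 T3 T4] by (simp only:)
  qed
qed

section \<open>Fluctuations of an indicator sample with a change\<close>

lemma harmonic_le_ln: "(\<Sum>i<Suc n. 1 / real (Suc i)) \<le> 1 + ln (real (Suc n))"
proof (induction n)
  case (Suc n)
  have "ln (real (Suc n) / real (Suc (Suc n))) \<le> real (Suc n) / real (Suc (Suc n)) - 1"
    by (rule ln_le_minus_one) simp
  also have "\<dots> = - (1 / real (Suc (Suc n)))" by (simp add: field_simps)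
  finally have "1 / real (Suc (Suc n)) \<le> ln (real (Suc (Suc n))) - ln (real (Suc n))"
    by (simp add: ln_div)
  moreover have "(\<Sum>i<Suc (Suc n). 1 / real (Suc i)) = (\<Sum>i<Suc n. 1 / real (Suc i)) + 1 / real (Suc (Suc n))"
    by simp
  ultimately show ?case using Suc.IH by linarith
qed simp

text \<open>
  The common parameter \<open>q\<close> is the variance scale of a step; in the application it is \<open>l1 * \<Delta>\<close>. The change
  index stays a fraction \<open>b\<close> away from both ends.
\<close>

locale change_sample = prob_space M for M :: "'a measure" +
  fixes J :: "nat \<Rightarrow> 'a \<Rightarrow> real" and N k0 :: nat and p1 p2 q b :: real
  assumes indJ: "indep_vars (\<lambda>_. borel) J {..<N}"
    and J01: "\<And>i \<omega>. J i \<omega> \<in> {0, 1}"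
    and EJ: "\<And>i. i < N \<Longrightarrow> expectation (J i) = (if i < k0 then p1 else p2)"
    and N2: "2 \<le> N"
    and b: "0 < b" "b \<le> 1 / 2" and k0: "b * real N \<le> real k0" "real k0 \<le> (1 - b) * real N"
    and p: "0 < p1" "p1 < p2" "p2 \<le> 2 * q" "p2 \<le> 1"
begin

text \<open>
  In the triangular arrays below \<open>a\<close> is the length of one step in the rescaled time and \<open>s\<close> the factor that
  gives the walk \<open>m\<close> unit variance per unit of that time.
\<close>

definition \<delta> where "\<delta> = p2 - p1"
definition a where "a = \<delta>\<^sup>2 / q"
definition s where "s = \<delta> / q"
definition X where "X i \<omega> = J i \<omega> - (if i < k0 then p1 else p2)"
definition m where "m k \<omega> = (\<Sum>i<k. X i \<omega>)"

lemma pos: "0 < \<delta>" "0 < q" "0 < a" "0 < s" "s * \<delta> = a" "2 * q * s\<^sup>2 = 2 * a"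
proof -
  show d: "0 < \<delta>" and q: "0 < q" using p unfolding \<delta>_def by auto
  show "0 < a" "0 < s" "s * \<delta> = a" "2 * q * s\<^sup>2 = 2 * a"
    unfolding a_def s_def using d q by (simp_all add: power2_eq_square)
qed

lemma k0_bounds: "1 \<le> k0" "k0 \<le> N - 1" "k0 < N"
proof -
  have N: "0 < real N" using N2 by simp
  have "0 < b * real N" using b N by simp
  then show 1: "1 \<le> k0" using k0 by linarith
  have "(1 - b) * real N < 1 * real N" using b N by (intro mult_strict_right_mono) auto
  then show "k0 < N" "k0 \<le> N - 1" using k0 by linarith+
qed

lemma J_measurable: "i < N \<Longrightarrow> J i \<in> borel_measurable M"
  using indJ by (auto simp: indep_vars_def2)

lemma X_measurable: "i < N \<Longrightarrow> X i \<in> borel_measurable M"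
  unfolding X_def using J_measurable by auto

lemma X_indep: "indep_vars (\<lambda>_. borel) X {..<N}"
  unfolding X_def using indep_vars_compose2[OF indJ, of "\<lambda>i x. x - (if i < k0 then p1 else p2)" "\<lambda>_. borel"] by simp

lemma X_bound: "\<bar>X i \<omega>\<bar> \<le> 1"
  using J01[of i \<omega>] p unfolding X_def by auto

lemma X_integrable: "i < N \<Longrightarrow> integrable M (X i)" "i < N \<Longrightarrow> integrable M (\<lambda>\<omega>. (X i \<omega>)\<^sup>2)"
  using X_bound[of i] X_measurable[of i]
  by (auto intro!: integrable_const_bound[where B=1] AE_I2 simp: abs_square_le_1)

lemma X_mean: "i < N \<Longrightarrow> expectation (X i) = 0"
  and X_var: "i < N \<Longrightarrow> expectation (\<lambda>\<omega>. (X i \<omega>)\<^sup>2) = (if i < k0 then p1 * (1 - p1) else p2 * (1 - p2))"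
proof -
  assume i: "i < N"
  let ?p = "if i < k0 then p1 else p2"
  have int: "integrable M (J i)"
  proof (rule integrable_const_bound[where B=1])
    have "norm (J i \<omega>) \<le> 1" for \<omega> using J01[of i \<omega>] by auto
    then show "AE \<omega> in M. norm (J i \<omega>) \<le> 1" by simp
  qed (rule J_measurable[OF i])
  show "expectation (X i) = 0"
    unfolding X_def using int EJ[OF i] by (simp add: prob_space)
  have "expectation (\<lambda>\<omega>. (X i \<omega>)\<^sup>2) = expectation (\<lambda>\<omega>. (1 - 2 * ?p) * J i \<omega> + ?p\<^sup>2)"
  proof (rule Bochner_Integration.integral_cong[OF refl])
    fix \<omega>
    have "(J i \<omega>)\<^sup>2 = J i \<omega>" using J01[of i \<omega>] by auto
    then show "(X i \<omega>)\<^sup>2 = (1 - 2 * ?p) * J i \<omega> + ?p\<^sup>2"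
      unfolding X_def by (simp add: power2_diff algebra_simps)
  qed
  also have "\<dots> = (1 - 2 * ?p) * ?p + ?p\<^sup>2" using int EJ[OF i] by (simp add: prob_space)
  also have "\<dots> = ?p * (1 - ?p)" by (simp add: power2_eq_square algebra_simps)
  finally show "expectation (\<lambda>\<omega>. (X i \<omega>)\<^sup>2) = (if i < k0 then p1 * (1 - p1) else p2 * (1 - p2))" by simp
qed

lemma X_var_le: "i < N \<Longrightarrow> expectation (\<lambda>\<omega>. (X i \<omega>)\<^sup>2) \<le> 2 * q"
proof -
  assume i: "i < N"
  have "p1 * (1 - p1) \<le> p1" "p2 * (1 - p2) \<le> p2" using p by (simp_all add: mult_left_le)
  then have "p1 * (1 - p1) \<le> 2 * q" "p2 * (1 - p2) \<le> 2 * q" using p by linarith+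
  then show ?thesis using X_var[OF i] by simp
qed

lemma X_reindexed: fixes r :: nat assumes "inj_on g {..<r}" "g ` {..<r} \<subseteq> {..<N}"
  shows "indep_vars (\<lambda>_. borel) (\<lambda>i. X (g i)) {..<r}"
  by (rule indep_vars_reindex[OF _ assms(1) indep_vars_subset[OF X_indep assms(2)]]) simp

lemma hajek_renyi_walk:
  fixes r :: nat and g c
  assumes g: "inj_on g {..<r}" "g ` {..<r} \<subseteq> {..<N}" and c: "\<And>i. 0 \<le> c i" "\<And>i. c (Suc i) \<le> c i"
  shows "prob {\<omega>\<in>space M. \<exists>k\<le>r. 1 \<le> c k * \<bar>\<Sum>i<k. X (g i) \<omega>\<bar>} \<le> 2 * q * (\<Sum>i<r. (c (Suc i))\<^sup>2)"
proof -
  have gN: "g i < N" if "i < r" for i using g(2) that by auto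
  have "prob {\<omega>\<in>space M. \<exists>k\<le>r. 1 \<le> c k * \<bar>\<Sum>i<k. X (g i) \<omega>\<bar>} \<le> (\<Sum>i<r. (c (Suc i))\<^sup>2 * (2 * q))"
    by (rule hajek_renyi[OF X_reindexed[OF g]])
       (use X_integrable X_mean X_var_le gN c in auto)
  then show ?thesis by (simp add: sum_distrib_left mult_ac)
qed

lemma m_forward: "(\<Sum>i<k. X (l + i) \<omega>) = m (l + k) \<omega> - m l \<omega>"
  unfolding m_def by (induction k) auto

lemma m_backward: "k \<le> l \<Longrightarrow> (\<Sum>i<k. X (l - 1 - i) \<omega>) = m l \<omega> - m (l - k) \<omega>"
proof (induction k)
  case (Suc k)
  have "m (l - k) \<omega> = m (l - Suc k) \<omega> + X (l - 1 - k) \<omega>"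
  proof -
    have e: "l - k = Suc (l - Suc k)" using Suc.prems by simp
    show ?thesis unfolding m_def e by simp
  qed
  then show ?case using Suc by simp
qed simp

lemma m_measurable: "k \<le> N \<Longrightarrow> m k \<in> borel_measurable M"
  unfolding m_def by (intro borel_measurable_sum X_measurable) auto

text \<open>
  The walk read backwards from \<open>l\<close> is again a sum of distinct centred indicators, so the same
  inequality serves both directions.
\<close>

lemma walk_exceedance:
  assumes c: "\<And>i. 0 \<le> c i" "\<And>i. c (Suc i) \<le> c i"
  shows "r \<le> N - l \<Longrightarrow> l \<le> N \<Longrightarrow> prob {\<omega>\<in>space M. \<exists>k\<le>r. 1 \<le> c k * \<bar>m (l + k) \<omega> - m l \<omega>\<bar>} \<le> 2 * q * (\<Sum>i<r. (c (Suc i))\<^sup>2)"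
    and "r \<le> l \<Longrightarrow> l \<le> N \<Longrightarrow> prob {\<omega>\<in>space M. \<exists>k\<le>r. 1 \<le> c k * \<bar>m l \<omega> - m (l - k) \<omega>\<bar>} \<le> 2 * q * (\<Sum>i<r. (c (Suc i))\<^sup>2)"
    and "r \<le> N - l \<Longrightarrow> l \<le> N \<Longrightarrow> {\<omega>\<in>space M. \<exists>k\<le>r. 1 \<le> c k * \<bar>m (l + k) \<omega> - m l \<omega>\<bar>} \<in> events"
    and "r \<le> l \<Longrightarrow> l \<le> N \<Longrightarrow> {\<omega>\<in>space M. \<exists>k\<le>r. 1 \<le> c k * \<bar>m l \<omega> - m (l - k) \<omega>\<bar>} \<in> events"
proof -
  have ev: "{\<omega>\<in>space M. \<exists>k\<le>r. 1 \<le> c k * \<bar>f k \<omega>\<bar>} \<in> events"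
    if "\<And>k. k \<le> r \<Longrightarrow> f k \<in> borel_measurable M" for f :: "nat \<Rightarrow> 'a \<Rightarrow> real"
  proof -
    have "{\<omega>\<in>space M. \<exists>k\<le>r. 1 \<le> c k * \<bar>f k \<omega>\<bar>} = (\<Union>k\<in>{..r}. {\<omega>\<in>space M. 1 \<le> c k * \<bar>f k \<omega>\<bar>})" by auto
    also have "\<dots> \<in> events"
    proof (intro sets.finite_UN)
      fix k assume "k \<in> {..r}"
      then have [measurable]: "f k \<in> borel_measurable M" using that by simp
      show "{\<omega>\<in>space M. 1 \<le> c k * \<bar>f k \<omega>\<bar>} \<in> events" by measurable
    qed simp
    finally show ?thesis .
  qed
  show "{\<omega>\<in>space M. \<exists>k\<le>r. 1 \<le> c k * \<bar>m (l + k) \<omega> - m l \<omega>\<bar>} \<in> events" if "r \<le> N - l" "l \<le> N"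
    by (rule ev) (intro borel_measurable_diff m_measurable; use that in auto)
  show "{\<omega>\<in>space M. \<exists>k\<le>r. 1 \<le> c k * \<bar>m l \<omega> - m (l - k) \<omega>\<bar>} \<in> events" if "r \<le> l" "l \<le> N"
    by (rule ev) (intro borel_measurable_diff m_measurable; use that in auto)
  show "prob {\<omega>\<in>space M. \<exists>k\<le>r. 1 \<le> c k * \<bar>m (l + k) \<omega> - m l \<omega>\<bar>} \<le> 2 * q * (\<Sum>i<r. (c (Suc i))\<^sup>2)"
    if "r \<le> N - l" "l \<le> N"
  proof -
    have "(\<lambda>i. l + i) ` {..<r} \<subseteq> {..<N}" using that by auto
    from hajek_renyi_walk[OF _ this, of c] show ?thesis using c unfolding m_forward by (auto simp: inj_on_def)
  qed
  show "prob {\<omega>\<in>space M. \<exists>k\<le>r. 1 \<le> c k * \<bar>m l \<omega> - m (l - k) \<omega>\<bar>} \<le> 2 * q * (\<Sum>i<r. (c (Suc i))\<^sup>2)"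
    if rl: "r \<le> l" "l \<le> N"
  proof -
    have "prob {\<omega>\<in>space M. \<exists>k\<le>r. 1 \<le> c k * \<bar>\<Sum>i<k. X (l - 1 - i) \<omega>\<bar>} \<le> 2 * q * (\<Sum>i<r. (c (Suc i))\<^sup>2)"
      by (rule hajek_renyi_walk) (use rl c in \<open>auto simp: inj_on_def\<close>)
    moreover have "{\<omega>\<in>space M. \<exists>k\<le>r. 1 \<le> c k * \<bar>\<Sum>i<k. X (l - 1 - i) \<omega>\<bar>} =
        {\<omega>\<in>space M. \<exists>k\<le>r. 1 \<le> c k * \<bar>m l \<omega> - m (l - k) \<omega>\<bar>}"
    proof (rule Collect_cong)
      fix \<omega>
      have "(\<Sum>i<k. X (l - 1 - i) \<omega>) = m l \<omega> - m (l - k) \<omega>" if "k \<le> r" for k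
        using that rl by (intro m_backward) simp
      then show "\<omega> \<in> space M \<and> (\<exists>k\<le>r. 1 \<le> c k * \<bar>\<Sum>i<k. X (l - 1 - i) \<omega>\<bar>) \<longleftrightarrow>
          \<omega> \<in> space M \<and> (\<exists>k\<le>r. 1 \<le> c k * \<bar>m l \<omega> - m (l - k) \<omega>\<bar>)"
        by (intro conj_cong refl ex_cong1) auto
    qed
    ultimately show ?thesis by simp
  qed
qed

text \<open>
  In terms of \<open>x = k / N\<close>: the normalised walk is at most \<open>\<epsilon> * \<delta> * sqrt x\<close> at distance \<open>x\<close> from either end of the
  sample.
\<close>

definition uniformly_small :: "real \<Rightarrow> 'a \<Rightarrow> bool" where
  "uniformly_small \<epsilon> \<omega> \<longleftrightarrow> (\<forall>k\<le>N. (m k \<omega>)\<^sup>2 \<le> \<epsilon>\<^sup>2 * \<delta>\<^sup>2 * (real N * real k) \<and>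
     (m N \<omega> - m (N - k) \<omega>)\<^sup>2 \<le> \<epsilon>\<^sup>2 * \<delta>\<^sup>2 * (real N * real k))"

text \<open>
  Weights proportional to \<open>1 / sqrt k\<close> turn the Hajek-Renyi sum into a harmonic sum, which is the source
  of the logarithm. The bound is needed from both ends of the sample, because the weight
  \<open>k * (N - k)\<close> in the contrast degenerates at both.
\<close>

lemma not_uniformly_small_prob:
  assumes \<epsilon>: "0 < \<epsilon>"
  shows "\<exists>E\<in>events. prob E \<le> 4 / \<epsilon>\<^sup>2 * ((1 + ln (real N)) / (real N * a)) \<and> (\<forall>\<omega>\<in>space M - E. uniformly_small \<epsilon> \<omega>)"
proof -
  define c where "c k = 1 / (\<epsilon> * \<delta> * sqrt (real N * real (max 1 k)))" for k
  have N0: "0 < real N" using N2 by simp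
  have cpos: "0 < \<epsilon> * \<delta> * sqrt (real N * real (max 1 k))" for k :: nat
    using \<epsilon> pos N0 by (intro mult_pos_pos real_sqrt_gt_zero) auto
  have c: "0 \<le> c i" "c (Suc i) \<le> c i" for i
  proof -
    show "0 \<le> c i" unfolding c_def using cpos[of i] by simp
    have "\<epsilon> * \<delta> * sqrt (real N * real (max 1 i)) \<le> \<epsilon> * \<delta> * sqrt (real N * real (max 1 (Suc i)))"
      using \<epsilon> pos by (intro mult_left_mono real_sqrt_le_mono) auto
    then show "c (Suc i) \<le> c i" unfolding c_def by (rule divide_left_mono[OF _ zero_le_one mult_pos_pos[OF cpos cpos]])
  qed
  have c2: "(c (Suc i))\<^sup>2 = 1 / (\<epsilon>\<^sup>2 * \<delta>\<^sup>2 * real N) * (1 / real (Suc i))" for i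
  proof -
    have "max 1 (Suc i) = Suc i" "(sqrt (real N * real (Suc i)))\<^sup>2 = real N * real (Suc i)" by simp_all
    then have "(c (Suc i))\<^sup>2 = 1 / (\<epsilon>\<^sup>2 * \<delta>\<^sup>2 * (real N * real (Suc i)))"
      unfolding c_def by (simp only: power_divide power_mult_distrib power_one)
    then show ?thesis by (simp only: times_divide_times_eq mult_1 mult.assoc)
  qed
  have "(\<Sum>i<N. (c (Suc i))\<^sup>2) = 1 / (\<epsilon>\<^sup>2 * \<delta>\<^sup>2 * real N) * (\<Sum>i<N. 1 / real (Suc i))"
    unfolding c2 by (simp add: sum_distrib_left del: of_nat_Suc)
  also have "\<dots> \<le> 1 / (\<epsilon>\<^sup>2 * \<delta>\<^sup>2 * real N) * (1 + ln (real N))"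
    using harmonic_le_ln[of "N - 1"] N2 by (intro mult_left_mono) auto
  finally have "2 * q * (\<Sum>i<N. (c (Suc i))\<^sup>2) \<le> 2 * q * (1 / (\<epsilon>\<^sup>2 * \<delta>\<^sup>2 * real N) * (1 + ln (real N)))"
    using pos by (intro mult_left_mono) auto
  also have "\<dots> = 2 / \<epsilon>\<^sup>2 * ((1 + ln (real N)) / (real N * a))"
    unfolding a_def using pos N0 \<epsilon> by (simp add: field_simps)
  finally have bd: "2 * q * (\<Sum>i<N. (c (Suc i))\<^sup>2) \<le> 2 / \<epsilon>\<^sup>2 * ((1 + ln (real N)) / (real N * a))" .
  define E1 where "E1 = {\<omega>\<in>space M. \<exists>k\<le>N. 1 \<le> c k * \<bar>m (0 + k) \<omega> - m 0 \<omega>\<bar>}"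
  define E2 where "E2 = {\<omega>\<in>space M. \<exists>k\<le>N. 1 \<le> c k * \<bar>m N \<omega> - m (N - k) \<omega>\<bar>}"
  have E: "E1 \<in> events" "E2 \<in> events"
    unfolding E1_def E2_def
    by (rule walk_exceedance(3)[of c, OF c(1) c(2)], simp, simp) (rule walk_exceedance(4)[of c, OF c(1) c(2)], simp, simp)
  have "prob E1 \<le> 2 * q * (\<Sum>i<N. (c (Suc i))\<^sup>2)"
    unfolding E1_def by (rule walk_exceedance(1)[of c, OF c(1) c(2)]) simp_all
  moreover have "prob E2 \<le> 2 * q * (\<Sum>i<N. (c (Suc i))\<^sup>2)"
    unfolding E2_def by (rule walk_exceedance(2)[of c, OF c(1) c(2)]) simp_all
  moreover have "prob (E1 \<union> E2) \<le> prob E1 + prob E2" using E by (intro measure_Un_le)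
  ultimately have prE: "prob (E1 \<union> E2) \<le> 2 * q * (\<Sum>i<N. (c (Suc i))\<^sup>2) + 2 * q * (\<Sum>i<N. (c (Suc i))\<^sup>2)"
    by linarith
  have pE: "prob (E1 \<union> E2) \<le> 4 / \<epsilon>\<^sup>2 * ((1 + ln (real N)) / (real N * a))"
  proof -
    let ?Y = "(1 + ln (real N)) / (real N * a)"
    have "4 / \<epsilon>\<^sup>2 * ?Y = 2 / \<epsilon>\<^sup>2 * ?Y + 2 / \<epsilon>\<^sup>2 * ?Y" by (simp only: distrib_right[symmetric] add_divide_distrib[symmetric]) simp
    then show ?thesis using bd prE by linarith
  qed
  have sq: "y\<^sup>2 \<le> \<epsilon>\<^sup>2 * \<delta>\<^sup>2 * (real N * real k)" if "\<not> 1 \<le> c k * \<bar>y\<bar>" "k = 0 \<Longrightarrow> y = 0" for k y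
  proof (cases "k = 0")
    case False
    then have mk: "max 1 k = k" by simp
    have "\<bar>y\<bar> < \<epsilon> * \<delta> * sqrt (real N * real k)"
      using that(1) cpos[of k] unfolding c_def mk by (simp add: divide_less_eq)
    then have "\<bar>y\<bar>\<^sup>2 \<le> (\<epsilon> * \<delta> * sqrt (real N * real k))\<^sup>2" by (intro power_mono) auto
    then show ?thesis by (simp add: power_mult_distrib)
  qed (use that in simp)
  have "uniformly_small \<epsilon> \<omega>" if w: "\<omega> \<in> space M - (E1 \<union> E2)" for \<omega>
    unfolding uniformly_small_def
  proof (intro allI impI conjI)
    fix k assume k: "k \<le> N"
    have m0: "m 0 \<omega> = 0" unfolding m_def by simp
    show "(m k \<omega>)\<^sup>2 \<le> \<epsilon>\<^sup>2 * \<delta>\<^sup>2 * (real N * real k)"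
      by (rule sq) (use w k m0 in \<open>auto simp: E1_def\<close>)
    show "(m N \<omega> - m (N - k) \<omega>)\<^sup>2 \<le> \<epsilon>\<^sup>2 * \<delta>\<^sup>2 * (real N * real k)"
      by (rule sq) (use w k in \<open>auto simp: E2_def\<close>)
  qed
  then show ?thesis using E pE by blast
qed

text \<open>
  A decreasing weight in the distance to the change index, applied to the walk on either side of it.
\<close>

lemma two_sided_exceedance:
  assumes c: "\<And>i. 0 \<le> c i" "\<And>i. c (Suc i) \<le> c i"
    and bd: "\<And>r'. r' \<le> r \<Longrightarrow> 2 * q * (\<Sum>i<r'. (c (Suc i))\<^sup>2) \<le> B"
  shows "\<exists>E\<in>events. prob E \<le> 2 * B \<and> (\<forall>\<omega>\<in>space M - E. \<forall>k\<le>N. \<bar>int k - int k0\<bar> \<le> int r \<longrightarrow>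
     c (nat \<bar>int k - int k0\<bar>) * \<bar>m k \<omega> - m k0 \<omega>\<bar> < 1)"
proof -
  let ?r1 = "min r (N - k0)" and ?r2 = "min r k0"
  define E1 where "E1 = {\<omega>\<in>space M. \<exists>k\<le>?r1. 1 \<le> c k * \<bar>m (k0 + k) \<omega> - m k0 \<omega>\<bar>}"
  define E2 where "E2 = {\<omega>\<in>space M. \<exists>k\<le>?r2. 1 \<le> c k * \<bar>m k0 \<omega> - m (k0 - k) \<omega>\<bar>}"
  have k0N: "k0 \<le> N" using k0_bounds by simp
  have E: "E1 \<in> events" "E2 \<in> events"
    unfolding E1_def E2_def
    by (rule walk_exceedance(3)[of c, OF c(1) c(2)], simp, rule k0N) (rule walk_exceedance(4)[of c, OF c(1) c(2)], simp, rule k0N)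
  have "prob E1 \<le> 2 * q * (\<Sum>i<?r1. (c (Suc i))\<^sup>2)"
    unfolding E1_def by (rule walk_exceedance(1)[of c, OF c(1) c(2)]) (simp_all add: k0N)
  moreover have "prob E2 \<le> 2 * q * (\<Sum>i<?r2. (c (Suc i))\<^sup>2)"
    unfolding E2_def by (rule walk_exceedance(2)[of c, OF c(1) c(2)]) (simp_all add: k0N)
  moreover have "prob (E1 \<union> E2) \<le> prob E1 + prob E2" using E by (intro measure_Un_le)
  ultimately have pE: "prob (E1 \<union> E2) \<le> 2 * B" using bd[of ?r1] bd[of ?r2] by simp
  have "c (nat \<bar>int k - int k0\<bar>) * \<bar>m k \<omega> - m k0 \<omega>\<bar> < 1"
    if w: "\<omega> \<in> space M - (E1 \<union> E2)" and k: "k \<le> N" "\<bar>int k - int k0\<bar> \<le> int r" for \<omega> k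
  proof (cases "k0 \<le> k")
    case True
    then have e: "nat \<bar>int k - int k0\<bar> = k - k0" "k0 + (k - k0) = k" "k - k0 \<le> ?r1" using k by auto
    have "\<not> 1 \<le> c (k - k0) * \<bar>m (k0 + (k - k0)) \<omega> - m k0 \<omega>\<bar>"
      using w e(3) unfolding E1_def by blast
    then show ?thesis unfolding e(1,2) by simp
  next
    case False
    then have e: "nat \<bar>int k - int k0\<bar> = k0 - k" "k0 - (k0 - k) = k" "k0 - k \<le> ?r2" using k by auto
    have "\<not> 1 \<le> c (k0 - k) * \<bar>m k0 \<omega> - m (k0 - (k0 - k)) \<omega>\<bar>"
      using w e(3) unfolding E2_def by blast
    then show ?thesis unfolding e(1,2) by (simp add: abs_minus_commute)
  qed
  then show ?thesis using E pE by blast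
qed

text \<open>
  Far from the change index the walk stays below a small multiple of the drift. The offset \<open>K / a\<close> is
  the window size in original time, and it makes the Hajek-Renyi sum of order \<open>1 / K\<close>.
\<close>

lemma tail_exceedance:
  assumes K: "0 < K"
  shows "\<exists>E\<in>events. prob E \<le> 4096 / K \<and> (\<forall>\<omega>\<in>space M - E. \<forall>k\<le>N.
     \<bar>m k \<omega> - m k0 \<omega>\<bar> < \<delta> / 32 * (\<bar>real k - real k0\<bar> + K / a))"
proof -
  let ?y = "K / a"
  have y: "0 < ?y" using K pos by simp
  define c where "c i = 32 / (\<delta> * (real i + ?y))" for i :: nat
  have d: "0 < \<delta> * (real i + ?y)" for i using pos y by (simp add: add_nonneg_pos)
  have c0: "0 \<le> c i" for i unfolding c_def using d[of i] by simp
  have c1: "c (Suc i) \<le> c i" for i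
    unfolding c_def using pos by (intro divide_left_mono[OF _ _ mult_pos_pos[OF d d]] mult_left_mono) auto
  \<comment> \<open>\<open>2 * q * 32^2 / (\<delta>^2 * (K / a)) = 2048 / K\<close>, once for each side\<close>
  have "2 * q * (\<Sum>i<r. (c (Suc i))\<^sup>2) \<le> 2048 / K" for r
  proof -
    have "(\<Sum>i<r. (c (Suc i))\<^sup>2) = 1024 / \<delta>\<^sup>2 * (\<Sum>i<r. 1 / (real (Suc i) * 1 + ?y)\<^sup>2)"
      unfolding c_def by (simp add: power_divide power_mult_distrib sum_distrib_left)
    also have "\<dots> \<le> 1024 / \<delta>\<^sup>2 * (1 / ?y)" by (intro mult_left_mono sum_inverse_square_le y) auto
    finally have "2 * q * (\<Sum>i<r. (c (Suc i))\<^sup>2) \<le> 2 * q * (1024 / \<delta>\<^sup>2 * (1 / ?y))"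
      using pos by (intro mult_left_mono) auto
    also have "\<dots> = 2048 / K" unfolding a_def using pos K by (simp add: field_simps)
    finally show ?thesis .
  qed
  from two_sided_exceedance[of c N "2048 / K", OF c0 c1 this] obtain E where E: "E \<in> events" "prob E \<le> 2 * (2048 / K)"
    and lt: "\<And>\<omega> k. \<omega> \<in> space M - E \<Longrightarrow> k \<le> N \<Longrightarrow> \<bar>int k - int k0\<bar> \<le> int N \<Longrightarrow>
     c (nat \<bar>int k - int k0\<bar>) * \<bar>m k \<omega> - m k0 \<omega>\<bar> < 1" by blast
  have "\<bar>m k \<omega> - m k0 \<omega>\<bar> < \<delta> / 32 * (\<bar>real k - real k0\<bar> + K / a)" if "\<omega> \<in> space M - E" "k \<le> N" for \<omega> k
  proof -
    have e: "real (nat \<bar>int k - int k0\<bar>) = \<bar>real k - real k0\<bar>" by simp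
    have "c (nat \<bar>int k - int k0\<bar>) * \<bar>m k \<omega> - m k0 \<omega>\<bar> < 1" using that k0_bounds by (intro lt) auto
    then show ?thesis unfolding c_def e using d[of "nat \<bar>int k - int k0\<bar>", unfolded e] by (simp add: divide_less_eq)
  qed
  then show ?thesis using E by auto
qed

text \<open>
  Constant weights, that is Kolmogorov's inequality: in the window the scaled walk has total variance
  of order \<open>K\<close>. The summand \<open>1\<close> in \<open>K + 1\<close> absorbs rounding the window to whole steps.
\<close>

lemma local_exceedance:
  assumes L: "0 < L" and K: "0 < K" and a1: "a \<le> 1"
  shows "\<exists>E\<in>events. prob E \<le> 4 * (K + 1) / L\<^sup>2 \<and> (\<forall>\<omega>\<in>space M - E. \<forall>k\<le>N. a * \<bar>real k - real k0\<bar> \<le> K \<longrightarrow>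
     s * \<bar>m k \<omega> - m k0 \<omega>\<bar> < L)"
proof -
  let ?r = "nat \<lceil>K / a\<rceil>"
  have "2 * q * (\<Sum>i<r'. (s / L)\<^sup>2) \<le> 2 * (K + 1) / L\<^sup>2" if "r' \<le> ?r" for r'
  proof -
    have Ka: "0 < K / a" using K pos by simp
    have "real r' \<le> K / a + 1" using that Ka by linarith
    then have "a * real r' \<le> a * (K / a + 1)" using pos by (intro mult_left_mono) auto
    also have "\<dots> \<le> K + 1" using pos a1 by (simp add: distrib_left)
    finally have "2 * (a * real r') / L\<^sup>2 \<le> 2 * (K + 1) / L\<^sup>2" by (intro divide_right_mono) auto
    moreover have "2 * q * (\<Sum>i<r'. (s / L)\<^sup>2) = (2 * q * s\<^sup>2) * real r' / L\<^sup>2" by (simp add: power_divide)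
    ultimately show ?thesis unfolding pos(6) by simp
  qed
  from two_sided_exceedance[of "\<lambda>_. s / L" ?r "2 * (K + 1) / L\<^sup>2", OF _ _ this] obtain E where E: "E \<in> events" "prob E \<le> 2 * (2 * (K + 1) / L\<^sup>2)"
    and lt: "\<And>\<omega> k. \<omega> \<in> space M - E \<Longrightarrow> k \<le> N \<Longrightarrow> \<bar>int k - int k0\<bar> \<le> int ?r \<Longrightarrow> s / L * \<bar>m k \<omega> - m k0 \<omega>\<bar> < 1"
    using pos L by auto
  have "s * \<bar>m k \<omega> - m k0 \<omega>\<bar> < L" if w: "\<omega> \<in> space M - E" "k \<le> N" "a * \<bar>real k - real k0\<bar> \<le> K" for \<omega> k
  proof -
    have "\<bar>real k - real k0\<bar> \<le> K / a" using w(3) pos by (simp add: pos_le_divide_eq mult.commute)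
    then have "\<bar>int k - int k0\<bar> \<le> int ?r" by linarith
    from lt[OF w(1,2) this] show ?thesis using L by (simp add: divide_less_eq)
  qed
  then show ?thesis using E by auto
qed

text \<open>
  The scaled steps have variance at most \<open>2 * a\<close> and are bounded by \<open>s\<close>, so a cell of length \<open>h\<close> in the
  rescaled time has total variance at most \<open>2 * h\<close>.
\<close>

lemma cell_oscillation:
  assumes \<eta>: "0 < \<eta>" and lr: "l + r \<le> N" and r: "a * real r \<le> h"
  shows "\<exists>E\<in>events. prob E \<le> (16 * h\<^sup>2 + 6 * s\<^sup>2 * h) / \<eta>^4 \<and> (\<forall>\<omega>\<in>space M - E. \<forall>k\<le>r. s * \<bar>m (l + k) \<omega> - m l \<omega>\<bar> < \<eta>)"
proof -
  let ?E = "{\<omega>\<in>space M. \<exists>k\<le>r. \<eta> \<le> \<bar>\<Sum>i<k. s * X (l + i) \<omega>\<bar>}"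
  have sum: "(\<Sum>i<k. s * X (l + i) \<omega>) = s * (m (l + k) \<omega> - m l \<omega>)" for k \<omega>
    unfolding m_forward[symmetric] by (simp add: sum_distrib_left)
  have lt: "l + i < N" if "i < r" for i using that lr by simp
  have "?E = (\<Union>k\<in>{..r}. {\<omega>\<in>space M. \<eta> \<le> \<bar>s * (m (l + k) \<omega> - m l \<omega>)\<bar>})" unfolding sum by auto
  also have "\<dots> \<in> events"
  proof (intro sets.finite_UN)
    fix k assume k: "k \<in> {..r}"
    have [measurable]: "m (l + k) \<in> borel_measurable M" "m l \<in> borel_measurable M"
      using k lr by (auto intro!: m_measurable)
    show "{\<omega>\<in>space M. \<eta> \<le> \<bar>s * (m (l + k) \<omega> - m l \<omega>)\<bar>} \<in> events" by measurable
  qed simp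
  finally have Em: "?E \<in> events" .
  have "prob ?E \<le> (4 * (real r * (2 * a))\<^sup>2 + 3 * s\<^sup>2 * (real r * (2 * a))) / \<eta>^4"
  proof (rule fourth_moment_maximal_inequality)
    have "indep_vars (\<lambda>_. borel) (\<lambda>i. X (l + i)) {..<r}"
      by (rule X_reindexed) (use lr in \<open>auto simp: inj_on_def\<close>)
    from indep_vars_compose2[OF this, of "\<lambda>_ x. s * x" "\<lambda>_. borel"]
    show "indep_vars (\<lambda>_. borel) (\<lambda>i \<omega>. s * X (l + i) \<omega>) {..<r}" by simp
    show "expectation (\<lambda>\<omega>. (s * X (l + i) \<omega>)\<^sup>2) \<le> 2 * a" if "i < r" for i
    proof -
      have "s\<^sup>2 * expectation (\<lambda>\<omega>. (X (l + i) \<omega>)\<^sup>2) \<le> s\<^sup>2 * (2 * q)"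
        using X_var_le[OF lt[OF that]] by (intro mult_left_mono) auto
      also have "\<dots> = 2 * a" using pos(6) by (simp add: mult_ac)
      finally show ?thesis by (simp add: power_mult_distrib)
    qed
    show "\<bar>s * X (l + i) \<omega>\<bar> \<le> s" for i \<omega>
      using mult_left_mono[OF X_bound[of "l + i" \<omega>], of s] pos by (simp add: abs_mult)
  qed (use X_integrable X_mean lt pos \<eta> in \<open>auto simp: power_mult_distrib\<close>)
  also have "\<dots> \<le> (16 * h\<^sup>2 + 6 * s\<^sup>2 * h) / \<eta>^4"
  proof (rule divide_right_mono)
    have ra: "0 \<le> a * real r" using pos by simp
    have "(a * real r)\<^sup>2 \<le> h\<^sup>2" using r ra by (intro power_mono)
    moreover have "s\<^sup>2 * (a * real r) \<le> s\<^sup>2 * h" using r by (intro mult_left_mono) auto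
    ultimately show "4 * (real r * (2 * a))\<^sup>2 + 3 * s\<^sup>2 * (real r * (2 * a)) \<le> 16 * h\<^sup>2 + 6 * s\<^sup>2 * h"
      by (simp add: power_mult_distrib mult_ac)
  qed simp
  finally have "prob ?E \<le> (16 * h\<^sup>2 + 6 * s\<^sup>2 * h) / \<eta>^4" .
  moreover have "s * \<bar>m (l + k) \<omega> - m l \<omega>\<bar> < \<eta>" if "\<omega> \<in> space M - ?E" "k \<le> r" for \<omega> k
    using that pos unfolding sum by (auto simp: abs_mult not_le dest: spec[of _ k])
  ultimately show ?thesis using Em by blast
qed

end

section \<open>The contrast as a random walk with drift\<close>

context change_sample begin

definition Q where "Q k \<omega> = contrast N (\<lambda>i. J i \<omega>) k"

definition \<rho> where "\<rho> k \<omega> = (real k / real N * m N \<omega> - m k \<omega>) / real N"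

text \<open>
  The mean of the cusum is a tent function with its peak at the change index; the rest is the
  noise \<open>\<rho>\<close>. Both are divided by \<open>N\<close>, and the sign is reversed, which squaring ignores.
\<close>

lemma Q_eq:
  assumes k: "1 \<le> k" "k \<le> N - 1"
  defines "x \<equiv> real k / real N" and "t \<equiv> real k0 / real N"
  shows "Q k \<omega> = (\<delta> * min (x * (1 - t)) (t * (1 - x)) + \<rho> k \<omega>)\<^sup>2 / (x * (1 - x))"
proof -
  have N0: "0 < real N" using N2 by simp
  \<comment> \<open>the mean of the first \<open>l\<close> indicators\<close>
  define P where "P l = real l * p1 + (if l \<le> k0 then 0 else real l - real k0) * \<delta>" for l
  have P: "(\<Sum>i<l. if i < k0 then p1 else p2) = P l" for l
  proof (induction l)
    case (Suc l)
    have "P (Suc l) = P l + (if l < k0 then p1 else p2)"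
      by (cases "l < k0"; cases "l = k0") (auto simp: P_def \<delta>_def algebra_simps)
    then show ?case using Suc by (simp only: sum.lessThan_Suc)
  qed (simp add: P_def)
  have S: "(\<Sum>i<l. J i \<omega>) = m l \<omega> + P l" for l
  proof -
    have "(\<Sum>i<l. J i \<omega>) = (\<Sum>i<l. X i \<omega> + (if i < k0 then p1 else p2))" by (simp only: X_def diff_add_cancel)
    also have "\<dots> = m l \<omega> + P l" by (simp only: sum.distrib m_def P)
    finally show ?thesis .
  qed
  have xN: "real k = real N * x" "real k0 = real N * t" unfolding x_def t_def using N0 by simp_all
  have kN: "x < 1" "0 < x" unfolding x_def using k N0 by (auto simp: divide_less_eq)
  have "P k - x * P N = - real N * (\<delta> * min (x * (1 - t)) (t * (1 - x)))"
  proof (cases "k \<le> k0")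
    case True
    then have "x \<le> t" unfolding x_def t_def using N0 by (intro divide_right_mono) auto
    then have "x * (1 - t) \<le> t * (1 - x)" by (simp add: algebra_simps)
    then have mn: "min (x * (1 - t)) (t * (1 - x)) = x * (1 - t)" by simp
    have PP: "P k = real N * x * p1" "P N = real N * p1 + (real N - real N * t) * \<delta>"
      unfolding P_def using True k0_bounds xN by simp_all
    show ?thesis unfolding mn PP by (simp add: algebra_simps)
  next
    case False
    then have "t \<le> x" unfolding x_def t_def using N0 by (intro divide_right_mono) auto
    then have "t * (1 - x) \<le> x * (1 - t)" by (simp add: algebra_simps)
    then have mn: "min (x * (1 - t)) (t * (1 - x)) = t * (1 - x)" by simp
    have PP: "P k = real N * x * p1 + (real N * x - real N * t) * \<delta>" "P N = real N * p1 + (real N - real N * t) * \<delta>"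
      unfolding P_def using False k0_bounds xN by simp_all
    show ?thesis unfolding mn PP by (simp add: algebra_simps)
  qed
  note PkN = this
  have "cusum N (\<lambda>i. J i \<omega>) k = - real N * (\<delta> * min (x * (1 - t)) (t * (1 - x)) + \<rho> k \<omega>)"
  proof -
    have "real N * \<rho> k \<omega> = x * m N \<omega> - m k \<omega>" unfolding \<rho>_def x_def[symmetric] using N0 by simp
    moreover have "cusum N (\<lambda>i. J i \<omega>) k = (m k \<omega> - x * m N \<omega>) + (P k - x * P N)"
      unfolding cusum_def S x_def[symmetric] by (simp add: algebra_simps)
    ultimately show ?thesis unfolding PkN by (simp add: distrib_left)
  qed
  then have "Q k \<omega> = (real N)\<^sup>2 * (\<delta> * min (x * (1 - t)) (t * (1 - x)) + \<rho> k \<omega>)\<^sup>2 / (real N * x * (real N - real N * x))"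
    unfolding Q_def contrast_def by (simp add: power_mult_distrib flip: xN)
  also have "real N * x * (real N - real N * x) = (real N)\<^sup>2 * (x * (1 - x))"
    by (simp add: power2_eq_square algebra_simps)
  also have "(real N)\<^sup>2 * (\<delta> * min (x * (1 - t)) (t * (1 - x)) + \<rho> k \<omega>)\<^sup>2 / ((real N)\<^sup>2 * (x * (1 - x))) =
      (\<delta> * min (x * (1 - t)) (t * (1 - x)) + \<rho> k \<omega>)\<^sup>2 / (x * (1 - x))"
    using N0 by (intro mult_divide_mult_cancel_left) simp
  finally show ?thesis .
qed

text \<open>
  Up to signs the noise is a convex combination of the walk read from the left end and from the right end, so it
  inherits the degeneracy of the weight \<open>x * (1 - x)\<close> at both ends.
\<close>

lemma \<rho>_small:
  assumes small: "uniformly_small \<epsilon> \<omega>" and k: "k \<le> N"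
  shows "(\<rho> k \<omega>)\<^sup>2 \<le> 4 * \<epsilon>\<^sup>2 * \<delta>\<^sup>2 * (real k / real N * (1 - real k / real N))"
proof -
  have N0: "0 < real N" using N2 by simp
  define x where "x = real k / real N"
  have x: "0 \<le> x" "x \<le> 1" "real k = real N * x" unfolding x_def using k N0 by auto
  \<comment> \<open>the walk seen from the right and from the left end\<close>
  define A B where "A = m N \<omega> - m k \<omega>" and "B = m k \<omega>"
  define e where "e = \<epsilon>\<^sup>2 * \<delta>\<^sup>2"
  have e0: "0 \<le> e" unfolding e_def by simp
  have "A\<^sup>2 \<le> e * (real N * real (N - k))" "B\<^sup>2 \<le> e * (real N * real k)"
    using small k unfolding uniformly_small_def A_def B_def e_def by (metis diff_diff_cancel diff_le_self)+
  then have AB: "A\<^sup>2 \<le> e * (real N)\<^sup>2 * (1 - x)" "B\<^sup>2 \<le> e * (real N)\<^sup>2 * x"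
    using x k by (simp_all add: of_nat_diff power2_eq_square algebra_simps)
  have "(real N * \<rho> k \<omega>)\<^sup>2 = (x * A - (1 - x) * B)\<^sup>2"
  proof -
    have "real N * \<rho> k \<omega> = x * m N \<omega> - m k \<omega>" unfolding \<rho>_def x_def[symmetric] using N0 by simp
    also have "\<dots> = x * A - (1 - x) * B" unfolding A_def B_def by (simp add: algebra_simps)
    finally show ?thesis by simp
  qed
  also have "\<dots> \<le> 2 * (x\<^sup>2 * A\<^sup>2) + 2 * ((1 - x)\<^sup>2 * B\<^sup>2)"
  proof -
    have "0 \<le> (x * A + (1 - x) * B)\<^sup>2" by simp
    moreover have "(x * A - (1 - x) * B)\<^sup>2 + (x * A + (1 - x) * B)\<^sup>2 = 2 * (x\<^sup>2 * A\<^sup>2) + 2 * ((1 - x)\<^sup>2 * B\<^sup>2)" by algebra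
    ultimately show ?thesis by linarith
  qed
  also have "\<dots> \<le> 2 * (x\<^sup>2 * (e * (real N)\<^sup>2 * (1 - x))) + 2 * ((1 - x)\<^sup>2 * (e * (real N)\<^sup>2 * x))"
    using AB by (intro add_mono mult_left_mono) auto
  also have "\<dots> = (real N)\<^sup>2 * (2 * e * (x * (1 - x)))" by algebra
  finally have "(real N)\<^sup>2 * (\<rho> k \<omega>)\<^sup>2 \<le> (real N)\<^sup>2 * (2 * e * (x * (1 - x)))" by (simp add: power_mult_distrib)
  then have "(\<rho> k \<omega>)\<^sup>2 \<le> 2 * e * (x * (1 - x))" using N0 by simp
  also have "\<dots> \<le> 4 * e * (x * (1 - x))" using e0 x by (intro mult_right_mono) auto
  finally show ?thesis unfolding e_def x_def by (simp add: mult_ac)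
qed

text \<open>
  The perturbation estimate in terms of the walk: \<open>N * (\<rho> k - \<rho> k0)\<close> is \<open>- (m k - m k0)\<close> up to a term in
  \<open>m N\<close> that is small because the distance is measured relative to \<open>N\<close>.
\<close>

lemma contrast_change_bounds:
  assumes small: "uniformly_small \<epsilon> \<omega>" and \<epsilon>: "0 < \<epsilon>" "\<epsilon> \<le> 1" and k: "1 \<le> k" "k \<le> N - 1"
  defines "j \<equiv> \<bar>real k - real k0\<bar>"
  shows "Q k \<omega> - Q k0 \<omega> \<le> - \<delta>\<^sup>2 * b * (j / real N) + 8 * \<epsilon> * \<delta>\<^sup>2"
    and "\<bar>real N / (2 * \<delta>) * (Q k \<omega> - Q k0 \<omega>) - (- \<delta> * j / 2 - (m k \<omega> - m k0 \<omega>))\<bar>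
      \<le> 8 / b * (\<epsilon> + j / real N) * (\<delta> * j) + 2 * \<epsilon> / b * \<bar>m k \<omega> - m k0 \<omega>\<bar>"
proof -
  have N0: "0 < real N" using N2 by simp
  define x t where "x = real k / real N" and "t = real k0 / real N"
  have x: "0 < x" "x < 1" unfolding x_def using k N0 by (auto simp: divide_less_eq)
  have t: "b \<le> t" "t \<le> 1 - b" unfolding t_def using k0 N0 by (auto simp: pos_le_divide_eq pos_divide_le_eq)
  have k0': "1 \<le> k0" "k0 \<le> N - 1" using k0_bounds by auto
  have kN: "k \<le> N" "k0 \<le> N" using k k0_bounds by auto
  have minT: "min (t * (1 - t)) (t * (1 - t)) = t * (1 - t)" by simp
  note Qk = Q_eq[OF k, of \<omega>, folded x_def t_def]
  note Qk0 = Q_eq[OF k0', of \<omega>, folded t_def, unfolded minT]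
  have jd: "\<bar>x - t\<bar> = j / real N" unfolding x_def t_def j_def using N0 by (simp only: diff_divide_distrib[symmetric] abs_divide abs_of_nat)
  note P = contrast_perturbation[OF x t b pos(1) \<epsilon> \<rho>_small[OF small kN(1), folded x_def] \<rho>_small[OF small kN(2), folded t_def],
      folded Qk Qk0, unfolded jd]
  show "Q k \<omega> - Q k0 \<omega> \<le> - \<delta>\<^sup>2 * b * (j / real N) + 8 * \<epsilon> * \<delta>\<^sup>2" by (rule P(1))
  define D R where "D = m k \<omega> - m k0 \<omega>" and "R = \<rho> k \<omega> - \<rho> k0 \<omega>"
  have j0: "0 \<le> j" unfolding j_def by simp
  have R: "real N * R = (x - t) * m N \<omega> - D"
    unfolding R_def \<rho>_def D_def x_def t_def using N0 by (simp add: field_simps)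
  have mN: "\<bar>m N \<omega>\<bar> \<le> \<epsilon> * \<delta> * real N"
  proof -
    have "(m N \<omega>)\<^sup>2 \<le> \<epsilon>\<^sup>2 * \<delta>\<^sup>2 * (real N * real N)" using small unfolding uniformly_small_def by blast
    then have "(m N \<omega>)\<^sup>2 \<le> (\<epsilon> * \<delta> * real N)\<^sup>2" by (simp add: power_mult_distrib power2_eq_square mult_ac)
    moreover have "0 \<le> \<epsilon> * \<delta> * real N" using \<epsilon> pos by simp
    ultimately show ?thesis by (metis abs_le_square_iff abs_of_nonneg)
  qed
  have xm: "\<bar>(x - t) * m N \<omega>\<bar> \<le> \<epsilon> * (\<delta> * j)"
  proof -
    have "\<bar>(x - t) * m N \<omega>\<bar> \<le> (j / real N) * (\<epsilon> * \<delta> * real N)"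
      unfolding abs_mult jd using mN j0 by (intro mult_left_mono) auto
    then show ?thesis using N0 by (simp add: mult_ac)
  qed
  have NR: "real N * \<bar>R\<bar> \<le> \<epsilon> * (\<delta> * j) + \<bar>D\<bar>"
  proof -
    have "real N * \<bar>R\<bar> = \<bar>(x - t) * m N \<omega> - D\<bar>" using N0 unfolding R[symmetric] by (simp add: abs_mult)
    then show ?thesis using xm by linarith
  qed
  let ?c = "real N / (2 * \<delta>)"
  have c0: "0 \<le> ?c" using pos by simp
  have cm: "\<bar>?c * y\<bar> \<le> ?c * z" if "\<bar>y\<bar> \<le> z" for y z
    using mult_left_mono[OF that c0] unfolding abs_mult abs_of_nonneg[OF c0] .
  have "\<bar>?c * ((Q k \<omega> - Q k0 \<omega>) - (- \<delta>\<^sup>2 * (j / real N) + 2 * \<delta> * R))\<bar> \<le>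
    ?c * (\<delta>\<^sup>2 * (j / real N)\<^sup>2 / b + 10 * \<epsilon> * \<delta>\<^sup>2 * (j / real N) / b + 4 * \<epsilon> * \<delta> * \<bar>R\<bar> / b)"
    unfolding R_def by (rule cm[OF P(2)])
  also have "\<dots> = (j / real N) * (\<delta> * j) / (2 * b) + 5 * \<epsilon> * (\<delta> * j) / b + 2 * \<epsilon> / b * (real N * \<bar>R\<bar>)"
    using N0 pos b by (simp add: field_simps power2_eq_square)
  also have "\<dots> \<le> (j / real N) * (\<delta> * j) / (2 * b) + 5 * \<epsilon> * (\<delta> * j) / b + 2 * \<epsilon> / b * (\<epsilon> * (\<delta> * j) + \<bar>D\<bar>)"
    using NR \<epsilon> b by (intro add_mono mult_left_mono) auto
  also have "?c * ((Q k \<omega> - Q k0 \<omega>) - (- \<delta>\<^sup>2 * (j / real N) + 2 * \<delta> * R)) =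
      ?c * (Q k \<omega> - Q k0 \<omega>) - (- \<delta> * j / 2 - D) - (x - t) * m N \<omega>"
  proof -
    have "?c * (- \<delta>\<^sup>2 * (j / real N) + 2 * \<delta> * R) = - \<delta> * j / 2 + real N * R"
      using N0 pos by (simp add: field_simps power2_eq_square)
    then show ?thesis unfolding R by (simp add: right_diff_distrib)
  qed
  finally have main: "\<bar>?c * (Q k \<omega> - Q k0 \<omega>) - (- \<delta> * j / 2 - D) - (x - t) * m N \<omega>\<bar> \<le>
    (j / real N) * (\<delta> * j) / (2 * b) + 5 * \<epsilon> * (\<delta> * j) / b + 2 * \<epsilon> / b * (\<epsilon> * (\<delta> * j) + \<bar>D\<bar>)" .
  define y where "y = \<delta> * j"
  have y0: "0 \<le> y" unfolding y_def using pos j0 by simp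
  define A B C E where "A = \<epsilon> * y / b" and "B = j / real N * y / b"
    and "C = \<epsilon> * (\<epsilon> * y) / b" and "E = 2 * \<epsilon> / b * \<bar>D\<bar>"
  have eA: "\<epsilon> * y \<le> A" unfolding A_def using \<epsilon> b y0 by (simp add: pos_le_divide_eq mult_left_le)
  have CA: "C \<le> A"
  proof -
    have "\<epsilon> * (\<epsilon> * y) \<le> 1 * (\<epsilon> * y)" using \<epsilon> y0 by (intro mult_right_mono) auto
    then show ?thesis unfolding A_def C_def using b by (intro divide_right_mono) auto
  qed
  have B0: "0 \<le> B" unfolding B_def using j0 y0 b by simp
  have e1: "j / real N * y / (2 * b) = B / 2" unfolding B_def by simp
  have e2: "8 / b * (\<epsilon> + j / real N) * y = 8 * A + 8 * B"
    unfolding A_def B_def by (simp add: distrib_left distrib_right add_divide_distrib mult_ac)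
  have e3: "2 * \<epsilon> / b * (\<epsilon> * y + \<bar>D\<bar>) = 2 * C + E"
    unfolding C_def E_def by (simp add: distrib_left)
  have e4: "5 * \<epsilon> * y / b = 5 * A" unfolding A_def by simp
  have fin: "\<bar>V\<bar> \<le> 8 * A + 8 * B + E" if "\<bar>V - T\<bar> \<le> B / 2 + 5 * A + (2 * C + E)" "\<bar>T\<bar> \<le> \<epsilon> * y" for V T
    using that eA CA B0 by linarith
  show "\<bar>?c * (Q k \<omega> - Q k0 \<omega>) - (- \<delta> * j / 2 - (m k \<omega> - m k0 \<omega>))\<bar>
      \<le> 8 / b * (\<epsilon> + j / real N) * (\<delta> * j) + 2 * \<epsilon> / b * \<bar>m k \<omega> - m k0 \<omega>\<bar>"
    using fin[OF main[folded y_def, unfolded e1 e3 e4] xm[folded y_def]]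
    unfolding D_def[symmetric] y_def[symmetric] e2 E_def[symmetric] .
qed

text \<open>
  At a distance of order \<open>N\<close> the crude bound suffices. Closer in, the linearised drift \<open>- \<delta> * j / 2\<close>
  beats the walk, which is at most \<open>\<delta> * j / 16\<close>, and the errors, which are at most \<open>1 / 4 + 1 / 16\<close>
  of \<open>\<delta> * j\<close>. The constant \<open>512\<close> makes the latter true: with \<open>j / N \<le> 8 * \<epsilon> / b\<close> the coefficient is
  at most \<open>8 * b / 512 + 64 / 512 \<le> 1 / 4\<close>.
\<close>

lemma contrast_less_far_from_change:
  assumes small: "uniformly_small \<epsilon> \<omega>" and \<epsilon>: "0 < \<epsilon>" "\<epsilon> \<le> b\<^sup>2 / 512"
    and tail: "\<And>k. k \<le> N \<Longrightarrow> \<bar>m k \<omega> - m k0 \<omega>\<bar> < \<delta> / 32 * (\<bar>real k - real k0\<bar> + K / a)"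
    and k: "1 \<le> k" "k \<le> N - 1" and far: "K / a \<le> \<bar>real k - real k0\<bar>" and K: "0 < K"
  shows "Q k \<omega> < Q k0 \<omega>"
proof -
  have N0: "0 < real N" using N2 by simp
  define j where "j = \<bar>real k - real k0\<bar>"
  have "0 < K / a" using K pos by simp
  then have j: "0 < j" using far unfolding j_def by linarith
  have b2: "b\<^sup>2 \<le> b" "b\<^sup>2 \<le> 1" using b by (simp_all add: power2_eq_square mult_left_le mult_le_one)
  then have \<epsilon>1: "\<epsilon> \<le> 1" using \<epsilon> by linarith
  note bd = contrast_change_bounds[OF small \<epsilon>(1) \<epsilon>1 k, folded j_def]
  show ?thesis
  proof (cases "8 * \<epsilon> < b * (j / real N)")
    case True
    have "\<delta>\<^sup>2 * (8 * \<epsilon>) < \<delta>\<^sup>2 * (b * (j / real N))" using True pos by (intro mult_strict_left_mono) auto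
    then show ?thesis using bd(1) by (simp add: mult_ac)
  next
    case False
    have jN: "j / real N \<le> 8 * \<epsilon> / b" using False b by (simp add: pos_le_divide_eq mult.commute not_less)
    have y: "0 < \<delta> * j" using j pos by simp
    have D: "\<bar>m k \<omega> - m k0 \<omega>\<bar> \<le> \<delta> * j / 16"
    proof -
      have "\<delta> / 32 * (j + K / a) \<le> \<delta> / 32 * (j + j)" using far pos unfolding j_def by (intro mult_left_mono) auto
      moreover have "k \<le> N" using k by simp
      moreover have "\<delta> / 32 * (j + j) = \<delta> * j / 16" by simp
      ultimately show ?thesis using tail[of k, folded j_def] by linarith
    qed
    have e1: "8 / b * (\<epsilon> + j / real N) \<le> 1 / 4"
    proof -
      have eb: "\<epsilon> / b \<le> b / 512" "\<epsilon> / b / b \<le> 1 / 512" using \<epsilon> b by (simp_all add: divide_simps power2_eq_square mult_ac)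
      have "8 / b * (\<epsilon> + j / real N) \<le> 8 / b * (\<epsilon> + 8 * \<epsilon> / b)" using jN b by (intro mult_left_mono) auto
      also have "\<dots> = 8 * (\<epsilon> / b) + 64 * (\<epsilon> / b / b)" using b by (simp add: field_simps)
      also have "\<dots> \<le> 1 / 4" using eb b by linarith
      finally show ?thesis .
    qed
    have "2 * \<epsilon> / b * \<bar>m k \<omega> - m k0 \<omega>\<bar> \<le> 1 * (\<delta> * j / 16)"
    proof (rule mult_mono[OF _ D])
      have "2 * \<epsilon> \<le> b" using \<epsilon> b2 by linarith
      then show "2 * \<epsilon> / b \<le> 1" using b by (simp add: pos_divide_le_eq)
    qed (use y in auto)
    moreover have "8 / b * (\<epsilon> + j / real N) * (\<delta> * j) \<le> 1 / 4 * (\<delta> * j)" using e1 y by (intro mult_right_mono) auto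
    ultimately have "real N / (2 * \<delta>) * (Q k \<omega> - Q k0 \<omega>) < 0" using bd(2) D y by linarith
    then show ?thesis using N0 pos by (simp add: mult_less_0_iff zero_less_divide_iff divide_less_0_iff)
  qed
qed

text \<open>
  In the window the rescaled contrast and the walk with drift differ by at most half of the last
  summand, so comparing contrasts compares walks up to twice that error.
\<close>

lemma maximiser_near_walk_maximiser:
  assumes small: "uniformly_small \<epsilon> \<omega>" and \<epsilon>: "0 < \<epsilon>" "\<epsilon> \<le> 1"
    and loc: "\<And>k. k \<le> N \<Longrightarrow> a * \<bar>real k - real k0\<bar> \<le> K \<Longrightarrow> s * \<bar>m k \<omega> - m k0 \<omega>\<bar> < L"
    and K: "0 \<le> K"
    and k: "1 \<le> k" "k \<le> N - 1" "a * \<bar>real k - real k0\<bar> \<le> K"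
    and k': "1 \<le> k'" "k' \<le> N - 1" "a * \<bar>real k' - real k0\<bar> \<le> K" and le: "Q k' \<omega> \<le> Q k \<omega>"
  shows "- s * (m k' \<omega> - m k0 \<omega>) - a * \<bar>real k' - real k0\<bar> / 2 \<le>
     - s * (m k \<omega> - m k0 \<omega>) - a * \<bar>real k - real k0\<bar> / 2 + 2 * (8 / b * (\<epsilon> + K / (a * real N)) * K + 2 * \<epsilon> / b * L)"
proof -
  have N0: "0 < real N" using N2 by simp
  let ?\<theta> = "8 / b * (\<epsilon> + K / (a * real N)) * K + 2 * \<epsilon> / b * L"
  have key: "\<bar>real N * s / (2 * \<delta>) * (Q l \<omega> - Q k0 \<omega>) - (- s * (m l \<omega> - m k0 \<omega>) - a * \<bar>real l - real k0\<bar> / 2)\<bar> \<le> ?\<theta>"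
    if l: "1 \<le> l" "l \<le> N - 1" "a * \<bar>real l - real k0\<bar> \<le> K" for l
  proof -
    let ?j = "\<bar>real l - real k0\<bar>"
    have "s * \<bar>real N / (2 * \<delta>) * (Q l \<omega> - Q k0 \<omega>) - (- \<delta> * ?j / 2 - (m l \<omega> - m k0 \<omega>))\<bar>
      \<le> s * (8 / b * (\<epsilon> + ?j / real N) * (\<delta> * ?j) + 2 * \<epsilon> / b * \<bar>m l \<omega> - m k0 \<omega>\<bar>)"
      using contrast_change_bounds(2)[OF small \<epsilon> l(1,2)] pos by (intro mult_left_mono) auto
    also have "\<dots> = 8 / b * (\<epsilon> + ?j / real N) * (a * ?j) + 2 * \<epsilon> / b * (s * \<bar>m l \<omega> - m k0 \<omega>\<bar>)"
      unfolding pos(5)[symmetric] by (simp add: algebra_simps)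
    also have "\<dots> \<le> ?\<theta>"
    proof (rule add_mono)
      have "?j \<le> K / a" using l(3) pos by (simp add: pos_le_divide_eq mult.commute)
      then have "?j / real N \<le> K / a / real N" using N0 by (intro divide_right_mono) auto
      then have 1: "8 / b * (\<epsilon> + ?j / real N) \<le> 8 / b * (\<epsilon> + K / (a * real N))"
        using b by (intro mult_left_mono) auto
      have 2: "0 \<le> 8 / b * (\<epsilon> + K / (a * real N))" using b \<epsilon> K pos by simp
      show "8 / b * (\<epsilon> + ?j / real N) * (a * ?j) \<le> 8 / b * (\<epsilon> + K / (a * real N)) * K"
        by (rule mult_mono[OF 1 l(3) 2]) (use pos in simp)
      show "2 * \<epsilon> / b * (s * \<bar>m l \<omega> - m k0 \<omega>\<bar>) \<le> 2 * \<epsilon> / b * L"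
      proof (rule mult_left_mono)
        have "l \<le> N" using l by simp
        then show "s * \<bar>m l \<omega> - m k0 \<omega>\<bar> \<le> L" using loc[of l] l(3) by simp
      qed (use \<epsilon> b in simp)
    qed
    also have "s * \<bar>real N / (2 * \<delta>) * (Q l \<omega> - Q k0 \<omega>) - (- \<delta> * ?j / 2 - (m l \<omega> - m k0 \<omega>))\<bar> =
      \<bar>s * (real N / (2 * \<delta>) * (Q l \<omega> - Q k0 \<omega>) - (- \<delta> * ?j / 2 - (m l \<omega> - m k0 \<omega>)))\<bar>"
      using pos by (simp add: abs_mult)
    also have "s * (real N / (2 * \<delta>) * (Q l \<omega> - Q k0 \<omega>) - (- \<delta> * ?j / 2 - (m l \<omega> - m k0 \<omega>))) =
       real N * s / (2 * \<delta>) * (Q l \<omega> - Q k0 \<omega>) - (- s * (m l \<omega> - m k0 \<omega>) - a * ?j / 2)"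
      unfolding pos(5)[symmetric] by (simp add: algebra_simps diff_divide_distrib)
    finally show ?thesis .
  qed
  have "real N * s / (2 * \<delta>) * (Q k' \<omega> - Q k0 \<omega>) \<le> real N * s / (2 * \<delta>) * (Q k \<omega> - Q k0 \<omega>)"
    using le pos by (intro mult_left_mono) auto
  moreover have "B' \<le> B + 2 * \<theta>" if "A' \<le> A" "\<bar>A - B\<bar> \<le> \<theta>" "\<bar>A' - B'\<bar> \<le> \<theta>" for A A' B B' \<theta> :: real
    using that by linarith
  ultimately show ?thesis using key[OF k] key[OF k'] by blast
qed

end

section \<open>Grid functions and block increments\<close>

text \<open>
  The function on the integer grid that vanishes at \<open>0\<close> and has the increments \<open>u\<close>.
\<close>

definition grid_pos :: "(int \<Rightarrow> real) \<Rightarrow> int \<Rightarrow> real" where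
  "grid_pos u i = (if 0 \<le> i then \<Sum>l\<in>{0..<i}. u l else - (\<Sum>l\<in>{i..<0}. u l))"

text \<open>
  The counterpart of \<open>grid_near_argmax\<close> for an arbitrary sequence of increments, so that the
  random walk and Brownian motion can be tested against the same set.
\<close>

definition grid_set :: "real set \<Rightarrow> nat \<Rightarrow> nat \<Rightarrow> real \<Rightarrow> (int \<Rightarrow> real) set" where
  "grid_set S K r \<eta> = {u. \<exists>i\<in>{- int (K * Suc r)..int (K * Suc r)}.
     (\<exists>s\<in>S. \<bar>of_int i / real (Suc r) - s\<bar> \<le> 1 / real (Suc r)) \<and>
     (\<forall>j\<in>{- int (K * Suc r)..int (K * Suc r)}.
        grid_pos u j - \<bar>of_int j / real (Suc r)\<bar> / 2 - \<eta> \<le> grid_pos u i - \<bar>of_int i / real (Suc r)\<bar> / 2)}"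

lemma sum_int_telescope:
  fixes f :: "int \<Rightarrow> real" assumes "i \<le> j"
  shows "(\<Sum>l\<in>{i..<j}. f (l + 1) - f l) = f j - f i"
  using assms
proof (induction j rule: int_ge_induct)
  case (step j)
  have "{i..<j + 1} = insert j {i..<j}" using step by auto
  then show ?case using step by simp
qed simp

text \<open>
  A function vanishing at the origin is recovered from its increments, in both directions.
\<close>

lemma grid_pos_increments:
  fixes f :: "int \<Rightarrow> real"
  assumes u: "\<And>l. l \<in> {- m..<m} \<Longrightarrow> u l = f (l + 1) - f l" and "f 0 = 0" and i: "- m \<le> i" "i \<le> m"
  shows "grid_pos u i = f i"
proof (cases "0 \<le> i")
  case True
  have "(\<Sum>l\<in>{0..<i}. u l) = (\<Sum>l\<in>{0..<i}. f (l + 1) - f l)" using i True by (intro sum.cong) (auto intro: u)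
  then show ?thesis using sum_int_telescope[of 0 i f] True assms(2) by (simp add: grid_pos_def)
next
  case False
  have "(\<Sum>l\<in>{i..<0}. u l) = (\<Sum>l\<in>{i..<0}. f (l + 1) - f l)" using i False by (intro sum.cong) (auto intro: u)
  then show ?thesis using sum_int_telescope[of i 0 f] False assms(2) by (simp add: grid_pos_def)
qed

text \<open>
  The set is a finite union of finite intersections of closed conditions on finitely many coordinates.
  It is stated for increments and not for values since the increments are the independent variables.
\<close>

lemma closed_grid_set: "closed (grid_set S K r \<eta>)"
proof -
  let ?I = "{- int (K * Suc r)..int (K * Suc r)}"
  have cont: "continuous_on UNIV (\<lambda>u. grid_pos u i)" for i
  proof (cases "0 \<le> i")
    case True
    then show ?thesis unfolding grid_pos_def by (simp add: continuous_on_sum continuous_on_product_coordinates)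
  next
    case False
    then show ?thesis unfolding grid_pos_def by (simp add: continuous_on_minus continuous_on_sum continuous_on_product_coordinates)
  qed
  have "grid_set S K r \<eta> = (\<Union>i\<in>{i\<in>?I. \<exists>s\<in>S. \<bar>of_int i / real (Suc r) - s\<bar> \<le> 1 / real (Suc r)}. \<Inter>j\<in>?I.
     {u. grid_pos u j - \<bar>of_int j / real (Suc r)\<bar> / 2 - \<eta> \<le> grid_pos u i - \<bar>of_int i / real (Suc r)\<bar> / 2})"
    unfolding grid_set_def by blast
  also have "closed \<dots>"
    by (intro closed_UN closed_INT ballI closed_Collect_le continuous_on_diff cont continuous_on_const)
       (rule finite_subset[where B="?I"], blast, simp)
  finally show ?thesis .
qed

lemma (in two_sided_bm) W_increments_in_grid_set:
  "{\<omega>\<in>space P. restrict (\<lambda>i. W (of_int (i + 1) * (1 / real (Suc r))) \<omega> - W (of_int i * (1 / real (Suc r))) \<omega>)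
     {- int (K * Suc r)..<int (K * Suc r)} \<in> grid_set S K r \<eta>} = grid_near_argmax S K r \<eta>"
proof -
  have "grid_pos (restrict (\<lambda>i. W (of_int (i + 1) * (1 / real (Suc r))) \<omega> - W (of_int i * (1 / real (Suc r))) \<omega>)
     {- int (K * Suc r)..<int (K * Suc r)}) i - \<bar>of_int i / real (Suc r)\<bar> / 2 = Z (of_int i / real (Suc r)) \<omega>"
    if "\<omega> \<in> space P" "i \<in> {- int (K * Suc r)..int (K * Suc r)}" for \<omega> i
    using that W_0[of \<omega>]
    by (subst grid_pos_increments[where m="int (K * Suc r)" and f="\<lambda>i. W (of_int i * (1 / real (Suc r))) \<omega>"])
       (auto simp: Z_def simp del: of_nat_Suc)
  then show ?thesis unfolding grid_set_def grid_near_argmax_def by (auto simp del: of_nat_Suc of_nat_mult)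
qed

context change_sample begin

text \<open>
  \<open>H\<close> is the scaled walk around the change index, \<open>cell h i\<close> the step at which the rescaled time reaches
  \<open>i * h\<close>, and \<open>block h i\<close> the steps between two such times. Cutting the block to the sample keeps the
  block sums \<open>U\<close> independent without any assumption on the range.
\<close>

definition H :: "int \<Rightarrow> 'a \<Rightarrow> real" where "H j \<omega> = - s * (m (nat (int k0 + j)) \<omega> - m k0 \<omega>)"
definition cell :: "real \<Rightarrow> int \<Rightarrow> int" where "cell h i = \<lfloor>of_int i * h / a\<rfloor>"
definition block :: "real \<Rightarrow> int \<Rightarrow> nat set" where
  "block h i = {l. l < N \<and> int k0 + cell h i \<le> int l \<and> int l < int k0 + cell h (i + 1)}"
definition U :: "real \<Rightarrow> int \<Rightarrow> 'a \<Rightarrow> real" where "U h i \<omega> = - s * (\<Sum>l\<in>block h i. X l \<omega>)"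

lemma cell_mono: "0 \<le> h \<Longrightarrow> i \<le> j \<Longrightarrow> cell h i \<le> cell h j"
  unfolding cell_def using pos by (intro floor_mono divide_right_mono mult_right_mono) auto

lemma cell_0: "cell h 0 = 0" unfolding cell_def by simp

lemma cell_bounds: "of_int i * h - a < a * of_int (cell h i)" "a * of_int (cell h i) \<le> of_int i * h"
proof -
  have "of_int i * h / a - 1 < of_int (cell h i)" "of_int (cell h i) \<le> of_int i * h / a" unfolding cell_def by linarith+
  then have "a * (of_int i * h / a - 1) < a * of_int (cell h i)" "a * of_int (cell h i) \<le> a * (of_int i * h / a)"
    using pos(3) by (blast intro: mult_strict_left_mono mult_left_mono less_imp_le)+
  then show "of_int i * h - a < a * of_int (cell h i)" "a * of_int (cell h i) \<le> of_int i * h"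
    using pos by (simp_all add: right_diff_distrib)
qed

lemma block_subset: "block h i \<subseteq> {..<N}" and finite_block: "finite (block h i)"
proof -
  show 1: "block h i \<subseteq> {..<N}" unfolding block_def by auto
  show "finite (block h i)" by (rule finite_subset[OF 1]) simp
qed

text \<open>
  Consecutive cells share an endpoint but no step.
\<close>

lemma block_disjoint: "0 \<le> h \<Longrightarrow> disjoint_family_on (block h) I"
proof -
  assume h: "0 \<le> h"
  have "block h i \<inter> block h j = {}" if "i < j" for i j
    using cell_mono[OF h, of "i + 1" j] that unfolding block_def by auto
  then show ?thesis unfolding disjoint_family_on_def by (metis Int_commute linorder_neqE)
qed

lemma U_indep:
  assumes h: "0 \<le> h" shows "indep_vars (\<lambda>_. borel) (U h) I"
proof -
  have "indep_vars (\<lambda>j. PiM (block h j) (\<lambda>_. borel)) (\<lambda>j \<omega>. restrict (\<lambda>i. X i \<omega>) (block h j)) I"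
    by (rule indep_vars_restrict[OF X_indep block_subset block_disjoint[OF h]])
  then have "indep_vars (\<lambda>_. borel) (\<lambda>j \<omega>. - s * (\<Sum>l\<in>block h j. restrict (\<lambda>i. X i \<omega>) (block h j) l)) I"
    by (rule indep_vars_compose2)
       (intro borel_measurable_times borel_measurable_const borel_measurable_sum measurable_component_singleton)
  then show ?thesis unfolding U_def by simp
qed

lemma block_eq:
  assumes "0 \<le> int k0 + cell h i" "int k0 + cell h (i + 1) \<le> int N"
  shows "block h i = {nat (int k0 + cell h i)..<nat (int k0 + cell h (i + 1))}"
  using assms unfolding block_def by auto

lemma m_diff: "i \<le> j \<Longrightarrow> (\<Sum>l\<in>{i..<j}. X l \<omega>) = m j \<omega> - m i \<omega>"
  unfolding m_def by (simp add: sum_diff_nat_ivl lessThan_atLeast0)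

text \<open>
  Whenever the cell lies inside the sample, truncating the block at the sample bounds has no effect.
\<close>

lemma U_eq:
  assumes h: "0 \<le> h" and r: "0 \<le> int k0 + cell h i" "int k0 + cell h (i + 1) \<le> int N"
  shows "U h i \<omega> = H (cell h (i + 1)) \<omega> - H (cell h i) \<omega>"
proof -
  have "(\<Sum>l\<in>block h i. X l \<omega>) = m (nat (int k0 + cell h (i + 1))) \<omega> - m (nat (int k0 + cell h i)) \<omega>"
    unfolding block_eq[OF r] using cell_mono[OF h, of i "i + 1"] by (intro m_diff nat_mono) simp
  from this show ?thesis unfolding U_def H_def by (simp only:) (simp add: algebra_simps)
qed

lemma grid_pos_U:
  assumes h: "0 \<le> h" and range: "\<And>i. i \<in> {- n..n} \<Longrightarrow> 1 \<le> int k0 + cell h i \<and> int k0 + cell h i \<le> int N - 1"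
    and i: "i \<in> {- n..n}"
  shows "grid_pos (restrict (\<lambda>i. U h i \<omega>) {- n..<n}) i = H (cell h i) \<omega>"
proof (rule grid_pos_increments[where m=n])
  fix l assume l: "l \<in> {- n..<n}"
  then have "U h l \<omega> = H (cell h (l + 1)) \<omega> - H (cell h l) \<omega>"
    using range[of l] range[of "l + 1"] by (intro U_eq h) auto
  then show "restrict (\<lambda>i. U h i \<omega>) {- n..<n} l = H (cell h (l + 1)) \<omega> - H (cell h l) \<omega>" using l by simp
qed (use i in \<open>auto simp: cell_0 H_def\<close>)

text \<open>
  The deterministic core. The maximiser \<open>\<kappa>\<close> of the contrast lies in the window, say in the cell to the right
  of the grid point \<open>i\<close>. Moving from \<open>\<kappa>\<close> to the grid point costs one oscillation \<open>\<eta>\<close> and half a mesh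
  of drift, and the comparison of contrast and walk costs another \<open>\<eta>\<close>; up to \<open>2 * \<eta> + h\<close> the grid
  point \<open>i\<close> is therefore maximal among grid points, and it is within \<open>h\<close> of a point of \<open>S\<close>.
\<close>

lemma walk_in_grid_set:
  fixes K r :: nat
  defines "n \<equiv> int (K * Suc r)" and "h \<equiv> 1 / real (Suc r)"
  assumes small: "uniformly_small \<epsilon> \<omega>" and \<epsilon>: "0 < \<epsilon>" "\<epsilon> \<le> b\<^sup>2 / 512" and K: "0 < K" and a1: "a \<le> 1"
    and tail: "\<And>k. k \<le> N \<Longrightarrow> \<bar>m k \<omega> - m k0 \<omega>\<bar> < \<delta> / 32 * (\<bar>real k - real k0\<bar> + real K / a)"
    and loc: "\<And>k. k \<le> N \<Longrightarrow> a * \<bar>real k - real k0\<bar> \<le> real K + 1 \<Longrightarrow> s * \<bar>m k \<omega> - m k0 \<omega>\<bar> < L"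
    and range: "\<And>i. i \<in> {- n..n} \<Longrightarrow> 1 \<le> int k0 + cell h i \<and> int k0 + cell h i \<le> int N - 1"
    and osc: "\<And>i k. i \<in> {- n..<n} \<Longrightarrow> int k0 + cell h i \<le> int k \<Longrightarrow> int k \<le> int k0 + cell h (i + 1) \<Longrightarrow>
      s * \<bar>m k \<omega> - m (nat (int k0 + cell h i)) \<omega>\<bar> < \<eta>"
    and \<kappa>: "1 \<le> \<kappa>" "\<kappa> \<le> N - 1" "\<And>k. 1 \<le> k \<Longrightarrow> k \<le> N - 1 \<Longrightarrow> Q k \<omega> \<le> Q \<kappa> \<omega>"
    and S: "a * (real \<kappa> - real k0) \<in> S"
    and \<eta>: "2 * (8 / b * (\<epsilon> + (real K + 1) / (a * real N)) * (real K + 1) + 2 * \<epsilon> / b * L) + a / 2 \<le> \<eta>"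
  shows "restrict (\<lambda>i. U h i \<omega>) {- n..<n} \<in> grid_set S K r (2 * \<eta> + h)"
proof -
  have h: "0 < h" "1 / real (Suc r) = h" unfolding h_def by auto
  have nh: "of_int n * h = real K" unfolding n_def h_def by (simp del: of_nat_Suc mult_Suc mult_Suc_right)
  have b2: "b\<^sup>2 \<le> 1" using b by (simp add: power2_eq_square mult_le_one)
  then have \<epsilon>1: "\<epsilon> \<le> 1" using \<epsilon> by linarith
  let ?j = "real \<kappa> - real k0"
  have near: "a * \<bar>?j\<bar> < real K"
  proof (rule ccontr)
    assume "\<not> ?thesis"
    then have "real K / a \<le> \<bar>?j\<bar>" using pos by (simp add: pos_divide_le_eq mult.commute)
    then have "Q \<kappa> \<omega> < Q k0 \<omega>"
      using K by (intro contrast_less_far_from_change[OF small \<epsilon> tail \<kappa>(1,2)]) auto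
    then show False using \<kappa>(3)[of k0] k0_bounds by simp
  qed
  then have aj: "- real K < a * ?j" "a * ?j < real K"
  proof -
    have "a * \<bar>?j\<bar> = \<bar>a * ?j\<bar>" using pos by (simp add: abs_mult)
    then show "- real K < a * ?j" "a * ?j < real K" using near by linarith+
  qed
  \<comment> \<open>the grid cell that contains the maximiser\<close>
  define i where "i = \<lfloor>a * ?j / h\<rfloor>"
  have "of_int i \<le> a * ?j / h" "a * ?j / h < of_int i + 1" unfolding i_def by linarith+
  then have ih: "of_int i * h \<le> a * ?j" "a * ?j < of_int (i + 1) * h"
    using h by (simp_all add: pos_le_divide_eq pos_divide_less_eq)
  have i1: "- n \<le> i" "i < n"
  proof -
    have "of_int i * h < of_int n * h" using ih aj nh by linarith
    then show "i < n" using h by simp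
    have "of_int (- n) * h < of_int (i + 1) * h" using ih aj nh by simp
    then have "- n < i + 1" using h by (simp only: mult_less_cancel_right_pos of_int_less_iff)
    then show "- n \<le> i" by simp
  qed
  have ci: "cell h i \<le> int \<kappa> - int k0" "int \<kappa> - int k0 \<le> cell h (i + 1)"
  proof -
    have "of_int i * h / a \<le> ?j" "?j \<le> of_int (i + 1) * h / a"
      using ih pos by (simp_all add: pos_divide_le_eq pos_le_divide_eq mult.commute)
    then show "cell h i \<le> int \<kappa> - int k0" "int \<kappa> - int k0 \<le> cell h (i + 1)" unfolding cell_def by linarith+
  qed
  let ?u = "restrict (\<lambda>i. U h i \<omega>) {- n..<n}"
  have gp: "grid_pos ?u j = H (cell h j) \<omega>" if "j \<in> {- n..n}" for j
    using grid_pos_U[OF less_imp_le[OF h(1)] range that] .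
  have H\<kappa>: "H (cell h i) \<omega> \<ge> - s * (m \<kappa> \<omega> - m k0 \<omega>) - \<eta>"
  proof -
    have "s * \<bar>m \<kappa> \<omega> - m (nat (int k0 + cell h i)) \<omega>\<bar> < \<eta>" using i1 ci by (intro osc) auto
    moreover have "\<bar>s * (m \<kappa> \<omega> - m (nat (int k0 + cell h i)) \<omega>)\<bar> = s * \<bar>m \<kappa> \<omega> - m (nat (int k0 + cell h i)) \<omega>\<bar>"
      using pos by (simp add: abs_mult)
    moreover have "H (cell h i) \<omega> = - s * (m \<kappa> \<omega> - m k0 \<omega>) + s * (m \<kappa> \<omega> - m (nat (int k0 + cell h i)) \<omega>)"
      unfolding H_def by (simp add: algebra_simps)
    ultimately show ?thesis by linarith
  qed
  have top: "H (cell h j) \<omega> - \<bar>of_int j * h\<bar> / 2 - (2 * \<eta> + h) \<le> H (cell h i) \<omega> - \<bar>of_int i * h\<bar> / 2"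
    if j: "j \<in> {- n..n}" for j
  proof -
    let ?k = "nat (int k0 + cell h j)"
    have k: "1 \<le> ?k" "?k \<le> N - 1" "real ?k - real k0 = of_int (cell h j)" using range[OF j] by auto
    have jn: "- real K \<le> of_int j * h" "of_int j * h \<le> real K"
    proof -
      have "of_int (- n) * h \<le> of_int j * h" "of_int j * h \<le> of_int n * h"
        using j h by (intro mult_right_mono; simp)+
      then show "- real K \<le> of_int j * h" "of_int j * h \<le> real K" using nh by simp_all
    qed
    have ac: "\<bar>a * of_int (cell h j) - of_int j * h\<bar> \<le> a" using cell_bounds[where i=j and h=h] pos(3) by linarith
    have aabs: "a * \<bar>of_int (cell h j)\<bar> = \<bar>a * of_int (cell h j)\<bar>" using pos by (simp add: abs_mult)
    have ak: "a * \<bar>real ?k - real k0\<bar> \<le> real K + 1" unfolding k(3) aabs using ac jn a1 by linarith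
    have "- s * (m ?k \<omega> - m k0 \<omega>) - a * \<bar>real ?k - real k0\<bar> / 2 \<le>
      - s * (m \<kappa> \<omega> - m k0 \<omega>) - a * \<bar>?j\<bar> / 2 + 2 * (8 / b * (\<epsilon> + (real K + 1) / (a * real N)) * (real K + 1) + 2 * \<epsilon> / b * L)"
      by (rule maximiser_near_walk_maximiser[OF small \<epsilon>(1) \<epsilon>1 loc _ \<kappa>(1,2) _ k(1,2) ak])
         (use near \<kappa>(3)[OF k(1,2)] in auto)
    moreover have "H (cell h j) \<omega> = - s * (m ?k \<omega> - m k0 \<omega>)" unfolding H_def ..
    moreover have "a * \<bar>real ?k - real k0\<bar> \<le> \<bar>of_int j * h\<bar> + a" unfolding k(3) aabs using ac by linarith
    moreover have "\<bar>of_int i * h\<bar> \<le> a * \<bar>?j\<bar> + h"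
    proof -
      have "a * \<bar>?j\<bar> = \<bar>a * ?j\<bar>" using pos by (simp add: abs_mult)
      moreover have "of_int (i + 1) * h = of_int i * h + h" by (simp add: distrib_right)
      ultimately show ?thesis using ih by linarith
    qed
    ultimately show ?thesis using H\<kappa> \<eta> h(1) by linarith
  qed
  show ?thesis
    unfolding grid_set_def mem_Collect_eq n_def[symmetric] h(2)
  proof (intro bexI[of _ i] conjI ballI bexI[of _ "a * ?j"])
    have e: "of_int l / real (Suc r) = of_int l * h" for l unfolding h_def by simp
    show "\<bar>of_int i / real (Suc r) - a * ?j\<bar> \<le> h"
    proof -
      have "of_int (i + 1) * h = of_int i * h + h" by (simp add: distrib_right)
      then show ?thesis unfolding e using ih by linarith
    qed
    show "grid_pos ?u j - \<bar>of_int j / real (Suc r)\<bar> / 2 - (2 * \<eta> + h) \<le> grid_pos ?u i - \<bar>of_int i / real (Suc r)\<bar> / 2"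
      if j: "j \<in> {- n..n}" for j
      unfolding e using top[OF j] gp[OF j] gp[of i] i1 by simp
  qed (use i1 S in auto)
qed

text \<open>
  A union bound over the \<open>2 * n\<close> cells. Rounding makes a cell at most \<open>a\<close> longer than \<open>h\<close>.
\<close>

lemma grid_oscillation:
  fixes h \<eta> :: real and n :: int
  assumes h: "0 < h" and \<eta>: "0 < \<eta>"
    and range: "\<And>i. i \<in> {- n..n} \<Longrightarrow> 1 \<le> int k0 + cell h i \<and> int k0 + cell h i \<le> int N - 1" and n: "0 \<le> n"
  shows "\<exists>E\<in>events. prob E \<le> 2 * of_int n * ((16 * (h + a)\<^sup>2 + 6 * s\<^sup>2 * (h + a)) / \<eta>^4) \<and>
    (\<forall>\<omega>\<in>space M - E. \<forall>i\<in>{- n..<n}. \<forall>k::nat. int k0 + cell h i \<le> int k \<longrightarrow> int k \<le> int k0 + cell h (i + 1) \<longrightarrow>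
      s * \<bar>m k \<omega> - m (nat (int k0 + cell h i)) \<omega>\<bar> < \<eta>)"
proof -
  let ?B = "(16 * (h + a)\<^sup>2 + 6 * s\<^sup>2 * (h + a)) / \<eta>^4"
  have "\<exists>E\<in>events. prob E \<le> ?B \<and> (\<forall>\<omega>\<in>space M - E. \<forall>k::nat. int k0 + cell h i \<le> int k \<longrightarrow> int k \<le> int k0 + cell h (i + 1) \<longrightarrow>
      s * \<bar>m k \<omega> - m (nat (int k0 + cell h i)) \<omega>\<bar> < \<eta>)" if i: "i \<in> {- n..<n}" for i
  proof -
    let ?l = "nat (int k0 + cell h i)" and ?r = "nat (cell h (i + 1) - cell h i)"
    have mono: "cell h i \<le> cell h (i + 1)" using h by (intro cell_mono) auto
    have ri: "1 \<le> int k0 + cell h i" "int k0 + cell h (i + 1) \<le> int N - 1" using range[of i] range[of "i + 1"] i by auto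
    have lr: "?l + ?r \<le> N" using ri mono by linarith
    have "real ?r = of_int (cell h (i + 1)) - of_int (cell h i)" using mono by simp
    then have "a * real ?r = a * of_int (cell h (i + 1)) - a * of_int (cell h i)" by (simp add: right_diff_distrib)
    also have "\<dots> \<le> h + a"
      using cell_bounds(2)[where i="i + 1" and h=h] cell_bounds(1)[where i=i and h=h] by (simp add: distrib_right)
    finally have ar: "a * real ?r \<le> h + a" .
    obtain E where E: "E \<in> events" "prob E \<le> ?B" "\<And>\<omega> k. \<omega> \<in> space M - E \<Longrightarrow> k \<le> ?r \<Longrightarrow> s * \<bar>m (?l + k) \<omega> - m ?l \<omega>\<bar> < \<eta>"
      using cell_oscillation[OF \<eta> lr ar] by blast
    have "s * \<bar>m k \<omega> - m ?l \<omega>\<bar> < \<eta>" if "\<omega> \<in> space M - E" "int k0 + cell h i \<le> int k" "int k \<le> int k0 + cell h (i + 1)" for \<omega> k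
    proof -
      have "k - ?l \<le> ?r" "?l + (k - ?l) = k" using that ri by linarith+
      then show ?thesis using E(3)[OF that(1), of "k - ?l"] by simp
    qed
    then show ?thesis using E by blast
  qed
  then obtain E where E: "\<And>i. i \<in> {- n..<n} \<Longrightarrow> E i \<in> events" "\<And>i. i \<in> {- n..<n} \<Longrightarrow> prob (E i) \<le> ?B"
    "\<And>i \<omega> k. i \<in> {- n..<n} \<Longrightarrow> \<omega> \<in> space M - E i \<Longrightarrow> int k0 + cell h i \<le> int k \<Longrightarrow> int k \<le> int k0 + cell h (i + 1) \<Longrightarrow>
      s * \<bar>m k \<omega> - m (nat (int k0 + cell h i)) \<omega>\<bar> < \<eta>" by metis
  have "prob (\<Union>i\<in>{- n..<n}. E i) \<le> (\<Sum>i\<in>{- n..<n}. prob (E i))"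
    using E(1) by (intro finite_measure_subadditive_finite) auto
  also have "\<dots> \<le> (\<Sum>i\<in>{- n..<n}. ?B)" using E(2) by (intro sum_mono) auto
  also have "\<dots> = 2 * of_int n * ?B" using n by simp
  finally have "prob (\<Union>i\<in>{- n..<n}. E i) \<le> 2 * of_int n * ?B" .
  moreover have "(\<Union>i\<in>{- n..<n}. E i) \<in> events" using E(1) by auto
  ultimately show ?thesis using E(3) by blast
qed

end

section \<open>The rescaled maximiser of the contrast\<close>

text \<open>
  The block has about \<open>h / a\<close> steps, each of variance about \<open>q\<close> on either side of the change, and
  \<open>s^2 * q = a\<close>. A block never straddles the change because \<open>0\<close> is a grid point.
\<close>

lemma block_sums_converge:
  fixes M :: "nat \<Rightarrow> 'a measure" and J :: "nat \<Rightarrow> nat \<Rightarrow> 'a \<Rightarrow> real" and N k0 :: "nat \<Rightarrow> nat"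
    and p1 p2 q :: "nat \<Rightarrow> real" and b h :: real and P :: "'b measure"
  assumes cs: "\<And>n. change_sample (M n) (J n) (N n) (k0 n) (p1 n) (p2 n) (q n) b"
    and s_lim: "(\<lambda>n. (p2 n - p1 n) / q n) \<longlonglongrightarrow> 0" and a_lim: "(\<lambda>n. (p2 n - p1 n)\<^sup>2 / q n) \<longlonglongrightarrow> 0"
    and p1q: "(\<lambda>n. p1 n / q n) \<longlonglongrightarrow> 1" and p2q: "(\<lambda>n. p2 n / q n) \<longlonglongrightarrow> 1" and q_lim: "q \<longlonglongrightarrow> 0"
    and h: "0 < h"
    and range: "eventually (\<lambda>n. 0 \<le> int (k0 n) + change_sample.cell (p1 n) (p2 n) (q n) h i \<and>
      int (k0 n) + change_sample.cell (p1 n) (p2 n) (q n) h (i + 1) \<le> int (N n)) sequentially"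
    and P: "prob_space P" "distributed P lborel V (normal_density 0 (sqrt h))"
  shows "weak_conv_m (\<lambda>n. distr (M n) borel (change_sample.U (J n) (N n) (k0 n) (p1 n) (p2 n) (q n) h i)) (distr P borel V)"
proof -
  interpret C: change_sample "M n" "J n" "N n" "k0 n" "p1 n" "p2 n" "q n" b for n by (rule cs)
  have sl: "(\<lambda>n. C.s n) \<longlonglongrightarrow> 0" unfolding C.s_def C.\<delta>_def by (rule s_lim)
  have al: "(\<lambda>n. C.a n) \<longlonglongrightarrow> 0" unfolding C.a_def C.\<delta>_def by (rule a_lim)
  define w where "w n = (if i < 0 then p1 n * (1 - p1 n) else p2 n * (1 - p2 n))" for n
  have p01: "0 \<le> p1 n" "p1 n \<le> 1" "0 \<le> p2 n" "p2 n \<le> 1" for n using C.p[of n] by auto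
  have w01: "0 \<le> w n" "w n \<le> 1" for n
    unfolding w_def using p01[of n] by (auto intro: mult_le_one)
  have plim: "p1 \<longlonglongrightarrow> 0" "p2 \<longlonglongrightarrow> 0"
  proof -
    have "(\<lambda>n. p1 n / q n * q n) \<longlonglongrightarrow> 1 * 0" "(\<lambda>n. p2 n / q n * q n) \<longlonglongrightarrow> 1 * 0"
      by (intro tendsto_mult p1q p2q q_lim)+
    moreover have "p1 n / q n * q n = p1 n" "p2 n / q n * q n = p2 n" for n using C.pos(2)[of n] by auto
    ultimately show "p1 \<longlonglongrightarrow> 0" "p2 \<longlonglongrightarrow> 0" by simp_all
  qed
  have wq: "(\<lambda>n. w n / q n) \<longlonglongrightarrow> 1"
  proof -
    have "(\<lambda>n. p1 n / q n * (1 - p1 n)) \<longlonglongrightarrow> 1 * (1 - 0)" "(\<lambda>n. p2 n / q n * (1 - p2 n)) \<longlonglongrightarrow> 1 * (1 - 0)"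
      by (intro tendsto_mult tendsto_diff tendsto_const p1q p2q plim)+
    then show ?thesis unfolding w_def by (cases "i < 0") simp_all
  qed
  have cell_lim: "(\<lambda>n. C.a n * of_int (C.cell n h j)) \<longlonglongrightarrow> of_int j * h" for j
  proof (rule tendsto_sandwich)
    show "eventually (\<lambda>n. of_int j * h - C.a n \<le> C.a n * of_int (C.cell n h j)) sequentially"
      using C.cell_bounds(1) by (intro always_eventually allI less_imp_le)
    show "eventually (\<lambda>n. C.a n * of_int (C.cell n h j) \<le> of_int j * h) sequentially"
      using C.cell_bounds(2) by (intro always_eventually allI)
    show "(\<lambda>n. of_int j * h - C.a n) \<longlonglongrightarrow> of_int j * h" using tendsto_diff[OF tendsto_const al, of "of_int j * h"] by simp
  qed simp
  have card_lim: "(\<lambda>n. real (card (C.block n h i)) * (- C.s n)\<^sup>2 * w n) \<longlonglongrightarrow> h"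
  proof -
    have "(\<lambda>n. (C.a n * of_int (C.cell n h (i + 1)) - C.a n * of_int (C.cell n h i)) * (w n / q n)) \<longlonglongrightarrow>
        (of_int (i + 1) * h - of_int i * h) * 1"
      by (intro tendsto_mult tendsto_diff cell_lim wq)
    also have "(of_int (i + 1) * h - of_int i * h) * 1 = h" by (simp add: distrib_right)
    finally have l: "(\<lambda>n. (C.a n * of_int (C.cell n h (i + 1)) - C.a n * of_int (C.cell n h i)) * (w n / q n)) \<longlonglongrightarrow> h" .
    have "eventually (\<lambda>n. (C.a n * of_int (C.cell n h (i + 1)) - C.a n * of_int (C.cell n h i)) * (w n / q n) =
        real (card (C.block n h i)) * (- C.s n)\<^sup>2 * w n) sequentially"
      using range
    proof eventually_elim
      case (elim n)
      have mono: "C.cell n h i \<le> C.cell n h (i + 1)" using h by (intro C.cell_mono) auto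
      have "card (C.block n h i) = nat (int (k0 n) + C.cell n h (i + 1)) - nat (int (k0 n) + C.cell n h i)"
        using C.block_eq[of n h i] elim by simp
      then have "real (card (C.block n h i)) = of_int (C.cell n h (i + 1)) - of_int (C.cell n h i)"
        using mono elim by linarith
      moreover have "(- C.s n)\<^sup>2 * w n = C.a n * (w n / q n)"
        unfolding C.s_def C.a_def by (simp add: power_divide power2_eq_square)
      ultimately show ?case by (simp only: mult.assoc) (simp add: algebra_simps)
    qed
    then show ?thesis by (rule Lim_transform_eventually[OF l])
  qed
  have blk: "l < N n" "l < k0 n \<longleftrightarrow> i < 0" if "l \<in> C.block n h i" for n l
  proof -
    have 1: "l < N n" "int (k0 n) + C.cell n h i \<le> int l" "int l < int (k0 n) + C.cell n h (i + 1)"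
      using that unfolding C.block_def by auto
    show "l < N n" by fact
    have "C.cell n h (i + 1) \<le> 0" if "i < 0" using C.cell_mono[of h "i + 1" 0 n] C.cell_0[of n h] h that by simp
    moreover have "0 \<le> C.cell n h i" if "0 \<le> i" using C.cell_mono[of h 0 i n] C.cell_0[of n h] h that by simp
    ultimately show "l < k0 n \<longleftrightarrow> i < 0" using 1 by linarith
  qed
  have "weak_conv_m (\<lambda>n. distr (M n) borel (\<lambda>\<omega>. - C.s n * (\<Sum>l\<in>C.block n h i. C.X n l \<omega>))) (distr P borel V)"
  proof (rule triangular_block_clt[where w=w and h=h])
    show "prob_space (M n)" for n by (rule C.prob_space_axioms)
    show "prob_space.indep_vars (M n) (\<lambda>_. borel) (C.X n) (C.block n h i)" for n
      by (rule C.indep_vars_subset[OF C.X_indep C.block_subset])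
    show "finite (C.block n h i)" for n by (rule C.finite_block)
    show "(\<integral>\<omega>. C.X n l \<omega> \<partial>M n) = 0" if "l \<in> C.block n h i" for n l
      using C.X_mean[OF blk(1)[OF that]] .
    show "(\<integral>\<omega>. (C.X n l \<omega>)\<^sup>2 \<partial>M n) = w n" if "l \<in> C.block n h i" for n l
      using C.X_var[OF blk(1)[OF that]] blk(2)[OF that] unfolding w_def by simp
    show "\<bar>C.X n l \<omega>\<bar> \<le> 1" for n l \<omega> by (rule C.X_bound)
    show "(\<lambda>n. - C.s n) \<longlonglongrightarrow> 0" using tendsto_minus[OF sl] by simp
  qed (use w01 card_lim h P in auto)
  then show ?thesis unfolding C.U_def[abs_def] .
qed

text \<open>
  Off four exceptional events, of probability below \<open>e\<close> each, the maximiser can be in \<open>S\<close> only if the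
  block increments are in the closed grid set. The central limit theorem bounds the probability of the
  latter by its Brownian value plus \<open>e\<close>, and that value exceeds the probability of \<open>\<xi> \<in> S\<close> by at most the
  window error \<open>e\<close> and the mesh error \<open>e\<close>. This adds up to less than \<open>8 * e = \<epsilon>\<close>.
\<close>

lemma rescaled_maximiser_limsup:
  fixes M :: "nat \<Rightarrow> 'a measure" and J :: "nat \<Rightarrow> nat \<Rightarrow> 'a \<Rightarrow> real" and N k0 :: "nat \<Rightarrow> nat"
    and p1 p2 q :: "nat \<Rightarrow> real" and b \<epsilon> :: real and \<kappa> :: "nat \<Rightarrow> 'a \<Rightarrow> nat" and P :: "'b measure"
  assumes cs: "\<And>n. change_sample (M n) (J n) (N n) (k0 n) (p1 n) (p2 n) (q n) b"
    and \<kappa>: "\<And>n. AE \<omega> in M n. 1 \<le> \<kappa> n \<omega> \<and> \<kappa> n \<omega> \<le> N n - 1 \<and>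
      (\<forall>k. 1 \<le> k \<longrightarrow> k \<le> N n - 1 \<longrightarrow> contrast (N n) (\<lambda>i. J n i \<omega>) k \<le> contrast (N n) (\<lambda>i. J n i \<omega>) (\<kappa> n \<omega>))"
    and s_lim: "(\<lambda>n. (p2 n - p1 n) / q n) \<longlonglongrightarrow> 0" and a_lim: "(\<lambda>n. (p2 n - p1 n)\<^sup>2 / q n) \<longlonglongrightarrow> 0"
    and p1q: "(\<lambda>n. p1 n / q n) \<longlonglongrightarrow> 1" and p2q: "(\<lambda>n. p2 n / q n) \<longlonglongrightarrow> 1" and q_lim: "q \<longlonglongrightarrow> 0"
    and log_lim: "(\<lambda>n. (1 + ln (real (N n))) / (real (N n) * ((p2 n - p1 n)\<^sup>2 / q n))) \<longlonglongrightarrow> 0"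
    and bm: "two_sided_bm P W"
    and \<xi>: "\<xi> \<in> borel_measurable P" "AE \<omega> in P. two_sided_bm.maximisers W \<omega> = {\<xi> \<omega>}"
    and S: "closed S" and \<epsilon>: "0 < \<epsilon>"
  shows "eventually (\<lambda>n. measure (M n) {\<omega>\<in>space (M n). (p2 n - p1 n)\<^sup>2 / q n * (real (\<kappa> n \<omega>) - real (k0 n)) \<in> S}
     < measure P {\<omega>\<in>space P. \<xi> \<omega> \<in> S} + \<epsilon>) sequentially"
proof -
  interpret C: change_sample "M n" "J n" "N n" "k0 n" "p1 n" "p2 n" "q n" b for n by (rule cs)
  interpret B: two_sided_bm P W by (rule bm)
  note \<xi>(1)[measurable]
  have sl: "(\<lambda>n. C.s n) \<longlonglongrightarrow> 0" unfolding C.s_def C.\<delta>_def by (rule s_lim)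
  have al: "(\<lambda>n. C.a n) \<longlonglongrightarrow> 0" unfolding C.a_def C.\<delta>_def by (rule a_lim)
  have logl: "(\<lambda>n. (1 + ln (real (N n))) / (real (N n) * C.a n)) \<longlonglongrightarrow> 0" unfolding C.a_def C.\<delta>_def by (rule log_lim)
  have b: "0 < b" "b \<le> 1 / 2" by (rule C.b)+
  have aN: "(\<lambda>n. 1 / (C.a n * real (N n))) \<longlonglongrightarrow> 0"
  proof (rule tendsto_sandwich[OF _ _ tendsto_const logl])
    show "eventually (\<lambda>n. 0 \<le> 1 / (C.a n * real (N n))) sequentially"
      using C.pos(3) by (intro always_eventually allI) (simp add: less_imp_le)
    show "eventually (\<lambda>n. 1 / (C.a n * real (N n)) \<le> (1 + ln (real (N n))) / (real (N n) * C.a n)) sequentially"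
    proof (intro always_eventually allI)
      fix n
      have "1 \<le> 1 + ln (real (N n))" using C.N2[of n] by simp
      then have "1 / (real (N n) * C.a n) \<le> (1 + ln (real (N n))) / (real (N n) * C.a n)"
        using C.pos(3)[of n] by (intro divide_right_mono) auto
      then show "1 / (C.a n * real (N n)) \<le> (1 + ln (real (N n))) / (real (N n) * C.a n)" by (simp add: mult.commute)
    qed
  qed
  define e where "e = \<epsilon> / 8"
  have e: "0 < e" unfolding e_def using \<epsilon> by simp
  \<comment> \<open>the window holds the Brownian maximiser, and the walk outside it stays below the drift, up to probability \<open>e\<close>\<close>
  have "(\<lambda>K. B.prob {\<omega>\<in>space P. real K \<le> \<bar>\<xi> \<omega>\<bar>}) \<longlonglongrightarrow> 0"
  proof (rule B.prob_tendsto_zero_if_eventually_outside)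
    show "AE \<omega> in P. eventually (\<lambda>K. \<omega> \<notin> {\<omega>\<in>space P. real K \<le> \<bar>\<xi> \<omega>\<bar>}) sequentially"
    proof (rule AE_I2)
      fix \<omega>
      show "eventually (\<lambda>K. \<omega> \<notin> {\<omega>\<in>space P. real K \<le> \<bar>\<xi> \<omega>\<bar>}) sequentially"
        using eventually_gt_at_top[of "nat \<lceil>\<bar>\<xi> \<omega>\<bar>\<rceil>"] by eventually_elim (auto simp: not_le; linarith)
    qed
  qed measurable
  then have "eventually (\<lambda>K. B.prob {\<omega>\<in>space P. real K \<le> \<bar>\<xi> \<omega>\<bar>} < e) sequentially" using e by (rule order_tendstoD)
  moreover have "eventually (\<lambda>K. 4096 / real K < e) sequentially"
    using lim_const_over_n[of "4096 :: real"] e by (rule order_tendstoD)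
  ultimately have "eventually (\<lambda>K. B.prob {\<omega>\<in>space P. real K \<le> \<bar>\<xi> \<omega>\<bar>} < e \<and> 4096 / real K < e \<and> 1 \<le> K) sequentially"
    using eventually_ge_at_top[of "1 :: nat"] by eventually_elim blast
  then obtain K :: nat where K: "B.prob {\<omega>\<in>space P. real K \<le> \<bar>\<xi> \<omega>\<bar>} < e" "4096 / real K < e" "1 \<le> K"
    unfolding eventually_sequentially by blast
  \<comment> \<open>with mesh \<open>h = x^2\<close> and \<open>\<eta>^4 = x\<close> the \<open>2 * K / h\<close> cells contribute \<open>2 * K / h * 16 * h^2 / \<eta>^4 = 32 * K * x\<close>\<close>
  have h0: "(\<lambda>r. 1 / real (Suc r)) \<longlonglongrightarrow> 0" using LIMSEQ_Suc[OF lim_const_over_n[of "1 :: real"]] by simp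
  define x where "x r = sqrt (1 / real (Suc r))" for r
  define \<eta> where "\<eta> r = sqrt (sqrt (x r))" for r
  have x: "0 < x r" "(x r)\<^sup>2 = 1 / real (Suc r)" for r unfolding x_def by simp_all
  have \<eta>: "0 < \<eta> r" "\<eta> r ^ 4 = x r" for r
  proof -
    show "0 < \<eta> r" unfolding \<eta>_def using x(1) by simp
    have "\<eta> r ^ 4 = ((\<eta> r)\<^sup>2)\<^sup>2" by simp
    also have "\<dots> = x r" unfolding \<eta>_def using x(1)[of r] by simp
    finally show "\<eta> r ^ 4 = x r" .
  qed
  have x0: "x \<longlonglongrightarrow> 0" unfolding x_def using tendsto_real_sqrt[OF h0] by simp
  have \<eta>0: "\<eta> \<longlonglongrightarrow> 0" unfolding \<eta>_def using tendsto_real_sqrt[OF tendsto_real_sqrt[OF x0]] by simp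
  have "(\<lambda>r. 2 * \<eta> r + 1 / real (Suc r)) \<longlonglongrightarrow> 2 * 0 + 0" by (intro tendsto_intros \<eta>0 h0)
  then have "eventually (\<lambda>r. B.prob (B.grid_near_argmax S K r (2 * \<eta> r + 1 / real (Suc r))) <
    B.prob {\<omega>\<in>space P. \<xi> \<omega> \<in> S} + B.prob {\<omega>\<in>space P. real K \<le> \<bar>\<xi> \<omega>\<bar>} + e) sequentially"
    using \<eta>(1) by (intro B.grid_near_argmax_eventually_less[OF S _ _ \<xi> e]) (auto intro!: add_pos_pos)
  moreover have "(\<lambda>r. 32 * real K * x r) \<longlonglongrightarrow> 32 * real K * 0" by (intro tendsto_intros x0)
  then have "eventually (\<lambda>r. 32 * real K * x r < e) sequentially" using e by (intro order_tendstoD) auto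
  ultimately have "eventually (\<lambda>r. B.prob (B.grid_near_argmax S K r (2 * \<eta> r + 1 / real (Suc r))) <
    B.prob {\<omega>\<in>space P. \<xi> \<omega> \<in> S} + B.prob {\<omega>\<in>space P. real K \<le> \<bar>\<xi> \<omega>\<bar>} + e \<and> 32 * real K * x r < e) sequentially"
    by eventually_elim blast
  then obtain r where r: "B.prob (B.grid_near_argmax S K r (2 * \<eta> r + 1 / real (Suc r))) <
    B.prob {\<omega>\<in>space P. \<xi> \<omega> \<in> S} + B.prob {\<omega>\<in>space P. real K \<le> \<bar>\<xi> \<omega>\<bar>} + e" "32 * real K * x r < e"
    unfolding eventually_sequentially by blast
  define h g where "h = 1 / real (Suc r)" and "g = int (K * Suc r)"
  have h: "0 < h" unfolding h_def by simp
  have gh: "of_int g * h = real K" unfolding g_def h_def by (simp del: of_nat_Suc mult_Suc mult_Suc_right)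
  have g0: "0 < g" unfolding g_def using K(3) by (simp del: mult_Suc_right of_nat_mult)
  \<comment> \<open>\<open>L\<close> bounds the walk in the window; \<open>\<epsilon>1\<close> is small enough for localisation and for a contrast error of order \<open>\<eta>\<close>\<close>
  define L where "L = 1 + 32 * (real K + 2) / \<epsilon>"
  have "0 \<le> 32 * (real K + 2) / \<epsilon>" using \<epsilon> by simp
  then have L: "1 \<le> L" "0 < L" unfolding L_def by linarith+
  have LB: "4 * ((real K + 1) + 1) / L\<^sup>2 < e"
  proof -
    have "32 * (real K + 2) / \<epsilon> < L * 1" unfolding L_def by simp
    also have "\<dots> \<le> L * L" using L by (intro mult_left_mono) auto
    finally have "32 * (real K + 2) < \<epsilon> * L\<^sup>2" using \<epsilon> by (simp add: pos_divide_less_eq power2_eq_square mult_ac)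
    then show ?thesis unfolding e_def using L by (simp add: divide_simps)
  qed
  define c where "c = 8 * (real K + 1) + 2 * L"
  have c: "0 < c" unfolding c_def using L by simp
  define \<epsilon>1 where "\<epsilon>1 = min (b\<^sup>2 / 512) (\<eta> r * b / (8 * c))"
  have \<epsilon>1: "0 < \<epsilon>1" "\<epsilon>1 \<le> b\<^sup>2 / 512" "\<epsilon>1 \<le> \<eta> r * b / (8 * c)"
    unfolding \<epsilon>1_def using b \<eta>(1)[of r] c by auto
  have ev_a: "eventually (\<lambda>n. C.a n < min 1 (\<eta> r / 4)) sequentially"
    using al \<eta>(1)[of r] by (intro order_tendstoD) auto
  have "(\<lambda>n. (real K + 1) * (1 / (C.a n * real (N n)))) \<longlonglongrightarrow> (real K + 1) * 0" by (intro tendsto_intros aN)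
  then have ev_aN: "eventually (\<lambda>n. (real K + 1) * (1 / (C.a n * real (N n))) < min (b / 2) (\<eta> r * b / (64 * (real K + 1)))) sequentially"
    using b \<eta>(1)[of r] by (intro order_tendstoD) auto
  \<comment> \<open>the window occupies \<open>(K + 1) / a\<close> steps, a vanishing fraction of the sample\<close>
  have ev_range: "eventually (\<lambda>n. \<forall>i\<in>{- g..g}. 1 \<le> int (k0 n) + C.cell n h i \<and> int (k0 n) + C.cell n h i \<le> int (N n) - 1) sequentially"
    using ev_a ev_aN
  proof eventually_elim
    case (elim n)
    show ?case
    proof
      fix i assume i: "i \<in> {- g..g}"
      have a: "0 < C.a n" "C.a n < 1" using C.pos(3) elim by auto
      have N0: "0 < real (N n)" using C.N2[of n] by simp
      have "of_int (- g) * h \<le> of_int i * h" "of_int i * h \<le> of_int g * h" using i h by (intro mult_right_mono; simp)+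
      then have ih: "- real K \<le> of_int i * h" "of_int i * h \<le> real K" using gh by simp_all
      have "- (real K + 1) \<le> C.a n * of_int (C.cell n h i)" "C.a n * of_int (C.cell n h i) \<le> real K + 1"
        using C.cell_bounds[where i=i and h=h and n=n] ih a by linarith+
      then have c1: "- ((real K + 1) / C.a n) \<le> of_int (C.cell n h i)" "of_int (C.cell n h i) \<le> (real K + 1) / C.a n"
        using a by (simp_all add: pos_le_divide_eq pos_divide_le_eq minus_divide_left mult.commute)
      have "(real K + 1) / C.a n / real (N n) < b / 2" using elim(2) by simp
      from this[unfolded pos_divide_less_eq[OF N0]] have c2: "(real K + 1) / C.a n < b * real (N n) / 2" by linarith
      have "1 * C.a n \<le> real K + 1" using a by linarith
      then have c3: "1 \<le> (real K + 1) / C.a n" using a by (simp add: pos_le_divide_eq)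
      have "b * real (N n) \<le> real (k0 n)" "real (k0 n) \<le> real (N n) - b * real (N n)"
        using C.k0[of n] by (auto simp: left_diff_distrib)
      then have "1 \<le> real (k0 n) + of_int (C.cell n h i)" "real (k0 n) + of_int (C.cell n h i) \<le> real (N n) - 1"
        using c1 c2 c3 by linarith+
      then show "1 \<le> int (k0 n) + C.cell n h i \<and> int (k0 n) + C.cell n h i \<le> int (N n) - 1" by linarith
    qed
  qed
  have "(\<lambda>n. 4 / \<epsilon>1\<^sup>2 * ((1 + ln (real (N n))) / (real (N n) * C.a n))) \<longlonglongrightarrow> 4 / \<epsilon>1\<^sup>2 * 0"
    by (intro tendsto_intros logl)
  then have ev_small: "eventually (\<lambda>n. 4 / \<epsilon>1\<^sup>2 * ((1 + ln (real (N n))) / (real (N n) * C.a n)) < e) sequentially"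
    using e by (intro order_tendstoD) auto
  have ev_osc: "eventually (\<lambda>n. 2 * of_int g * ((16 * (h + C.a n)\<^sup>2 + 6 * (C.s n)\<^sup>2 * (h + C.a n)) / \<eta> r ^ 4) < e) sequentially"
  proof -
    have "(\<lambda>n. 2 * of_int g * ((16 * (h + C.a n)\<^sup>2 + 6 * (C.s n)\<^sup>2 * (h + C.a n)) / \<eta> r ^ 4)) \<longlonglongrightarrow>
      2 * of_int g * ((16 * (h + 0)\<^sup>2 + 6 * 0\<^sup>2 * (h + 0)) / \<eta> r ^ 4)"
      using \<eta>(1)[of r] by (intro tendsto_intros al sl) simp
    also have "2 * of_int g * ((16 * (h + 0)\<^sup>2 + 6 * 0\<^sup>2 * (h + 0)) / \<eta> r ^ 4) = 32 * (of_int g * h) * (h / x r)"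
      unfolding \<eta>(2) by (simp add: power2_eq_square)
    also have "h / x r = x r"
    proof -
      have "h = x r * x r" unfolding h_def x(2)[symmetric] power2_eq_square ..
      then show ?thesis using x(1)[of r] by simp
    qed
    finally show ?thesis using r(2) unfolding gh by (rule order_tendstoD)
  qed
  let ?V = "\<lambda>i \<omega>. W (of_int (i + 1) * h) \<omega> - W (of_int i * h) \<omega>"
  have ev_fidi: "eventually (\<lambda>n. measure (M n) {\<omega>\<in>space (M n). restrict (\<lambda>i. C.U n h i \<omega>) {- g..<g} \<in> grid_set S K r (2 * \<eta> r + h)}
     < measure P {\<omega>\<in>space P. restrict (\<lambda>i. ?V i \<omega>) {- g..<g} \<in> grid_set S K r (2 * \<eta> r + h)} + e) sequentially"
  proof (rule independent_coordinates_closed_set_limsup)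
    show "{- g..<g} \<noteq> {}" using g0 by simp
    show "prob_space (M n)" for n by (rule C.prob_space_axioms)
    show "prob_space.indep_vars (M n) (\<lambda>_. borel) (C.U n h) {- g..<g}" for n using h by (intro C.U_indep) simp
    show "prob_space.indep_vars P (\<lambda>_. borel) ?V {- g..<g}"
      unfolding g_def by (rule B.W_grid_increments_indep[OF h])
    show "weak_conv_m (\<lambda>n. distr (M n) borel (C.U n h i)) (distr P borel (?V i))" if i: "i \<in> {- g..<g}" for i
    proof (rule block_sums_converge[OF cs s_lim a_lim p1q p2q q_lim h])
      show "eventually (\<lambda>n. 0 \<le> int (k0 n) + C.cell n h i \<and> int (k0 n) + C.cell n h (i + 1) \<le> int (N n)) sequentially"
        using ev_range
      proof eventually_elim
        case (elim n)
        have ii: "i \<in> {- g..g}" "i + 1 \<in> {- g..g}" using i by auto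
        show ?case using bspec[OF elim ii(1)] bspec[OF elim ii(2)] by auto
      qed
      have d: "of_int (i + 1) * h - of_int i * h = h" by (simp add: distrib_right)
      have "0 \<le> of_int i * h \<or> of_int (i + 1) * h \<le> 0"
      proof (cases "0 \<le> i")
        case False
        then have "of_int (i + 1) \<le> (0 :: real)" by linarith
        then show ?thesis using h by (intro disjI2 mult_nonpos_nonneg) auto
      qed (use h in simp)
      moreover have "of_int i * h < of_int (i + 1) * h" using h by simp
      ultimately show "distributed P lborel (?V i) (normal_density 0 (sqrt h))"
        using B.W_increment_normal[of "of_int i * h" "of_int (i + 1) * h"] unfolding d by blast
    qed (rule B.prob_space_axioms)
  qed (use e B.prob_space_axioms closed_grid_set in auto)
  show ?thesis
    using ev_a ev_aN ev_range ev_small ev_osc ev_fidi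
  proof eventually_elim
    case (elim n)
    note a_small = elim(1) and in_range = elim(3)
    have K0: "0 < real K" using K(3) by simp
    obtain E1 where E1: "E1 \<in> sets (M n)" "measure (M n) E1 \<le> 4 / \<epsilon>1\<^sup>2 * ((1 + ln (real (N n))) / (real (N n) * C.a n))"
      "\<And>\<omega>. \<omega> \<in> space (M n) - E1 \<Longrightarrow> C.uniformly_small n \<epsilon>1 \<omega>"
      using C.not_uniformly_small_prob[OF \<epsilon>1(1)] by blast
    obtain E2 where E2: "E2 \<in> sets (M n)" "measure (M n) E2 \<le> 4096 / real K"
      "\<And>\<omega> k. \<omega> \<in> space (M n) - E2 \<Longrightarrow> k \<le> N n \<Longrightarrow>
        \<bar>C.m n k \<omega> - C.m n (k0 n) \<omega>\<bar> < C.\<delta> n / 32 * (\<bar>real k - real (k0 n)\<bar> + real K / C.a n)"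
      using C.tail_exceedance[OF K0, where n=n] by blast
    obtain E3 where E3: "E3 \<in> sets (M n)" "measure (M n) E3 \<le> 4 * ((real K + 1) + 1) / L\<^sup>2"
      "\<And>\<omega> k. \<omega> \<in> space (M n) - E3 \<Longrightarrow> k \<le> N n \<Longrightarrow> C.a n * \<bar>real k - real (k0 n)\<bar> \<le> real K + 1 \<Longrightarrow>
        C.s n * \<bar>C.m n k \<omega> - C.m n (k0 n) \<omega>\<bar> < L"
      using C.local_exceedance[where L=L and K="real K + 1" and n=n] L elim(1) by auto
    obtain E4 where E4: "E4 \<in> sets (M n)"
      "measure (M n) E4 \<le> 2 * of_int g * ((16 * (h + C.a n)\<^sup>2 + 6 * (C.s n)\<^sup>2 * (h + C.a n)) / \<eta> r ^ 4)"
      "\<And>\<omega> i k. \<omega> \<in> space (M n) - E4 \<Longrightarrow> i \<in> {- g..<g} \<Longrightarrow> int (k0 n) + C.cell n h i \<le> int k \<Longrightarrow>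
         int k \<le> int (k0 n) + C.cell n h (i + 1) \<Longrightarrow> C.s n * \<bar>C.m n k \<omega> - C.m n (nat (int (k0 n) + C.cell n h i)) \<omega>\<bar> < \<eta> r"
      using C.grid_oscillation[OF h \<eta>(1)[of r], where n=g and na=n] elim(3) g0 by (auto simp: less_imp_le)
    let ?G = "{\<omega>\<in>space (M n). restrict (\<lambda>i. C.U n h i \<omega>) {- g..<g} \<in> grid_set S K r (2 * \<eta> r + h)}"
    let ?T = "{\<omega>\<in>space (M n). (p2 n - p1 n)\<^sup>2 / q n * (real (\<kappa> n \<omega>) - real (k0 n)) \<in> S}"
    have G: "?G \<in> sets (M n)"
      using g0 h by (intro prob_restrict_indep_vars(1)[OF C.prob_space_axioms C.U_indep]) (auto simp: closed_grid_set)
    have tol: "2 * (8 / b * (\<epsilon>1 + (real K + 1) / (C.a n * real (N n))) * (real K + 1) + 2 * \<epsilon>1 / b * L) + C.a n / 2 \<le> \<eta> r"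
    proof -
      let ?y = "(real K + 1) / (C.a n * real (N n))"
      have "2 * \<epsilon>1 / b * c \<le> 2 * (\<eta> r * b / (8 * c)) / b * c"
        using \<epsilon>1 b c by (intro mult_right_mono divide_right_mono mult_left_mono) auto
      also have "\<dots> = \<eta> r / 4" using b c by simp
      finally have t1: "2 * \<epsilon>1 / b * c \<le> \<eta> r / 4" .
      have "?y \<le> \<eta> r * b / (64 * (real K + 1))" using elim(2) by simp
      then have "16 / b * (real K + 1) * ?y \<le> 16 / b * (real K + 1) * (\<eta> r * b / (64 * (real K + 1)))"
        using b by (intro mult_left_mono) auto
      also have "\<dots> = \<eta> r / 4"
      proof -
        have "16 / b * z * (y * b / (64 * z)) = y / 4" if "z \<noteq> 0" for y z :: real using that b by simp
        from this[of "real K + 1" "\<eta> r"] show ?thesis using K0 by linarith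
      qed
      finally have t2: "16 / b * (real K + 1) * ?y \<le> \<eta> r / 4" .
      have "2 * (8 / b * (\<epsilon>1 + ?y) * (real K + 1) + 2 * \<epsilon>1 / b * L) = 2 * \<epsilon>1 / b * c + 16 / b * (real K + 1) * ?y"
        unfolding c_def by (simp add: algebra_simps add_divide_distrib)
      then show ?thesis using t1 t2 elim(1) \<eta>(1)[of r] by linarith
    qed
    have "AE \<omega> in M n. \<omega> \<in> ?T \<longrightarrow> \<omega> \<in> ?G \<union> (E1 \<union> (E2 \<union> (E3 \<union> E4)))"
      using \<kappa>[of n] AE_space
    proof eventually_elim
      case (elim \<omega>)
      show ?case
      proof (intro impI, rule ccontr)
        assume T: "\<omega> \<in> ?T" and not: "\<omega> \<notin> ?G \<union> (E1 \<union> (E2 \<union> (E3 \<union> E4)))"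
        have w: "\<omega> \<in> space (M n) - E1" "\<omega> \<in> space (M n) - E2" "\<omega> \<in> space (M n) - E3" "\<omega> \<in> space (M n) - E4"
          using elim(2) not by auto
        have S\<kappa>: "C.a n * (real (\<kappa> n \<omega>) - real (k0 n)) \<in> S" using T unfolding C.a_def C.\<delta>_def by simp
        have "restrict (\<lambda>i. C.U n h i \<omega>) {- g..<g} \<in> grid_set S K r (2 * \<eta> r + h)"
        proof (rule C.walk_in_grid_set[where K=K and r=r and n=n, folded h_def g_def, where \<epsilon>=\<epsilon>1 and L=L and \<kappa>="\<kappa> n \<omega>", OF E1(3)[OF w(1)] \<epsilon>1(1,2) _ _ E2(3)[OF w(2)] E3(3)[OF w(3)] _ E4(3)[OF w(4)] _ _ _ S\<kappa> tol])
          show "0 < K" "C.a n \<le> 1" using K(3) a_small by auto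
          show "1 \<le> int (k0 n) + C.cell n h i \<and> int (k0 n) + C.cell n h i \<le> int (N n) - 1" if "i \<in> {- g..g}" for i
            using bspec[OF in_range that] .
          show "1 \<le> \<kappa> n \<omega>" "\<kappa> n \<omega> \<le> N n - 1" using elim(1) by auto
          show "C.Q n k \<omega> \<le> C.Q n (\<kappa> n \<omega>) \<omega>" if "1 \<le> k" "k \<le> N n - 1" for k
            using elim(1) that unfolding C.Q_def by blast
        qed
        then show False using not elim(2) by blast
      qed
    qed
    then have "measure (M n) ?T \<le> measure (M n) (?G \<union> (E1 \<union> (E2 \<union> (E3 \<union> E4))))"
      using G E1(1) E2(1) E3(1) E4(1) by (intro C.finite_measure_mono_AE) auto
    also have "\<dots> \<le> measure (M n) ?G + (measure (M n) E1 + (measure (M n) E2 + (measure (M n) E3 + measure (M n) E4)))"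
      using G E1(1) E2(1) E3(1) E4(1) by (intro order_trans[OF measure_Un_le] add_left_mono) auto
    finally have bound: "measure (M n) ?T \<le> measure (M n) ?G + (measure (M n) E1 + (measure (M n) E2 + (measure (M n) E3 + measure (M n) E4)))" .
    have fidi: "measure P {\<omega>\<in>space P. restrict (\<lambda>i. ?V i \<omega>) {- g..<g} \<in> grid_set S K r (2 * \<eta> r + h)} =
        B.prob (B.grid_near_argmax S K r (2 * \<eta> r + 1 / real (Suc r)))"
      unfolding g_def h_def B.W_increments_in_grid_set ..
    have small: "measure (M n) E1 < e" "measure (M n) E2 < e" "measure (M n) E3 < e" "measure (M n) E4 < e"
      using le_less_trans[OF E1(2) elim(4)] le_less_trans[OF E2(2) K(2)] le_less_trans[OF E3(2) LB] le_less_trans[OF E4(2) elim(5)]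
      by blast+
    have sum: "y < z + \<epsilon>"
      if "y \<le> u + (y1 + (y2 + (y3 + y4)))" "u < v + e" "v < z + z1 + e" "z1 < e" "y1 < e" "y2 < e" "y3 < e" "y4 < e"
      for y z u v z1 y1 y2 y3 y4 :: real
      using that \<epsilon> unfolding e_def by linarith
    show ?case
      by (rule sum[OF bound elim(6)[unfolded fidi] r(1) K(1) small])
  qed
qed

section \<open>Negligible perturbations\<close>

text \<open>
  Half-lines in both directions are closed, so the upper bounds on closed sets yield both bounds on the
  distribution function of \<open>A\<close>; shifting the half-lines by \<open>\<rho>\<close> absorbs the difference of \<open>T\<close> and \<open>A\<close> at
  a continuity point.
\<close>

lemma weak_conv_m_if_closed_limsup:
  fixes M :: "nat \<Rightarrow> 'a measure" and P :: "'b measure" and A T :: "nat \<Rightarrow> 'a \<Rightarrow> real"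
  assumes P: "prob_space P" and \<xi>[measurable]: "\<xi> \<in> borel_measurable P"
    and M: "eventually (\<lambda>n. prob_space (M n) \<and> A n \<in> borel_measurable (M n) \<and> T n \<in> borel_measurable (M n)) sequentially"
    and limsup: "\<And>S e. closed S \<Longrightarrow> 0 < e \<Longrightarrow>
      eventually (\<lambda>n. measure (M n) {\<omega>\<in>space (M n). A n \<omega> \<in> S} < measure P {\<omega>\<in>space P. \<xi> \<omega> \<in> S} + e) sequentially"
    and close: "\<And>\<rho> e. 0 < \<rho> \<Longrightarrow> 0 < e \<Longrightarrow>
      eventually (\<lambda>n. measure (M n) {\<omega>\<in>space (M n). \<rho> < \<bar>T n \<omega> - A n \<omega>\<bar>} < e) sequentially"
  shows "weak_conv_m (\<lambda>n. distr (M n) borel (T n)) (distr P borel \<xi>)"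
  unfolding weak_conv_m_def weak_conv_def
proof (intro allI impI)
  interpret P: prob_space P by fact
  let ?F = "cdf (distr P borel \<xi>)"
  fix x assume cont: "isCont ?F x"
  have F: "?F y = P.prob {\<omega>\<in>space P. \<xi> \<omega> \<le> y}" for y
    unfolding cdf_def by (subst measure_distr) (auto simp: vimage_def Int_def conj_commute)
  show "(\<lambda>n. cdf (distr (M n) borel (T n)) x) \<longlonglongrightarrow> ?F x"
  proof (rule tendstoI)
    fix e :: real assume e: "0 < e"
    define d where "d = e / 4"
    have d: "0 < d" unfolding d_def using e by simp
    obtain r where r: "0 < r" "\<And>y. dist y x < r \<Longrightarrow> dist (?F y) (?F x) < d"
      using cont d unfolding continuous_at_eps_delta by blast
    define \<rho> where "\<rho> = r / 4"
    have \<rho>: "0 < \<rho>" "\<rho> < r" "2 * \<rho> < r" unfolding \<rho>_def using r by auto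
    have F1: "?F (x + \<rho>) < ?F x + d" "?F x - d < ?F (x - 2 * \<rho>)"
      using r(2)[of "x + \<rho>"] r(2)[of "x - 2 * \<rho>"] \<rho> by (auto simp: dist_real_def abs_less_iff)
    have ge: "P.prob {\<omega>\<in>space P. \<xi> \<omega> \<in> {x - \<rho>..}} \<le> 1 - ?F (x - 2 * \<rho>)"
    proof -
      have "P.prob {\<omega>\<in>space P. \<xi> \<omega> \<in> {x - \<rho>..}} \<le> P.prob (space P - {\<omega>\<in>space P. \<xi> \<omega> \<le> x - 2 * \<rho>})"
        using \<rho> by (intro P.finite_measure_mono) auto
      also have "\<dots> = 1 - ?F (x - 2 * \<rho>)" unfolding F by (rule P.prob_compl) measurable
      finally show ?thesis .
    qed
    from limsup[OF closed_atMost d, of "x + \<rho>"] limsup[OF closed_atLeast d, of "x - \<rho>"] close[OF \<rho>(1) d] M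
    show "eventually (\<lambda>n. dist (cdf (distr (M n) borel (T n)) x) (?F x) < e) sequentially"
    proof eventually_elim
      case (elim n)
      interpret Mn: prob_space "M n" using elim(4) by blast
      have [measurable]: "A n \<in> borel_measurable (M n)" "T n \<in> borel_measurable (M n)" using elim(4) by auto
      have c: "cdf (distr (M n) borel (T n)) x = Mn.prob {\<omega>\<in>space (M n). T n \<omega> \<le> x}"
        unfolding cdf_def by (subst measure_distr) (auto simp: vimage_def Int_def conj_commute)
      let ?D = "{\<omega>\<in>space (M n). \<rho> < \<bar>T n \<omega> - A n \<omega>\<bar>}"
      have "Mn.prob {\<omega>\<in>space (M n). T n \<omega> \<le> x} \<le> Mn.prob ({\<omega>\<in>space (M n). A n \<omega> \<in> {..x + \<rho>}} \<union> ?D)"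
        by (intro Mn.finite_measure_mono) auto
      also have "\<dots> \<le> Mn.prob {\<omega>\<in>space (M n). A n \<omega> \<in> {..x + \<rho>}} + Mn.prob ?D"
        by (intro measure_Un_le) measurable
      finally have up: "Mn.prob {\<omega>\<in>space (M n). T n \<omega> \<le> x} < ?F x + 3 * d"
        using elim(1,3) F1(1) unfolding F by simp
      have "Mn.prob {\<omega>\<in>space (M n). \<not> T n \<omega> \<le> x} \<le> Mn.prob ({\<omega>\<in>space (M n). A n \<omega> \<in> {x - \<rho>..}} \<union> ?D)"
        by (intro Mn.finite_measure_mono) auto
      also have "\<dots> \<le> Mn.prob {\<omega>\<in>space (M n). A n \<omega> \<in> {x - \<rho>..}} + Mn.prob ?D"
        by (intro measure_Un_le) measurable
      finally have "Mn.prob {\<omega>\<in>space (M n). \<not> T n \<omega> \<le> x} < 1 - ?F x + 3 * d"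
        using elim(2,3) F1(2) ge by simp
      moreover have "Mn.prob {\<omega>\<in>space (M n). \<not> T n \<omega> \<le> x} = 1 - Mn.prob {\<omega>\<in>space (M n). T n \<omega> \<le> x}"
        by (rule Mn.prob_neg) measurable
      ultimately show ?case using up unfolding c d_def by (simp add: dist_real_def abs_less_iff)
    qed
  qed
qed

text \<open>
  Off small events \<open>A\<close> is bounded by \<open>K\<close> and \<open>\<Lambda>\<close> is close to \<open>l\<close>, and there the ratio differs from \<open>A\<close> by
  \<open>(l - \<Lambda>) / \<Lambda> * (A + u) + u\<close>.
\<close>

lemma ratio_close_in_prob:
  fixes M :: "nat \<Rightarrow> 'a measure" and A \<Lambda> :: "nat \<Rightarrow> 'a \<Rightarrow> real" and u :: "nat \<Rightarrow> real"
  assumes l: "0 < l"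
    and M: "eventually (\<lambda>n. prob_space (M n) \<and> A n \<in> borel_measurable (M n) \<and> \<Lambda> n \<in> borel_measurable (M n)) sequentially"
    and tight: "\<And>e. 0 < e \<Longrightarrow> \<exists>K. eventually (\<lambda>n. measure (M n) {\<omega>\<in>space (M n). K \<le> \<bar>A n \<omega>\<bar>} < e) sequentially"
    and \<Lambda>: "\<And>\<theta>. 0 < \<theta> \<Longrightarrow> (\<lambda>n. measure (M n) {\<omega>\<in>space (M n). \<theta> < \<bar>\<Lambda> n \<omega> - l\<bar>}) \<longlonglongrightarrow> 0"
    and u: "u \<longlonglongrightarrow> 0" and \<rho>: "0 < \<rho>" and e: "0 < e"
  shows "eventually (\<lambda>n. measure (M n) {\<omega>\<in>space (M n). \<rho> < \<bar>l * (A n \<omega> + u n) / \<Lambda> n \<omega> - A n \<omega>\<bar>} < e) sequentially"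
proof -
  obtain K0 where K0: "eventually (\<lambda>n. measure (M n) {\<omega>\<in>space (M n). K0 \<le> \<bar>A n \<omega>\<bar>} < e / 2) sequentially"
    using tight[of "e / 2"] e by auto
  define K where "K = \<bar>K0\<bar> + 1"
  have K: "0 < K" "K0 \<le> K" unfolding K_def by auto
  \<comment> \<open>\<open>\<theta> \<le> l / 2\<close> keeps the denominator away from \<open>0\<close>; the other bound makes the relative error at most \<open>\<rho> / (4 * (K + 1))\<close>\<close>
  define \<theta> where "\<theta> = min (l / 2) (l * \<rho> / (8 * (K + 1)))"
  have \<theta>: "0 < \<theta>" "\<theta> \<le> l / 2" "\<theta> \<le> l * \<rho> / (8 * (K + 1))"
    unfolding \<theta>_def using l \<rho> K by (simp_all only: min.cobounded1 min.cobounded2) simp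
  have "eventually (\<lambda>n. \<bar>u n\<bar> < min 1 (\<rho> / 2)) sequentially"
    using tendsto_rabs_zero[OF u] \<rho> by (intro order_tendstoD) auto
  moreover have "eventually (\<lambda>n. measure (M n) {\<omega>\<in>space (M n). \<theta> < \<bar>\<Lambda> n \<omega> - l\<bar>} < e / 2) sequentially"
    using \<Lambda>[OF \<theta>(1)] e by (intro order_tendstoD) auto
  ultimately show ?thesis using K0 M
  proof eventually_elim
    case (elim n)
    interpret Mn: prob_space "M n" using elim(4) by blast
    have [measurable]: "A n \<in> borel_measurable (M n)" "\<Lambda> n \<in> borel_measurable (M n)" using elim(4) by auto
    let ?B = "{\<omega>\<in>space (M n). K0 \<le> \<bar>A n \<omega>\<bar>}" and ?C = "{\<omega>\<in>space (M n). \<theta> < \<bar>\<Lambda> n \<omega> - l\<bar>}"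
    have key: "\<bar>l * (x + u n) / y - x\<bar> \<le> \<rho>" if x: "\<bar>x\<bar> < K" and y: "\<bar>y - l\<bar> \<le> \<theta>" for x y
    proof -
      have arith: "(l * \<rho> / (8 * z)) / (l / 2) = \<rho> / (4 * z)" "\<rho> / (4 * z) * z = \<rho> / 4" if "0 < z" for z
        using l that by (simp_all add: field_simps)
      have split: "l * w / y - (w - r) = (l - y) / y * w + r" if "0 < y" for w r
        using that by (simp add: field_simps)
      have K1: "0 < K + 1" using K(1) by simp
      have y2: "l / 2 \<le> y" using y \<theta>(2) by linarith
      then have y0: "0 < y" using l by linarith
      have "\<bar>l - y\<bar> / y \<le> \<theta> / (l / 2)" using y y2 l \<theta>(1) by (intro frac_le) auto
      also have "\<dots> \<le> (l * \<rho> / (8 * (K + 1))) / (l / 2)" using \<theta>(3) l by (intro divide_right_mono) auto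
      also have "\<dots> = \<rho> / (4 * (K + 1))" by (rule arith(1)[OF K1])
      finally have f: "\<bar>(l - y) / y\<bar> \<le> \<rho> / (4 * (K + 1))" using y0 by (simp add: abs_divide)
      have "l * (x + u n) / y - x = (l - y) / y * (x + u n) + u n"
        using split[OF y0, of "x + u n" "u n"] by simp
      also have "\<bar>\<dots>\<bar> \<le> \<bar>(l - y) / y\<bar> * \<bar>x + u n\<bar> + \<bar>u n\<bar>" by (metis abs_mult abs_triangle_ineq)
      also have "\<bar>(l - y) / y\<bar> * \<bar>x + u n\<bar> \<le> \<rho> / (4 * (K + 1)) * (K + 1)"
        using f x elim(1) \<rho> K by (intro mult_mono) auto
      also have "\<rho> / (4 * (K + 1)) * (K + 1) = \<rho> / 4" by (rule arith(2)[OF K1])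
      finally show ?thesis using elim(1) \<rho> by simp
    qed
    have "Mn.prob {\<omega>\<in>space (M n). \<rho> < \<bar>l * (A n \<omega> + u n) / \<Lambda> n \<omega> - A n \<omega>\<bar>} \<le> Mn.prob (?B \<union> ?C)"
    proof (rule Mn.finite_measure_mono)
      show "{\<omega>\<in>space (M n). \<rho> < \<bar>l * (A n \<omega> + u n) / \<Lambda> n \<omega> - A n \<omega>\<bar>} \<subseteq> ?B \<union> ?C"
      proof
        fix \<omega> assume w: "\<omega> \<in> {\<omega>\<in>space (M n). \<rho> < \<bar>l * (A n \<omega> + u n) / \<Lambda> n \<omega> - A n \<omega>\<bar>}"
        show "\<omega> \<in> ?B \<union> ?C"
        proof (rule ccontr)
          assume "\<omega> \<notin> ?B \<union> ?C"
          then have "\<bar>A n \<omega>\<bar> < K" "\<bar>\<Lambda> n \<omega> - l\<bar> \<le> \<theta>" using w K by auto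
          from key[OF this] show False using w by simp
        qed
      qed
    qed measurable
    also have "\<dots> \<le> Mn.prob ?B + Mn.prob ?C" by (intro measure_Un_le) measurable
    finally show ?case using elim(2,3) by simp
  qed
qed

lemma one_minus_exp_over_tendsto:
  fixes x :: "nat \<Rightarrow> real"
  assumes x: "x \<longlonglongrightarrow> 0" and pos: "eventually (\<lambda>n. 0 < x n) sequentially"
  shows "(\<lambda>n. (1 - exp (- x n)) / x n) \<longlonglongrightarrow> 1"
proof -
  have "filterlim (\<lambda>n. - x n) (at 0) sequentially"
    using tendsto_minus[OF x] pos by (intro filterlim_atI) (auto elim: eventually_mono)
  from filterlim_compose[OF lim_exp_minus_1 this] have "(\<lambda>n. (exp (- x n) - 1) / (- x n)) \<longlonglongrightarrow> 1" .
  moreover have "(exp (- x n) - 1) / (- x n) = (1 - exp (- x n)) / x n" for n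
    by (metis minus_diff_eq minus_divide_divide)
  ultimately show ?thesis by simp
qed

section \<open>The change point estimator\<close>

text \<open>
  Since \<open>1 - exp (- x)\<close> behaves like \<open>x\<close> and the two rates merge, both switch probabilities are
  asymptotic to \<open>q\<close>. The hypothesis on \<open>\<gamma>\<close> says that \<open>n * a / ln n\<close> tends to infinity, as
  \<open>a = \<Delta> * \<gamma>^2 / l1\<close>, and as the limit is \<open>+\<infinity>\<close> it also forces \<open>p1 < p2\<close> for large \<open>n\<close>.
\<close>

lemma switch_probability_asymptotics:
  fixes \<Delta> l2 :: "nat \<Rightarrow> real" and l1 :: real
  defines "\<gamma> \<equiv> \<lambda>n. gam (\<Delta> n) (l2 n) - gam (\<Delta> n) l1"
    and "p1 \<equiv> \<lambda>n. 1 - exp (- l1 * \<Delta> n)" and "p2 \<equiv> \<lambda>n. 1 - exp (- l2 n * \<Delta> n)" and "q \<equiv> \<lambda>n. l1 * \<Delta> n"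
  assumes l1: "0 < l1" and l2_pos: "\<forall>n\<ge>2. 0 < l2 n" and \<Delta>_pos: "\<forall>n\<ge>2. 0 < \<Delta> n"
    and \<Delta>_lim: "\<Delta> \<longlonglongrightarrow> 0" and l_lim: "(\<lambda>n. l2 n - l1) \<longlonglongrightarrow> 0"
    and gamma_lim: "filterlim (\<lambda>n. sqrt (real n * \<Delta> n) * \<gamma> n / sqrt (ln (real n))) at_top sequentially"
  shows "(\<lambda>n. p1 n / q n) \<longlonglongrightarrow> 1" "(\<lambda>n. p2 n / q n) \<longlonglongrightarrow> 1" "q \<longlonglongrightarrow> 0"
    "(\<lambda>n. (p2 n - p1 n) / q n) \<longlonglongrightarrow> 0" "(\<lambda>n. (p2 n - p1 n)\<^sup>2 / q n) \<longlonglongrightarrow> 0"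
    "(\<lambda>n. (1 + ln (real n)) / (real n * ((p2 n - p1 n)\<^sup>2 / q n))) \<longlonglongrightarrow> 0"
    "eventually (\<lambda>n. p1 n < p2 n) sequentially" "eventually (\<lambda>n. p2 n \<le> 2 * q n) sequentially"
    "\<And>n. n \<ge> 2 \<Longrightarrow> p2 n - p1 n = \<Delta> n * \<gamma> n"
proof -
  have l2: "0 < l2 n" and \<Delta>: "0 < \<Delta> n" if "n \<ge> 2" for n using l2_pos \<Delta>_pos that by auto
  have ev2: "eventually (\<lambda>n. n \<ge> 2) sequentially" by (rule eventually_ge_at_top)
  show q0: "q \<longlonglongrightarrow> 0" unfolding q_def using tendsto_mult[OF tendsto_const \<Delta>_lim, of l1] by simp
  have "(\<lambda>n. (1 - exp (- q n)) / q n) \<longlonglongrightarrow> 1"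
    by (rule one_minus_exp_over_tendsto[OF q0]) (rule eventually_mono[OF ev2], use l1 \<Delta> in \<open>simp add: q_def\<close>)
  then show p1q: "(\<lambda>n. p1 n / q n) \<longlonglongrightarrow> 1" unfolding p1_def q_def by simp
  have l2_lim: "l2 \<longlonglongrightarrow> l1" using l_lim by (simp add: LIM_zero_iff)
  have r0: "(\<lambda>n. l2 n * \<Delta> n) \<longlonglongrightarrow> 0" using tendsto_mult[OF l2_lim \<Delta>_lim] by simp
  have "(\<lambda>n. (1 - exp (- (l2 n * \<Delta> n))) / (l2 n * \<Delta> n)) \<longlonglongrightarrow> 1"
    by (rule one_minus_exp_over_tendsto[OF r0]) (rule eventually_mono[OF ev2], use l2 \<Delta> in simp)
  then have "(\<lambda>n. (1 - exp (- (l2 n * \<Delta> n))) / (l2 n * \<Delta> n) * (l2 n / l1)) \<longlonglongrightarrow> 1 * (l1 / l1)"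
    using l1 by (intro tendsto_mult tendsto_divide l2_lim tendsto_const) auto
  moreover have "eventually (\<lambda>n. (1 - exp (- (l2 n * \<Delta> n))) / (l2 n * \<Delta> n) * (l2 n / l1) = p2 n / q n) sequentially"
    using ev2
  proof eventually_elim
    case (elim n)
    then show ?case using l2[of n] \<Delta>[of n] l1 unfolding p2_def q_def by simp
  qed
  ultimately have "(\<lambda>n. p2 n / q n) \<longlonglongrightarrow> 1 * (l1 / l1)" by (rule Lim_transform_eventually)
  then show p2q: "(\<lambda>n. p2 n / q n) \<longlonglongrightarrow> 1" using l1 by simp
  have s: "(\<lambda>n. p2 n / q n - p1 n / q n) \<longlonglongrightarrow> 1 - 1" by (intro tendsto_diff p1q p2q)
  then show s0: "(\<lambda>n. (p2 n - p1 n) / q n) \<longlonglongrightarrow> 0" by (simp add: diff_divide_distrib)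
  have a_eq: "(p2 n - p1 n)\<^sup>2 / q n = ((p2 n - p1 n) / q n)\<^sup>2 * q n" for n
    by (cases "q n = 0") (simp_all add: power2_eq_square)
  have "(\<lambda>n. ((p2 n - p1 n) / q n)\<^sup>2 * q n) \<longlonglongrightarrow> 0\<^sup>2 * 0" by (intro tendsto_intros s0 q0)
  then show "(\<lambda>n. (p2 n - p1 n)\<^sup>2 / q n) \<longlonglongrightarrow> 0" unfolding a_eq by simp
  show gp: "p2 n - p1 n = \<Delta> n * \<gamma> n" if "n \<ge> 2" for n
    unfolding \<gamma>_def gam_def p1_def p2_def using \<Delta>[OF that] by (simp add: field_simps)
  define G where "G n = sqrt (real n * \<Delta> n) * \<gamma> n / sqrt (ln (real n))" for n
  have G: "filterlim G at_top sequentially" unfolding G_def by (rule gamma_lim)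
  have evG: "eventually (\<lambda>n. 0 < G n) sequentially" using G by (simp add: filterlim_at_top_dense)
  show "eventually (\<lambda>n. p1 n < p2 n) sequentially"
    using ev2 evG
  proof eventually_elim
    case (elim n)
    have "0 < sqrt (real n * \<Delta> n)" "0 < sqrt (ln (real n))" using elim(1) \<Delta>[of n] by auto
    then have "G n \<le> 0" if "\<gamma> n \<le> 0"
      unfolding G_def using that by (intro divide_nonpos_pos mult_nonneg_nonpos) simp_all
    then have "0 < \<gamma> n" using elim(2) by linarith
    then have "0 < p2 n - p1 n" unfolding gp[OF elim(1)] using \<Delta>[OF elim(1)] by simp
    then show ?case by simp
  qed
  have "eventually (\<lambda>n. p2 n / q n < 2) sequentially" using p2q by (rule order_tendstoD) simp
  then show "eventually (\<lambda>n. p2 n \<le> 2 * q n) sequentially"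
    using ev2
  proof eventually_elim
    case (elim n)
    then show ?case using l1 \<Delta>[of n] by (simp add: q_def pos_divide_less_eq)
  qed
  have G2: "(\<lambda>n. 2 * l1 / (G n)\<^sup>2) \<longlonglongrightarrow> 0"
    by (rule tendsto_divide_0[OF tendsto_const filterlim_at_top_imp_at_infinity[OF filterlim_pow_at_top[OF _ G]]]) simp
  show "(\<lambda>n. (1 + ln (real n)) / (real n * ((p2 n - p1 n)\<^sup>2 / q n))) \<longlonglongrightarrow> 0"
  proof (rule tendsto_sandwich[OF _ _ tendsto_const G2])
    have ev3: "eventually (\<lambda>n. n \<ge> 3) sequentially" by (rule eventually_ge_at_top)
    show "eventually (\<lambda>n. 0 \<le> (1 + ln (real n)) / (real n * ((p2 n - p1 n)\<^sup>2 / q n))) sequentially"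
      using ev2
    proof eventually_elim
      case (elim n)
      have "0 < q n" unfolding q_def using l1 \<Delta>[OF elim] by simp
      then show ?case using elim by (intro divide_nonneg_nonneg mult_nonneg_nonneg) auto
    qed
    show "eventually (\<lambda>n. (1 + ln (real n)) / (real n * ((p2 n - p1 n)\<^sup>2 / q n)) \<le> 2 * l1 / (G n)\<^sup>2) sequentially"
      using ev3 evG
    proof eventually_elim
      case (elim n)
      have n2: "n \<ge> 2" using elim by simp
      have D: "0 < \<Delta> n" using \<Delta>[OF n2] .
      have ln1: "1 \<le> ln (real n)"
      proof -
        have "exp 1 \<le> real n" using exp_le elim(1) by linarith
        then show ?thesis using ln_ge_iff[of "real n" 1] elim(1) by simp
      qed
      have "\<gamma> n \<noteq> 0" using elim(2) unfolding G_def by auto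
      then have g0: "0 < real n * \<Delta> n * (\<gamma> n)\<^sup>2" using D n2 by simp
      have "(G n)\<^sup>2 = real n * \<Delta> n * (\<gamma> n)\<^sup>2 / ln (real n)"
        unfolding G_def using D ln1 by (simp add: power_divide power_mult_distrib)
      then have R: "2 * l1 / (G n)\<^sup>2 = 2 * ln (real n) * l1 / (real n * \<Delta> n * (\<gamma> n)\<^sup>2)" by simp
      have "real n * ((p2 n - p1 n)\<^sup>2 / q n) = (real n * \<Delta> n * (\<gamma> n)\<^sup>2) / l1"
        unfolding gp[OF n2] q_def using D l1 by (simp add: power2_eq_square)
      then have L: "(1 + ln (real n)) / (real n * ((p2 n - p1 n)\<^sup>2 / q n)) = (1 + ln (real n)) * l1 / (real n * \<Delta> n * (\<gamma> n)\<^sup>2)" by simp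
      show ?case unfolding L R using ln1 l1 g0 by (intro divide_right_mono mult_right_mono) auto
    qed
  qed
qed

text \<open>
  The half of the distance from \<open>\<tau>\<close> to the nearer end leaves room for rounding \<open>n * \<tau>\<close> down.
\<close>

lemma change_index_bounds:
  assumes \<tau>: "0 < \<tau>" "\<tau> < 1"
  defines "b \<equiv> min \<tau> (1 - \<tau>) / 2"
  shows "0 < b" "b \<le> 1 / 2" "\<bar>real (change_index \<tau> n) - real n * \<tau>\<bar> \<le> 1"
    "eventually (\<lambda>n. b * real n \<le> real (change_index \<tau> n) \<and> real (change_index \<tau> n) \<le> (1 - b) * real n) sequentially"
proof -
  show b0: "0 < b" "b \<le> 1 / 2" unfolding b_def using \<tau> by auto
  have c: "real n * \<tau> - 1 \<le> real (change_index \<tau> n)" "real (change_index \<tau> n) \<le> real n * \<tau>" for n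
  proof -
    have "0 \<le> real n * \<tau>" using \<tau> by simp
    then show "real n * \<tau> - 1 \<le> real (change_index \<tau> n)" "real (change_index \<tau> n) \<le> real n * \<tau>"
      unfolding change_index_def by linarith+
  qed
  show "\<bar>real (change_index \<tau> n) - real n * \<tau>\<bar> \<le> 1" using c[of n] by linarith
  have bt: "b < \<tau>" "\<tau> \<le> 1 - b" unfolding b_def using \<tau> by (auto simp: min_def field_simps)
  obtain m :: nat where m: "1 / (\<tau> - b) < real m" using reals_Archimedean2 by blast
  show "eventually (\<lambda>n. b * real n \<le> real (change_index \<tau> n) \<and> real (change_index \<tau> n) \<le> (1 - b) * real n) sequentially"
    using eventually_ge_at_top[of m]
  proof eventually_elim
    case (elim n)
    have "1 / (\<tau> - b) \<le> real n" using m elim by simp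
    then have "1 \<le> real n * (\<tau> - b)" using bt by (simp add: pos_divide_le_eq)
    then have "b * real n \<le> real n * \<tau> - 1" by (simp add: algebra_simps)
    moreover have "real n * \<tau> \<le> (1 - b) * real n" using mult_left_mono[OF bt(2), of "real n"] by (simp add: mult.commute)
    ultimately show ?case using c[of n] by linarith
  qed
qed

theorem theorem4p1:
  fixes c \<tau> l1 :: real
    and \<Delta> l2 :: "nat \<Rightarrow> real"
    and M :: "nat \<Rightarrow> 'a measure"
    and V0 :: "nat \<Rightarrow> 'a \<Rightarrow> real"
    and N :: "nat \<Rightarrow> real \<Rightarrow> 'a \<Rightarrow> nat"
    and khat :: "nat \<Rightarrow> (nat \<Rightarrow> real) \<Rightarrow> nat"
    and ltilde :: "nat \<Rightarrow> (nat \<Rightarrow> real) \<Rightarrow> real"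
    and P :: "'b measure"
    and W :: "real \<Rightarrow> 'b \<Rightarrow> real"
  defines "obs \<equiv> \<lambda>n \<omega>. observations n (\<Delta> n) (telegraph (V0 n) (N n)) \<omega>"
    and "\<gamma> \<equiv> \<lambda>n. gam (\<Delta> n) (l2 n) - gam (\<Delta> n) l1"
  assumes c_pos: "c > 0"
    and tau: "0 < \<tau>" "\<tau> < 1"
    and l1_pos: "l1 > 0"
    and l2_pos: "\<And>n. n \<ge> 2 \<Longrightarrow> l2 n > 0"
    and Delta_pos: "\<And>n. n \<ge> 2 \<Longrightarrow> \<Delta> n > 0"
    and model: "\<And>n. n \<ge> 2 \<Longrightarrow>
      telegraph_driver (M n) c
        (change_intensity l1 (l2 n) (real (change_index \<tau> n) * \<Delta> n)) (V0 n) (N n)"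
    and khat: "\<And>n. n \<ge> 2 \<Longrightarrow> ls_change_estimator c (\<Delta> n) n (khat n)"
    and Delta_lim: "\<Delta> \<longlonglongrightarrow> 0"
    and nDelta_lim: "filterlim (\<lambda>n. real n * \<Delta> n) at_top sequentially"
    and lambda_lim: "(\<lambda>n. l2 n - l1) \<longlonglongrightarrow> 0"
    and gamma_lim:
      "filterlim (\<lambda>n. sqrt (real n * \<Delta> n) * \<gamma> n / sqrt (ln (real n))) at_top sequentially"
    and ltilde_statistic: "\<And>n. n \<ge> 2 \<Longrightarrow> ltilde n \<in> borel_measurable (data_space n)"
    and ltilde_consistent:
      "tendsto_zero_in_prob M (\<lambda>n \<omega>. ltilde n (obs n \<omega>) - l1) \<or>
       tendsto_zero_in_prob M (\<lambda>n \<omega>. ltilde n (obs n \<omega>) - l2 n)"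
    and W: "two_sided_brownian_motion P W"
  shows "\<exists>\<xi>. is_argmax_rv P (\<lambda>v \<omega>. W v \<omega> - \<bar>v\<bar> / 2) \<xi> \<and>
    weak_conv_m
      (\<lambda>n. distr (M n) borel (\<lambda>\<omega>.
         real n * \<Delta> n * (\<gamma> n)\<^sup>2 * (real (khat n (obs n \<omega>)) / real n - \<tau>) / ltilde n (obs n \<omega>)))
      (distr P borel \<xi>)"
proof -
  have bm: "two_sided_bm P W"
  proof -
    have "prob_space P" using W unfolding two_sided_brownian_motion_def brownian_motion_def by blast
    then show ?thesis using W by (intro two_sided_bm.intro two_sided_bm_axioms.intro)
  qed
  interpret B: two_sided_bm P W by (rule bm)
  obtain \<xi> where \<xi>: "\<xi> \<in> borel_measurable P" "AE \<omega> in P. B.maximisers \<omega> = {\<xi> \<omega>}"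
    by (rule B.argmax_exists)
  have "{v. is_arg_max (\<lambda>v. W v \<omega> - \<bar>v\<bar> / 2) (\<lambda>_. True) v} = B.maximisers \<omega>" for \<omega>
    unfolding B.maximisers_def B.Z_def is_arg_max_def by (auto simp: not_less)
  then have argmax: "is_argmax_rv P (\<lambda>v \<omega>. W v \<omega> - \<bar>v\<bar> / 2) \<xi>"
    unfolding is_argmax_rv_def using \<xi> by simp
  define p1 p2 q where "p1 n = 1 - exp (- l1 * \<Delta> n)" and "p2 n = 1 - exp (- l2 n * \<Delta> n)" and "q n = l1 * \<Delta> n" for n
  have pos: "\<forall>n\<ge>2. 0 < l2 n" "\<forall>n\<ge>2. 0 < \<Delta> n" using l2_pos Delta_pos by auto
  note lims' = switch_probability_asymptotics[OF l1_pos pos Delta_lim lambda_lim gamma_lim[unfolded \<gamma>_def]]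
  have lims: "(\<lambda>n. p1 n / q n) \<longlonglongrightarrow> 1" "(\<lambda>n. p2 n / q n) \<longlonglongrightarrow> 1" "(\<lambda>n. q n) \<longlonglongrightarrow> 0"
    "(\<lambda>n. (p2 n - p1 n) / q n) \<longlonglongrightarrow> 0" "(\<lambda>n. (p2 n - p1 n)\<^sup>2 / q n) \<longlonglongrightarrow> 0"
    "(\<lambda>n. (1 + ln (real n)) / (real n * ((p2 n - p1 n)\<^sup>2 / q n))) \<longlonglongrightarrow> 0"
    "eventually (\<lambda>n. p1 n < p2 n) sequentially" "eventually (\<lambda>n. p2 n \<le> 2 * q n) sequentially"
    "\<And>n. n \<ge> 2 \<Longrightarrow> p2 n - p1 n = \<Delta> n * \<gamma> n"
    unfolding p1_def p2_def q_def \<gamma>_def by (fact lims')+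
  define b where "b = min \<tau> (1 - \<tau>) / 2"
  note cib = change_index_bounds[OF tau, folded b_def]
  define J where "J n i \<omega> = (if 1 \<le> N n (real (Suc i) * \<Delta> n) \<omega> - N n (real i * \<Delta> n) \<omega> then 1 else (0 :: real))" for n i \<omega>
  define k0 where "k0 n = change_index \<tau> n" for n
  define \<kappa> where "\<kappa> n \<omega> = khat n (obs n \<omega>)" for n \<omega>
  define a where "a n = (p2 n - p1 n)\<^sup>2 / q n" for n
  have "eventually (\<lambda>n. n \<ge> 2 \<and> p1 n < p2 n \<and> p2 n \<le> 2 * q n \<and> b * real n \<le> real (k0 n) \<and> real (k0 n) \<le> (1 - b) * real n) sequentially"
    using eventually_ge_at_top[of "2 :: nat"] lims(7,8) cib(4) unfolding k0_def by eventually_elim blast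
  then obtain n0 where n0: "\<And>n. n \<ge> n0 \<Longrightarrow> n \<ge> 2 \<and> p1 n < p2 n \<and> p2 n \<le> 2 * q n \<and> b * real n \<le> real (k0 n) \<and> real (k0 n) \<le> (1 - b) * real n"
    unfolding eventually_sequentially by blast
  have T: "prob_space (M n)" "prob_space.indep_vars (M n) (\<lambda>_. borel) (J n) {..<n}"
    "\<And>i. (\<integral>\<omega>. J n i \<omega> \<partial>M n) = 1 - exp (- (if i < k0 n then l1 else l2 n) * \<Delta> n)"
    "\<And>i \<omega>. J n i \<omega> \<in> {0, 1}"
    "obs n \<in> measurable (M n) (data_space n)"
    "AE \<omega> in M n. \<forall>i\<in>{1..n}. Y_stat c (\<Delta> n) (obs n \<omega>) i = J n (i - 1) \<omega> / \<Delta> n"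
    if n: "n \<ge> 2" for n
  proof -
    note t = telegraph_switch_indicators[OF model[OF n] c_pos Delta_pos[OF n] l1_pos l2_pos[OF n], folded J_def]
    show "prob_space (M n)" by (rule t(1))
    show "prob_space.indep_vars (M n) (\<lambda>_. borel) (J n) {..<n}" using t(2)[of n] unfolding J_def .
    show "(\<integral>\<omega>. J n i \<omega> \<partial>M n) = 1 - exp (- (if i < k0 n then l1 else l2 n) * \<Delta> n)" for i
      using t(3)[of i] unfolding k0_def .
    show "J n i \<omega> \<in> {0, 1}" for i \<omega> by (rule t(4))
    show "obs n \<in> measurable (M n) (data_space n)" using t(5)[of n] unfolding obs_def .
    show "AE \<omega> in M n. \<forall>i\<in>{1..n}. Y_stat c (\<Delta> n) (obs n \<omega>) i = J n (i - 1) \<omega> / \<Delta> n"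
      using t(6)[of n] unfolding obs_def .
  qed
  have cs: "change_sample (M n) (J n) n (k0 n) (p1 n) (p2 n) (q n) b" if n: "n \<ge> n0" for n
  proof -
    have n2: "n \<ge> 2" using n0[OF n] by simp
    have "0 < l1 * \<Delta> n" using l1_pos Delta_pos[OF n2] by simp
    then have p10: "0 < p1 n" unfolding p1_def by simp
    show ?thesis
    proof (intro change_sample.intro change_sample_axioms.intro)
      show "prob_space (M n)" by (rule T(1)[OF n2])
      show "prob_space.indep_vars (M n) (\<lambda>_. borel) (J n) {..<n}" by (rule T(2)[OF n2])
      show "(\<integral>\<omega>. J n i \<omega> \<partial>M n) = (if i < k0 n then p1 n else p2 n)" for i
        unfolding T(3)[OF n2] p1_def p2_def by simp
      show "p2 n \<le> 1" unfolding p2_def by simp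
    qed (use n0[OF n] p10 T(4)[OF n2] cib(1,2) n2 in auto)
  qed
  have obs_space: "obs n \<omega> \<in> space (data_space n)" if "n \<ge> 2" "\<omega> \<in> space (M n)" for n \<omega>
    using T(5)[OF that(1)] that(2) by (rule measurable_space)
  have \<kappa>max: "AE \<omega> in M n. 1 \<le> \<kappa> n \<omega> \<and> \<kappa> n \<omega> \<le> n - 1 \<and>
      (\<forall>k. 1 \<le> k \<longrightarrow> k \<le> n - 1 \<longrightarrow> contrast n (\<lambda>i. J n i \<omega>) k \<le> contrast n (\<lambda>i. J n i \<omega>) (\<kappa> n \<omega>))"
    if n: "n \<ge> 2" for n
    using T(6)[OF n] AE_space
  proof eventually_elim
    case (elim \<omega>)
    have min: "is_arg_min (ls_criterion n (Y_stat c (\<Delta> n) (obs n \<omega>))) (\<lambda>k. 1 \<le> k \<and> k \<le> n - 1) (\<kappa> n \<omega>)"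
      using khat[OF n] obs_space[OF n elim(2)] unfolding ls_change_estimator_def \<kappa>_def by blast
    have "contrast n (\<lambda>i. J n i \<omega>) k \<le> contrast n (\<lambda>i. J n i \<omega>) (\<kappa> n \<omega>)" if "1 \<le> k" "k \<le> n - 1" for k
      by (rule ls_minimiser_maximises_contrast[OF min, where \<delta>="\<Delta> n"]) (use elim(1) Delta_pos[OF n] that in auto)
    then show ?case using min unfolding is_arg_min_def by blast
  qed
  \<comment> \<open>finitely many sample sizes may violate \<open>p1 < p2\<close> or the bounds on \<open>k0\<close>; they are replaced by the size \<open>n0\<close>\<close>
  define \<nu> where "\<nu> n = max n n0" for n
  have \<nu>: "n0 \<le> \<nu> n" "2 \<le> \<nu> n" for n unfolding \<nu>_def using n0[of "max n n0"] by auto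
  have ev\<nu>: "eventually (\<lambda>n. \<nu> n = n) sequentially"
    using eventually_ge_at_top[of n0] by eventually_elim (simp add: \<nu>_def)
  have sub: "(\<lambda>n. f (\<nu> n)) \<longlonglongrightarrow> y" if "f \<longlonglongrightarrow> y" for f :: "nat \<Rightarrow> real" and y
    by (rule Lim_transform_eventually[OF that]) (rule eventually_mono[OF ev\<nu>], simp)
  have limsup: "eventually (\<lambda>n. measure (M n) {\<omega>\<in>space (M n). a n * (real (\<kappa> n \<omega>) - real (k0 n)) \<in> S}
      < measure P {\<omega>\<in>space P. \<xi> \<omega> \<in> S} + e) sequentially" if S: "closed S" and e: "0 < e" for S e
  proof -
    have "eventually (\<lambda>n. measure (M (\<nu> n)) {\<omega>\<in>space (M (\<nu> n)). (p2 (\<nu> n) - p1 (\<nu> n))\<^sup>2 / q (\<nu> n) * (real (\<kappa> (\<nu> n) \<omega>) - real (k0 (\<nu> n))) \<in> S}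
      < measure P {\<omega>\<in>space P. \<xi> \<omega> \<in> S} + e) sequentially"
      by (rule rescaled_maximiser_limsup[OF cs[OF \<nu>(1)] \<kappa>max[OF \<nu>(2)] sub[OF lims(4)] sub[OF lims(5)] sub[OF lims(1)]
            sub[OF lims(2)] sub[OF lims(3)] sub[OF lims(6)] bm \<xi> S e])
    with ev\<nu> show ?thesis unfolding a_def by eventually_elim simp
  qed
  have meas: "(\<lambda>\<omega>. real (\<kappa> n \<omega>)) \<in> borel_measurable (M n)" "(\<lambda>\<omega>. ltilde n (obs n \<omega>)) \<in> borel_measurable (M n)" if n: "n \<ge> 2" for n
  proof -
    have "khat n \<in> measurable (data_space n) (count_space UNIV)" using khat[OF n] unfolding ls_change_estimator_def by blast
    from measurable_compose[OF T(5)[OF n] this] show "(\<lambda>\<omega>. real (\<kappa> n \<omega>)) \<in> borel_measurable (M n)"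
      unfolding \<kappa>_def by measurable
    show "(\<lambda>\<omega>. ltilde n (obs n \<omega>)) \<in> borel_measurable (M n)"
      by (rule measurable_compose[OF T(5)[OF n] ltilde_statistic[OF n]])
  qed
  have ev2: "eventually (\<lambda>n. n \<ge> 2) sequentially" by (rule eventually_ge_at_top)
  have consistent: "(\<lambda>n. measure (M n) {\<omega>\<in>space (M n). \<theta> < \<bar>ltilde n (obs n \<omega>) - l1\<bar>}) \<longlonglongrightarrow> 0" if \<theta>: "0 < \<theta>" for \<theta>
    using ltilde_consistent
  proof
    assume "tendsto_zero_in_prob M (\<lambda>n \<omega>. ltilde n (obs n \<omega>) - l1)"
    then show ?thesis using \<theta> unfolding tendsto_zero_in_prob_def by blast
  next
    assume "tendsto_zero_in_prob M (\<lambda>n \<omega>. ltilde n (obs n \<omega>) - l2 n)"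
    then have c2: "(\<lambda>n. measure (M n) {\<omega>\<in>space (M n). \<theta> / 2 < \<bar>ltilde n (obs n \<omega>) - l2 n\<bar>}) \<longlonglongrightarrow> 0"
      using half_gt_zero[OF \<theta>] unfolding tendsto_zero_in_prob_def by blast
    show ?thesis
    proof (rule tendsto_sandwich[OF _ _ tendsto_const c2])
      have "eventually (\<lambda>n. \<bar>l2 n - l1\<bar> < \<theta> / 2) sequentially"
        using tendsto_rabs_zero[OF lambda_lim] \<theta> by (intro order_tendstoD) auto
      with ev2 show "eventually (\<lambda>n. measure (M n) {\<omega>\<in>space (M n). \<theta> < \<bar>ltilde n (obs n \<omega>) - l1\<bar>} \<le>
          measure (M n) {\<omega>\<in>space (M n). \<theta> / 2 < \<bar>ltilde n (obs n \<omega>) - l2 n\<bar>}) sequentially"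
      proof eventually_elim
        case (elim n)
        interpret Mn: prob_space "M n" by (rule T(1)[OF elim(1)])
        note meas(2)[OF elim(1), measurable]
        have half: "\<theta> / 2 < \<bar>y - l2 n\<bar>" if "\<theta> < \<bar>y - l1\<bar>" for y
          using elim(2) that by linarith
        show ?case by (rule Mn.finite_measure_mono) (use half in blast, measurable)
      qed
    qed simp
  qed
  \<comment> \<open>\<open>u\<close> is the effect of rounding \<open>n * \<tau>\<close> to the change index\<close>
  define A u where "A n \<omega> = a n * (real (\<kappa> n \<omega>) - real (k0 n))" and "u n = a n * (real (k0 n) - real n * \<tau>)" for n \<omega>
  have u0: "u \<longlonglongrightarrow> 0"
  proof (rule Lim_null_comparison)
    have "\<bar>real (k0 n) - real n * \<tau>\<bar> \<le> 1" for n using cib(3)[of n] unfolding k0_def .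
    then have "norm (u n) \<le> \<bar>a n\<bar>" for n
      unfolding u_def real_norm_def abs_mult by (intro mult_left_le) auto
    then show "eventually (\<lambda>n. norm (u n) \<le> \<bar>a n\<bar>) sequentially" by simp
    show "(\<lambda>n. \<bar>a n\<bar>) \<longlonglongrightarrow> 0" unfolding a_def by (rule tendsto_rabs_zero[OF lims(5)])
  qed
  have Tn: "real n * \<Delta> n * (\<gamma> n)\<^sup>2 * (real (khat n (obs n \<omega>)) / real n - \<tau>) / ltilde n (obs n \<omega>) =
      l1 * (A n \<omega> + u n) / ltilde n (obs n \<omega>)" if n: "n \<ge> 2" for n \<omega>
  proof -
    have D: "0 < \<Delta> n" using Delta_pos[OF n] .
    have "a n = \<Delta> n * (\<gamma> n)\<^sup>2 / l1"
      unfolding a_def lims(9)[OF n] q_def using D l1_pos by (simp add: power2_eq_square)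
    then have la: "l1 * a n = \<Delta> n * (\<gamma> n)\<^sup>2" using l1_pos by simp
    have "real n * \<Delta> n * (\<gamma> n)\<^sup>2 * (real (\<kappa> n \<omega>) / real n - \<tau>) = \<Delta> n * (\<gamma> n)\<^sup>2 * (real (\<kappa> n \<omega>) - real n * \<tau>)"
      using n by (simp add: field_simps)
    also have "\<dots> = l1 * (A n \<omega> + u n)" unfolding la[symmetric] A_def u_def by (simp add: algebra_simps)
    finally show ?thesis unfolding \<kappa>_def by simp
  qed
  have evM: "eventually (\<lambda>n. prob_space (M n) \<and> A n \<in> borel_measurable (M n) \<and> (\<lambda>\<omega>. ltilde n (obs n \<omega>)) \<in> borel_measurable (M n)) sequentially"
    using ev2
  proof eventually_elim
    case (elim n)
    note meas[OF elim, measurable]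
    show ?case unfolding A_def using T(1)[OF elim] by (intro conjI; measurable)
  qed
  have tight: "\<exists>K. eventually (\<lambda>n. measure (M n) {\<omega>\<in>space (M n). K \<le> \<bar>A n \<omega>\<bar>} < e) sequentially" if e: "0 < e" for e
  proof -
    note \<xi>(1)[measurable]
    have "(\<lambda>K. B.prob {\<omega>\<in>space P. real K \<le> \<bar>\<xi> \<omega>\<bar>}) \<longlonglongrightarrow> 0"
    proof (rule B.prob_tendsto_zero_if_eventually_outside)
      show "AE \<omega> in P. eventually (\<lambda>K. \<omega> \<notin> {\<omega>\<in>space P. real K \<le> \<bar>\<xi> \<omega>\<bar>}) sequentially"
      proof (rule AE_I2)
        fix \<omega>
        show "eventually (\<lambda>K. \<omega> \<notin> {\<omega>\<in>space P. real K \<le> \<bar>\<xi> \<omega>\<bar>}) sequentially"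
          using eventually_gt_at_top[of "nat \<lceil>\<bar>\<xi> \<omega>\<bar>\<rceil>"] by eventually_elim (auto simp: not_le; linarith)
      qed
    qed measurable
    then have "eventually (\<lambda>K. B.prob {\<omega>\<in>space P. real K \<le> \<bar>\<xi> \<omega>\<bar>} < e / 2) sequentially"
      using e by (intro order_tendstoD) auto
    then obtain K :: nat where K: "B.prob {\<omega>\<in>space P. real K \<le> \<bar>\<xi> \<omega>\<bar>} < e / 2"
      unfolding eventually_sequentially by blast
    have "closed {x :: real. real K \<le> \<bar>x\<bar>}" by (intro closed_Collect_le continuous_intros)
    from limsup[OF this, of "e / 2"] e
    have "eventually (\<lambda>n. measure (M n) {\<omega>\<in>space (M n). a n * (real (\<kappa> n \<omega>) - real (k0 n)) \<in> {x. real K \<le> \<bar>x\<bar>}}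
      < measure P {\<omega>\<in>space P. \<xi> \<omega> \<in> {x. real K \<le> \<bar>x\<bar>}} + e / 2) sequentially" by simp
    then show ?thesis using K by (intro exI[of _ "real K"]) (auto elim!: eventually_mono simp: A_def)
  qed
  have "weak_conv_m (\<lambda>n. distr (M n) borel (\<lambda>\<omega>.
         real n * \<Delta> n * (\<gamma> n)\<^sup>2 * (real (khat n (obs n \<omega>)) / real n - \<tau>) / ltilde n (obs n \<omega>)))
      (distr P borel \<xi>)"
  proof (rule weak_conv_m_if_closed_limsup[where A=A])
    show "prob_space P" "\<xi> \<in> borel_measurable P" by (rule B.prob_space_axioms, rule \<xi>(1))
    show "eventually (\<lambda>n. prob_space (M n) \<and> A n \<in> borel_measurable (M n) \<and>
      (\<lambda>\<omega>. real n * \<Delta> n * (\<gamma> n)\<^sup>2 * (real (khat n (obs n \<omega>)) / real n - \<tau>) / ltilde n (obs n \<omega>)) \<in> borel_measurable (M n)) sequentially"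
      using evM ev2
    proof eventually_elim
      case (elim n)
      have [measurable]: "A n \<in> borel_measurable (M n)" "(\<lambda>\<omega>. ltilde n (obs n \<omega>)) \<in> borel_measurable (M n)"
        using elim(1) by auto
      show ?case unfolding Tn[OF elim(2)] using elim(1) by (intro conjI; measurable)
    qed
    show "eventually (\<lambda>n. measure (M n) {\<omega>\<in>space (M n). A n \<omega> \<in> S} < measure P {\<omega>\<in>space P. \<xi> \<omega> \<in> S} + e) sequentially"
      if "closed S" "0 < e" for S e
      unfolding A_def by (rule limsup[OF that])
    show "eventually (\<lambda>n. measure (M n) {\<omega>\<in>space (M n). \<rho> < \<bar>real n * \<Delta> n * (\<gamma> n)\<^sup>2 * (real (khat n (obs n \<omega>)) / real n - \<tau>) / ltilde n (obs n \<omega>) - A n \<omega>\<bar>} < e) sequentially"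
      if "0 < \<rho>" "0 < e" for \<rho> e
    proof -
      have "eventually (\<lambda>n. measure (M n) {\<omega>\<in>space (M n). \<rho> < \<bar>l1 * (A n \<omega> + u n) / ltilde n (obs n \<omega>) - A n \<omega>\<bar>} < e) sequentially"
        by (rule ratio_close_in_prob[OF l1_pos evM tight consistent u0 that])
      with ev2 show ?thesis by eventually_elim (simp only: Tn)
    qed
  qed
  with argmax show ?thesis by blast
qed

end
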